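(* Let $\Omega$ be convex and suppose that (A.1)--(A.3) hold. Let $\bar u\in\mathbb{U}_{ad}$ be a local solution of the optimal control problem (P), with state $\bar y$ and adjoint state $\bar p$, satisfying the sufficient second order condition $j''(\bar u)v^2>0$ for all $v\in C_{\bar u}\setminus\{0\}$, or equivalently: there exist $\mu,\tau>0$ such that $j''(\bar u)v^2\ge\mu\|v\|_{L^2(\Omega)}^2$ for all $v\in C_{\bar u}^{\tau}$. Let $\mathscr{T}\in\mathbb{T}$ and let $\bar u_{\mathscr{T}}\in\mathbb{U}_{ad,1}(\mathscr{T})$ be a local minimum of the discrete problem (P$_{\mathscr{T}}^1$) with piecewise linear controls, with $\bar y_{\mathscr{T}}$ and $\bar p_{\mathscr{T}}$ the corresponding discrete state and adjoint state. Let $\tilde u:=\Pi_{[\mathtt{a},\mathtt{b}]}(-\nu^{-1}\bar p_{\mathscr{T}})$, and let $\mathsf{M}>0$ be such that $\max\{\|\bar u+\theta_{\mathscr{T}}(\tilde u-\bar u)\|_{L^\infty(\Omega)},\|\tilde u-\bar u\|_{L^\infty(\Omega)}\}\le\mathsf{M}$, where $\theta_{\mathscr{T}}\in(0,1)$ is such that $(j'(\tilde u)-j'(\bar u))(\tilde u-\bar u)=j''(\bar u+\theta_{\mathscr{T}}(\tilde u-\bar u))(\tilde u-\bar u)^2$. Assume the mesh $\mathscr{T}$ is such that $$\|\bar p-\bar p_{\mathscr{T}}\|_{L^\infty(\Omega)}\le\min\{\nu\mu(2C_{\mathsf{M}})^{-1},\tau/2\}.$$ Let $E_{st},E_{ad}\geq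 0$ be a posteriori error estimators such that, for a constant $C_0>0$ independent of the continuous and discrete optimal variables and of the mesh, $$\|\hat y-\bar y_{\mathscr{T}}\|_{L^2(\Omega)}\le C_0E_{st},\qquad\|\hat p-\bar p_{\mathscr{T}}\|_{L^2(\Omega)}\le C_0E_{ad},$$ where $\hat y$ and $\hat p$ are the auxiliary functions defined in the context. Then $$\|\bar y-\bar y_{\mathscr{T}}\|_{L^2(\Omega)}+\|\bar p-\bar p_{\mathscr{T}}\|_{L^2(\Omega)}+\|\bar u-\bar u_{\mathscr{T}}\|_{L^2(\Omega)}\le C\,(E_{st}+E_{ad}+\mathcal{E}_{ct}),$$ where $\mathcal{E}_{ct}:=\|\tilde u-\bar u_{\mathscr{T}}\|_{L^2(\Omega)}$ and $C>0$ is independent of the continuous and discrete optimal variables, the size of the elements in the mesh $\mathscr{T}$, and the number of elements $\#\mathscr{T}$ (it may depend on the data of the continuous problem, on $\mu$, on $C_0$, and on the shape regularity of $\mathbb{T}$).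
   Context: Setting. $d\in\{2,3\}$; $\Omega\subset\mathbb{R}^d$ is an open bounded polytopal domain with Lipschitz boundary; $\nu>0$; $y_\Omega\in L^2(\Omega)$; $\mathtt{a},\mathtt{b}\in\mathbb{R}$ with $\mathtt{a}<\mathtt{b}$; $\mathbb{U}_{ad}=\{v\in L^2(\Omega):\mathtt{a}\le v(x)\le\mathtt{b}\text{ a.e. }x\in\Omega\}$. Assumptions on $a=a(x,y)$: (A.1) $a:\Omega\times\mathbb{R}\to\mathbb{R}$ is a Carathéodory function, of class $C^2$ in the second variable, and $a(\cdot,0)\in L^2(\Omega)$. (A.2) $\frac{\partial a}{\partial y}(x,y)\ge0$ for a.e. $x\in\Omega$ and all $y\in\mathbb{R}$. (A.3) For all $M>0$ there is $C_M>0$ with $\sum_{i=1}^2|\frac{\partial^i a}{\partial y^i}(x,y)|\le C_M$ for a.e. $x\in\Omega$ and $|y|\le M$. Problem (P): minimize $J(y,u)=\frac12\|y-y_\Omega\|_{L^2(\Omega)}^2+\frac{\nu}{2}\|u\|_{L^2(\Omega)}^2$ over $(y,u)\in H_0^1(\Omega)\times\mathbb{U}_{ad}$ subject to the state equation $(\nabla y,\nabla v)_{L^2(\Omega)}+(a(\cdot,y),v)_{L^2(\Omega)}=(u,v)_{L^2(\Omega)}$ for all $v\in H_0^1(\Omega)$. For each $u\in L^2(\Omega)$ this equation has a unique solution $y=\mathcal{S}u\in H_0^1(\Omega)\cap L^\infty(\Omega)$. The reduced cost is $j(u)=J(\mathcal{S}u,u)$; $j',j''$ denote its first and second derivatives (on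 $L^2(\Omega)$), and $j''(u)v^2:=j''(u)(v,v)$. Local solutions/minima are understood in the sense of $L^2(\Omega)$ (for the control). For a local solution $\bar u$: $\bar y=\mathcal{S}\bar u$, and $\bar p\in H_0^1(\Omega)\cap L^\infty(\Omega)$ solves $(\nabla w,\nabla\bar p)_{L^2(\Omega)}+(\frac{\partial a}{\partial y}(\cdot,\bar y)\bar p,w)_{L^2(\Omega)}=(\bar y-y_\Omega,w)_{L^2(\Omega)}$ for all $w\in H_0^1(\Omega)$. The first order necessary condition is $(\bar p+\nu\bar u,u-\bar u)_{L^2(\Omega)}\ge0$ for all $u\in\mathbb{U}_{ad}$. Projection: $\Pi_{[\mathtt{a},\mathtt{b}]}(v)=\min\{\mathtt{b},\max\{v,\mathtt{a}\}\}$ a.e. in $\Omega$. Cones: with $\bar{\mathfrak{p}}=\bar p+\nu\bar u$, say that $v$ satisfies the sign condition if $v(x)\ge0$ for a.e. $x$ with $\bar u(x)=\mathtt{a}$ and $v(x)\le0$ for a.e. $x$ with $\bar u(x)=\mathtt{b}$. Then $C_{\bar u}=\{v\in L^2(\Omega): v$ satisfies the sign condition and $v(x)=0$ if $\bar{\mathfrak{p}}(x)\ne0\}$ and $C_{\bar u}^\tau=\{v\in L^2(\Omega): v$ satisfies the sign condition and $v(x)=0$ if $|\bar{\mathfrak{p}}(x)|>\tau\}$. It is known that $j''(\bar u)v^2>0$ on $C_{\bar u}\setminus\{0\}$ is equivalent to the existence of $\mu,\tau>0$ with $j''(\bar u)v^2\ge\mu\|v\|^2_{L^2(\Omega)}$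 on $C_{\bar u}^\tau$. Constant $C_{\mathsf{M}}$: for $\mathsf{M}>0$, $C_{\mathsf{M}}>0$ is a constant (known to exist) such that $|j''(u+h)v^2-j''(u)v^2|\le C_{\mathsf{M}}\|h\|_{L^\infty(\Omega)}\|v\|_{L^2(\Omega)}^2$ for all $u,h,v\in L^\infty(\Omega)$ with $\max\{\|u\|_{L^\infty(\Omega)},\|h\|_{L^\infty(\Omega)}\}\le\mathsf{M}$. Meshes: $\mathbb{T}$ is a collection of conforming, (uniformly) shape regular simplicial partitions $\mathscr{T}=\{T\}$ of $\bar\Omega$ that are refinements of an initial mesh $\mathscr{T}_0$. $\mathbb{V}(\mathscr{T})=\{v\in C(\bar\Omega):v|_T\in\mathbb{P}_1(T)\ \forall T\in\mathscr{T}\}\cap H_0^1(\Omega)$; $\mathbb{U}_{ad,1}(\mathscr{T})=\{u\in C(\bar\Omega):u|_T\in\mathbb{P}_1(T)\ \forall T\in\mathscr{T}\}\cap\mathbb{U}_{ad}$. Discrete problem (P$_{\mathscr{T}}^1$): minimize $J(y_{\mathscr{T}},u_{\mathscr{T}})$ over $u_{\mathscr{T}}\in\mathbb{U}_{ad,1}(\mathscr{T})$ subject to $y_{\mathscr{T}}\in\mathbb{V}(\mathscr{T})$, $(\nabla y_{\mathscr{T}},\nabla v)_{L^2(\Omega)}+(a(\cdot,y_{\mathscr{T}}),v)_{L^2(\Omega)}=(u_{\mathscr{T}},v)_{L^2(\Omega)}$ for all $v\in\mathbb{V}(\mathscr{T})$. For a local minimum $\bar u_{\mathscr{T}}$, $\bar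 y_{\mathscr{T}}$ is its discrete state and $\bar p_{\mathscr{T}}\in\mathbb{V}(\mathscr{T})$ solves $(\nabla w,\nabla\bar p_{\mathscr{T}})_{L^2(\Omega)}+(\frac{\partial a}{\partial y}(\cdot,\bar y_{\mathscr{T}})\bar p_{\mathscr{T}},w)_{L^2(\Omega)}=(\bar y_{\mathscr{T}}-y_\Omega,w)_{L^2(\Omega)}$ for all $w\in\mathbb{V}(\mathscr{T})$. Auxiliary functions: $\hat y\in H_0^1(\Omega)$ solves $(\nabla\hat y,\nabla v)_{L^2(\Omega)}+(a(\cdot,\hat y),v)_{L^2(\Omega)}=(\bar u_{\mathscr{T}},v)_{L^2(\Omega)}$ for all $v\in H_0^1(\Omega)$; $\hat p\in H_0^1(\Omega)$ solves $(\nabla w,\nabla\hat p)_{L^2(\Omega)}+(\frac{\partial a}{\partial y}(\cdot,\bar y_{\mathscr{T}})\hat p,w)_{L^2(\Omega)}=(\bar y_{\mathscr{T}}-y_\Omega,w)_{L^2(\Omega)}$ for all $w\in H_0^1(\Omega)$. *)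

theory Defs
  imports "HOL-Analysis.Analysis" "HOL-Probability.Essential_Supremum"
begin

section \<open>Lebesgue spaces on a domain\<close>

text \<open>
  Elements of $L^2(\Omega)$, $L^\infty(\Omega)$ and $H^1(\Omega)$ are represented by functions on the
  whole space; only their restriction to \<open>\<Omega>\<close>, up to null sets, matters.
\<close>

definition L2 :: "'a::euclidean_space set \<Rightarrow> ('a \<Rightarrow> real) set" where
  "L2 \<Omega> = {f \<in> borel_measurable (lebesgue_on \<Omega>). integrable (lebesgue_on \<Omega>) (\<lambda>x. (f x)\<^sup>2)}"

definition L2_inner :: "'a::euclidean_space set \<Rightarrow> ('a \<Rightarrow> real) \<Rightarrow> ('a \<Rightarrow> real) \<Rightarrow> real" where
  "L2_inner \<Omega> f g = (\<integral>x. f x * g x \<partial>lebesgue_on \<Omega>)"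

definition L2_norm :: "'a::euclidean_space set \<Rightarrow> ('a \<Rightarrow> real) \<Rightarrow> real" where
  "L2_norm \<Omega> f = sqrt (L2_inner \<Omega> f f)"

definition Linf :: "'a::euclidean_space set \<Rightarrow> ('a \<Rightarrow> real) set" where
  "Linf \<Omega> = {f \<in> borel_measurable (lebesgue_on \<Omega>). esssup (lebesgue_on \<Omega>) (\<lambda>x. ereal \<bar>f x\<bar>) < \<infinity>}"

text \<open>Only meaningful on \<^const>\<open>Linf\<close>: an infinite essential supremum is mapped to \<open>0\<close>.\<close>

definition Linf_norm :: "'a::euclidean_space set \<Rightarrow> ('a \<Rightarrow> real) \<Rightarrow> real" where
  "Linf_norm \<Omega> f = real_of_ereal (esssup (lebesgue_on \<Omega>) (\<lambda>x. ereal \<bar>f x\<bar>))"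


section \<open>The Sobolev space $H_0^1$\<close>

primrec C_k :: "nat \<Rightarrow> ('a::euclidean_space \<Rightarrow> real) \<Rightarrow> bool" where
  "C_k 0 f \<longleftrightarrow> continuous_on UNIV f"
| "C_k (Suc k) f \<longleftrightarrow> (\<forall>x. f differentiable at x) \<and>
     (\<forall>i\<in>Basis. C_k k (\<lambda>x. frechet_derivative f (at x) i))"

definition test_functions :: "'a::euclidean_space set \<Rightarrow> ('a \<Rightarrow> real) set" where
  "test_functions \<Omega> =
     {\<phi>. (\<forall>k. C_k k \<phi>) \<and> (\<exists>K. compact K \<and> K \<subseteq> \<Omega> \<and> (\<forall>x. x \<notin> K \<longrightarrow> \<phi> x = 0))}"

definition weak_gradient :: "'a::euclidean_space set \<Rightarrow> ('a \<Rightarrow> real) \<Rightarrow> ('a \<Rightarrow> 'a) \<Rightarrow> bool" where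
  "weak_gradient \<Omega> y g \<longleftrightarrow> (\<forall>i\<in>Basis. (\<lambda>x. g x \<bullet> i) \<in> L2 \<Omega> \<and>
     (\<forall>\<phi>\<in>test_functions \<Omega>.
        L2_inner \<Omega> y (\<lambda>x. frechet_derivative \<phi> (at x) i) = - L2_inner \<Omega> (\<lambda>x. g x \<bullet> i) \<phi>))"

definition H1 :: "'a::euclidean_space set \<Rightarrow> ('a \<Rightarrow> real) set" where
  "H1 \<Omega> = {y \<in> L2 \<Omega>. \<exists>g. weak_gradient \<Omega> y g}"

text \<open>Weak gradients are unique only up to null sets, hence the choice operator.\<close>

definition wgrad :: "'a::euclidean_space set \<Rightarrow> ('a \<Rightarrow> real) \<Rightarrow> 'a \<Rightarrow> 'a" where
  "wgrad \<Omega> y = (SOME g. weak_gradient \<Omega> y g)"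

definition grad_inner :: "'a::euclidean_space set \<Rightarrow> ('a \<Rightarrow> real) \<Rightarrow> ('a \<Rightarrow> real) \<Rightarrow> real" where
  "grad_inner \<Omega> y v = (\<integral>x. wgrad \<Omega> y x \<bullet> wgrad \<Omega> v x \<partial>lebesgue_on \<Omega>)"

definition H1_norm :: "'a::euclidean_space set \<Rightarrow> ('a \<Rightarrow> real) \<Rightarrow> real" where
  "H1_norm \<Omega> y = sqrt ((L2_norm \<Omega> y)\<^sup>2 + grad_inner \<Omega> y y)"

text \<open>The closure of the test functions in $H^1(\Omega)$.\<close>

definition H10 :: "'a::euclidean_space set \<Rightarrow> ('a \<Rightarrow> real) set" where
  "H10 \<Omega> = {y \<in> H1 \<Omega>. \<forall>\<epsilon>>0. \<exists>\<phi>\<in>test_functions \<Omega>. H1_norm \<Omega> (\<lambda>x. y x - \<phi> x) < \<epsilon>}"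


section \<open>Frechet derivatives of functionals on $L^2$\<close>

text \<open>
  $L^2(\Omega)$ is a set of functions rather than a normed-space type, so \<^const>\<open>has_derivative\<close>
  does not apply; its definition is spelled out with the $L^2$ norm.
\<close>

definition L2_linear :: "'a::euclidean_space set \<Rightarrow> (('a \<Rightarrow> real) \<Rightarrow> real) \<Rightarrow> bool" where
  "L2_linear \<Omega> D \<longleftrightarrow>
     (\<forall>v\<in>L2 \<Omega>. \<forall>w\<in>L2 \<Omega>. D (\<lambda>x. v x + w x) = D v + D w) \<and>
     (\<forall>c. \<forall>v\<in>L2 \<Omega>. D (\<lambda>x. c * v x) = c * D v)"

definition has_L2_deriv ::
  "'a::euclidean_space set \<Rightarrow> (('a \<Rightarrow> real) \<Rightarrow> real) \<Rightarrow> (('a \<Rightarrow> real) \<Rightarrow> real) \<Rightarrow> ('a \<Rightarrow> real) \<Rightarrow> bool"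
where
  "has_L2_deriv \<Omega> F D u \<longleftrightarrow>
     L2_linear \<Omega> D \<and> (\<exists>K. \<forall>v\<in>L2 \<Omega>. \<bar>D v\<bar> \<le> K * L2_norm \<Omega> v) \<and>
     (\<forall>\<epsilon>>0. \<exists>\<delta>>0. \<forall>h\<in>L2 \<Omega>. L2_norm \<Omega> h < \<delta> \<longrightarrow>
        \<bar>F (\<lambda>x. u x + h x) - F u - D h\<bar> \<le> \<epsilon> * L2_norm \<Omega> h)"

text \<open>The derivative is unique on \<^const>\<open>L2\<close>, but not as a function on all of \<open>'a \<Rightarrow> real\<close>.\<close>

definition L2_deriv ::
  "'a::euclidean_space set \<Rightarrow> (('a \<Rightarrow> real) \<Rightarrow> real) \<Rightarrow> ('a \<Rightarrow> real) \<Rightarrow> ('a \<Rightarrow> real) \<Rightarrow> real"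
where
  "L2_deriv \<Omega> F u = (SOME D. has_L2_deriv \<Omega> F D u)"

text \<open>
  The second derivative is the derivative of $u \mapsto F'(u)$ as a map into the dual of $L^2(\Omega)$,
  i.e. with respect to the operator norm; \<open>B h v\<close> is $F''(u)(h,v)$.
\<close>

definition has_L2_deriv2 ::
  "'a::euclidean_space set \<Rightarrow> (('a \<Rightarrow> real) \<Rightarrow> real) \<Rightarrow>
   (('a \<Rightarrow> real) \<Rightarrow> ('a \<Rightarrow> real) \<Rightarrow> real) \<Rightarrow> ('a \<Rightarrow> real) \<Rightarrow> bool"
where
  "has_L2_deriv2 \<Omega> F B u \<longleftrightarrow>
     (\<exists>r>0. \<forall>w\<in>L2 \<Omega>. L2_norm \<Omega> (\<lambda>x. w x - u x) < r \<longrightarrow> (\<exists>D. has_L2_deriv \<Omega> F D w)) \<and>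
     (\<forall>h\<in>L2 \<Omega>. L2_linear \<Omega> (B h)) \<and> (\<forall>v\<in>L2 \<Omega>. L2_linear \<Omega> (\<lambda>h. B h v)) \<and>
     (\<exists>K. \<forall>h\<in>L2 \<Omega>. \<forall>v\<in>L2 \<Omega>. \<bar>B h v\<bar> \<le> K * L2_norm \<Omega> h * L2_norm \<Omega> v) \<and>
     (\<forall>\<epsilon>>0. \<exists>\<delta>>0. \<forall>h\<in>L2 \<Omega>. L2_norm \<Omega> h < \<delta> \<longrightarrow>
        (\<forall>v\<in>L2 \<Omega>. \<bar>L2_deriv \<Omega> F (\<lambda>x. u x + h x) v - L2_deriv \<Omega> F u v - B h v\<bar>
                     \<le> \<epsilon> * L2_norm \<Omega> h * L2_norm \<Omega> v))"

definition L2_deriv2 ::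
  "'a::euclidean_space set \<Rightarrow> (('a \<Rightarrow> real) \<Rightarrow> real) \<Rightarrow>
   ('a \<Rightarrow> real) \<Rightarrow> ('a \<Rightarrow> real) \<Rightarrow> ('a \<Rightarrow> real) \<Rightarrow> real"
where
  "L2_deriv2 \<Omega> F u = (SOME B. has_L2_deriv2 \<Omega> F B u)"


section \<open>Domain and nonlinearity\<close>

definition polytopal_domain :: "'a::euclidean_space set \<Rightarrow> bool" where
  "polytopal_domain \<Omega> \<longleftrightarrow> open \<Omega> \<and> connected \<Omega> \<and> \<Omega> \<noteq> {} \<and> bounded \<Omega> \<and>
     (\<exists>P. finite P \<and> (\<forall>p\<in>P. polytope p) \<and> closure \<Omega> = \<Union>P)"

text \<open>
  Near every boundary point, \<open>\<Omega>\<close> is the part of space lying above a Lipschitz graph over the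
  hyperplane orthogonal to a unit vector \<open>e\<close>; \<open>g\<close> only sees the projection to that hyperplane.
\<close>

definition lipschitz_boundary :: "'a::euclidean_space set \<Rightarrow> bool" where
  "lipschitz_boundary \<Omega> \<longleftrightarrow> (\<forall>x0\<in>frontier \<Omega>. \<exists>r>0. \<exists>e g L. norm e = 1 \<and>
     L-lipschitz_on UNIV (g :: 'a \<Rightarrow> real) \<and>
     \<Omega> \<inter> ball x0 r = {x \<in> ball x0 r. g (x - (x \<bullet> e) *\<^sub>R e) < x \<bullet> e})"

definition assumption_A1 :: "'a::euclidean_space set \<Rightarrow> ('a \<Rightarrow> real \<Rightarrow> real) \<Rightarrow> bool" where
  "assumption_A1 \<Omega> a \<longleftrightarrow>
     (\<forall>y. (\<lambda>x. a x y) \<in> borel_measurable (lebesgue_on \<Omega>)) \<and>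
     (AE x in lebesgue_on \<Omega>. continuous_on UNIV (a x)) \<and>
     (AE x in lebesgue_on \<Omega>.
        (\<forall>y. a x differentiable at y) \<and> (\<forall>y. deriv (a x) differentiable at y) \<and>
        continuous_on UNIV (deriv (deriv (a x)))) \<and>
     (\<lambda>x. a x 0) \<in> L2 \<Omega>"

definition assumption_A2 :: "'a::euclidean_space set \<Rightarrow> ('a \<Rightarrow> real \<Rightarrow> real) \<Rightarrow> bool" where
  "assumption_A2 \<Omega> a \<longleftrightarrow> (AE x in lebesgue_on \<Omega>. \<forall>y. deriv (a x) y \<ge> 0)"

definition assumption_A3 :: "'a::euclidean_space set \<Rightarrow> ('a \<Rightarrow> real \<Rightarrow> real) \<Rightarrow> bool" where
  "assumption_A3 \<Omega> a \<longleftrightarrow> (\<forall>M>0. \<exists>C>0. AE x in lebesgue_on \<Omega>. \<forall>y. \<bar>y\<bar> \<le> M \<longrightarrow>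
     (\<Sum>i=1..2. \<bar>(deriv ^^ i) (a x) y\<bar>) \<le> C)"


section \<open>State and adjoint equations\<close>

text \<open>
  The trial and test space \<open>V\<close> is \<^term>\<open>H10 \<Omega>\<close> for the continuous and a finite element space for the
  discrete equations.  Integrability of the nonlinear term is required explicitly, because the
  Bochner integral of a non-integrable function is \<open>0\<close>.
\<close>

definition state_eq ::
  "'a::euclidean_space set \<Rightarrow> ('a \<Rightarrow> real \<Rightarrow> real) \<Rightarrow> ('a \<Rightarrow> real) set \<Rightarrow> ('a \<Rightarrow> real) \<Rightarrow> ('a \<Rightarrow> real) \<Rightarrow> bool"
where
  "state_eq \<Omega> a V u y \<longleftrightarrow> y \<in> V \<and>
     (\<forall>v\<in>V. integrable (lebesgue_on \<Omega>) (\<lambda>x. a x (y x) * v x) \<and>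
        grad_inner \<Omega> y v + L2_inner \<Omega> (\<lambda>x. a x (y x)) v = L2_inner \<Omega> u v)"

definition adjoint_eq ::
  "'a::euclidean_space set \<Rightarrow> ('a \<Rightarrow> real \<Rightarrow> real) \<Rightarrow> ('a \<Rightarrow> real) \<Rightarrow> ('a \<Rightarrow> real) set \<Rightarrow>
   ('a \<Rightarrow> real) \<Rightarrow> ('a \<Rightarrow> real) \<Rightarrow> bool"
where
  "adjoint_eq \<Omega> a yd V y p \<longleftrightarrow> p \<in> V \<and>
     (\<forall>w\<in>V. integrable (lebesgue_on \<Omega>) (\<lambda>x. deriv (a x) (y x) * p x * w x) \<and>
        grad_inner \<Omega> w p + L2_inner \<Omega> (\<lambda>x. deriv (a x) (y x) * p x) w
          = L2_inner \<Omega> (\<lambda>x. y x - yd x) w)"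

definition control_to_state ::
  "'a::euclidean_space set \<Rightarrow> ('a \<Rightarrow> real \<Rightarrow> real) \<Rightarrow> ('a \<Rightarrow> real) \<Rightarrow> 'a \<Rightarrow> real" where
  "control_to_state \<Omega> a u = (SOME y. state_eq \<Omega> a (H10 \<Omega>) u y)"


section \<open>The optimal control problem\<close>

definition cost ::
  "'a::euclidean_space set \<Rightarrow> real \<Rightarrow> ('a \<Rightarrow> real) \<Rightarrow> ('a \<Rightarrow> real) \<Rightarrow> ('a \<Rightarrow> real) \<Rightarrow> real" where
  "cost \<Omega> \<nu> yd y u = 1/2 * (L2_norm \<Omega> (\<lambda>x. y x - yd x))\<^sup>2 + \<nu>/2 * (L2_norm \<Omega> u)\<^sup>2"

definition reduced_cost ::
  "'a::euclidean_space set \<Rightarrow> ('a \<Rightarrow> real \<Rightarrow> real) \<Rightarrow> real \<Rightarrow> ('a \<Rightarrow> real) \<Rightarrow> ('a \<Rightarrow> real) \<Rightarrow> real" where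
  "reduced_cost \<Omega> a \<nu> yd u = cost \<Omega> \<nu> yd (control_to_state \<Omega> a u) u"

definition U_ad :: "'a::euclidean_space set \<Rightarrow> real \<Rightarrow> real \<Rightarrow> ('a \<Rightarrow> real) set" where
  "U_ad \<Omega> lb ub = {v \<in> L2 \<Omega>. AE x in lebesgue_on \<Omega>. lb \<le> v x \<and> v x \<le> ub}"

text \<open>
  Local minimality, in the $L^2$ sense for the control, of the pair \<open>(y, u)\<close> for the problem with
  control set \<open>U\<close> and state space \<open>V\<close>.
\<close>

definition local_solution ::
  "'a::euclidean_space set \<Rightarrow> ('a \<Rightarrow> real \<Rightarrow> real) \<Rightarrow> real \<Rightarrow> ('a \<Rightarrow> real) \<Rightarrow>
   ('a \<Rightarrow> real) set \<Rightarrow> ('a \<Rightarrow> real) set \<Rightarrow> ('a \<Rightarrow> real) \<Rightarrow> ('a \<Rightarrow> real) \<Rightarrow> bool"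
where
  "local_solution \<Omega> a \<nu> yd V U y u \<longleftrightarrow> u \<in> U \<and> state_eq \<Omega> a V u y \<and>
     (\<exists>\<epsilon>>0. \<forall>u'\<in>U. \<forall>y'. state_eq \<Omega> a V u' y' \<longrightarrow> L2_norm \<Omega> (\<lambda>x. u' x - u x) < \<epsilon> \<longrightarrow>
        cost \<Omega> \<nu> yd y u \<le> cost \<Omega> \<nu> yd y' u')"

definition proj_box :: "real \<Rightarrow> real \<Rightarrow> ('a \<Rightarrow> real) \<Rightarrow> 'a \<Rightarrow> real" where
  "proj_box lb ub v = (\<lambda>x. min ub (max (v x) lb))"

definition sign_condition ::
  "'a::euclidean_space set \<Rightarrow> real \<Rightarrow> real \<Rightarrow> ('a \<Rightarrow> real) \<Rightarrow> ('a \<Rightarrow> real) \<Rightarrow> bool" where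
  "sign_condition \<Omega> lb ub u v \<longleftrightarrow>
     (AE x in lebesgue_on \<Omega>. (u x = lb \<longrightarrow> v x \<ge> 0) \<and> (u x = ub \<longrightarrow> v x \<le> 0))"

definition critical_cone ::
  "'a::euclidean_space set \<Rightarrow> real \<Rightarrow> real \<Rightarrow> real \<Rightarrow> ('a \<Rightarrow> real) \<Rightarrow> ('a \<Rightarrow> real) \<Rightarrow> ('a \<Rightarrow> real) set"
where
  "critical_cone \<Omega> lb ub \<nu> u p = {v \<in> L2 \<Omega>. sign_condition \<Omega> lb ub u v \<and>
     (AE x in lebesgue_on \<Omega>. p x + \<nu> * u x \<noteq> 0 \<longrightarrow> v x = 0)}"

definition extended_cone ::
  "'a::euclidean_space set \<Rightarrow> real \<Rightarrow> real \<Rightarrow> real \<Rightarrow> ('a \<Rightarrow> real) \<Rightarrow> ('a \<Rightarrow> real) \<Rightarrow> real \<Rightarrow>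
   ('a \<Rightarrow> real) set"
where
  "extended_cone \<Omega> lb ub \<nu> u p \<tau> = {v \<in> L2 \<Omega>. sign_condition \<Omega> lb ub u v \<and>
     (AE x in lebesgue_on \<Omega>. \<bar>p x + \<nu> * u x\<bar> > \<tau> \<longrightarrow> v x = 0)}"

text \<open>\<open>CM\<close> is an admissible choice of the constant $C_{\mathsf M}$ for the functional \<open>j\<close>.\<close>

definition hessian_lipschitz_constant ::
  "'a::euclidean_space set \<Rightarrow> (('a \<Rightarrow> real) \<Rightarrow> real) \<Rightarrow> real \<Rightarrow> real \<Rightarrow> bool" where
  "hessian_lipschitz_constant \<Omega> j M CM \<longleftrightarrow> CM > 0 \<and>
     (\<forall>u\<in>Linf \<Omega>. \<forall>h\<in>Linf \<Omega>. \<forall>v\<in>Linf \<Omega>. max (Linf_norm \<Omega> u) (Linf_norm \<Omega> h) \<le> M \<longrightarrow>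
        \<bar>L2_deriv2 \<Omega> j (\<lambda>x. u x + h x) v v - L2_deriv2 \<Omega> j u v v\<bar>
          \<le> CM * Linf_norm \<Omega> h * (L2_norm \<Omega> v)\<^sup>2)"


section \<open>Meshes and finite element spaces\<close>

text \<open>\<^const>\<open>triangulation\<close> includes conformity: any two cells meet in a common face.\<close>

definition conforming_mesh :: "'a::euclidean_space set \<Rightarrow> 'a set set \<Rightarrow> bool" where
  "conforming_mesh \<Omega> \<T> \<longleftrightarrow> triangulation \<T> \<and> (\<forall>T\<in>\<T>. int DIM('a) simplex T) \<and> \<Union>\<T> = closure \<Omega>"

definition inradius :: "'a::euclidean_space set \<Rightarrow> real" where
  "inradius T = Sup {r. r \<ge> 0 \<and> (\<exists>c. cball c r \<subseteq> T)}"

definition mesh_family ::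
  "'a::euclidean_space set \<Rightarrow> real \<Rightarrow> 'a set set \<Rightarrow> 'a set set set \<Rightarrow> bool" where
  "mesh_family \<Omega> \<sigma> \<T>\<^sub>0 TT \<longleftrightarrow> conforming_mesh \<Omega> \<T>\<^sub>0 \<and>
     (\<forall>\<T>\<in>TT. conforming_mesh \<Omega> \<T> \<and> (\<forall>T\<in>\<T>. \<exists>T'\<in>\<T>\<^sub>0. T \<subseteq> T') \<and>
        (\<forall>T\<in>\<T>. diameter T \<le> \<sigma> * inradius T))"

definition P1_continuous :: "'a::euclidean_space set \<Rightarrow> 'a set set \<Rightarrow> ('a \<Rightarrow> real) set" where
  "P1_continuous \<Omega> \<T> =
     {v. continuous_on (closure \<Omega>) v \<and> (\<forall>T\<in>\<T>. \<exists>c b. \<forall>x\<in>T. v x = c + b \<bullet> x)}"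

definition fe_space :: "'a::euclidean_space set \<Rightarrow> 'a set set \<Rightarrow> ('a \<Rightarrow> real) set" where
  "fe_space \<Omega> \<T> = P1_continuous \<Omega> \<T> \<inter> H10 \<Omega>"

definition U_ad1 :: "'a::euclidean_space set \<Rightarrow> 'a set set \<Rightarrow> real \<Rightarrow> real \<Rightarrow> ('a \<Rightarrow> real) set" where
  "U_ad1 \<Omega> \<T> lb ub = P1_continuous \<Omega> \<T> \<inter> U_ad \<Omega> lb ub"

end

theory Submission
  imports Defs "HOL-Computational_Algebra.Polynomial"
begin

text \<open>
  The second-order condition and the variational inequalities reduce the error of the control to the
  distance of adjoint states, as usual.  The delicate point is that no uniform \<open>L\<^sup>\<infinity>\<close> bound on
  the discrete state \<open>yT\<close> is available, so the coefficient of the auxiliary adjoint equation may be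
  arbitrarily large where \<open>yT\<close> is large.  Put \<open>e = yhat - yT\<close>.  Galerkin orthogonality and monotonicity
  bound the squared energy norm of \<open>e\<close> linearly by its \<open>L\<^sup>2\<close> norm.  The capacity of the set where
  \<open>\<bar>e\<bar> \<ge> 1\<close> is therefore of the order of the state estimator, and testing the adjoint equation with cut-offs
  around this set shows that the large coefficient perturbs the adjoint state only by that order.
  Essential bounds for solutions of elliptic equations with \<open>L\<^sup>2\<close> data come from testing
  with regularised fundamental solutions instead of Sobolev embeddings.
\<close>


section \<open>L2 spaces of vector-valued functions\<close>

text \<open>A finite element function is bounded, but by a number that depends on the mesh. Such
  bounds (\<open>KT\<close>, \<open>PT\<close>, \<open>Q\<close>) serve only to make integrals
  exist; every constant that survives into the estimate (\<open>K\<close>, \<open>\<Lambda>\<close>,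
  \<open>E\<close>, \<open>F\<close>, \<open>B\<close>) comes from the data. Sup bounds for adjoint
  states rest on the sign of the coefficient alone, so they hold for \<open>phat\<close> uniformly.

  Adjoint states are compared by duality: a linear problem with bounded coefficient is solved for
  the error, and the sup norm of its solution is controlled by the L2 norm of the error. An L1 bound
  for the perturbation caused by the coefficient at \<open>yT\<close> is then enough, and this is
  what the cut-off argument supplies.

  The derivative of the reduced cost at \<open>ut\<close> is expressed by the adjoint state
  \<open>pt\<close> that belongs to the continuous state of \<open>ut\<close>. Comparing
  \<open>pt\<close> with \<open>phat\<close> involves \<open>ut\<close> and \<open>uT\<close> but
  not the optimal control, so the control error can be estimated before the errors of state and
  adjoint state, and nothing is circular.\<close>

definition L2v :: "'a measure \<Rightarrow> ('a \<Rightarrow> 'b::euclidean_space) set" where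
  "L2v M = {f \<in> borel_measurable M. integrable M (\<lambda>x. (norm (f x))\<^sup>2)}"

definition L2vn :: "'a measure \<Rightarrow> ('a \<Rightarrow> 'b::euclidean_space) \<Rightarrow> real" where
  "L2vn M f = sqrt (\<integral>x. (norm (f x))\<^sup>2 \<partial>M)"

lemma L2_eq_L2v: "L2 \<Omega> = L2v (lebesgue_on \<Omega>)"
  by (auto simp: L2_def L2v_def)

lemma L2_norm_eq: "L2_norm \<Omega> = L2vn (lebesgue_on \<Omega>)"
  by (auto simp: L2_norm_def L2vn_def L2_inner_def power2_eq_square)

lemma L2v_meas: "f \<in> L2v M \<Longrightarrow> f \<in> borel_measurable M"
  and L2v_integrable: "f \<in> L2v M \<Longrightarrow> integrable M (\<lambda>x. (norm (f x))\<^sup>2)"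
  by (auto simp: L2v_def)

lemma L2vn_nonneg [simp]: "0 \<le> L2vn M f"
  by (simp add: L2vn_def)

lemma L2vn_sq: "(L2vn M f)\<^sup>2 = (\<integral>x. (norm (f x))\<^sup>2 \<partial>M)"
  by (simp add: L2vn_def)

lemma L2vI_bound:
  assumes "f \<in> borel_measurable M" "integrable M g" "AE x in M. (norm (f x))\<^sup>2 \<le> g x"
  shows "f \<in> L2v M"
proof -
  have "AE x in M. norm ((norm (f x))\<^sup>2) \<le> norm (g x)"
    using assms(3) by eventually_elim simp
  moreover have "(\<lambda>x. (norm (f x))\<^sup>2) \<in> borel_measurable M" using assms(1) by simp
  ultimately have "integrable M (\<lambda>x. (norm (f x))\<^sup>2)"
    by (intro Bochner_Integration.integrable_bound[OF assms(2)])
  thus ?thesis using assms(1) by (simp add: L2v_def)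
qed

lemma L2v_norm_bound:
  assumes "f \<in> borel_measurable M" "g \<in> L2v M" "AE x in M. norm (f x) \<le> norm (g x)"
  shows "f \<in> L2v M" "L2vn M f \<le> L2vn M g"
proof -
  have *: "AE x in M. (norm (f x))\<^sup>2 \<le> (norm (g x))\<^sup>2"
    using assms(3) by eventually_elim (simp add: power_mono)
  show f: "f \<in> L2v M"
    by (rule L2vI_bound[OF assms(1) L2v_integrable[OF assms(2)] *])
  show "L2vn M f \<le> L2vn M g"
    unfolding L2vn_def
    by (intro real_sqrt_le_mono integral_mono_AE L2v_integrable f assms *)
qed

lemma L2v_cong_AE:
  assumes "f \<in> L2v M" "g \<in> borel_measurable M" "AE x in M. f x = g x"
  shows "g \<in> L2v M"
  by (rule L2v_norm_bound[OF assms(2,1)]) (use assms(3) in auto)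

lemma L2vn_cong_AE:
  assumes "f \<in> borel_measurable M" "g \<in> borel_measurable M" "AE x in M. f x = g x"
  shows "L2vn M f = L2vn M g"
  unfolding L2vn_def using assms by (intro arg_cong[where f = sqrt] integral_cong_AE) auto

lemma L2v_add:
  assumes "f \<in> L2v M" "g \<in> L2v M"
  shows "(\<lambda>x. f x + g x) \<in> L2v M"
proof (rule L2vI_bound)
  show "integrable M (\<lambda>x. 2 * (norm (f x))\<^sup>2 + 2 * (norm (g x))\<^sup>2)"
    using assms by (auto simp: L2v_def)
  have "(norm (f x + g x))\<^sup>2 \<le> 2 * (norm (f x))\<^sup>2 + 2 * (norm (g x))\<^sup>2" for x
  proof -
    have "(norm (f x + g x))\<^sup>2 \<le> (norm (f x) + norm (g x))\<^sup>2"
      by (intro power_mono norm_triangle_ineq) auto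
    also have "\<dots> \<le> 2 * (norm (f x))\<^sup>2 + 2 * (norm (g x))\<^sup>2"
      using zero_le_power2[of "norm (f x) - norm (g x)"] by (simp add: power2_eq_square algebra_simps)
    finally show ?thesis .
  qed
  thus "AE x in M. (norm (f x + g x))\<^sup>2 \<le> 2 * (norm (f x))\<^sup>2 + 2 * (norm (g x))\<^sup>2" by simp
qed (use assms in \<open>auto simp: L2v_def\<close>)

lemma L2v_scaleR:
  assumes "f \<in> L2v M" shows "(\<lambda>x. c *\<^sub>R f x) \<in> L2v M"
  using assms by (auto simp: L2v_def power_mult_distrib)

lemma L2vn_scaleR: "L2vn M (\<lambda>x. c *\<^sub>R f x) = \<bar>c\<bar> * L2vn M f"
  by (simp add: L2vn_def power_mult_distrib real_sqrt_mult)

lemma L2v_cmult: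
  fixes f :: "'a \<Rightarrow> real"
  shows "f \<in> L2v M \<Longrightarrow> (\<lambda>x. c * f x) \<in> L2v M"
  using L2v_scaleR[of f M c] by simp

lemma L2vn_cmult:
  fixes f :: "'a \<Rightarrow> real"
  shows "L2vn M (\<lambda>x. c * f x) = \<bar>c\<bar> * L2vn M f"
  using L2vn_scaleR[of M c f] by simp

lemma L2v_minus: "f \<in> L2v M \<Longrightarrow> (\<lambda>x. - f x) \<in> L2v M"
  by (auto simp: L2v_def)

lemma L2v_diff:
  assumes "f \<in> L2v M" "g \<in> L2v M"
  shows "(\<lambda>x. f x - g x) \<in> L2v M"
  using L2v_add[OF assms(1) L2v_minus[OF assms(2)]] by simp

lemma L2vn_commute: "L2vn M (\<lambda>x. f x - g x) = L2vn M (\<lambda>x. g x - f x)"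
  by (simp add: L2vn_def norm_minus_commute)

lemma L2v_integrable_norm_mult:
  assumes "f \<in> L2v M" "g \<in> L2v M"
  shows "integrable M (\<lambda>x. norm (f x) * norm (g x))"
proof (rule Bochner_Integration.integrable_bound)
  show "integrable M (\<lambda>x. (norm (f x))\<^sup>2 + (norm (g x))\<^sup>2)"
    using assms by (auto simp: L2v_def)
  have "norm (norm (f x) * norm (g x)) \<le> norm ((norm (f x))\<^sup>2 + (norm (g x))\<^sup>2)" for x
  proof -
    have "2 * (norm (f x) * norm (g x)) \<le> (norm (f x))\<^sup>2 + (norm (g x))\<^sup>2"
      using zero_le_power2[of "norm (f x) - norm (g x)"] unfolding power2_diff by simp
    moreover have "0 \<le> norm (f x) * norm (g x)" by simp
    ultimately show ?thesis unfolding real_norm_def by linarith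
  qed
  thus "AE x in M. norm (norm (f x) * norm (g x)) \<le> norm ((norm (f x))\<^sup>2 + (norm (g x))\<^sup>2)" by simp
qed (use assms in \<open>auto simp: L2v_def\<close>)

lemma L2v_integrable_inner:
  assumes "f \<in> L2v M" "g \<in> L2v M"
  shows "integrable M (\<lambda>x. f x \<bullet> g x)"
  by (rule Bochner_Integration.integrable_bound[OF L2v_integrable_norm_mult[OF assms]])
     (use assms in \<open>auto simp: L2v_def abs_mult Cauchy_Schwarz_ineq2\<close>)

lemma L2v_integrable_mult:
  fixes f g :: "'a \<Rightarrow> real"
  assumes "f \<in> L2v M" "g \<in> L2v M"
  shows "integrable M (\<lambda>x. f x * g x)"
  using L2v_integrable_inner[OF assms] by simp

text \<open>The discriminant argument behind the Cauchy-Schwarz inequality, kept apart from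
  integrals because the degenerate case \<open>a = 0\<close>, a linear function bounded below, needs
  its own treatment.\<close>

lemma quadratic_nonneg_imp:
  fixes a b c :: real
  assumes "\<And>t. 0 \<le> a * t\<^sup>2 - 2 * c * t + b" "a \<ge> 0" "b \<ge> 0"
  shows "c \<le> sqrt a * sqrt b"
proof (cases "a = 0")
  case True
  have "c \<le> 0"
  proof (rule ccontr)
    assume "\<not> c \<le> 0"
    hence "c > 0" by simp
    \<comment> \<open>Here the expression evaluates to \<open>b - (b + 1) = -1\<close>.\<close>
    with assms(1)[of "(b + 1) / (2 * c)"] True show False by simp
  qed
  thus ?thesis using True by simp
next
  case False
  hence a: "a > 0" using assms by simp
  have "c\<^sup>2 \<le> a * b"
    using assms(1)[of "c / a"] a by (simp add: power2_eq_square field_simps)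
  hence "\<bar>c\<bar> \<le> sqrt (a * b)" by (metis real_sqrt_abs real_sqrt_le_mono)
  thus ?thesis by (simp add: real_sqrt_mult)
qed

lemma L2v_CS_norm:
  assumes f: "f \<in> L2v M" and g: "g \<in> L2v M"
  shows "(\<integral>x. norm (f x) * norm (g x) \<partial>M) \<le> L2vn M f * L2vn M g"
  unfolding L2vn_def
proof (rule quadratic_nonneg_imp)
  fix t :: real
  note i = L2v_integrable[OF f] L2v_integrable[OF g] L2v_integrable_norm_mult[OF f g]
  have "0 \<le> (\<integral>x. (t * norm (f x) - norm (g x))\<^sup>2 \<partial>M)" by simp
  also have "\<dots> = (\<integral>x. t\<^sup>2 * (norm (f x))\<^sup>2 - 2 * t * (norm (f x) * norm (g x)) + (norm (g x))\<^sup>2 \<partial>M)"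
    by (intro Bochner_Integration.integral_cong refl) (simp add: power2_eq_square algebra_simps)
  also have "\<dots> = t\<^sup>2 * (\<integral>x. (norm (f x))\<^sup>2 \<partial>M) - 2 * t * (\<integral>x. norm (f x) * norm (g x) \<partial>M)
      + (\<integral>x. (norm (g x))\<^sup>2 \<partial>M)"
    using i by simp
  finally show "0 \<le> (\<integral>x. (norm (f x))\<^sup>2 \<partial>M) * t\<^sup>2 - 2 * (\<integral>x. norm (f x) * norm (g x) \<partial>M) * t
      + (\<integral>x. (norm (g x))\<^sup>2 \<partial>M)" by (simp add: algebra_simps)
qed auto

lemma L2v_CS:
  assumes f: "f \<in> L2v M" and g: "g \<in> L2v M"
  shows "\<bar>\<integral>x. f x \<bullet> g x \<partial>M\<bar> \<le> L2vn M f * L2vn M g"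
proof -
  have "\<bar>\<integral>x. f x \<bullet> g x \<partial>M\<bar> \<le> (\<integral>x. \<bar>f x \<bullet> g x\<bar> \<partial>M)" by (rule integral_abs_bound)
  also have "\<dots> \<le> (\<integral>x. norm (f x) * norm (g x) \<partial>M)"
    by (intro integral_mono L2v_integrable_norm_mult f g integrable_abs L2v_integrable_inner)
       (auto simp: Cauchy_Schwarz_ineq2)
  also note L2v_CS_norm[OF f g]
  finally show ?thesis .
qed

lemma L2v_CS_real:
  fixes f g :: "'a \<Rightarrow> real"
  assumes f: "f \<in> L2v M" and g: "g \<in> L2v M"
  shows "\<bar>\<integral>x. f x * g x \<partial>M\<bar> \<le> L2vn M f * L2vn M g"
  using L2v_CS[OF assms] by simp

lemma L2vn_triangle:
  assumes f: "f \<in> L2v M" and g: "g \<in> L2v M"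
  shows "L2vn M (\<lambda>x. f x + g x) \<le> L2vn M f + L2vn M g"
proof (rule power2_le_imp_le)
  have "(L2vn M (\<lambda>x. f x + g x))\<^sup>2 = (\<integral>x. (norm (f x))\<^sup>2 + 2 * (f x \<bullet> g x) + (norm (g x))\<^sup>2 \<partial>M)"
    unfolding L2vn_sq
    by (intro Bochner_Integration.integral_cong refl)
       (simp add: power2_norm_eq_inner inner_add_left inner_add_right inner_commute)
  also have "\<dots> = (L2vn M f)\<^sup>2 + 2 * (\<integral>x. f x \<bullet> g x \<partial>M) + (L2vn M g)\<^sup>2"
    unfolding L2vn_sq using L2v_integrable[OF f] L2v_integrable[OF g] L2v_integrable_inner[OF f g] by simp
  also have "\<dots> \<le> (L2vn M f + L2vn M g)\<^sup>2"
    using L2v_CS[OF f g] by (simp add: power2_eq_square algebra_simps)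
  finally show "(L2vn M (\<lambda>x. f x + g x))\<^sup>2 \<le> (L2vn M f + L2vn M g)\<^sup>2" .
qed (simp add: add_nonneg_nonneg)

lemma L2vn_triangle_diff:
  assumes f: "f \<in> L2v M" and g: "g \<in> L2v M" and h: "h \<in> L2v M"
  shows "L2vn M (\<lambda>x. f x - h x) \<le> L2vn M (\<lambda>x. f x - g x) + L2vn M (\<lambda>x. g x - h x)"
  using L2vn_triangle[OF L2v_diff[OF f g] L2v_diff[OF g h]] by simp

lemma L2vn_diff_ineq:
  assumes f: "f \<in> L2v M" and g: "g \<in> L2v M"
  shows "\<bar>L2vn M f - L2vn M g\<bar> \<le> L2vn M (\<lambda>x. f x - g x)"
  using L2vn_triangle[OF L2v_diff[OF f g] g] L2vn_triangle[OF L2v_diff[OF g f] f] L2vn_commute[of M f g]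
  by simp

lemma L2vn_eq_0_iff:
  assumes "f \<in> L2v M"
  shows "L2vn M f = 0 \<longleftrightarrow> (AE x in M. f x = 0)"
  unfolding L2vn_def using integral_nonneg_eq_0_iff_AE[OF L2v_integrable[OF assms]] by simp

lemma L2v_Bounded:
  assumes "finite_measure M" "f \<in> borel_measurable M" "AE x in M. norm (f x) \<le> B"
  shows "f \<in> L2v M" "L2vn M f \<le> \<bar>B\<bar> * sqrt (measure M (space M))"
proof -
  interpret finite_measure M by fact
  have *: "AE x in M. norm (f x) \<le> norm ((\<lambda>x. B) x)" using assms(3) by eventually_elim simp
  have c: "(\<lambda>x. B) \<in> L2v M" by (simp add: L2v_def)
  show "f \<in> L2v M" by (rule L2v_norm_bound[OF assms(2) c *])
  have "L2vn M f \<le> L2vn M (\<lambda>x. B)" by (rule L2v_norm_bound[OF assms(2) c *])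
  also have "\<dots> = \<bar>B\<bar> * sqrt (measure M (space M))"
    by (simp add: L2vn_def real_sqrt_mult mult.commute)
  finally show "L2vn M f \<le> \<bar>B\<bar> * sqrt (measure M (space M))" .
qed

lemma L2v_integrable_norm:
  assumes "finite_measure M" "f \<in> L2v M"
  shows "integrable M (\<lambda>x. norm (f x))" "(\<integral>x. norm (f x) \<partial>M) \<le> L2vn M f * sqrt (measure M (space M))"
    "integrable M f"
proof -
  interpret finite_measure M by fact
  have c: "(\<lambda>x. 1::real) \<in> L2v M" by (simp add: L2v_def)
  show *: "integrable M (\<lambda>x. norm (f x))" using L2v_integrable_norm_mult[OF assms(2) c] by simp
  show "integrable M f" using * L2v_meas[OF assms(2)] by (simp add: integrable_norm_iff)
  show "(\<integral>x. norm (f x) \<partial>M) \<le> L2vn M f * sqrt (measure M (space M))"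
    using L2v_CS_norm[OF assms(2) c] by (simp add: L2vn_def)
qed

lemma L2v_mult_bounded:
  fixes f :: "'a \<Rightarrow> 'b::euclidean_space"
  assumes "f \<in> L2v M" "b \<in> borel_measurable M" "AE x in M. \<bar>b x\<bar> \<le> B"
  shows "(\<lambda>x. b x *\<^sub>R f x) \<in> L2v M" "L2vn M (\<lambda>x. b x *\<^sub>R f x) \<le> \<bar>B\<bar> * L2vn M f"
proof -
  have m: "(\<lambda>x. b x *\<^sub>R f x) \<in> borel_measurable M" using assms by (auto simp: L2v_def)
  have *: "AE x in M. norm (b x *\<^sub>R f x) \<le> norm (B *\<^sub>R f x)"
    using assms(3) by eventually_elim (auto intro!: mult_right_mono)
  show "(\<lambda>x. b x *\<^sub>R f x) \<in> L2v M" "L2vn M (\<lambda>x. b x *\<^sub>R f x) \<le> \<bar>B\<bar> * L2vn M f"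
    using L2v_norm_bound[OF m L2v_scaleR[OF assms(1)] *] by (simp_all add: L2vn_scaleR)
qed

section \<open>Almost everywhere limits and completeness of L2\<close>

lemma L2v_AE_subseq:
  assumes f: "\<And>n. f n \<in> L2v M" and g: "g \<in> L2v M" and lim: "(\<lambda>n. L2vn M (\<lambda>x. f n x - g x)) \<longlonglongrightarrow> 0"
  obtains r :: "nat \<Rightarrow> nat" where "strict_mono r" "AE x in M. (\<lambda>n. f (r n) x) \<longlonglongrightarrow> g x"
proof -
  have i: "integrable M (\<lambda>x. (norm (f n x - g x))\<^sup>2)" for n
    by (intro L2v_integrable L2v_diff f g)
  have "(\<lambda>n. (L2vn M (\<lambda>x. f n x - g x))\<^sup>2) \<longlonglongrightarrow> 0\<^sup>2" by (intro tendsto_power lim)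
  hence "(\<lambda>n. \<integral>x. norm ((norm (f n x - g x))\<^sup>2) \<partial>M) \<longlonglongrightarrow> 0" unfolding L2vn_sq by simp
  from tendsto_L1_AE_subseq[OF i this] obtain r where r: "strict_mono r"
    "AE x in M. (\<lambda>n. (norm (f (r n) x - g x))\<^sup>2) \<longlonglongrightarrow> 0" by auto
  have "AE x in M. (\<lambda>n. f (r n) x) \<longlonglongrightarrow> g x"
    using r(2)
  proof eventually_elim
    case (elim x)
    have "(\<lambda>n. sqrt ((norm (f (r n) x - g x))\<^sup>2)) \<longlonglongrightarrow> sqrt 0" by (intro tendsto_real_sqrt elim)
    hence "(\<lambda>n. norm (f (r n) x - g x)) \<longlonglongrightarrow> 0" by simp
    thus ?case by (simp add: LIM_zero_iff tendsto_norm_zero_iff)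
  qed
  with r(1) that show ?thesis by blast
qed

text \<open>Lower semicontinuity of the norm under pointwise convergence. It places an almost
  everywhere limit in L2 when only bounds for the sequence are known.\<close>

lemma L2vn_Fatou:
  fixes f :: "nat \<Rightarrow> 'a \<Rightarrow> 'b::euclidean_space"
  assumes f: "\<And>n. f n \<in> L2v M" and g: "g \<in> borel_measurable M"
    and lim: "AE x in M. (\<lambda>n. f n x) \<longlonglongrightarrow> g x" and B: "\<And>n. L2vn M (f n) \<le> B"
  shows "g \<in> L2v M" "L2vn M g \<le> B"
proof -
  have B0: "B \<ge> 0" using B[of 0] L2vn_nonneg[of M "f 0"] by linarith
  have "(\<integral>\<^sup>+x. ennreal ((norm (g x))\<^sup>2) \<partial>M) = (\<integral>\<^sup>+x. liminf (\<lambda>n. ennreal ((norm (f n x))\<^sup>2)) \<partial>M)"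
  proof (rule nn_integral_cong_AE, use lim in eventually_elim)
    case (elim x)
    have "(\<lambda>n. ennreal ((norm (f n x))\<^sup>2)) \<longlonglongrightarrow> ennreal ((norm (g x))\<^sup>2)"
      by (intro tendsto_intros elim)
    from lim_imp_Liminf[OF sequentially_bot this] show ?case by (rule sym)
  qed
  also have "\<dots> \<le> liminf (\<lambda>n. \<integral>\<^sup>+x. ennreal ((norm (f n x))\<^sup>2) \<partial>M)"
    using f[THEN L2v_meas] by (intro nn_integral_liminf) simp
  also have "\<dots> \<le> ennreal (B\<^sup>2)"
  proof -
    have "(\<integral>\<^sup>+x. ennreal ((norm (f n x))\<^sup>2) \<partial>M) \<le> ennreal (B\<^sup>2)" for n
    proof -
      have "(\<integral>\<^sup>+x. ennreal ((norm (f n x))\<^sup>2) \<partial>M) = ennreal ((L2vn M (f n))\<^sup>2)"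
        unfolding L2vn_sq by (intro nn_integral_eq_integral L2v_integrable f) auto
      thus ?thesis using B[of n] by (simp add: ennreal_leI power_mono)
    qed
    hence "liminf (\<lambda>n. \<integral>\<^sup>+x. ennreal ((norm (f n x))\<^sup>2) \<partial>M) \<le> liminf (\<lambda>n::nat. ennreal (B\<^sup>2))"
      by (intro Liminf_mono) auto
    thus ?thesis by (simp add: Liminf_const)
  qed
  finally have *: "(\<integral>\<^sup>+x. ennreal ((norm (g x))\<^sup>2) \<partial>M) \<le> ennreal (B\<^sup>2)" .
  have gi: "integrable M (\<lambda>x. (norm (g x))\<^sup>2)"
    using g * by (intro integrableI_nonneg) (auto intro: le_less_trans)
  thus "g \<in> L2v M" using g by (simp add: L2v_def)
  have "ennreal ((L2vn M g)\<^sup>2) \<le> ennreal (B\<^sup>2)"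
    using * unfolding L2vn_sq by (subst (asm) nn_integral_eq_integral[OF gi]) auto
  thus "L2vn M g \<le> B" using B0 by (metis ennreal_le_iff power2_le_imp_le zero_le_power2)
qed

text \<open>Riesz-Fischer: a subsequence with geometrically small increments is extracted. On a
  finite measure space L2 bounds are L1 bounds, so the increments are absolutely summable almost
  everywhere and a pointwise limit exists; Fatou's lemma turns it into an L2 limit of the whole
  sequence.\<close>

theorem L2v_complete:
  fixes f :: "nat \<Rightarrow> 'a \<Rightarrow> 'b::euclidean_space"
  assumes M: "finite_measure M" and f: "\<And>n. f n \<in> L2v M"
    and cauchy: "\<And>e. e > 0 \<Longrightarrow> \<exists>N. \<forall>m\<ge>N. \<forall>n\<ge>N. L2vn M (\<lambda>x. f m x - f n x) < e"
  obtains g where "g \<in> L2v M" "(\<lambda>n. L2vn M (\<lambda>x. f n x - g x)) \<longlonglongrightarrow> 0"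
proof -
  interpret finite_measure M by fact
  define N where "N k = (SOME N. \<forall>m\<ge>N. \<forall>n\<ge>N. L2vn M (\<lambda>x. f m x - f n x) < (1/2)^k)" for k :: nat
  have N: "L2vn M (\<lambda>x. f m x - f n x) < (1/2)^k" if "m \<ge> N k" "n \<ge> N k" for k m n
    using someI_ex[OF cauchy[of "(1/2)^k"]] that unfolding N_def[symmetric] by auto
  \<comment> \<open>The sum makes \<open>r\<close> monotone and at least \<open>N k\<close>; the
    summand \<open>k\<close> makes it unbounded even if every \<open>N i\<close> is 0.\<close>
  define r where "r k = (\<Sum>i\<le>k. N i) + k" for k
  have rN: "r k \<ge> N k" for k unfolding r_def by (rule trans_le_add1, rule member_le_sum) auto
  have rmono: "r k \<le> r (Suc k)" for k by (simp add: r_def)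
  have rk: "r k \<ge> k" for k by (simp add: r_def)
  define d where "d k x = f (r (Suc k)) x - f (r k) x" for k x
  have d: "d k \<in> L2v M" for k unfolding d_def by (intro L2v_diff f)
  have dn: "L2vn M (d k) < (1/2)^k" for k
    unfolding d_def using rN[of k] rmono[of k] by (intro N) auto
  define c where "c = sqrt (measure M (space M))"
  have c0: "c \<ge> 0" by (simp add: c_def)
  have "(\<integral>\<^sup>+x. (\<Sum>k. ennreal (norm (d k x))) \<partial>M) = (\<Sum>k. \<integral>\<^sup>+x. ennreal (norm (d k x)) \<partial>M)"
    using d[THEN L2v_meas] by (intro nn_integral_suminf) simp
  also have "\<dots> \<le> (\<Sum>k. ennreal (c * (1/2)^k))"
  proof (intro suminf_le allI)
    fix k
    have "(\<integral>\<^sup>+x. ennreal (norm (d k x)) \<partial>M) = ennreal (\<integral>x. norm (d k x) \<partial>M)"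
      by (intro nn_integral_eq_integral L2v_integrable_norm M d) auto
    also have "(\<integral>x. norm (d k x) \<partial>M) \<le> L2vn M (d k) * c"
      unfolding c_def by (intro L2v_integrable_norm M d)
    also have "\<dots> \<le> c * (1/2)^k" using dn[of k] c0 by (simp add: mult.commute mult_left_mono)
    finally show "(\<integral>\<^sup>+x. ennreal (norm (d k x)) \<partial>M) \<le> ennreal (c * (1/2)^k)" by (simp add: ennreal_leI)
  qed auto
  also have "\<dots> < \<infinity>"
  proof -
    have s: "summable (\<lambda>k. c * (1/2::real)^k)" by (intro summable_mult summable_geometric) simp
    have "(\<Sum>k. ennreal (c * (1/2)^k)) = ennreal (\<Sum>k. c * (1/2)^k)"
      by (intro suminf_ennreal2 s) (use c0 in auto)
    thus ?thesis by simp
  qed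
  finally have "(\<integral>\<^sup>+x. (\<Sum>k. ennreal (norm (d k x))) \<partial>M) \<noteq> \<infinity>" by simp
  hence "AE x in M. (\<Sum>k. ennreal (norm (d k x))) \<noteq> \<infinity>"
    using d[THEN L2v_meas] by (intro nn_integral_PInf_AE) auto
  hence conv: "AE x in M. convergent (\<lambda>k. f (r k) x)"
  proof eventually_elim
    case (elim x)
    have "summable (\<lambda>k. norm (d k x))" using elim by (intro summable_suminf_not_top) auto
    hence "summable (\<lambda>k. d k x)" by (rule summable_norm_cancel)
    hence "convergent (\<lambda>n. (\<Sum>k<n. d k x))" by (simp add: summable_iff_convergent)
    moreover have "(\<Sum>k<n. d k x) = f (r n) x - f (r 0) x" for n
      unfolding d_def by (rule sum_lessThan_telescope)
    ultimately have "convergent (\<lambda>n. f (r n) x - f (r 0) x)" by simp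
    hence "convergent (\<lambda>n. (f (r n) x - f (r 0) x) + f (r 0) x)"
      by (intro convergent_add convergent_const)
    thus ?case by simp
  qed
  define g where "g x = lim (\<lambda>k. f (r k) x)" for x
  have gm: "g \<in> borel_measurable M" unfolding g_def
    using f[THEN L2v_meas] by (intro borel_measurable_lim_metric)
  have glim: "AE x in M. (\<lambda>k. f (r k) x) \<longlonglongrightarrow> g x"
    using conv by eventually_elim (simp add: g_def convergent_LIMSEQ_iff)
  \<comment> \<open>For fixed \<open>m\<close>, Fatou's lemma is applied along the tail
    \<open>n + K\<close> of the subsequence, whose members all lie within \<open>e\<close> of
    \<open>f m\<close>.\<close>
  have est: "(\<lambda>x. f m x - g x) \<in> L2v M \<and> L2vn M (\<lambda>x. f m x - g x) \<le> e"
    if K: "\<forall>m\<ge>K. \<forall>n\<ge>K. L2vn M (\<lambda>x. f m x - f n x) < e" "m \<ge> K" for e m K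
  proof -
    have a: "(\<lambda>x. f m x - f (r (n + K)) x) \<in> L2v M" for n by (intro L2v_diff f)
    have b: "(\<lambda>x. f m x - g x) \<in> borel_measurable M" using f[THEN L2v_meas] gm by simp
    have c: "AE x in M. (\<lambda>n. f m x - f (r (n + K)) x) \<longlonglongrightarrow> f m x - g x"
      using glim by eventually_elim (intro tendsto_intros LIMSEQ_ignore_initial_segment)
    have d: "L2vn M (\<lambda>x. f m x - f (r (n + K)) x) \<le> e" for n
      using K rk[of "n + K"] by (intro less_imp_le) (auto intro!: K(1)[rule_format])
    show ?thesis using L2vn_Fatou[OF a b c d] by simp
  qed
  obtain K where K: "\<forall>m\<ge>K. \<forall>n\<ge>K. L2vn M (\<lambda>x. f m x - f n x) < 1" using cauchy[of 1] by auto
  \<comment> \<open>Membership of \<open>g\<close> in L2 is recovered from that of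
    \<open>f K\<close> and of \<open>f K - g\<close>.\<close>
  have "(\<lambda>x. f K x - (f K x - g x)) \<in> L2v M"
    using est[OF K order_refl, THEN conjunct1] by (rule L2v_diff[OF f])
  moreover have "(\<lambda>x. f K x - (f K x - g x)) = g" by (rule ext) (rule diff_diff_eq2[THEN trans], simp)
  ultimately have g: "g \<in> L2v M" by (rule back_subst)
  have "(\<lambda>n. L2vn M (\<lambda>x. f n x - g x)) \<longlonglongrightarrow> 0"
  proof (rule LIMSEQ_I)
    fix e :: real assume "e > 0"
    then obtain K where K: "\<forall>m\<ge>K. \<forall>n\<ge>K. L2vn M (\<lambda>x. f m x - f n x) < e / 2" using cauchy[of "e/2"] by auto
    show "\<exists>no. \<forall>n\<ge>no. norm (L2vn M (\<lambda>x. f n x - g x) - 0) < e"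
    proof (intro exI[of _ K] allI impI)
      fix n assume "n \<ge> K"
      hence "L2vn M (\<lambda>x. f n x - g x) \<le> e / 2" using est[OF K] by blast
      thus "norm (L2vn M (\<lambda>x. f n x - g x) - 0) < e" using \<open>e > 0\<close> by simp
    qed
  qed
  with g that show ?thesis by blast
qed


section \<open>Smooth functions and test functions\<close>

abbreviation pd :: "('a::euclidean_space \<Rightarrow> real) \<Rightarrow> 'a \<Rightarrow> 'a \<Rightarrow> real" where
  "pd f i x \<equiv> frechet_derivative f (at x) i"

definition smooth :: "('a::euclidean_space \<Rightarrow> real) \<Rightarrow> bool" where
  "smooth f \<longleftrightarrow> (\<forall>k. C_k k f)"

definition grad :: "('a::euclidean_space \<Rightarrow> real) \<Rightarrow> 'a \<Rightarrow> 'a" where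
  "grad f x = (\<Sum>i\<in>Basis. pd f i x *\<^sub>R i)"

section \<open>Calculus of smooth functions\<close>

lemma C_k_SucI:
  assumes "\<And>x. (f has_derivative f' x) (at x)" "\<And>i. i \<in> Basis \<Longrightarrow> C_k k (\<lambda>x. f' x i)"
  shows "C_k (Suc k) f"
proof -
  have "frechet_derivative f (at x) = f' x" for x
    using frechet_derivative_at[OF assms(1)] by simp
  thus ?thesis using assms by (auto simp: differentiable_def)
qed

lemma C_k_SucD:
  assumes "C_k (Suc k) f"
  shows "(f has_derivative frechet_derivative f (at x)) (at x)" "i \<in> Basis \<Longrightarrow> C_k k (pd f i)"
  using assms by (auto simp: frechet_derivative_works)

lemma C_k_Suc_imp: "C_k (Suc k) f \<Longrightarrow> C_k k f"
proof (induction k arbitrary: f)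
  case 0
  thus ?case by (auto intro!: continuous_at_imp_continuous_on differentiable_imp_continuous_within)
next
  case (Suc k)
  note d = C_k_SucD[OF Suc.prems]
  show ?case by (rule C_k_SucI[OF d(1)]) (use Suc.IH d(2) in blast)
qed

lemma C_k_const: "C_k k (\<lambda>x. c)"
proof (induction k arbitrary: c)
  case (Suc k)
  show ?case by (rule C_k_SucI[where f' = "\<lambda>_ _. 0"]) (auto intro!: Suc)
qed auto

lemma C_k_add: "C_k k f \<Longrightarrow> C_k k g \<Longrightarrow> C_k k (\<lambda>x. f x + g x)"
proof (induction k arbitrary: f g)
  case 0
  thus ?case by (auto intro: continuous_on_add)
next
  case (Suc k)
  note f = C_k_SucD[OF Suc.prems(1)] and g = C_k_SucD[OF Suc.prems(2)]
  show ?case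
    by (rule C_k_SucI[OF has_derivative_add[OF f(1) g(1)]]) (intro Suc.IH f g)
qed

lemma C_k_mult: "C_k k f \<Longrightarrow> C_k k g \<Longrightarrow> C_k k (\<lambda>x. f x * g x)"
proof (induction k arbitrary: f g)
  case 0
  thus ?case by (auto intro: continuous_on_mult)
next
  case (Suc k)
  note f = C_k_SucD[OF Suc.prems(1)] and g = C_k_SucD[OF Suc.prems(2)]
  show ?case
    by (rule C_k_SucI[OF has_derivative_mult[OF f(1) g(1)]])
       (intro C_k_add Suc.IH f g Suc.prems[THEN C_k_Suc_imp])
qed

lemma C_k_inner: "C_k k (\<lambda>x. x \<bullet> a)"
proof (cases k)
  case (Suc m)
  show ?thesis unfolding Suc
    by (rule C_k_SucI[where f' = "\<lambda>_ h. h \<bullet> a"]) (auto intro!: derivative_eq_intros C_k_const)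
qed (auto intro!: continuous_intros)

lemma C_k_sum: "finite A \<Longrightarrow> (\<And>j. j \<in> A \<Longrightarrow> C_k k (f j)) \<Longrightarrow> C_k k (\<lambda>x. \<Sum>j\<in>A. f j x)"
  by (induction A rule: finite_induct) (auto intro: C_k_const C_k_add)

lemma C_k_prod: "finite A \<Longrightarrow> (\<And>j. j \<in> A \<Longrightarrow> C_k k (f j)) \<Longrightarrow> C_k k (\<lambda>x. \<Prod>j\<in>A. f j x)"
  by (induction A rule: finite_induct) (auto intro: C_k_const C_k_mult)

lemma C_k_power: "C_k k f \<Longrightarrow> C_k k (\<lambda>x. f x ^ n)"
  by (induction n) (auto intro: C_k_const C_k_mult)

text \<open>The outer function comes with the whole sequence \<open>F\<close> of its derivatives, so
  the induction on \<open>k\<close> can run for all \<open>n\<close> at once. The set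
  \<open>I\<close> admits outer functions such as real powers and logarithms, which are smooth only
  for positive arguments.\<close>

lemma C_k_comp:
  fixes F :: "nat \<Rightarrow> real \<Rightarrow> real"
  assumes F: "\<And>n t. t \<in> I \<Longrightarrow> (F n has_real_derivative F (Suc n) t) (at t)"
    and f: "C_k k f" "\<And>x. f x \<in> I"
  shows "C_k k (\<lambda>x. F n (f x))"
  using f(1)
proof (induction k arbitrary: n)
  case 0
  show ?case unfolding C_k.simps
  proof (intro continuous_at_imp_continuous_on ballI)
    fix x
    have "isCont f x" using 0 by (simp add: continuous_on_eq_continuous_at)
    thus "isCont (\<lambda>x. F n (f x)) x" using DERIV_isCont[OF F[OF f(2)]] by (rule isCont_o2)
  qed
next
  case (Suc k)
  note d = C_k_SucD[OF Suc.prems]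
  have "((\<lambda>x. F n (f x)) has_derivative (\<lambda>h. F (Suc n) (f x) * frechet_derivative f (at x) h)) (at x)" for x
    using has_derivative_compose[OF d(1) F[OF f(2), unfolded has_field_derivative_def]] .
  thus ?case
    by (rule C_k_SucI) (intro C_k_mult Suc.IH d C_k_Suc_imp[OF Suc.prems])
qed

lemma smooth_const [simp]: "smooth (\<lambda>x. c)"
  and smooth_inner [simp]: "smooth (\<lambda>x. x \<bullet> a)"
  and smooth_add: "smooth f \<Longrightarrow> smooth g \<Longrightarrow> smooth (\<lambda>x. f x + g x)"
  and smooth_mult: "smooth f \<Longrightarrow> smooth g \<Longrightarrow> smooth (\<lambda>x. f x * g x)"
  and smooth_power: "smooth f \<Longrightarrow> smooth (\<lambda>x. f x ^ n)"
  and smooth_sum: "finite A \<Longrightarrow> (\<And>j. j \<in> A \<Longrightarrow> smooth (h j)) \<Longrightarrow> smooth (\<lambda>x. \<Sum>j\<in>A. h j x)"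
  and smooth_prod: "finite A \<Longrightarrow> (\<And>j. j \<in> A \<Longrightarrow> smooth (h j)) \<Longrightarrow> smooth (\<lambda>x. \<Prod>j\<in>A. h j x)"
  by (simp_all add: smooth_def C_k_const C_k_inner C_k_add C_k_mult C_k_power C_k_sum C_k_prod)

lemma smooth_comp:
  fixes F :: "nat \<Rightarrow> real \<Rightarrow> real"
  assumes "\<And>n t. t \<in> I \<Longrightarrow> (F n has_real_derivative F (Suc n) t) (at t)" "smooth f" "\<And>x. f x \<in> I"
  shows "smooth (\<lambda>x. F n (f x))"
  using assms C_k_comp[of I F _ f n] by (simp add: smooth_def)

lemma smooth_has_derivative: "smooth f \<Longrightarrow> (f has_derivative frechet_derivative f (at x)) (at x)"
  using C_k_SucD(1)[of 0 f] by (simp add: smooth_def del: C_k.simps)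

lemma smooth_pd: "smooth f \<Longrightarrow> i \<in> Basis \<Longrightarrow> smooth (pd f i)"
  unfolding smooth_def using C_k_SucD(2) by blast

lemma smooth_continuous: "smooth f \<Longrightarrow> continuous_on A f"
  using continuous_on_subset[of UNIV f A] C_k.simps(1)[of f] by (auto simp: smooth_def simp del: C_k.simps(2))

lemma smooth_borel: "smooth f \<Longrightarrow> f \<in> borel_measurable borel"
  by (intro borel_measurable_continuous_onI smooth_continuous)

lemma pd_eqI: "(f has_derivative f') (at x) \<Longrightarrow> pd f i x = f' i"
  using frechet_derivative_at by metis

lemma pd_add: "smooth f \<Longrightarrow> smooth g \<Longrightarrow> pd (\<lambda>x. f x + g x) i x = pd f i x + pd g i x"
  by (rule pd_eqI[OF has_derivative_add]) (auto intro: smooth_has_derivative)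

lemma pd_mult: "smooth f \<Longrightarrow> smooth g \<Longrightarrow> pd (\<lambda>x. f x * g x) i x = f x * pd g i x + pd f i x * g x"
  by (rule pd_eqI[OF has_derivative_mult]) (auto intro: smooth_has_derivative)

lemma pd_cmult: "smooth f \<Longrightarrow> pd (\<lambda>x. c * f x) i x = c * pd f i x"
  by (rule pd_eqI[OF has_derivative_mult_right]) (auto intro: smooth_has_derivative)

lemma pd_inner: "pd (\<lambda>x. x \<bullet> a) i x = i \<bullet> a"
  by (rule pd_eqI[of _ "\<lambda>h. h \<bullet> a"]) (auto intro!: derivative_eq_intros)

lemma pd_comp:
  assumes "smooth f" "(F has_real_derivative F') (at (f x))"
  shows "pd (\<lambda>x. F (f x)) i x = F' * pd f i x"
  using pd_eqI[OF has_derivative_compose[OF smooth_has_derivative[OF assms(1)] assms(2)[unfolded has_field_derivative_def]]] .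

lemma grad_inner_Basis: "i \<in> Basis \<Longrightarrow> grad f x \<bullet> i = pd f i x"
  by (simp add: grad_def inner_sum_left inner_Basis if_distrib cong: if_cong)

lemma grad_add: "smooth f \<Longrightarrow> smooth g \<Longrightarrow> grad (\<lambda>x. f x + g x) x = grad f x + grad g x"
  by (rule euclidean_eqI) (simp add: grad_inner_Basis pd_add inner_add_left)

lemma grad_mult: "smooth f \<Longrightarrow> smooth g \<Longrightarrow> grad (\<lambda>x. f x * g x) x = f x *\<^sub>R grad g x + g x *\<^sub>R grad f x"
  by (rule euclidean_eqI) (simp add: grad_inner_Basis pd_mult inner_add_left)

lemma grad_comp:
  assumes "smooth f" "(F has_real_derivative F') (at (f x))"
  shows "grad (\<lambda>x. F (f x)) x = F' *\<^sub>R grad f x"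
  by (rule euclidean_eqI) (simp add: grad_inner_Basis pd_comp[OF assms])

subsection \<open>Bump functions\<close>

text \<open>The derivatives of \<open>exp (- 1 / t)\<close> have the form
  \<open>P s * exp (- s)\<close> with \<open>s = 1 / t\<close>. Since \<open>d/dt\<close> is
  \<open>- s^2 d/ds\<close>, one differentiation sends \<open>P\<close> to
  \<open>s^2 * (P - P')\<close>.\<close>

primrec bump_poly :: "nat \<Rightarrow> real poly" where
  "bump_poly 0 = 1"
| "bump_poly (Suc n) = [:0, 0, 1:] * (bump_poly n - pderiv (bump_poly n))"

definition bump :: "nat \<Rightarrow> real \<Rightarrow> real" where
  "bump n t = (if t > 0 then poly (bump_poly n) (1 / t) * exp (- (1 / t)) else 0)"

lemma poly_exp_tendsto_0: "((\<lambda>s. poly p s * exp (- s)) \<longlongrightarrow> (0::real)) at_top"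
proof -
  have "((\<lambda>s. \<Sum>i\<le>degree p. coeff p i * (s ^ i / exp s)) \<longlongrightarrow> (\<Sum>i\<le>degree p. coeff p i * 0)) at_top"
    by (intro tendsto_intros tendsto_power_div_exp_0)
  moreover have "(\<Sum>i\<le>degree p. coeff p i * (s ^ i / exp s)) = poly p s * exp (- s)" for s
    by (simp add: poly_altdef exp_minus sum_distrib_right divide_inverse mult.assoc)
  ultimately show ?thesis by simp
qed

text \<open>Only \<open>t = 0\<close> is delicate: from the left the difference quotient vanishes,
  and from the right exponential decay in \<open>1 / t\<close> beats every polynomial in
  \<open>1 / t\<close>.\<close>

lemma bump_deriv: "(bump n has_real_derivative bump (Suc n) t) (at t)"
proof -
  consider "t > 0" | "t < 0" | "t = 0" by linarith
  thus ?thesis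
  proof cases
    case 1
    have "((\<lambda>t. poly (bump_poly n) (1 / t) * exp (- (1 / t))) has_real_derivative bump (Suc n) t) (at t)"
      using 1 by (auto intro!: derivative_eq_intros poly_DERIV simp: bump_def power2_eq_square field_simps)
    moreover have "\<forall>\<^sub>F x in nhds t. bump n x = poly (bump_poly n) (1 / x) * exp (- (1 / x))"
      using eventually_nhds_in_open[of "{0<..}" t] 1 by (auto elim!: eventually_mono simp: bump_def)
    ultimately show ?thesis by (subst DERIV_cong_ev[OF refl _ refl])
  next
    case 2
    have "\<forall>\<^sub>F x in nhds t. bump n x = 0"
      using eventually_nhds_in_open[of "{..<0}" t] 2 by (auto elim!: eventually_mono simp: bump_def)
    thus ?thesis using DERIV_cong_ev[of t t "bump n" "\<lambda>_. 0" 0 0] 2 by (simp add: bump_def)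
  next
    case 3
    have "((\<lambda>y. (bump n y - bump n 0) / (y - 0)) \<longlongrightarrow> 0) (at 0)"
    proof (rule filterlim_split_at)
      have "\<forall>\<^sub>F y in at_left (0::real). (bump n y - bump n 0) / (y - 0) = 0"
        by (auto simp: bump_def eventually_at_filter)
      thus "((\<lambda>y. (bump n y - bump n 0) / (y - 0)) \<longlongrightarrow> 0) (at_left 0)"
        by (rule tendsto_eventually)
      \<comment> \<open>Dividing by \<open>y\<close> multiplies the polynomial in
        \<open>1 / y\<close> by its variable, hence the factor \<open>[:0, 1:]\<close>.\<close>
      have "((\<lambda>y. poly ([:0, 1:] * bump_poly n) (inverse y) * exp (- inverse y)) \<longlongrightarrow> 0) (at_right (0::real))"
        by (rule filterlim_compose[OF poly_exp_tendsto_0 filterlim_inverse_at_top_right])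
      moreover have "\<forall>\<^sub>F y in at_right (0::real). poly ([:0, 1:] * bump_poly n) (inverse y) * exp (- inverse y)
          = (bump n y - bump n 0) / (y - 0)"
        using eventually_at_right_less[of "0::real"] by eventually_elim (simp add: bump_def field_simps)
      ultimately show "((\<lambda>y. (bump n y - bump n 0) / (y - 0)) \<longlongrightarrow> 0) (at_right 0)"
        by (rule Lim_transform_eventually)
    qed
    thus ?thesis unfolding 3 has_field_derivative_iff by (simp add: bump_def)
  qed
qed

lemma smooth_bump: "smooth f \<Longrightarrow> smooth (\<lambda>x. bump n (f x))"
  by (rule smooth_comp[where I = UNIV and F = bump]) (auto intro: bump_deriv)

lemma bump_0: "bump 0 t = (if t > 0 then exp (- (1 / t)) else 0)"
  by (simp add: bump_def)

lemma bump_bounds: "0 \<le> bump 0 t" "bump 0 t \<le> 1"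
  by (auto simp: bump_0)

text \<open>For positive \<open>t\<close> the exponent \<open>- 1 / (n t)\<close> tends to 0.
  Dilated bumps thus approach the indicator of the positive half-line, and products of them the
  indicator of a box.\<close>

lemma bump_scaled_limit: "(\<lambda>n. bump 0 (real n * t)) \<longlonglongrightarrow> (if t > 0 then 1 else 0)"
proof (cases "t > 0")
  case True
  have "(\<lambda>n. exp (- (1 / t * inverse (real n)))) \<longlonglongrightarrow> exp (- (1 / t * 0))"
    by (intro tendsto_intros lim_inverse_n)
  moreover have "\<forall>\<^sub>F n in sequentially. exp (- (1 / t * inverse (real n))) = bump 0 (real n * t)"
    using eventually_gt_at_top[of 0] by eventually_elim (use True in \<open>auto simp: bump_0 field_simps\<close>)
  ultimately show ?thesis using True by (simp add: Lim_transform_eventually)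
next
  case False
  hence "bump 0 (real n * t) = 0" for n by (simp add: bump_0 mult_nonneg_nonpos not_less)
  thus ?thesis using False by simp
qed

subsection \<open>Test functions\<close>

lemma test_functions_iff:
  "\<phi> \<in> test_functions \<Omega> \<longleftrightarrow> smooth \<phi> \<and> (\<exists>K. compact K \<and> K \<subseteq> \<Omega> \<and> (\<forall>x. x \<notin> K \<longrightarrow> \<phi> x = 0))"
  by (simp add: test_functions_def smooth_def)

lemma test_smooth: "\<phi> \<in> test_functions \<Omega> \<Longrightarrow> smooth \<phi>"
  by (simp add: test_functions_iff)

lemma test_mult: "\<phi> \<in> test_functions \<Omega> \<Longrightarrow> smooth f \<Longrightarrow> (\<lambda>x. f x * \<phi> x) \<in> test_functions \<Omega>"
  unfolding test_functions_iff by (auto intro!: smooth_mult)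

lemma test_zero [simp]: "(\<lambda>x. 0) \<in> test_functions \<Omega>"
  unfolding test_functions_iff by (auto intro!: exI[of _ "{}"])

lemma test_add: 
  assumes "\<phi> \<in> test_functions \<Omega>" "\<psi> \<in> test_functions \<Omega>"
  shows "(\<lambda>x. \<phi> x + \<psi> x) \<in> test_functions \<Omega>"
proof -
  obtain K L where "compact K" "K \<subseteq> \<Omega>" "\<forall>x. x \<notin> K \<longrightarrow> \<phi> x = 0" "compact L" "L \<subseteq> \<Omega>" "\<forall>x. x \<notin> L \<longrightarrow> \<psi> x = 0"
    using assms unfolding test_functions_iff by metis
  thus ?thesis using assms unfolding test_functions_iff
    by (auto intro!: smooth_add exI[of _ "K \<union> L"] compact_Un)
qed

lemma pd_zero_outside:
  assumes "compact K" "\<forall>x. x \<notin> K \<longrightarrow> \<phi> x = 0" "x \<notin> K"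
  shows "pd \<phi> i x = 0"
proof -
  have "(\<phi> has_derivative (\<lambda>_. 0)) (at x)"
    by (rule has_derivative_transform_within_open[of "\<lambda>_. 0" _ _ _ "- K"])
       (use assms in \<open>auto simp: compact_imp_closed\<close>)
  thus ?thesis using pd_eqI[of \<phi> "\<lambda>_. 0"] by simp
qed

lemma test_pd: "\<phi> \<in> test_functions \<Omega> \<Longrightarrow> i \<in> Basis \<Longrightarrow> pd \<phi> i \<in> test_functions \<Omega>"
  unfolding test_functions_iff using pd_zero_outside smooth_pd by blast

lemma test_bounded:
  assumes "\<phi> \<in> test_functions \<Omega>"
  obtains B where "B > 0" "\<And>x. \<bar>\<phi> x\<bar> \<le> B"
proof -
  obtain K where K: "compact K" "\<forall>x. x \<notin> K \<longrightarrow> \<phi> x = 0" using assms unfolding test_functions_iff by blast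
  have "compact (\<phi> ` K)" using K test_smooth[OF assms] by (intro compact_continuous_image smooth_continuous)
  hence "bounded (\<phi> ` K)" by (rule compact_imp_bounded)
  then obtain B where "\<forall>x\<in>\<phi> ` K. norm x \<le> B" unfolding bounded_iff by blast
  hence "\<bar>\<phi> x\<bar> \<le> max B 1" for x using K by (cases "x \<in> K") auto
  with that[of "max B 1"] show ?thesis by auto
qed

lemma test_outside: "\<phi> \<in> test_functions \<Omega> \<Longrightarrow> x \<notin> \<Omega> \<Longrightarrow> \<phi> x = 0"
  unfolding test_functions_iff by blast

lemma test_integrable: "\<phi> \<in> test_functions \<Omega> \<Longrightarrow> integrable lborel \<phi>"
proof -
  assume a: "\<phi> \<in> test_functions \<Omega>"
  obtain K where K: "compact K" "\<forall>x. x \<notin> K \<longrightarrow> \<phi> x = 0" using a unfolding test_functions_iff by blast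
  have "integrable lborel (\<lambda>x. indicator K x *\<^sub>R \<phi> x)"
    using borel_integrable_compact[OF K(1) smooth_continuous[OF test_smooth[OF a]]]
    by (simp add: indicator_def if_distrib cong: if_cong)
  moreover have "(\<lambda>x. indicator K x *\<^sub>R \<phi> x) = \<phi>" using K by (intro ext) (auto simp: indicator_def)
  ultimately show ?thesis by simp
qed

text \<open>The derivative is the limit of difference quotients. By translation invariance of
  Lebesgue measure each quotient has integral 0, and dominated convergence carries this to the
  limit.\<close>

lemma integral_pd_test:
  assumes \<phi>: "\<phi> \<in> test_functions \<Omega>" and i: "i \<in> Basis"
  shows "(\<integral>x. pd \<phi> i x \<partial>lborel) = 0"
proof -
  have s: "smooth \<phi>" by (rule test_smooth[OF \<phi>])
  obtain K where K: "compact K" "\<forall>x. x \<notin> K \<longrightarrow> \<phi> x = 0" using \<phi> unfolding test_functions_iff by blast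
  obtain B where B: "B > 0" "\<And>x. \<bar>pd \<phi> i x\<bar> \<le> B" using test_bounded[OF test_pd[OF \<phi> i]] by blast
  define t where "t n = 1 / real (Suc n)" for n
  have t: "0 < t n" "t n \<le> 1" for n by (auto simp: t_def)
  have t0: "t \<longlonglongrightarrow> 0" unfolding t_def by (rule LIMSEQ_Suc[OF lim_1_over_n])
  define q where "q n x = (\<phi> (t n *\<^sub>R i + x) - \<phi> x) / t n" for n x
  \<comment> \<open>The unit neighbourhood of the support: step sizes are at most 1, so outside it
    both terms of the difference quotient vanish and its indicator can serve in the dominating
    function.\<close>
  define L where "L = {x + y | x y. x \<in> K \<and> y \<in> cball (0::'a) 1}"
  have L: "compact L" unfolding L_def by (intro compact_sums K) auto
  have line: "((\<lambda>s. \<phi> (s *\<^sub>R i + x)) has_real_derivative pd \<phi> i (s *\<^sub>R i + x)) (at s)" for s x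
  proof -
    have "((\<lambda>s. \<phi> (s *\<^sub>R i + x)) has_derivative (\<lambda>h. frechet_derivative \<phi> (at (s *\<^sub>R i + x)) (h *\<^sub>R i))) (at s)"
      by (rule has_derivative_compose[OF _ smooth_has_derivative[OF s], of "\<lambda>s. s *\<^sub>R i + x"])
         (auto intro!: derivative_eq_intros)
    moreover have "frechet_derivative \<phi> (at (s *\<^sub>R i + x)) (h *\<^sub>R i) = pd \<phi> i (s *\<^sub>R i + x) * h" for h
      using linear_scale[OF has_derivative_linear[OF smooth_has_derivative[OF s]]] by simp
    ultimately show ?thesis by (simp add: has_field_derivative_def)
  qed
  have qb: "\<bar>q n x\<bar> \<le> B * indicator L x" for n x
  proof (cases "x \<in> L")
    case True
    obtain z where z: "0 < z" "z < t n" "\<phi> (t n *\<^sub>R i + x) - \<phi> (0 *\<^sub>R i + x) = (t n - 0) * pd \<phi> i (z *\<^sub>R i + x)"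
      using MVT2[OF t(1)[of n], of "\<lambda>s. \<phi> (s *\<^sub>R i + x)" "\<lambda>s. pd \<phi> i (s *\<^sub>R i + x)"] line by blast
    hence "q n x = pd \<phi> i (z *\<^sub>R i + x)" using t(1)[of n] by (simp add: q_def)
    thus ?thesis using True B by simp
  next
    case False
    have "x \<notin> K" using False unfolding L_def by force
    moreover have "t n *\<^sub>R i + x \<notin> K"
    proof
      assume "t n *\<^sub>R i + x \<in> K"
      hence "(t n *\<^sub>R i + x) + (- (t n *\<^sub>R i)) \<in> L" unfolding L_def
        using t(1)[of n] t(2)[of n] i
        by (intro CollectI exI[of _ "t n *\<^sub>R i + x"] exI[of _ "- (t n *\<^sub>R i)"] conjI refl) (auto simp: norm_Basis)
      thus False using False by simp
    qed
    ultimately show ?thesis using K B(1) by (simp add: q_def)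
  qed
  have ql: "(\<lambda>n. q n x) \<longlonglongrightarrow> pd \<phi> i x" for x
  proof -
    have "((\<lambda>s. (\<phi> (s *\<^sub>R i + x) - \<phi> (0 *\<^sub>R i + x)) / (s - 0)) \<longlongrightarrow> pd \<phi> i (0 *\<^sub>R i + x)) (at 0)"
      using line[of x 0] by (simp add: has_field_derivative_iff)
    moreover have "filterlim t (at 0) sequentially"
      using t0 t(1) by (simp add: filterlim_at less_imp_neq[symmetric] eventually_sequentiallyI)
    ultimately have "(\<lambda>n. (\<phi> (t n *\<^sub>R i + x) - \<phi> (0 *\<^sub>R i + x)) / (t n - 0)) \<longlonglongrightarrow> pd \<phi> i (0 *\<^sub>R i + x)"
      by (rule filterlim_compose)
    thus ?thesis by (simp add: q_def)
  qed
  have \<phi>i: "integrable lborel \<phi>" by (rule test_integrable[OF \<phi>])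
  have tr: "integrable lborel (\<lambda>x. \<phi> (c + x))" "(\<integral>x. \<phi> (c + x) \<partial>lborel) = (\<integral>x. \<phi> x \<partial>lborel)" for c
  proof -
    have "integrable (distr lborel borel ((+) c)) \<phi>" using \<phi>i by (simp add: lborel_distr_plus)
    thus "integrable lborel (\<lambda>x. \<phi> (c + x))"
      by (subst (asm) integrable_distr_eq) (auto intro: smooth_borel s)
    have "(\<integral>x. \<phi> x \<partial>lborel) = (\<integral>x. \<phi> x \<partial>distr lborel borel ((+) c))" by (simp add: lborel_distr_plus)
    also have "\<dots> = (\<integral>x. \<phi> (c + x) \<partial>lborel)"
      by (subst integral_distr) (auto intro: smooth_borel s)
    finally show "(\<integral>x. \<phi> (c + x) \<partial>lborel) = (\<integral>x. \<phi> x \<partial>lborel)" by simp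
  qed
  have "(\<lambda>n. \<integral>x. q n x \<partial>lborel) \<longlonglongrightarrow> (\<integral>x. pd \<phi> i x \<partial>lborel)"
  proof (rule integral_dominated_convergence[where w = "\<lambda>x. B * indicator L x"])
    show "pd \<phi> i \<in> borel_measurable lborel" using smooth_borel[OF smooth_pd[OF s i]] by simp
    show "q n \<in> borel_measurable lborel" for n
      unfolding q_def using smooth_borel[OF s] by measurable
    show "integrable lborel (\<lambda>x. B * indicator L x)"
      using L by (auto intro!: integrable_mult_right integrable_real_indicator simp: borel_compact emeasure_bounded_finite[unfolded infinity_ennreal_def] compact_imp_bounded)
  qed (use qb ql in auto)
  moreover have "(\<integral>x. q n x \<partial>lborel) = 0" for n
    unfolding q_def using tr \<phi>i by simp
  ultimately show ?thesis by (simp add: LIMSEQ_const_iff)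
qed

lemma integral_test_on:
  assumes "\<Omega> \<in> sets lebesgue" "\<phi> \<in> borel_measurable borel" "\<And>x. x \<notin> \<Omega> \<Longrightarrow> \<phi> x = (0::real)"
  shows "(\<integral>x. \<phi> x \<partial>lebesgue_on \<Omega>) = (\<integral>x. \<phi> x \<partial>lborel)"
proof -
  have "(\<integral>x. \<phi> x \<partial>lebesgue_on \<Omega>) = (\<integral>x. indicator \<Omega> x *\<^sub>R \<phi> x \<partial>lebesgue)"
    using assms(1) by (intro integral_restrict_space) simp
  also have "(\<lambda>x. indicator \<Omega> x *\<^sub>R \<phi> x) = \<phi>" using assms(3) by (intro ext) (auto simp: indicator_def)
  also have "integral\<^sup>L lebesgue \<phi> = integral\<^sup>L lborel \<phi>"
    using assms(2) by (intro integral_completion) simp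
  finally show ?thesis .
qed

lemma integral_pd_test_on:
  assumes "\<Omega> \<in> sets lebesgue" "\<phi> \<in> test_functions \<Omega>" "i \<in> Basis"
  shows "(\<integral>x. pd \<phi> i x \<partial>lebesgue_on \<Omega>) = 0"
  by (subst integral_test_on)
     (use assms integral_pd_test test_outside[OF test_pd] smooth_borel[OF smooth_pd[OF test_smooth]] in auto)

subsection \<open>Averages over small cubes\<close>

lemma AE_lebesgue_on_iff:
  assumes "\<Omega> \<in> sets lebesgue"
  shows "(AE x in lebesgue_on \<Omega>. P x) \<longleftrightarrow> (AE x in lebesgue. x \<in> \<Omega> \<longrightarrow> P x)"
  using assms by (intro AE_restrict_space_iff) auto

text \<open>Lebesgue's differentiation theorem for cubes whose lower corner is the point, applied to
  the extension \<open>F\<close> of \<open>f\<close> by 0. An open set contains all sufficiently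
  small cubes of this kind, so bounds are asked only for cubes inside the domain and of side at most
  1.\<close>

lemma AE_le_of_cube_averages:
  fixes f :: "'a::euclidean_space \<Rightarrow> real"
  assumes \<Omega>: "open \<Omega>" and f: "integrable (lebesgue_on \<Omega>) f"
    and avg: "\<And>x h. 0 < h \<Longrightarrow> h \<le> 1 \<Longrightarrow> cbox x (x + h *\<^sub>R One) \<subseteq> \<Omega> \<Longrightarrow>
      (\<integral>y. indicator (cbox x (x + h *\<^sub>R One)) y * f y \<partial>lebesgue_on \<Omega>) \<le> B * h ^ DIM('a)"
  shows "AE x in lebesgue_on \<Omega>. f x \<le> B"
proof -
  have ms: "\<Omega> \<in> sets lebesgue" using \<Omega> by simp
  define F where "F x = indicator \<Omega> x *\<^sub>R f x" for x
  have F: "integrable lebesgue F"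
    using f ms unfolding F_def by (subst (asm) integrable_restrict_space) auto
  have Fon: "F absolutely_integrable_on S" if "S \<in> sets lebesgue" for S
  proof -
    have "F absolutely_integrable_on UNIV" using F by (simp add: set_integrable_def)
    thus ?thesis using that by (rule set_integrable_subset) auto
  qed
  have "F integrable_on cbox a b" for a b
    using Fon[of "cbox a b"] by (simp add: absolutely_integrable_on_def)
  then obtain N where N: "negligible N"
    "\<And>x e. \<lbrakk>x \<notin> N; 0 < e\<rbrakk> \<Longrightarrow> \<exists>d>0. \<forall>h. 0 < h \<and> h < d \<longrightarrow>
        norm (integral (cbox x (x + h *\<^sub>R One)) F /\<^sub>R h ^ DIM('a) - F x) < e"
    using integrable_ccontinuous_explicit[of F] by metis
  have "f x \<le> B" if x: "x \<in> \<Omega>" "x \<notin> N" for x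
  proof (rule field_le_epsilon)
    fix e :: real assume "e > 0"
    obtain d where d: "d > 0" "\<And>h. 0 < h \<and> h < d \<Longrightarrow>
        norm (integral (cbox x (x + h *\<^sub>R One)) F /\<^sub>R h ^ DIM('a) - F x) < e"
      using N(2)[OF x(2) \<open>e > 0\<close>] by blast
    obtain r where r: "r > 0" "ball x r \<subseteq> \<Omega>" using \<Omega> x(1) open_contains_ball by blast
    \<comment> \<open>The three bounds give \<open>h < d\<close>, \<open>h \<le> 1\<close>, and a
      diagonal of length at most \<open>r / 2\<close>, which keeps the cube inside the ball.\<close>
    define h where "h = min (min (d / 2) 1) (r / (2 * (norm (One::'a) + 1)))"
    have n1: "norm (One::'a) + 1 > 0" by (simp add: add_nonneg_pos)
    have h: "0 < h" "h < d" "h \<le> 1" using d(1) r(1) n1 by (auto simp: h_def)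
    have "cbox x (x + h *\<^sub>R One) \<subseteq> ball x r"
    proof
      fix y assume y: "y \<in> cbox x (x + h *\<^sub>R One)"
      have "norm (y - x) \<le> norm (h *\<^sub>R (One::'a))"
        by (rule norm_le_componentwise) (use y h in \<open>auto simp: mem_box inner_diff_left inner_add_left\<close>)
      also have "\<dots> \<le> h * (norm (One::'a) + 1)" using h by simp
      also have "\<dots> \<le> r / (2 * (norm (One::'a) + 1)) * (norm (One::'a) + 1)"
        using n1 by (intro mult_right_mono) (auto simp: h_def)
      also have "\<dots> = r / 2" using n1 by (simp add: field_simps)
      also have "\<dots> < r" using r by simp
      finally show "y \<in> ball x r" by (simp add: dist_norm norm_minus_commute)
    qed
    hence sub: "cbox x (x + h *\<^sub>R One) \<subseteq> \<Omega>" using r by auto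
    have "integral (cbox x (x + h *\<^sub>R One)) F = (\<integral>y. indicator (cbox x (x + h *\<^sub>R One)) y *\<^sub>R F y \<partial>lebesgue)"
      using set_lebesgue_integral_eq_integral(2)[OF Fon[of "cbox x (x + h *\<^sub>R One)"]]
      by (simp add: set_lebesgue_integral_def)
    also have "\<dots> = (\<integral>y. indicator \<Omega> y *\<^sub>R (indicator (cbox x (x + h *\<^sub>R One)) y * f y) \<partial>lebesgue)"
      by (intro Bochner_Integration.integral_cong refl) (simp add: F_def)
    also have "\<dots> = (\<integral>y. indicator (cbox x (x + h *\<^sub>R One)) y * f y \<partial>lebesgue_on \<Omega>)"
      using ms by (subst integral_restrict_space) auto
    also have "\<dots> \<le> B * h ^ DIM('a)" using h sub by (intro avg) auto
    finally have "integral (cbox x (x + h *\<^sub>R One)) F /\<^sub>R h ^ DIM('a) \<le> B"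
      using h by (simp add: field_simps)
    moreover have "norm (integral (cbox x (x + h *\<^sub>R One)) F /\<^sub>R h ^ DIM('a) - F x) < e" using d(2) h by blast
    ultimately have "F x \<le> B + e" by (simp add: abs_less_iff)
    thus "f x \<le> B + e" using x by (simp add: F_def)
  qed
  thus ?thesis unfolding AE_lebesgue_on_iff[OF ms]
    using N(1) by (auto intro!: AE_I'[of N] simp: negligible_iff_null_sets)
qed

text \<open>Products of scaled bumps converge to the indicator function of a box.\<close>

lemma test_orthogonal_imp_AE_zero:
  fixes f :: "'a::euclidean_space \<Rightarrow> real"
  assumes \<Omega>: "open \<Omega>" and f: "integrable (lebesgue_on \<Omega>) f"
    and orth: "\<And>\<phi>. \<phi> \<in> test_functions \<Omega> \<Longrightarrow> (\<integral>x. f x * \<phi> x \<partial>lebesgue_on \<Omega>) = 0"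
  shows "AE x in lebesgue_on \<Omega>. f x = 0"
proof -
  have ms: "\<Omega> \<in> sets lebesgue" using \<Omega> by simp
  have box0: "(\<integral>y. f y * indicator (box a b) y \<partial>lebesgue_on \<Omega>) = 0" if ab: "cbox a b \<subseteq> \<Omega>" for a b
  proof -
    \<comment> \<open>One pair of factors per coordinate, for the lower and the upper face. The
      support stays in the closed box for every \<open>n\<close>, so these are test functions as
      soon as the closed box lies in the domain.\<close>
    define \<phi> where "\<phi> n x = (\<Prod>i\<in>Basis. bump 0 (real n * (x \<bullet> i + - (a \<bullet> i))) * bump 0 (real n * (b \<bullet> i + (- 1) * (x \<bullet> i))))"
      for n and x :: 'a
    have s: "smooth (\<phi> n)" for n
      unfolding \<phi>_def
      by (intro smooth_prod smooth_mult smooth_bump smooth_add smooth_const smooth_inner) auto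
    have z: "\<phi> n x = 0" if xn: "x \<notin> cbox a b" for n x
    proof -
      obtain i where i: "i \<in> Basis" "x \<bullet> i < a \<bullet> i \<or> x \<bullet> i > b \<bullet> i" using xn unfolding mem_box by (metis linorder_not_le)
      hence "real n * (x \<bullet> i + - (a \<bullet> i)) \<le> 0 \<or> real n * (b \<bullet> i + (- 1) * (x \<bullet> i)) \<le> 0"
        by (auto intro: mult_nonneg_nonpos)
      hence "bump 0 (real n * (x \<bullet> i + - (a \<bullet> i))) * bump 0 (real n * (b \<bullet> i + (- 1) * (x \<bullet> i))) = 0"
        by (auto simp: bump_0)
      thus ?thesis unfolding \<phi>_def using i by (intro prod_zero) auto
    qed
    have t: "\<phi> n \<in> test_functions \<Omega>" for n
      unfolding test_functions_iff using s z ab by (auto intro!: exI[of _ "cbox a b"] compact_cbox)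
    have b: "0 \<le> \<phi> n x" "\<phi> n x \<le> 1" for n x
      unfolding \<phi>_def using bump_bounds by (auto intro!: prod_nonneg prod_le_1 mult_le_one)
    have "(\<lambda>n. \<phi> n x) \<longlonglongrightarrow> (\<Prod>i\<in>Basis. (if x \<bullet> i + - (a \<bullet> i) > 0 then 1 else 0) * (if b \<bullet> i + (- 1) * (x \<bullet> i) > 0 then 1 else 0))" for x
      unfolding \<phi>_def by (intro tendsto_prod tendsto_mult bump_scaled_limit)
    moreover have "(\<Prod>i\<in>Basis. (if x \<bullet> i + - (a \<bullet> i) > 0 then 1 else 0) * (if b \<bullet> i + (- 1) * (x \<bullet> i) > 0 then 1 else (0::real)))
       = indicator (box a b) x" for x
    proof (cases "x \<in> box a b")
      case False
      then obtain i where "i \<in> Basis" "\<not> (a \<bullet> i < x \<bullet> i \<and> x \<bullet> i < b \<bullet> i)" by (auto simp: mem_box)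
      thus ?thesis using False by (auto intro!: prod_zero bexI[of _ i])
    qed (auto simp: mem_box intro!: prod.neutral)
    ultimately have lim: "(\<lambda>n. \<phi> n x) \<longlonglongrightarrow> indicator (box a b) x" for x by simp
    have "(\<lambda>n. \<integral>x. f x * \<phi> n x \<partial>lebesgue_on \<Omega>) \<longlonglongrightarrow> (\<integral>x. f x * indicator (box a b) x \<partial>lebesgue_on \<Omega>)"
    proof (rule integral_dominated_convergence[where w = "\<lambda>x. \<bar>f x\<bar>"])
      have fm: "f \<in> borel_measurable (lebesgue_on \<Omega>)" using f by auto
      have "\<phi> n \<in> borel_measurable (lebesgue_on \<Omega>)" for n
        using smooth_borel[OF s[of n]] by (simp add: measurable_completion measurable_restrict_space1)
      thus "(\<lambda>x. f x * \<phi> n x) \<in> borel_measurable (lebesgue_on \<Omega>)" for n using fm by simp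
      have "(\<lambda>x. indicator (box a b) x :: real) \<in> borel_measurable (lebesgue_on \<Omega>)"
        by (intro measurable_restrict_space1 measurable_completion) simp
      thus "(\<lambda>x. f x * indicator (box a b) x) \<in> borel_measurable (lebesgue_on \<Omega>)" using fm by simp
      show "integrable (lebesgue_on \<Omega>) (\<lambda>x. \<bar>f x\<bar>)" using f by simp
      show "AE x in lebesgue_on \<Omega>. (\<lambda>n. f x * \<phi> n x) \<longlonglongrightarrow> f x * indicator (box a b) x"
        by (intro AE_I2 tendsto_intros lim)
      show "AE x in lebesgue_on \<Omega>. norm (f x * \<phi> n x) \<le> \<bar>f x\<bar>" for n
        using b by (auto simp: abs_mult intro!: mult_left_le)
    qed
    thus ?thesis using orth[OF t] by (simp add: LIMSEQ_const_iff)
  qed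
  \<comment> \<open>Averages are taken over closed cubes while the bumps produce open boxes; the
    boundary is a null set.\<close>
  have cb: "(\<integral>y. indicator (cbox a b) y * f y \<partial>lebesgue_on \<Omega>) = 0" if "cbox a b \<subseteq> \<Omega>" for a b
  proof -
    have "negligible (cbox a b - box a b)" by (rule negligible_frontier_interval)
    hence "AE y in lebesgue. y \<notin> cbox a b - box a b"
      by (intro AE_not_in) (simp add: negligible_iff_null_sets)
    hence "AE y in lebesgue_on \<Omega>. indicator (cbox a b) y * f y = f y * indicator (box a b) y"
      unfolding AE_lebesgue_on_iff[OF ms]
      by eventually_elim (use box_subset_cbox[of a b] in \<open>auto simp: indicator_def\<close>)
    moreover have "(\<lambda>x. indicator A x :: real) \<in> borel_measurable (lebesgue_on \<Omega>)" if "A \<in> sets borel" for A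
      using that by (intro measurable_restrict_space1 measurable_completion) simp
    ultimately have "(\<integral>y. indicator (cbox a b) y * f y \<partial>lebesgue_on \<Omega>) = (\<integral>y. f y * indicator (box a b) y \<partial>lebesgue_on \<Omega>)"
      using f by (intro integral_cong_AE borel_measurable_times) auto
    thus ?thesis using box0[OF that] by simp
  qed
  \<comment> \<open>Vanishing cube averages bound both \<open>f\<close> and \<open>- f\<close> from
    above by 0.\<close>
  have "AE x in lebesgue_on \<Omega>. f x \<le> 0"
    by (rule AE_le_of_cube_averages[OF \<Omega> f]) (use cb in auto)
  moreover have "AE x in lebesgue_on \<Omega>. - f x \<le> 0"
    by (rule AE_le_of_cube_averages[OF \<Omega>]) (use cb f in auto)
  ultimately show ?thesis by eventually_elim simp
qed


section \<open>The space H10 as a closure of test functions\<close>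

text \<open>The H1 norm is the L2 norm of the pair of function and gradient; these relations convert
  between the pair and its two components.\<close>

lemma L2vn_Pair:
  assumes "y \<in> L2v M" "g \<in> L2v M"
  shows "(L2vn M (\<lambda>x. (y x, g x)))\<^sup>2 = (L2vn M y)\<^sup>2 + (L2vn M g)\<^sup>2"
    "L2vn M y \<le> L2vn M (\<lambda>x. (y x, g x))" "L2vn M g \<le> L2vn M (\<lambda>x. (y x, g x))"
    "L2vn M (\<lambda>x. (y x, g x)) \<le> L2vn M y + L2vn M g"
proof -
  show eq: "(L2vn M (\<lambda>x. (y x, g x)))\<^sup>2 = (L2vn M y)\<^sup>2 + (L2vn M g)\<^sup>2"
    unfolding L2vn_sq using assms by (simp add: norm_Pair L2v_integrable[where 'b = real, simplified] L2v_integrable)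
  show "L2vn M y \<le> L2vn M (\<lambda>x. (y x, g x))" "L2vn M g \<le> L2vn M (\<lambda>x. (y x, g x))"
    by (rule power2_le_imp_le; simp add: eq)+
  show "L2vn M (\<lambda>x. (y x, g x)) \<le> L2vn M y + L2vn M g"
    by (rule power2_le_imp_le) (simp_all add: eq power2_sum)
qed

lemma L2v_components:
  fixes g :: "'a \<Rightarrow> 'b::euclidean_space"
  shows "(\<forall>i\<in>Basis. (\<lambda>x. g x \<bullet> i) \<in> L2v M) \<longleftrightarrow> g \<in> L2v M"
proof
  assume a: "\<forall>i\<in>Basis. (\<lambda>x. g x \<bullet> i) \<in> L2v M"
  have m: "g \<in> borel_measurable M"
    using a by (subst borel_measurable_euclidean_space) (auto simp: L2v_def)
  have "integrable M (\<lambda>x. \<Sum>i\<in>Basis. (norm (g x \<bullet> i))\<^sup>2)"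
    using a by (auto simp: L2v_def)
  moreover have "(\<Sum>i\<in>Basis. (norm (g x \<bullet> i))\<^sup>2) = (norm (g x))\<^sup>2" for x
    unfolding power2_norm_eq_inner[of "g x"] by (subst euclidean_inner) (simp add: power2_eq_square)
  ultimately show "g \<in> L2v M" using m by (simp add: L2v_def)
next
  assume a: "g \<in> L2v M"
  show "\<forall>i\<in>Basis. (\<lambda>x. g x \<bullet> i) \<in> L2v M"
  proof
    fix i :: 'b assume "i \<in> Basis"
    thus "(\<lambda>x. g x \<bullet> i) \<in> L2v M"
      by (intro L2v_norm_bound(1)[OF _ a] AE_I2) (use L2v_meas[OF a] in \<open>auto simp: Basis_le_norm\<close>)
  qed
qed

lemma L2vn_dominated:
  assumes f: "\<And>n. f n \<in> borel_measurable M" and w: "w \<in> L2v M"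
    and b: "\<And>n. AE x in M. norm (f n x) \<le> norm (w x)" and lim: "AE x in M. (\<lambda>n. f n x) \<longlonglongrightarrow> 0"
  shows "(\<lambda>n. L2vn M (f n)) \<longlonglongrightarrow> 0"
proof -
  have "(\<lambda>n. \<integral>x. (norm (f n x))\<^sup>2 \<partial>M) \<longlonglongrightarrow> (\<integral>x. 0 \<partial>M)"
  proof (rule integral_dominated_convergence[where w = "\<lambda>x. (norm (w x))\<^sup>2"])
    show "AE x in M. (\<lambda>n. (norm (f n x))\<^sup>2) \<longlonglongrightarrow> 0"
      using lim by eventually_elim (metis tendsto_norm_zero tendsto_power power_zero_numeral)
    show "AE x in M. norm ((norm (f n x))\<^sup>2) \<le> (norm (w x))\<^sup>2" for n
      using b[of n] by eventually_elim (simp add: power_mono)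
  qed (use f L2v_integrable[OF w] in auto)
  hence "(\<lambda>n. sqrt (\<integral>x. (norm (f n x))\<^sup>2 \<partial>M)) \<longlonglongrightarrow> sqrt 0"
    by (intro tendsto_real_sqrt) simp
  thus ?thesis by (simp add: L2vn_def)
qed

text \<open>Glues one-sided derivatives at a point where a piecewise function changes its
  formula.\<close>

lemma has_field_derivative_Un:
  assumes "(f has_field_derivative D) (at x within S)" "(f has_field_derivative D) (at x within T)"
  shows "(f has_field_derivative D) (at x within (S \<union> T))"
proof -
  have "((\<lambda>y. (f y - f x) / (y - x)) \<longlongrightarrow> D) (sup (at x within S) (at x within T))"
    using assms unfolding has_field_derivative_iff by (rule filterlim_sup)
  thus ?thesis by (simp only: has_field_derivative_iff at_within_union[symmetric])
qed

lemma borel_lebesgue_on: "f \<in> borel_measurable borel \<Longrightarrow> f \<in> borel_measurable (lebesgue_on \<Omega>)"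
  by (intro measurable_restrict_space1 measurable_completion) simp

definition laplacian :: "('a::euclidean_space \<Rightarrow> real) \<Rightarrow> 'a \<Rightarrow> real" where
  "laplacian f x = (\<Sum>i\<in>Basis. pd (pd f i) i x)"

text \<open>Proofs work with an explicit gradient, because \<open>wgrad\<close> is determined only up to null sets.\<close>

definition H10g :: "'a::euclidean_space set \<Rightarrow> ('a \<Rightarrow> real) \<Rightarrow> ('a \<Rightarrow> 'a) \<Rightarrow> bool" where
  "H10g \<Omega> y g \<longleftrightarrow> y \<in> L2v (lebesgue_on \<Omega>) \<and> g \<in> L2v (lebesgue_on \<Omega>) \<and>
     (\<forall>e>0. \<exists>\<phi>\<in>test_functions \<Omega>. L2vn (lebesgue_on \<Omega>) (\<lambda>x. (\<phi> x - y x, grad \<phi> x - g x)) < e)"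

section \<open>Integration by parts and closure of test functions on a bounded domain\<close>

locale bounded_domain =
  fixes \<Omega> :: "'a::euclidean_space set"
  assumes open_dom: "open \<Omega>" and bounded_dom: "bounded \<Omega>"
begin

abbreviation "L \<equiv> lebesgue_on \<Omega>"

lemma dom_sets [simp]: "\<Omega> \<in> sets lebesgue"
  using open_dom by simp

lemma finite_L: "finite_measure L"
  using bounded_dom by (intro finite_measure_lebesgue_on bounded_set_imp_lmeasurable) auto

lemma space_L [simp]: "space L = \<Omega>"
  by simp

lemma smooth_bounded:
  assumes "smooth f" obtains B where "B > 0" "\<And>x. x \<in> \<Omega> \<Longrightarrow> \<bar>f x\<bar> \<le> B"
proof -
  have "compact (f ` closure \<Omega>)"
    using bounded_dom unfolding compact_closure[symmetric]
    by (rule compact_continuous_image[OF smooth_continuous[OF assms]])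
  hence "bounded (f ` closure \<Omega>)" by (rule compact_imp_bounded)
  then obtain B where "\<forall>x\<in>f ` closure \<Omega>. norm x \<le> B" unfolding bounded_iff by blast
  hence "\<bar>f x\<bar> \<le> max B 1" if "x \<in> \<Omega>" for x using that closure_subset[of \<Omega>] by force
  with that[of "max B 1"] show ?thesis by auto
qed

lemma smooth_meas: "smooth f \<Longrightarrow> f \<in> borel_measurable L"
  by (intro borel_lebesgue_on smooth_borel)

lemma smooth_L2v: assumes "smooth f" shows "f \<in> L2v L"
proof -
  obtain B where "B > 0" "\<And>x. x \<in> \<Omega> \<Longrightarrow> \<bar>f x\<bar> \<le> B" using smooth_bounded[OF assms] by blast
  thus ?thesis by (intro L2v_Bounded(1)[OF finite_L smooth_meas[OF assms], of B]) (auto intro!: AE_I2)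
qed

lemma grad_L2v: "smooth f \<Longrightarrow> grad f \<in> L2v L"
  by (subst L2v_components[symmetric]) (auto simp: grad_inner_Basis intro: smooth_L2v smooth_pd)

lemma grad_meas: "smooth f \<Longrightarrow> grad f \<in> borel_measurable L"
  by (intro L2v_meas grad_L2v)

lemma smooth_grad_bounded:
  assumes "smooth f" obtains B where "B > 0" "\<And>x. x \<in> \<Omega> \<Longrightarrow> norm (grad f x) \<le> B"
proof -
  have "\<exists>B. B > 0 \<and> (\<forall>x\<in>\<Omega>. \<bar>pd f i x\<bar> \<le> B)" if "i \<in> Basis" for i
    by (rule smooth_bounded[OF smooth_pd[OF assms that]]) blast
  then obtain B where B: "\<And>i. i \<in> Basis \<Longrightarrow> B i > 0 \<and> (\<forall>x\<in>\<Omega>. \<bar>pd f i x\<bar> \<le> B i)" by metis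
  have "norm (grad f x) \<le> (\<Sum>i\<in>Basis. B i)" if "x \<in> \<Omega>" for x
    unfolding grad_def using B that by (intro order_trans[OF norm_sum] sum_mono) auto
  moreover have "(\<Sum>i\<in>(Basis::'a set). B i) > 0" using B by (intro sum_pos) auto
  ultimately show ?thesis using that by blast
qed

lemma test_L2v: "\<phi> \<in> test_functions \<Omega> \<Longrightarrow> \<phi> \<in> L2v L" "\<phi> \<in> test_functions \<Omega> \<Longrightarrow> grad \<phi> \<in> L2v L"
  by (simp_all add: smooth_L2v grad_L2v test_smooth)

lemma smooth_laplacian: "smooth f \<Longrightarrow> smooth (laplacian f)"
  unfolding laplacian_def by (intro smooth_sum smooth_pd) auto

text \<open>The product of a test function with any smooth function is again a test function, so the
  derivative of the product has integral 0.\<close>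

lemma test_parts:
  assumes \<phi>: "\<phi> \<in> test_functions \<Omega>" and \<psi>: "smooth \<psi>" and i: "i \<in> Basis"
  shows "(\<integral>x. \<phi> x * pd \<psi> i x \<partial>L) = - (\<integral>x. pd \<phi> i x * \<psi> x \<partial>L)"
proof -
  note s = test_smooth[OF \<phi>]
  have "0 = (\<integral>x. pd (\<lambda>x. \<psi> x * \<phi> x) i x \<partial>L)"
    using integral_pd_test_on[OF dom_sets test_mult[OF \<phi> \<psi>] i] by simp
  also have "\<dots> = (\<integral>x. pd \<phi> i x * \<psi> x + \<phi> x * pd \<psi> i x \<partial>L)"
    unfolding pd_mult[OF \<psi> s] by (simp add: mult.commute)
  also have "\<dots> = (\<integral>x. pd \<phi> i x * \<psi> x \<partial>L) + (\<integral>x. \<phi> x * pd \<psi> i x \<partial>L)"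
    by (intro Bochner_Integration.integral_add L2v_integrable_mult smooth_L2v smooth_pd s \<psi> i)
  finally show ?thesis by simp
qed

text \<open>Compact support of one factor removes all boundary terms, so \<open>\<psi>\<close> may
  be any smooth function, in particular a regularised fundamental solution.\<close>

lemma test_green:
  assumes \<phi>: "\<phi> \<in> test_functions \<Omega>" and \<psi>: "smooth \<psi>"
  shows "(\<integral>x. grad \<phi> x \<bullet> grad \<psi> x \<partial>L) = - (\<integral>x. \<phi> x * laplacian \<psi> x \<partial>L)"
proof -
  note s = test_smooth[OF \<phi>]
  have "(\<integral>x. grad \<phi> x \<bullet> grad \<psi> x \<partial>L) = (\<integral>x. (\<Sum>i\<in>Basis. pd \<phi> i x * pd \<psi> i x) \<partial>L)"
    by (subst euclidean_inner) (simp add: grad_inner_Basis)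
  also have "\<dots> = (\<Sum>i\<in>Basis. \<integral>x. pd \<phi> i x * pd \<psi> i x \<partial>L)"
    by (intro Bochner_Integration.integral_sum L2v_integrable_mult smooth_L2v smooth_pd s \<psi>) auto
  also have "\<dots> = (\<Sum>i\<in>Basis. - (\<integral>x. \<phi> x * pd (pd \<psi> i) i x \<partial>L))"
    using test_parts[OF \<phi> smooth_pd[OF \<psi>]] by (intro sum.cong) auto
  also have "\<dots> = - (\<integral>x. (\<Sum>i\<in>Basis. \<phi> x * pd (pd \<psi> i) i x) \<partial>L)"
    unfolding sum_negf
    by (subst Bochner_Integration.integral_sum) (auto intro!: L2v_integrable_mult smooth_L2v smooth_pd s \<psi>)
  finally show ?thesis by (simp add: laplacian_def sum_distrib_left)
qed

lemma H10gD:
  assumes "H10g \<Omega> y g" shows "y \<in> L2v L" "g \<in> L2v L" "y \<in> borel_measurable L" "g \<in> borel_measurable L"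
  using assms by (auto simp: H10g_def L2v_meas)

lemma H10g_approx:
  assumes "H10g \<Omega> y g" "e > 0"
  obtains \<phi> where "\<phi> \<in> test_functions \<Omega>" "L2vn L (\<lambda>x. \<phi> x - y x) < e" "L2vn L (\<lambda>x. grad \<phi> x - g x) < e"
proof -
  obtain \<phi> where \<phi>: "\<phi> \<in> test_functions \<Omega>" "L2vn L (\<lambda>x. (\<phi> x - y x, grad \<phi> x - g x)) < e"
    using assms unfolding H10g_def by blast
  have "(\<lambda>x. \<phi> x - y x) \<in> L2v L" "(\<lambda>x. grad \<phi> x - g x) \<in> L2v L"
    using L2v_diff[OF test_L2v(1)[OF \<phi>(1)]] L2v_diff[OF test_L2v(2)[OF \<phi>(1)]] assms(1) unfolding H10g_def by auto
  from L2vn_Pair(2,3)[OF this] \<phi> that show ?thesis by fastforce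
qed

lemma H10gI:
  assumes "y \<in> L2v L" "g \<in> L2v L"
    and "\<And>e. e > 0 \<Longrightarrow> \<exists>\<phi>\<in>test_functions \<Omega>. L2vn L (\<lambda>x. \<phi> x - y x) < e \<and> L2vn L (\<lambda>x. grad \<phi> x - g x) < e"
  shows "H10g \<Omega> y g"
  unfolding H10g_def
proof (intro conjI assms allI impI)
  fix e :: real assume "e > 0"
  then obtain \<phi> where \<phi>: "\<phi> \<in> test_functions \<Omega>" "L2vn L (\<lambda>x. \<phi> x - y x) < e/2" "L2vn L (\<lambda>x. grad \<phi> x - g x) < e/2"
    using assms(3)[of "e/2"] by auto
  have "(\<lambda>x. \<phi> x - y x) \<in> L2v L" "(\<lambda>x. grad \<phi> x - g x) \<in> L2v L"
    using L2v_diff[OF test_L2v(1)[OF \<phi>(1)]] L2v_diff[OF test_L2v(2)[OF \<phi>(1)]] assms by auto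
  from L2vn_Pair(4)[OF this] \<phi> show "\<exists>\<phi>\<in>test_functions \<Omega>. L2vn L (\<lambda>x. (\<phi> x - y x, grad \<phi> x - g x)) < e"
    by (intro bexI[of _ \<phi>]) linarith+
qed

lemma H10g_closed:
  assumes yg: "y \<in> L2v L" "g \<in> L2v L"
    and ex: "\<And>e. e > 0 \<Longrightarrow> \<exists>z k. H10g \<Omega> z k \<and> L2vn L (\<lambda>x. z x - y x) < e \<and> L2vn L (\<lambda>x. k x - g x) < e"
  shows "H10g \<Omega> y g"
proof (rule H10gI[OF yg])
  fix e :: real assume "e > 0"
  hence e2: "e/2 > 0" by simp
  obtain z k where z: "H10g \<Omega> z k" "L2vn L (\<lambda>x. z x - y x) < e/2" "L2vn L (\<lambda>x. k x - g x) < e/2"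
    using ex[OF e2] by blast
  obtain \<phi> where \<phi>: "\<phi> \<in> test_functions \<Omega>" "L2vn L (\<lambda>x. \<phi> x - z x) < e/2" "L2vn L (\<lambda>x. grad \<phi> x - k x) < e/2"
    using H10g_approx[OF z(1) e2] by blast
  have "L2vn L (\<lambda>x. \<phi> x - y x) < e" "L2vn L (\<lambda>x. grad \<phi> x - g x) < e"
    using L2vn_triangle_diff[OF test_L2v(1)[OF \<phi>(1)] H10gD(1)[OF z(1)] yg(1)]
      L2vn_triangle_diff[OF test_L2v(2)[OF \<phi>(1)] H10gD(2)[OF z(1)] yg(2)] z \<phi> by auto
  with \<phi>(1) show "\<exists>\<phi>\<in>test_functions \<Omega>. L2vn L (\<lambda>x. \<phi> x - y x) < e \<and> L2vn L (\<lambda>x. grad \<phi> x - g x) < e"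
    by blast
qed

text \<open>Besides norm convergence, a subsequence provides pointwise convergence; the chain rule
  needs it to pass to the limit inside a merely continuous derivative.\<close>

lemma H10g_seq:
  assumes "H10g \<Omega> y g"
  obtains \<phi> where "\<And>n. \<phi> n \<in> test_functions \<Omega>" "(\<lambda>n. L2vn L (\<lambda>x. \<phi> n x - y x)) \<longlonglongrightarrow> 0"
    "(\<lambda>n. L2vn L (\<lambda>x. grad (\<phi> n) x - g x)) \<longlonglongrightarrow> 0" "AE x in L. (\<lambda>n. \<phi> n x) \<longlonglongrightarrow> y x"
proof -
  have "\<exists>\<phi>. \<phi> \<in> test_functions \<Omega> \<and> L2vn L (\<lambda>x. \<phi> x - y x) < 1 / real (Suc n) \<and> L2vn L (\<lambda>x. grad \<phi> x - g x) < 1 / real (Suc n)" for n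
    using H10g_approx[OF assms, of "1 / real (Suc n)"] by (metis of_nat_0_less_iff zero_less_Suc zero_less_divide_1_iff)
  then obtain \<phi> where \<phi>: "\<And>n. \<phi> n \<in> test_functions \<Omega>" "\<And>n. L2vn L (\<lambda>x. \<phi> n x - y x) < 1 / real (Suc n)"
    "\<And>n. L2vn L (\<lambda>x. grad (\<phi> n) x - g x) < 1 / real (Suc n)" by metis
  have z: "(\<lambda>n. 1 / real (Suc n)) \<longlonglongrightarrow> 0" by (rule LIMSEQ_Suc[OF lim_1_over_n])
  have a: "(\<lambda>n. L2vn L (\<lambda>x. \<phi> n x - y x)) \<longlonglongrightarrow> 0"
    by (rule tendsto_sandwich[OF _ _ tendsto_const z]) (use \<phi>(2) in \<open>auto intro!: always_eventually less_imp_le\<close>)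
  have b: "(\<lambda>n. L2vn L (\<lambda>x. grad (\<phi> n) x - g x)) \<longlonglongrightarrow> 0"
    by (rule tendsto_sandwich[OF _ _ tendsto_const z]) (use \<phi>(3) in \<open>auto intro!: always_eventually less_imp_le\<close>)
  obtain r where r: "strict_mono r" "AE x in L. (\<lambda>n. \<phi> (r n) x) \<longlonglongrightarrow> y x"
    using L2v_AE_subseq[OF test_L2v(1)[OF \<phi>(1)] H10gD(1)[OF assms] a] by blast
  show ?thesis
    using that[of "\<lambda>n. \<phi> (r n)"] \<phi>(1) r LIMSEQ_subseq_LIMSEQ[OF a r(1)] LIMSEQ_subseq_LIMSEQ[OF b r(1)]
    by (simp add: o_def)
qed

lemma L2v_integral_tendsto:
  assumes f: "\<And>n. f n \<in> L2v L" and g: "g \<in> L2v L" and h: "h \<in> L2v L"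
    and lim: "(\<lambda>n. L2vn L (\<lambda>x. f n x - g x)) \<longlonglongrightarrow> 0"
  shows "(\<lambda>n. \<integral>x. f n x \<bullet> h x \<partial>L) \<longlonglongrightarrow> (\<integral>x. g x \<bullet> h x \<partial>L)"
proof (rule Lim_null[THEN iffD2], rule tendsto_rabs_zero_cancel, rule tendsto_sandwich[OF _ _ tendsto_const])
  show "(\<lambda>n. L2vn L (\<lambda>x. f n x - g x) * L2vn L h) \<longlonglongrightarrow> 0"
    using tendsto_mult_right[OF lim, of "L2vn L h"] by simp
  have "\<bar>(\<integral>x. f n x \<bullet> h x \<partial>L) - (\<integral>x. g x \<bullet> h x \<partial>L)\<bar> \<le> L2vn L (\<lambda>x. f n x - g x) * L2vn L h" for n
  proof -
    have "(\<integral>x. f n x \<bullet> h x \<partial>L) - (\<integral>x. g x \<bullet> h x \<partial>L) = (\<integral>x. (f n x - g x) \<bullet> h x \<partial>L)"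
      using L2v_integrable_inner[OF f h] L2v_integrable_inner[OF g h] by (simp add: inner_diff_left)
    thus ?thesis using L2v_CS[OF L2v_diff[OF f g] h] by simp
  qed
  thus "\<forall>\<^sub>F n in sequentially. \<bar>(\<integral>x. f n x \<bullet> h x \<partial>L) - (\<integral>x. g x \<bullet> h x \<partial>L)\<bar> \<le> L2vn L (\<lambda>x. f n x - g x) * L2vn L h"
    by simp
qed auto

text \<open>For fixed \<open>\<psi>\<close> both sides are continuous in the pair of function and
  gradient, so the identity passes from test functions to their closure. The boundary values of
  \<open>\<psi>\<close> are unrestricted.\<close>

lemma H10g_green:
  assumes y: "H10g \<Omega> y g" and \<psi>: "smooth \<psi>"
  shows "(\<integral>x. g x \<bullet> grad \<psi> x \<partial>L) = - (\<integral>x. y x * laplacian \<psi> x \<partial>L)"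
proof -
  obtain \<phi> where \<phi>: "\<And>n. \<phi> n \<in> test_functions \<Omega>" "(\<lambda>n. L2vn L (\<lambda>x. \<phi> n x - y x)) \<longlonglongrightarrow> 0"
    "(\<lambda>n. L2vn L (\<lambda>x. grad (\<phi> n) x - g x)) \<longlonglongrightarrow> 0" "AE x in L. (\<lambda>n. \<phi> n x) \<longlonglongrightarrow> y x"
    by (rule H10g_seq[OF y]) (rule that; assumption)
  have 1: "(\<lambda>n. \<integral>x. grad (\<phi> n) x \<bullet> grad \<psi> x \<partial>L) \<longlonglongrightarrow> (\<integral>x. g x \<bullet> grad \<psi> x \<partial>L)"
    by (intro L2v_integral_tendsto \<phi> test_L2v H10gD[OF y] grad_L2v \<psi>)
  have "(\<lambda>n. \<integral>x. \<phi> n x \<bullet> laplacian \<psi> x \<partial>L) \<longlonglongrightarrow> (\<integral>x. y x \<bullet> laplacian \<psi> x \<partial>L)"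
    by (intro L2v_integral_tendsto \<phi> test_L2v H10gD[OF y] smooth_L2v smooth_laplacian \<psi>)
  hence "(\<lambda>n. - (\<integral>x. \<phi> n x * laplacian \<psi> x \<partial>L)) \<longlonglongrightarrow> - (\<integral>x. y x * laplacian \<psi> x \<partial>L)"
    by (intro tendsto_minus) simp
  with 1 show ?thesis unfolding test_green[OF \<phi>(1) \<psi>] by (rule LIMSEQ_unique)
qed

section \<open>Weak gradients and the identification with the given Sobolev space\<close>

lemma H10g_weak_gradient:
  assumes y: "H10g \<Omega> y g" shows "weak_gradient \<Omega> y g"
  unfolding weak_gradient_def L2_eq_L2v L2_inner_def
proof (intro ballI conjI)
  fix i :: 'a assume i: "i \<in> Basis"
  show gi: "(\<lambda>x. g x \<bullet> i) \<in> L2v L" using H10gD(2)[OF y] i L2v_components by blast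
  fix \<psi> assume \<psi>: "\<psi> \<in> test_functions \<Omega>"
  note s = test_smooth[OF \<psi>]
  obtain \<phi> where \<phi>: "\<And>n. \<phi> n \<in> test_functions \<Omega>" "(\<lambda>n. L2vn L (\<lambda>x. \<phi> n x - y x)) \<longlonglongrightarrow> 0"
    "(\<lambda>n. L2vn L (\<lambda>x. grad (\<phi> n) x - g x)) \<longlonglongrightarrow> 0" "AE x in L. (\<lambda>n. \<phi> n x) \<longlonglongrightarrow> y x"
    by (rule H10g_seq[OF y]) (rule that; assumption)
  have 1: "(\<lambda>n. \<integral>x. \<phi> n x \<bullet> pd \<psi> i x \<partial>L) \<longlonglongrightarrow> (\<integral>x. y x \<bullet> pd \<psi> i x \<partial>L)"
    by (intro L2v_integral_tendsto \<phi> test_L2v H10gD[OF y] smooth_L2v smooth_pd s i)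
  have "(\<lambda>x. \<psi> x *\<^sub>R i) \<in> L2v L"
    by (rule L2v_norm_bound(1)[OF _ smooth_L2v[OF s]]) (use smooth_meas[OF s] i in auto)
  hence "(\<lambda>n. \<integral>x. grad (\<phi> n) x \<bullet> (\<psi> x *\<^sub>R i) \<partial>L) \<longlonglongrightarrow> (\<integral>x. g x \<bullet> (\<psi> x *\<^sub>R i) \<partial>L)"
    by (intro L2v_integral_tendsto \<phi> test_L2v H10gD[OF y])
  hence "(\<lambda>n. - (\<integral>x. pd (\<phi> n) i x * \<psi> x \<partial>L)) \<longlonglongrightarrow> - (\<integral>x. (g x \<bullet> i) * \<psi> x \<partial>L)"
    by (intro tendsto_minus) (simp add: grad_inner_Basis i mult.commute)
  with 1 show "(\<integral>x. y x * pd \<psi> i x \<partial>L) = - (\<integral>x. g x \<bullet> i * \<psi> x \<partial>L)"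
    unfolding test_parts[OF \<phi>(1) s i] inner_real_def by (rule LIMSEQ_unique)
qed

lemma weak_gradient_L2v: "weak_gradient \<Omega> y g \<Longrightarrow> g \<in> L2v L"
  unfolding weak_gradient_def L2_eq_L2v by (subst L2v_components[symmetric]) auto

text \<open>Each component of the difference is orthogonal to all test functions.\<close>

lemma weak_gradient_unique:
  assumes g: "weak_gradient \<Omega> y g" and k: "weak_gradient \<Omega> y k"
  shows "AE x in L. g x = k x"
proof -
  have gk: "g \<in> L2v L" "k \<in> L2v L" using assms weak_gradient_L2v by auto
  have "AE x in L. (g x - k x) \<bullet> i = 0" if i: "i \<in> Basis" for i
  proof (rule test_orthogonal_imp_AE_zero[OF open_dom])
    have c: "(\<lambda>x. g x \<bullet> i) \<in> L2v L" "(\<lambda>x. k x \<bullet> i) \<in> L2v L" using gk i L2v_components by blast+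
    have "(\<lambda>x. g x \<bullet> i - k x \<bullet> i) \<in> L2v L" using c by (rule L2v_diff)
    thus "integrable L (\<lambda>x. (g x - k x) \<bullet> i)"
      using L2v_integrable_norm(3)[OF finite_L] by (simp add: inner_diff_left)
    fix \<phi> assume \<phi>: "\<phi> \<in> test_functions \<Omega>"
    have "(\<integral>x. (g x - k x) \<bullet> i * \<phi> x \<partial>L) = (\<integral>x. g x \<bullet> i * \<phi> x \<partial>L) - (\<integral>x. k x \<bullet> i * \<phi> x \<partial>L)"
      using L2v_integrable_mult[OF c(1) test_L2v(1)[OF \<phi>]] L2v_integrable_mult[OF c(2) test_L2v(1)[OF \<phi>]]
      by (simp add: inner_diff_left left_diff_distrib)
    also have "\<dots> = 0"
    proof -
      have "- (\<integral>x. g x \<bullet> i * \<phi> x \<partial>L) = - (\<integral>x. k x \<bullet> i * \<phi> x \<partial>L)"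
        using g k i \<phi> unfolding weak_gradient_def L2_inner_def by (rule_tac trans[OF sym]) auto
      thus ?thesis by simp
    qed
    finally show "(\<integral>x. (g x - k x) \<bullet> i * \<phi> x \<partial>L) = 0" .
  qed
  hence "AE x in L. \<forall>i\<in>Basis. (g x - k x) \<bullet> i = 0" by (simp add: AE_ball_countable countable_finite)
  thus ?thesis by eventually_elim (metis euclidean_all_zero_iff eq_iff_diff_eq_0)
qed

lemma weak_gradient_diff_test:
  assumes y: "y \<in> L2v L" and g: "weak_gradient \<Omega> y g" and \<phi>: "\<phi> \<in> test_functions \<Omega>"
  shows "weak_gradient \<Omega> (\<lambda>x. y x - \<phi> x) (\<lambda>x. g x - grad \<phi> x)"
  unfolding weak_gradient_def L2_eq_L2v L2_inner_def
proof (intro ballI conjI)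
  fix i :: 'a assume i: "i \<in> Basis"
  have gi: "(\<lambda>x. g x \<bullet> i) \<in> L2v L" using weak_gradient_L2v[OF g] i L2v_components by blast
  show "(\<lambda>x. (g x - grad \<phi> x) \<bullet> i) \<in> L2v L"
    using L2v_components[of "\<lambda>x. g x - grad \<phi> x" L] L2v_diff[OF weak_gradient_L2v[OF g] test_L2v(2)[OF \<phi>]] i by blast
  fix \<psi> assume \<psi>: "\<psi> \<in> test_functions \<Omega>"
  note s = test_smooth[OF \<psi>] and s' = test_smooth[OF \<phi>]
  have "(\<integral>x. (y x - \<phi> x) * pd \<psi> i x \<partial>L) = (\<integral>x. y x * pd \<psi> i x \<partial>L) - (\<integral>x. \<phi> x * pd \<psi> i x \<partial>L)"
    using L2v_integrable_mult[OF y smooth_L2v[OF smooth_pd[OF s i]]]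
      L2v_integrable_mult[OF smooth_L2v[OF s'] smooth_L2v[OF smooth_pd[OF s i]]]
    by (simp add: left_diff_distrib)
  also have "\<dots> = - (\<integral>x. g x \<bullet> i * \<psi> x \<partial>L) + (\<integral>x. pd \<phi> i x * \<psi> x \<partial>L)"
    using g i \<psi> test_parts[OF \<phi> s i] unfolding weak_gradient_def L2_inner_def by simp
  also have "\<dots> = - (\<integral>x. (g x - grad \<phi> x) \<bullet> i * \<psi> x \<partial>L)"
    using L2v_integrable_mult[OF gi smooth_L2v[OF s]] L2v_integrable_mult[OF smooth_L2v[OF smooth_pd[OF s' i]] smooth_L2v[OF s]]
    by (simp add: inner_diff_left left_diff_distrib grad_inner_Basis i)
  finally show "(\<integral>x. (y x - \<phi> x) * pd \<psi> i x \<partial>L) = - (\<integral>x. (g x - grad \<phi> x) \<bullet> i * \<psi> x \<partial>L)" .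
qed

lemma wgrad_weak_gradient: "weak_gradient \<Omega> y g \<Longrightarrow> weak_gradient \<Omega> y (wgrad \<Omega> y)"
  unfolding wgrad_def by (rule someI[where P = "weak_gradient \<Omega> y"])

lemma grad_inner_eq:
  assumes "weak_gradient \<Omega> y g" "weak_gradient \<Omega> v k"
  shows "grad_inner \<Omega> y v = (\<integral>x. g x \<bullet> k x \<partial>L)"
proof -
  note w = assms[THEN wgrad_weak_gradient]
  have "AE x in L. wgrad \<Omega> y x = g x" "AE x in L. wgrad \<Omega> v x = k x"
    using weak_gradient_unique w assms by blast+
  hence "AE x in L. wgrad \<Omega> y x \<bullet> wgrad \<Omega> v x = g x \<bullet> k x" by eventually_elim simp
  thus ?thesis unfolding grad_inner_def
    using L2v_meas[OF weak_gradient_L2v] w assms by (intro integral_cong_AE) auto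
qed

lemma H10g_cong_AE:
  assumes y: "H10g \<Omega> y g" and z: "z \<in> borel_measurable L" "AE x in L. y x = z x"
    and k: "k \<in> borel_measurable L" "AE x in L. g x = k x"
  shows "H10g \<Omega> z k"
proof (rule H10g_closed)
  show zk: "z \<in> L2v L" "k \<in> L2v L" using L2v_cong_AE H10gD[OF y] z k by blast+
  have "L2vn L (\<lambda>x. y x - z x) = 0"
    using z(2) by (subst L2vn_eq_0_iff[OF L2v_diff[OF H10gD(1)[OF y] zk(1)]]) auto
  moreover have "L2vn L (\<lambda>x. g x - k x) = 0"
    using k(2) by (subst L2vn_eq_0_iff[OF L2v_diff[OF H10gD(2)[OF y] zk(2)]]) auto
  ultimately show "\<exists>z' k'. H10g \<Omega> z' k' \<and> L2vn L (\<lambda>x. z' x - z x) < e \<and> L2vn L (\<lambda>x. k' x - k x) < e"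
    if "e > 0" for e using that y by (intro exI[of _ y] exI[of _ g]) simp
qed

text \<open>Connects the norm in the definition of \<open>H10\<close>, which refers to chosen
  gradients, with the pair norm in \<open>H10g\<close>: by uniqueness any weak gradient may be
  inserted.\<close>

lemma H1_norm_diff_test:
  assumes y: "y \<in> L2v L" and g: "weak_gradient \<Omega> y g" and \<phi>: "\<phi> \<in> test_functions \<Omega>"
  shows "H1_norm \<Omega> (\<lambda>x. y x - \<phi> x) = L2vn L (\<lambda>x. (\<phi> x - y x, grad \<phi> x - g x))"
proof -
  note d = weak_gradient_diff_test[OF assms]
  have m: "(\<lambda>x. y x - \<phi> x) \<in> L2v L" "(\<lambda>x. g x - grad \<phi> x) \<in> L2v L"
    using L2v_diff[OF y test_L2v(1)[OF \<phi>]] weak_gradient_L2v[OF d] by auto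
  have "(H1_norm \<Omega> (\<lambda>x. y x - \<phi> x))\<^sup>2 = (L2vn L (\<lambda>x. (y x - \<phi> x, g x - grad \<phi> x)))\<^sup>2"
    unfolding H1_norm_def L2_norm_eq grad_inner_eq[OF d d] L2vn_Pair(1)[OF m]
    by (simp add: L2vn_sq power2_norm_eq_inner[symmetric])
  moreover have "H1_norm \<Omega> (\<lambda>x. y x - \<phi> x) \<ge> 0"
    unfolding H1_norm_def grad_inner_eq[OF d d] by simp
  ultimately have "H1_norm \<Omega> (\<lambda>x. y x - \<phi> x) = L2vn L (\<lambda>x. (y x - \<phi> x, g x - grad \<phi> x))"
    by (simp add: power2_eq_iff_nonneg)
  also have "\<dots> = L2vn L (\<lambda>x. (\<phi> x - y x, grad \<phi> x - g x))"
    by (simp add: L2vn_def norm_Pair norm_minus_commute power2_commute)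
  finally show ?thesis .
qed

lemma H10_iff: "y \<in> H10 \<Omega> \<longleftrightarrow> H10g \<Omega> y (wgrad \<Omega> y)"
proof
  assume y: "y \<in> H10 \<Omega>"
  then obtain g where g: "weak_gradient \<Omega> y g" and yL: "y \<in> L2v L"
    unfolding H10_def H1_def L2_eq_L2v by blast
  note w = wgrad_weak_gradient[OF g]
  have "\<forall>e>0. \<exists>\<phi>\<in>test_functions \<Omega>. H1_norm \<Omega> (\<lambda>x. y x - \<phi> x) < e" using y by (simp add: H10_def)
  thus "H10g \<Omega> y (wgrad \<Omega> y)"
    unfolding H10g_def using yL weak_gradient_L2v[OF w] by (simp add: H1_norm_diff_test[OF yL w] cong: bex_cong)
next
  assume h: "H10g \<Omega> y (wgrad \<Omega> y)"
  note w = H10g_weak_gradient[OF h]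
  have yL: "y \<in> L2v L" by (rule H10gD[OF h])
  have "\<forall>e>0. \<exists>\<phi>\<in>test_functions \<Omega>. H1_norm \<Omega> (\<lambda>x. y x - \<phi> x) < e"
    using h unfolding H10g_def by (simp add: H1_norm_diff_test[OF yL w] cong: bex_cong)
  thus "y \<in> H10 \<Omega>" unfolding H10_def H1_def L2_eq_L2v using yL w by blast
qed

lemma H10gD_H10:
  assumes "H10g \<Omega> y g" shows "y \<in> H10 \<Omega>" "AE x in L. wgrad \<Omega> y x = g x"
proof -
  note w = H10g_weak_gradient[OF assms]
  show *: "AE x in L. wgrad \<Omega> y x = g x"
    by (rule weak_gradient_unique[OF wgrad_weak_gradient[OF w] w])
  show "y \<in> H10 \<Omega>" unfolding H10_iff
    by (rule H10g_cong_AE[OF assms])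
       (use * L2v_meas[OF weak_gradient_L2v[OF wgrad_weak_gradient[OF w]]] H10gD[OF assms] in auto)
qed

lemma H10_L2v: "y \<in> H10 \<Omega> \<Longrightarrow> y \<in> L2v L" "y \<in> H10 \<Omega> \<Longrightarrow> wgrad \<Omega> y \<in> L2v L"
  using H10gD[of y "wgrad \<Omega> y"] H10_iff by auto

lemma grad_inner_H10g: "H10g \<Omega> y g \<Longrightarrow> H10g \<Omega> v k \<Longrightarrow> grad_inner \<Omega> y v = (\<integral>x. g x \<bullet> k x \<partial>L)"
  by (intro grad_inner_eq H10g_weak_gradient)

section \<open>Algebra, Poincare inequality, completeness and chain rule in the Sobolev
  space\<close>

lemma test_H10g: assumes "\<phi> \<in> test_functions \<Omega>" shows "H10g \<Omega> \<phi> (grad \<phi>)"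
proof (rule H10gI)
  show "\<exists>\<psi>\<in>test_functions \<Omega>. L2vn L (\<lambda>x. \<psi> x - \<phi> x) < e \<and> L2vn L (\<lambda>x. grad \<psi> x - grad \<phi> x) < e" if "e > 0" for e
    using that assms by (intro bexI[of _ \<phi>]) (simp_all add: L2vn_def)
qed (use assms in \<open>auto intro: test_L2v\<close>)

lemma H10g_add:
  assumes y: "H10g \<Omega> y g" and z: "H10g \<Omega> z k"
  shows "H10g \<Omega> (\<lambda>x. y x + z x) (\<lambda>x. g x + k x)"
proof (rule H10gI)
  fix e :: real assume "e > 0"
  hence e2: "e / 2 > 0" by simp
  obtain \<phi> where \<phi>: "\<phi> \<in> test_functions \<Omega>" "L2vn L (\<lambda>x. \<phi> x - y x) < e/2" "L2vn L (\<lambda>x. grad \<phi> x - g x) < e/2"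
    using H10g_approx[OF y e2] by blast
  obtain \<psi> where \<psi>: "\<psi> \<in> test_functions \<Omega>" "L2vn L (\<lambda>x. \<psi> x - z x) < e/2" "L2vn L (\<lambda>x. grad \<psi> x - k x) < e/2"
    using H10g_approx[OF z e2] by blast
  have "L2vn L (\<lambda>x. (\<phi> x - y x) + (\<psi> x - z x)) < e" "L2vn L (\<lambda>x. (grad \<phi> x - g x) + (grad \<psi> x - k x)) < e"
    using L2vn_triangle[OF L2v_diff[OF test_L2v(1)[OF \<phi>(1)] H10gD(1)[OF y]] L2v_diff[OF test_L2v(1)[OF \<psi>(1)] H10gD(1)[OF z]]]
      L2vn_triangle[OF L2v_diff[OF test_L2v(2)[OF \<phi>(1)] H10gD(2)[OF y]] L2v_diff[OF test_L2v(2)[OF \<psi>(1)] H10gD(2)[OF z]]]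
      \<phi> \<psi> by linarith+
  moreover have "grad (\<lambda>x. \<phi> x + \<psi> x) x = grad \<phi> x + grad \<psi> x" for x
    by (rule grad_add) (use \<phi> \<psi> test_smooth in auto)
  ultimately show "\<exists>\<phi>\<in>test_functions \<Omega>. L2vn L (\<lambda>x. \<phi> x - (y x + z x)) < e \<and> L2vn L (\<lambda>x. grad \<phi> x - (g x + k x)) < e"
    by (intro bexI[OF _ test_add[OF \<phi>(1) \<psi>(1)]]) (simp add: algebra_simps)
qed (use y z in \<open>auto intro: L2v_add H10gD\<close>)

lemma H10g_mult_smooth:
  assumes y: "H10g \<Omega> y g" and \<psi>: "smooth \<psi>"
  shows "H10g \<Omega> (\<lambda>x. \<psi> x * y x) (\<lambda>x. \<psi> x *\<^sub>R g x + y x *\<^sub>R grad \<psi> x)"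
proof -
  obtain B where B: "B > 0" "\<And>x. x \<in> \<Omega> \<Longrightarrow> \<bar>\<psi> x\<bar> \<le> B" using smooth_bounded[OF \<psi>] by blast
  obtain B' where B': "B' > 0" "\<And>x. x \<in> \<Omega> \<Longrightarrow> norm (grad \<psi> x) \<le> B'" using smooth_grad_bounded[OF \<psi>] by blast
  have b: "AE x in L. \<bar>\<psi> x\<bar> \<le> B" using B by (intro AE_I2) simp
  note m = smooth_meas[OF \<psi>] grad_meas[OF \<psi>]
  have est1: "(\<lambda>x. \<psi> x *\<^sub>R f x) \<in> L2v L \<and> L2vn L (\<lambda>x. \<psi> x *\<^sub>R f x) \<le> B * L2vn L f" if "f \<in> L2v L" for f :: "'a \<Rightarrow> 'b::euclidean_space"
    using L2v_mult_bounded[OF that m(1) b] B by simp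
  have est2: "(\<lambda>x. f x *\<^sub>R grad \<psi> x) \<in> L2v L \<and> L2vn L (\<lambda>x. f x *\<^sub>R grad \<psi> x) \<le> B' * L2vn L f"
    if f: "f \<in> L2v L" for f :: "'a \<Rightarrow> real"
  proof -
    have *: "(\<lambda>x. f x *\<^sub>R grad \<psi> x) \<in> borel_measurable L" using L2v_meas[OF f] m by simp
    have **: "AE x in L. norm (f x *\<^sub>R grad \<psi> x) \<le> norm (B' *\<^sub>R f x)"
      using B' by (intro AE_I2) (auto simp: abs_mult mult.commute[of B'] intro!: mult_left_mono)
    show ?thesis using L2v_norm_bound[OF * L2v_scaleR[OF f] **] B' by (simp add: L2vn_cmult)
  qed
  show ?thesis
  proof (rule H10gI)
    show "(\<lambda>x. \<psi> x * y x) \<in> L2v L" using est1[of y] H10gD[OF y] by simp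
    show "(\<lambda>x. \<psi> x *\<^sub>R g x + y x *\<^sub>R grad \<psi> x) \<in> L2v L"
      using est1[of g] est2[of y] H10gD[OF y] by (intro L2v_add) auto
    fix e :: real assume "e > 0"
    \<comment> \<open>The product rule splits the gradient error into two parts, weighted by the
      bound \<open>B\<close> of \<open>\<psi>\<close> and the bound \<open>B'\<close> of its
      gradient.\<close>
    hence "e / (B + B') > 0" using B B' by simp
    then obtain \<phi> where \<phi>: "\<phi> \<in> test_functions \<Omega>" "L2vn L (\<lambda>x. \<phi> x - y x) < e / (B + B')" "L2vn L (\<lambda>x. grad \<phi> x - g x) < e / (B + B')"
      using H10g_approx[OF y] by blast
    note d = L2v_diff[OF test_L2v(1)[OF \<phi>(1)] H10gD(1)[OF y]] L2v_diff[OF test_L2v(2)[OF \<phi>(1)] H10gD(2)[OF y]]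
    have "L2vn L (\<lambda>x. \<psi> x * \<phi> x - \<psi> x * y x) = L2vn L (\<lambda>x. \<psi> x *\<^sub>R (\<phi> x - y x))"
      by (simp add: algebra_simps)
    also have "\<dots> \<le> B * L2vn L (\<lambda>x. \<phi> x - y x)" using est1[OF d(1)] by simp
    also have "\<dots> < (B + B') * (e / (B + B'))" using B B' \<phi> by (intro mult_le_less_imp_less) auto
    also have "(B + B') * (e / (B + B')) = e" using B B' by simp
    finally have 1: "L2vn L (\<lambda>x. \<psi> x * \<phi> x - \<psi> x * y x) < e" .
    have "grad (\<lambda>x. \<psi> x * \<phi> x) x - (\<psi> x *\<^sub>R g x + y x *\<^sub>R grad \<psi> x)
       = \<psi> x *\<^sub>R (grad \<phi> x - g x) + (\<phi> x - y x) *\<^sub>R grad \<psi> x" for x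
      using grad_mult[OF \<psi> test_smooth[OF \<phi>(1)]] by (simp add: algebra_simps)
    hence "L2vn L (\<lambda>x. grad (\<lambda>x. \<psi> x * \<phi> x) x - (\<psi> x *\<^sub>R g x + y x *\<^sub>R grad \<psi> x))
      \<le> L2vn L (\<lambda>x. \<psi> x *\<^sub>R (grad \<phi> x - g x)) + L2vn L (\<lambda>x. (\<phi> x - y x) *\<^sub>R grad \<psi> x)"
      using est1[OF d(2)] est2[OF d(1)] by (simp add: L2vn_triangle)
    also have "\<dots> \<le> B * L2vn L (\<lambda>x. grad \<phi> x - g x) + B' * L2vn L (\<lambda>x. \<phi> x - y x)"
      using est1[OF d(2)] est2[OF d(1)] by (intro add_mono) auto
    also have "\<dots> < B * (e / (B + B')) + B' * (e / (B + B'))" using B B' \<phi> by (intro add_strict_mono mult_strict_left_mono) auto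
    also have "\<dots> = (B + B') * (e / (B + B'))" by (simp only: algebra_simps)
    also have "\<dots> = e" using B B' by simp
    finally have 2: "L2vn L (\<lambda>x. grad (\<lambda>x. \<psi> x * \<phi> x) x - (\<psi> x *\<^sub>R g x + y x *\<^sub>R grad \<psi> x)) < e" .
    show "\<exists>\<phi>\<in>test_functions \<Omega>. L2vn L (\<lambda>x. \<phi> x - \<psi> x * y x) < e \<and> L2vn L (\<lambda>x. grad \<phi> x - (\<psi> x *\<^sub>R g x + y x *\<^sub>R grad \<psi> x)) < e"
      using 1 2 by (intro bexI[OF _ test_mult[OF \<phi>(1) \<psi>]]) auto
  qed
qed

lemma H10g_cmult:
  assumes "H10g \<Omega> y g" shows "H10g \<Omega> (\<lambda>x. c * y x) (\<lambda>x. c *\<^sub>R g x)"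
proof -
  have "grad (\<lambda>x. c) x = 0" for x :: 'a by (simp add: grad_def)
  thus ?thesis using H10g_mult_smooth[OF assms smooth_const[of c]] by simp
qed

lemma H10g_diff:
  assumes "H10g \<Omega> y g" "H10g \<Omega> z k"
  shows "H10g \<Omega> (\<lambda>x. y x - z x) (\<lambda>x. g x - k x)"
  using H10g_add[OF assms(1) H10g_cmult[OF assms(2), of "-1"]] by simp

lemma H10g_complete:
  fixes y :: "nat \<Rightarrow> 'a \<Rightarrow> real"
  assumes y: "\<And>n. H10g \<Omega> (y n) (g n)"
    and cauchy: "\<And>e. e > 0 \<Longrightarrow> \<exists>N. \<forall>m\<ge>N. \<forall>n\<ge>N. L2vn L (\<lambda>x. y m x - y n x) < e"
      "\<And>e. e > 0 \<Longrightarrow> \<exists>N. \<forall>m\<ge>N. \<forall>n\<ge>N. L2vn L (\<lambda>x. g m x - g n x) < e"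
  obtains z k where "H10g \<Omega> z k" "(\<lambda>n. L2vn L (\<lambda>x. y n x - z x)) \<longlonglongrightarrow> 0" "(\<lambda>n. L2vn L (\<lambda>x. g n x - k x)) \<longlonglongrightarrow> 0"
proof -
  obtain z where z: "z \<in> L2v L" "(\<lambda>n. L2vn L (\<lambda>x. y n x - z x)) \<longlonglongrightarrow> 0"
    using L2v_complete[OF finite_L H10gD(1)[OF y] cauchy(1)] by blast
  obtain k where k: "k \<in> L2v L" "(\<lambda>n. L2vn L (\<lambda>x. g n x - k x)) \<longlonglongrightarrow> 0"
    using L2v_complete[OF finite_L H10gD(2)[OF y] cauchy(2)] by blast
  have "H10g \<Omega> z k"
  proof (rule H10g_closed[OF z(1) k(1)])
    fix e :: real assume "e > 0"
    hence "\<forall>\<^sub>F n in sequentially. L2vn L (\<lambda>x. y n x - z x) < e \<and> L2vn L (\<lambda>x. g n x - k x) < e"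
      using z k by (intro eventually_conj order_tendstoD) auto
    then obtain n where "L2vn L (\<lambda>x. y n x - z x) < e \<and> L2vn L (\<lambda>x. g n x - k x) < e"
      using eventually_happens by force
    thus "\<exists>z' k'. H10g \<Omega> z' k' \<and> L2vn L (\<lambda>x. z' x - z x) < e \<and> L2vn L (\<lambda>x. k' x - k x) < e" using y by blast
  qed
  with z k that show ?thesis by blast
qed

text \<open>One coordinate direction suffices: the square of \<open>\<phi>\<close> equals the
  \<open>i\<close>-th derivative of \<open>x_i * \<phi>^2\<close> minus
  \<open>2 * x_i * \<phi>\<close> times the \<open>i\<close>-th derivative of \<open>\<phi>\<close>.
  The first term integrates to 0, and \<open>\<bar>x_i\<bar> \<le> R\<close> on the domain, which
  gives the constant \<open>2 * R\<close>.\<close>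

lemma Poincare:
  obtains C where "C > 0" "\<And>y g. H10g \<Omega> y g \<Longrightarrow> L2vn L y \<le> C * L2vn L g"
proof -
  obtain R where R: "R > 0" "\<And>x. x \<in> \<Omega> \<Longrightarrow> norm x \<le> R" using bounded_dom bounded_pos by blast
  obtain i :: 'a where i: "i \<in> Basis" using nonempty_Basis by blast
  have test: "L2vn L \<phi> \<le> 2 * R * L2vn L (grad \<phi>)" if \<phi>: "\<phi> \<in> test_functions \<Omega>" for \<phi>
  proof (cases "L2vn L \<phi> = 0")
    case False
    note s = test_smooth[OF \<phi>]
    have "(L2vn L \<phi>)\<^sup>2 = (\<integral>x. \<phi> x * \<phi> x \<partial>L)"
      unfolding L2vn_sq by (simp add: power2_eq_square[symmetric])
    also have "\<dots> = (\<integral>x. pd (\<lambda>x. (x \<bullet> i * \<phi> x) * \<phi> x) i x - 2 * ((x \<bullet> i) * \<phi> x * pd \<phi> i x) \<partial>L)"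
    proof (intro Bochner_Integration.integral_cong refl)
      fix x
      have "pd (\<lambda>x. x \<bullet> i * \<phi> x * \<phi> x) i x = x \<bullet> i * \<phi> x * pd \<phi> i x + (x \<bullet> i * pd \<phi> i x + 1 * \<phi> x) * \<phi> x"
        using i by (simp add: pd_mult smooth_mult s pd_inner)
      thus "\<phi> x * \<phi> x = pd (\<lambda>x. (x \<bullet> i * \<phi> x) * \<phi> x) i x - 2 * ((x \<bullet> i) * \<phi> x * pd \<phi> i x)"
        by (simp add: algebra_simps)
    qed
    also have "\<dots> = (\<integral>x. pd (\<lambda>x. (x \<bullet> i * \<phi> x) * \<phi> x) i x \<partial>L) - 2 * (\<integral>x. (x \<bullet> i) * \<phi> x * pd \<phi> i x \<partial>L)"
      by (subst Bochner_Integration.integral_diff)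
         (auto intro!: L2v_integrable_mult L2v_integrable_norm(3)[OF finite_L] smooth_L2v smooth_pd smooth_mult s i)
    also have "(\<integral>x. pd (\<lambda>x. (x \<bullet> i * \<phi> x) * \<phi> x) i x \<partial>L) = 0"
      by (intro integral_pd_test_on i test_mult \<phi> smooth_mult s) auto
    also have "0 - 2 * (\<integral>x. (x \<bullet> i) * \<phi> x * pd \<phi> i x \<partial>L) \<le> 2 * \<bar>\<integral>x. ((x \<bullet> i) * \<phi> x) * pd \<phi> i x \<partial>L\<bar>" by simp
    also have "\<dots> \<le> 2 * (L2vn L (\<lambda>x. (x \<bullet> i) * \<phi> x) * L2vn L (pd \<phi> i))"
      by (intro mult_left_mono L2v_CS_real smooth_L2v smooth_mult smooth_pd s i) auto
    also have "\<dots> \<le> 2 * ((R * L2vn L \<phi>) * L2vn L (grad \<phi>))"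
    proof (intro mult_left_mono mult_mono)
      have xb: "AE x in L. \<bar>x \<bullet> i\<bar> \<le> R" using R Basis_le_norm[OF i] by (intro AE_I2) (force intro: order_trans)
      show "L2vn L (\<lambda>x. x \<bullet> i * \<phi> x) \<le> R * L2vn L \<phi>"
        using L2v_mult_bounded(2)[OF test_L2v(1)[OF \<phi>] smooth_meas xb] R by simp
      show "L2vn L (pd \<phi> i) \<le> L2vn L (grad \<phi>)"
        by (intro L2v_norm_bound(2) smooth_meas smooth_pd s i test_L2v \<phi> AE_I2)
           (metis Basis_le_norm[OF i] grad_inner_Basis[OF i] real_norm_def)
    qed (use R in auto)
    finally have "L2vn L \<phi> * L2vn L \<phi> \<le> L2vn L \<phi> * (2 * R * L2vn L (grad \<phi>))" by (simp add: power2_eq_square mult_ac)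
    moreover have "L2vn L \<phi> > 0" using False L2vn_nonneg[of L \<phi>] by linarith
    ultimately show ?thesis by simp
  qed (use R in simp)
  have "L2vn L y \<le> 2 * R * L2vn L g" if y: "H10g \<Omega> y g" for y g
  proof (rule field_le_epsilon)
    fix e :: real assume "e > 0"
    hence "e / (1 + 2 * R) > 0" using R by simp
    then obtain \<phi> where \<phi>: "\<phi> \<in> test_functions \<Omega>" "L2vn L (\<lambda>x. \<phi> x - y x) < e / (1 + 2 * R)" "L2vn L (\<lambda>x. grad \<phi> x - g x) < e / (1 + 2 * R)"
      using H10g_approx[OF y] by blast
    have "L2vn L y \<le> L2vn L \<phi> + L2vn L (\<lambda>x. \<phi> x - y x)"
      using L2vn_diff_ineq[OF test_L2v(1)[OF \<phi>(1)] H10gD(1)[OF y]] by simp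
    also have "\<dots> \<le> 2 * R * L2vn L (grad \<phi>) + e / (1 + 2 * R)" using test[OF \<phi>(1)] \<phi> by simp
    also have "\<dots> \<le> 2 * R * (L2vn L g + e / (1 + 2 * R)) + e / (1 + 2 * R)"
      using L2vn_diff_ineq[OF test_L2v(2)[OF \<phi>(1)] H10gD(2)[OF y]] \<phi>(3) R by (intro add_mono mult_left_mono) auto
    also have "\<dots> = 2 * R * L2vn L g + (1 + 2 * R) * (e / (1 + 2 * R))"
      by (simp only: algebra_simps)
    also have "(1 + 2 * R) * (e / (1 + 2 * R)) = e" using R by simp
    finally show "L2vn L y \<le> 2 * R * L2vn L g + e" .
  qed
  with R that[of "2 * R"] show ?thesis by simp
qed

text \<open>By the Poincare inequality the gradient norm controls the full norm. Both the minimising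
  sequence and the fixed point iteration below are shown to be Cauchy in the gradient norm.\<close>

lemma H10g_complete_grad:
  fixes y :: "nat \<Rightarrow> 'a \<Rightarrow> real"
  assumes y: "\<And>n. H10g \<Omega> (y n) (g n)"
    and cauchy: "\<And>e. e > 0 \<Longrightarrow> \<exists>N. \<forall>m\<ge>N. \<forall>n\<ge>N. L2vn L (\<lambda>x. g m x - g n x) < e"
  obtains z k where "H10g \<Omega> z k" "(\<lambda>n. L2vn L (\<lambda>x. y n x - z x)) \<longlonglongrightarrow> 0" "(\<lambda>n. L2vn L (\<lambda>x. g n x - k x)) \<longlonglongrightarrow> 0"
proof (rule H10g_complete[OF y _ cauchy])
  fix e :: real assume e: "e > 0"
  obtain C where C: "C > 0" "\<And>y g. H10g \<Omega> y g \<Longrightarrow> L2vn L y \<le> C * L2vn L g" using Poincare by blast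
  obtain N where N: "\<forall>i\<ge>N. \<forall>j\<ge>N. L2vn L (\<lambda>x. g i x - g j x) < e / C" using cauchy[of "e / C"] e C by auto
  have "L2vn L (\<lambda>x. y i x - y j x) < e" if "i \<ge> N" "j \<ge> N" for i j
  proof -
    have "L2vn L (\<lambda>x. y i x - y j x) \<le> C * L2vn L (\<lambda>x. g i x - g j x)"
      by (rule C(2)[OF H10g_diff[OF y y]])
    also have "\<dots> < C * (e / C)" using N that C(1) by (intro mult_strict_left_mono) auto
    finally show ?thesis using C by simp
  qed
  thus "\<exists>N. \<forall>m\<ge>N. \<forall>n\<ge>N. L2vn L (\<lambda>x. y m x - y n x) < e" by blast
qed (assumption, (rule that; assumption))

text \<open>\<open>G\<close> is only continuously differentiable, so the composition is no test
  function. By Weierstrass, \<open>G'\<close> is approximated uniformly on the range of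
  \<open>\<phi>\<close> by a polynomial, and an antiderivative of that polynomial does yield test
  functions.\<close>

lemma H10g_comp_test:
  assumes \<phi>: "\<phi> \<in> test_functions \<Omega>" and G: "\<And>t. (G has_real_derivative G' t) (at t)" "continuous_on UNIV G'" "G 0 = 0"
  shows "H10g \<Omega> (\<lambda>x. G (\<phi> x)) (\<lambda>x. G' (\<phi> x) *\<^sub>R grad \<phi> x)"
proof -
  note s = test_smooth[OF \<phi>]
  obtain R where R: "R > 0" "\<And>x. \<bar>\<phi> x\<bar> \<le> R" using test_bounded[OF \<phi>] by blast
  have contG: "continuous_on UNIV G" using G(1) by (meson DERIV_isCont continuous_at_imp_continuous_on)
  have G'm: "(\<lambda>x. G' (\<phi> x)) \<in> borel_measurable L" "(\<lambda>x. G (\<phi> x)) \<in> borel_measurable L"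
    using borel_measurable_continuous_on[OF G(2) smooth_meas[OF s]] borel_measurable_continuous_on[OF contG smooth_meas[OF s]] by auto
  have "compact (G' ` {-R..R})" "compact (G ` {-R..R})"
    by (intro compact_continuous_image continuous_on_subset[OF G(2)] continuous_on_subset[OF contG]; simp)+
  hence "bounded (G' ` {-R..R})" "bounded (G ` {-R..R})" by (auto intro: compact_imp_bounded)
  then obtain B1 B2 where "\<forall>t\<in>G' ` {-R..R}. norm t \<le> B1" "\<forall>t\<in>G ` {-R..R}. norm t \<le> B2"
    unfolding bounded_iff by blast
  hence B: "\<And>t. t \<in> {-R..R} \<Longrightarrow> \<bar>G' t\<bar> \<le> B1" "\<And>t. t \<in> {-R..R} \<Longrightarrow> \<bar>G t\<bar> \<le> B2" by auto
  have in_R: "\<phi> x \<in> {-R..R}" for x using R(2)[of x] by auto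
  define m where "m = sqrt (measure L \<Omega>)"
  have m0: "m \<ge> 0" by (simp add: m_def)
  show ?thesis
  proof (rule H10gI)
    show "(\<lambda>x. G (\<phi> x)) \<in> L2v L" by (rule L2v_Bounded(1)[OF finite_L G'm(2), of B2]) (use B in_R in auto)
    show "(\<lambda>x. G' (\<phi> x) *\<^sub>R grad \<phi> x) \<in> L2v L"
      by (rule L2v_mult_bounded(1)[OF test_L2v(2)[OF \<phi>] G'm(1), of B1]) (use B in_R in auto)
    fix e :: real assume e: "e > 0"
    \<comment> \<open>Accuracy of the polynomial: it has to absorb the factor \<open>R * m\<close>
      in the function error and the norm of the gradient in the gradient error.\<close>
    define d where "d = e / (1 + R * m + L2vn L (grad \<phi>))"
    have den: "1 + R * m + L2vn L (grad \<phi>) > 0" using R m0 by (intro add_pos_nonneg) auto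
    have d: "d > 0" unfolding d_def using e den by simp
    obtain p where p: "real_polynomial_function p" "\<And>t. t \<in> {-R..R} \<Longrightarrow> \<bar>G' t - p t\<bar> < d"
      using Stone_Weierstrass_real_polynomial_function[of "{-R..R}" G' d] d continuous_on_subset[OF G(2)] by auto
    obtain a n where an: "p = (\<lambda>t. \<Sum>i\<le>n. a i * t ^ i)" using p(1) real_polynomial_function_iff_sum by auto
    \<comment> \<open>The antiderivative is normalised to vanish at 0, which preserves the compact
      support.\<close>
    define Q where "Q t = (\<Sum>i\<le>n. a i / real (Suc i) * t ^ Suc i)" for t :: real
    have Q: "(Q has_real_derivative p t) (at t)" for t
      unfolding Q_def an
      by (rule DERIV_sum, rule DERIV_cong[OF DERIV_cmult[OF DERIV_pow]]) simp
    have Q0: "Q 0 = 0" by (simp add: Q_def)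
    have QG: "\<bar>Q t - G t\<bar> \<le> d * R" if t: "t \<in> {-R..R}" for t
    proof -
      have "norm ((\<lambda>t. Q t - G t) t - (\<lambda>t. Q t - G t) 0) \<le> d * norm (t - 0)"
      proof (rule field_differentiable_bound[of "{-R..R}" _ "\<lambda>t. p t - G' t"])
        show "((\<lambda>t. Q t - G t) has_field_derivative p z - G' z) (at z within {-R..R})" for z
          by (intro DERIV_diff has_field_derivative_at_within[OF Q] has_field_derivative_at_within[OF G(1)])
        show "norm (p z - G' z) \<le> d" if "z \<in> {-R..R}" for z using p(2)[OF that] by (simp add: abs_minus_commute)
      qed (use t R in auto)
      also have "\<dots> \<le> d * R" using t d by auto
      finally show ?thesis using Q0 G(3) by simp
    qed
    have tQ: "(\<lambda>x. Q (\<phi> x)) \<in> test_functions \<Omega>"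
    proof -
      have "smooth (\<lambda>x. Q (\<phi> x))" unfolding Q_def by (intro smooth_sum smooth_mult smooth_power s smooth_const) auto
      thus ?thesis using \<phi> Q0 unfolding test_functions_iff by metis
    qed
    have gQ: "grad (\<lambda>x. Q (\<phi> x)) x = p (\<phi> x) *\<^sub>R grad \<phi> x" for x by (rule grad_comp[OF s Q])
    have "L2vn L (\<lambda>x. Q (\<phi> x) - G (\<phi> x)) \<le> \<bar>d * R\<bar> * sqrt (measure L (space L))"
      by (rule L2v_Bounded(2)[OF finite_L])
         (use QG in_R G'm smooth_meas[OF test_smooth[OF tQ]] in auto)
    also have "\<dots> = d * (R * m)" using d R by (simp add: m_def)
    also have "\<dots> < d * (1 + R * m + L2vn L (grad \<phi>))" using d by (intro mult_strict_left_mono) (simp_all add: add_pos_nonneg)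
    also have "\<dots> = e" unfolding d_def using den by simp
    finally have 1: "L2vn L (\<lambda>x. Q (\<phi> x) - G (\<phi> x)) < e" .
    have "L2vn L (\<lambda>x. (p (\<phi> x) - G' (\<phi> x)) *\<^sub>R grad \<phi> x) \<le> \<bar>d\<bar> * L2vn L (grad \<phi>)"
    proof (rule L2v_mult_bounded(2)[OF test_L2v(2)[OF \<phi>]])
      show "(\<lambda>x. p (\<phi> x) - G' (\<phi> x)) \<in> borel_measurable L"
        unfolding an using G'm smooth_meas[OF s] by simp
      show "AE x in L. \<bar>p (\<phi> x) - G' (\<phi> x)\<bar> \<le> d"
        by (intro AE_I2 less_imp_le) (subst abs_minus_commute, intro p(2) in_R)
    qed
    also have "\<dots> < d * (1 + R * m + L2vn L (grad \<phi>))" using d R m0 by (auto intro!: mult_strict_left_mono add_pos_nonneg)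
    also have "\<dots> = e" unfolding d_def using den by simp
    finally have 2: "L2vn L (\<lambda>x. grad (\<lambda>x. Q (\<phi> x)) x - G' (\<phi> x) *\<^sub>R grad \<phi> x) < e"
      by (simp add: gQ scaleR_diff_left)
    show "\<exists>\<phi>'\<in>test_functions \<Omega>. L2vn L (\<lambda>x. \<phi>' x - G (\<phi> x)) < e \<and> L2vn L (\<lambda>x. grad \<phi>' x - G' (\<phi> x) *\<^sub>R grad \<phi> x) < e"
      using 1 2 tQ by (intro bexI[of _ "\<lambda>x. Q (\<phi> x)"]) simp_all
  qed
qed

text \<open>A bounded derivative makes \<open>G\<close> Lipschitz, so composition is continuous in
  L2. The gradient error splits into \<open>G' (\<phi> n x)\<close> times the gradient error of the
  approximation, and the difference of the values of \<open>G'\<close> times the fixed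
  \<open>g\<close>; the latter tends to 0 by dominated convergence.\<close>

lemma H10g_comp:
  assumes y: "H10g \<Omega> y g" and G: "\<And>t. (G has_real_derivative G' t) (at t)" "continuous_on UNIV G'" "G 0 = 0"
    and B: "\<And>t. \<bar>G' t\<bar> \<le> B"
  shows "H10g \<Omega> (\<lambda>x. G (y x)) (\<lambda>x. G' (y x) *\<^sub>R g x)"
proof -
  have B0: "B \<ge> 0" using B[of 0] by simp
  have contG: "continuous_on UNIV G" using G(1) by (meson DERIV_isCont continuous_at_imp_continuous_on)
  have lip: "\<bar>G s - G t\<bar> \<le> B * \<bar>s - t\<bar>" for s t
    using field_differentiable_bound[of UNIV G G' B s t] G(1) B by simp
  note yD = H10gD[OF y]
  have Gm: "(\<lambda>x. G (y x)) \<in> borel_measurable L" "(\<lambda>x. G' (y x)) \<in> borel_measurable L"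
    using borel_measurable_continuous_on[OF G(2) yD(3)] borel_measurable_continuous_on[OF contG yD(3)] by auto
  have AEB: "AE x in L. \<bar>G' (h x)\<bar> \<le> B" for h using B by simp
  obtain \<phi> where \<phi>: "\<And>n. \<phi> n \<in> test_functions \<Omega>" "(\<lambda>n. L2vn L (\<lambda>x. \<phi> n x - y x)) \<longlonglongrightarrow> 0"
    "(\<lambda>n. L2vn L (\<lambda>x. grad (\<phi> n) x - g x)) \<longlonglongrightarrow> 0" "AE x in L. (\<lambda>n. \<phi> n x) \<longlonglongrightarrow> y x"
    by (rule H10g_seq[OF y]) (rule that; assumption)
  note c = H10g_comp_test[OF \<phi>(1) G]
  note cD = H10gD[OF c]
  have G'\<phi>m: "(\<lambda>x. G' (\<phi> n x)) \<in> borel_measurable L" for n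
    by (rule borel_measurable_continuous_on[OF G(2) smooth_meas[OF test_smooth[OF \<phi>(1)]]])
  have Gy: "(\<lambda>x. G (y x)) \<in> L2v L"
    by (rule L2v_norm_bound(1)[OF Gm(1) L2v_cmult[OF yD(1), of B]]) (use lip[of _ 0] G(3) B0 in \<open>auto simp: abs_mult\<close>)
  have Gg: "(\<lambda>x. G' (y x) *\<^sub>R g x) \<in> L2v L"
    by (rule L2v_mult_bounded(1)[OF yD(2) Gm(2) AEB])
  have l1: "(\<lambda>n. L2vn L (\<lambda>x. G (\<phi> n x) - G (y x))) \<longlonglongrightarrow> 0"
  proof (rule tendsto_sandwich[OF _ _ tendsto_const])
    show "(\<lambda>n. B * L2vn L (\<lambda>x. \<phi> n x - y x)) \<longlonglongrightarrow> 0" using tendsto_mult_left[OF \<phi>(2), of B] by simp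
    have "L2vn L (\<lambda>x. G (\<phi> n x) - G (y x)) \<le> L2vn L (\<lambda>x. B * (\<phi> n x - y x))" for n
      by (rule L2v_norm_bound(2)[OF _ L2v_cmult[OF L2v_diff[OF test_L2v(1)[OF \<phi>(1)] yD(1)]]])
         (use cD(3) Gm lip B0 in \<open>auto simp: abs_mult\<close>)
    thus "\<forall>\<^sub>F n in sequentially. L2vn L (\<lambda>x. G (\<phi> n x) - G (y x)) \<le> B * L2vn L (\<lambda>x. \<phi> n x - y x)"
      using B0 by (simp add: L2vn_cmult)
  qed auto
  have l2: "(\<lambda>n. L2vn L (\<lambda>x. G' (\<phi> n x) *\<^sub>R grad (\<phi> n) x - G' (y x) *\<^sub>R g x)) \<longlonglongrightarrow> 0"
  proof (rule tendsto_sandwich[OF _ _ tendsto_const])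
    have "(\<lambda>n. L2vn L (\<lambda>x. (G' (\<phi> n x) - G' (y x)) *\<^sub>R g x)) \<longlonglongrightarrow> 0"
    proof (rule L2vn_dominated)
      show "(\<lambda>x. (2 * B) *\<^sub>R g x) \<in> L2v L" by (rule L2v_scaleR[OF yD(2)])
      show "AE x in L. norm ((G' (\<phi> n x) - G' (y x)) *\<^sub>R g x) \<le> norm ((2 * B) *\<^sub>R g x)" for n
      proof (rule AE_I2)
        fix x
        have "\<bar>G' (\<phi> n x) - G' (y x)\<bar> \<le> 2 * B" using B[of "\<phi> n x"] B[of "y x"] by linarith
        thus "norm ((G' (\<phi> n x) - G' (y x)) *\<^sub>R g x) \<le> norm ((2 * B) *\<^sub>R g x)"
          using B0 by (auto intro!: mult_right_mono)
      qed
      show "AE x in L. (\<lambda>n. (G' (\<phi> n x) - G' (y x)) *\<^sub>R g x) \<longlonglongrightarrow> 0"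
        using \<phi>(4)
      proof eventually_elim
        case (elim x)
        have "isCont G' (y x)" using G(2) by (simp add: continuous_on_eq_continuous_at)
        hence "(\<lambda>n. G' (\<phi> n x)) \<longlonglongrightarrow> G' (y x)" using elim by (rule isCont_tendsto_compose)
        hence "(\<lambda>n. (G' (\<phi> n x) - G' (y x)) *\<^sub>R g x) \<longlonglongrightarrow> (G' (y x) - G' (y x)) *\<^sub>R g x"
          by (intro tendsto_intros)
        thus ?case by simp
      qed
      show "(\<lambda>x. (G' (\<phi> n x) - G' (y x)) *\<^sub>R g x) \<in> borel_measurable L" for n
        using G'\<phi>m[of n] Gm yD by simp
    qed
    thus "(\<lambda>n. B * L2vn L (\<lambda>x. grad (\<phi> n) x - g x) + L2vn L (\<lambda>x. (G' (\<phi> n x) - G' (y x)) *\<^sub>R g x)) \<longlonglongrightarrow> 0"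
      using tendsto_add[OF tendsto_mult_left[OF \<phi>(3), of B]] by fastforce
    have "L2vn L (\<lambda>x. G' (\<phi> n x) *\<^sub>R grad (\<phi> n) x - G' (y x) *\<^sub>R g x)
      \<le> B * L2vn L (\<lambda>x. grad (\<phi> n) x - g x) + L2vn L (\<lambda>x. (G' (\<phi> n x) - G' (y x)) *\<^sub>R g x)" for n
    proof -
      note d = L2v_diff[OF test_L2v(2)[OF \<phi>(1)[of n]] yD(2)]
      have a: "(\<lambda>x. G' (\<phi> n x) *\<^sub>R (grad (\<phi> n) x - g x)) \<in> L2v L" "L2vn L (\<lambda>x. G' (\<phi> n x) *\<^sub>R (grad (\<phi> n) x - g x)) \<le> \<bar>B\<bar> * L2vn L (\<lambda>x. grad (\<phi> n) x - g x)"
        using L2v_mult_bounded[OF d G'\<phi>m AEB] by auto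
      have b: "(\<lambda>x. (G' (\<phi> n x) - G' (y x)) *\<^sub>R g x) \<in> L2v L"
        using L2v_diff[OF L2v_mult_bounded(1)[OF yD(2) G'\<phi>m AEB] Gg] by (simp add: scaleR_diff_left)
      have "L2vn L (\<lambda>x. G' (\<phi> n x) *\<^sub>R grad (\<phi> n) x - G' (y x) *\<^sub>R g x) =
          L2vn L (\<lambda>x. G' (\<phi> n x) *\<^sub>R (grad (\<phi> n) x - g x) + (G' (\<phi> n x) - G' (y x)) *\<^sub>R g x)"
        by (simp add: algebra_simps)
      also have "\<dots> \<le> L2vn L (\<lambda>x. G' (\<phi> n x) *\<^sub>R (grad (\<phi> n) x - g x)) + L2vn L (\<lambda>x. (G' (\<phi> n x) - G' (y x)) *\<^sub>R g x)"
        by (rule L2vn_triangle[OF a(1) b])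
      finally show ?thesis using a(2) B0 by simp
    qed
    thus "\<forall>\<^sub>F n in sequentially. L2vn L (\<lambda>x. G' (\<phi> n x) *\<^sub>R grad (\<phi> n) x - G' (y x) *\<^sub>R g x)
      \<le> B * L2vn L (\<lambda>x. grad (\<phi> n) x - g x) + L2vn L (\<lambda>x. (G' (\<phi> n x) - G' (y x)) *\<^sub>R g x)" by simp
  qed auto
  show ?thesis
  proof (rule H10g_closed[OF Gy Gg])
    fix e :: real assume "e > 0"
    hence "\<forall>\<^sub>F n in sequentially. L2vn L (\<lambda>x. G (\<phi> n x) - G (y x)) < e \<and>
        L2vn L (\<lambda>x. G' (\<phi> n x) *\<^sub>R grad (\<phi> n) x - G' (y x) *\<^sub>R g x) < e"
      using l1 l2 by (intro eventually_conj order_tendstoD) auto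
    then obtain n where "L2vn L (\<lambda>x. G (\<phi> n x) - G (y x)) < e \<and>
        L2vn L (\<lambda>x. G' (\<phi> n x) *\<^sub>R grad (\<phi> n) x - G' (y x) *\<^sub>R g x) < e"
      using eventually_happens by force
    thus "\<exists>z k. H10g \<Omega> z k \<and> L2vn L (\<lambda>x. z x - G (y x)) < e \<and> L2vn L (\<lambda>x. k x - G' (y x) *\<^sub>R g x) < e"
      using c by blast
  qed
qed

text \<open>The derivative of the square is unbounded, so the chain rule is applied to a function
  \<open>G\<close> that continues the square linearly beyond a level \<open>k\<close> above the
  bound of \<open>y\<close>. On the range of \<open>y\<close> the two agree.\<close>

lemma H10g_square:
  assumes y: "H10g \<Omega> y g" and b: "AE x in L. \<bar>y x\<bar> \<le> K"
  shows "H10g \<Omega> (\<lambda>x. (y x)\<^sup>2) (\<lambda>x. (2 * y x) *\<^sub>R g x)"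
proof -
  define k where "k = \<bar>K\<bar> + 1"
  have k: "k > 0" by (simp add: k_def)
  define G where "G t = (if \<bar>t\<bar> \<le> k then t\<^sup>2 else 2 * k * \<bar>t\<bar> - k\<^sup>2)" for t :: real
  define G' where "G' t = 2 * max (- k) (min k t)" for t :: real
  have "(G has_real_derivative G' t) (at t)" for t
  proof -
    consider "\<bar>t\<bar> < k" | "t > k" | "t < - k" | "t = k" | "t = - k" by linarith
    thus ?thesis
    proof cases
      case 1
      have "((\<lambda>t. t\<^sup>2) has_real_derivative G' t) (at t)"
        using 1 by (auto intro!: derivative_eq_intros simp: G'_def)
      moreover have "\<forall>\<^sub>F x in nhds t. G x = x\<^sup>2"
      proof (rule eventually_mono)
        show "\<forall>\<^sub>F x in nhds t. x \<in> {-k<..<k}" using 1 by (intro eventually_nhds_in_open) auto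
      qed (auto simp: G_def)
      ultimately show ?thesis by (subst DERIV_cong_ev[OF refl _ refl])
    next
      case 2
      have "((\<lambda>t. 2 * k * t - k\<^sup>2) has_real_derivative G' t) (at t)"
        using 2 k by (auto intro!: derivative_eq_intros simp: G'_def)
      moreover have "\<forall>\<^sub>F x in nhds t. G x = 2 * k * x - k\<^sup>2"
        using eventually_nhds_in_open[of "{k<..}" t] 2 k by (auto elim!: eventually_mono simp: G_def)
      ultimately show ?thesis by (subst DERIV_cong_ev[OF refl _ refl])
    next
      case 3
      have "((\<lambda>t. 2 * k * (- t) - k\<^sup>2) has_real_derivative G' t) (at t)"
        using 3 k by (auto intro!: derivative_eq_intros simp: G'_def)
      moreover have "\<forall>\<^sub>F x in nhds t. G x = 2 * k * (- x) - k\<^sup>2"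
        using eventually_nhds_in_open[of "{..<-k}" t] 3 k by (auto elim!: eventually_mono simp: G_def)
      ultimately show ?thesis by (subst DERIV_cong_ev[OF refl _ refl])
    next
      case 4
      \<comment> \<open>At the junction the parabola and the tangent line share the slope
        \<open>2 * k\<close>; the two one-sided derivatives are glued on a neighbourhood of the
        point.\<close>
      have "(G has_real_derivative 2 * k) (at t within ({0..k} \<union> {k..}))"
      proof (rule has_field_derivative_Un)
        show "(G has_real_derivative 2 * k) (at t within {0..k})"
          by (rule has_field_derivative_transform_within[where f = "\<lambda>t. t\<^sup>2" and d = 1])
             (use 4 k in \<open>auto intro!: derivative_eq_intros simp: G_def\<close>)
        show "(G has_real_derivative 2 * k) (at t within {k..})"
          by (rule has_field_derivative_transform_within[where f = "\<lambda>t. 2 * k * t - k\<^sup>2" and d = 1])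
             (use 4 k in \<open>auto intro!: derivative_eq_intros simp: G_def power2_eq_square\<close>)
      qed
      moreover have "at t within ({0..k} \<union> {k..}) = at t"
      proof (rule at_within_interior)
        have "{0..k} \<union> {k..} = {0..}" using k by auto
        thus "t \<in> interior ({0..k} \<union> {k..})" using 4 k by simp
      qed
      ultimately show ?thesis using 4 k by (simp add: G'_def)
    next
      case 5
      have "(G has_real_derivative - 2 * k) (at t within ({-k..0} \<union> {..-k}))"
      proof (rule has_field_derivative_Un)
        show "(G has_real_derivative - 2 * k) (at t within {-k..0})"
          by (rule has_field_derivative_transform_within[where f = "\<lambda>t. t\<^sup>2" and d = 1])
             (use 5 k in \<open>auto intro!: derivative_eq_intros simp: G_def\<close>)
        show "(G has_real_derivative - 2 * k) (at t within {..-k})"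
          by (rule has_field_derivative_transform_within[where f = "\<lambda>t. 2 * k * (- t) - k\<^sup>2" and d = 1])
             (use 5 k in \<open>auto intro!: derivative_eq_intros simp: G_def power2_eq_square dest!: antisym\<close>)
      qed
      moreover have "at t within ({-k..0} \<union> {..-k}) = at t"
      proof (rule at_within_interior)
        have "{-k..0} \<union> {..-k} = {..0}" using k by auto
        thus "t \<in> interior ({-k..0} \<union> {..-k})" using 5 k by simp
      qed
      ultimately show ?thesis using 5 k by (simp add: G'_def)
    qed
  qed
  moreover have "continuous_on UNIV G'" unfolding G'_def by (intro continuous_intros)
  moreover have "G 0 = 0" using k by (simp add: G_def)
  moreover have "\<bar>G' t\<bar> \<le> 2 * k" for t using k by (auto simp: G'_def)
  ultimately have h: "H10g \<Omega> (\<lambda>x. G (y x)) (\<lambda>x. G' (y x) *\<^sub>R g x)" by (rule H10g_comp[OF y])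
  show ?thesis
  proof (rule H10g_cong_AE[OF h])
    show "AE x in L. G (y x) = (y x)\<^sup>2" using b by eventually_elim (auto simp: G_def k_def)
    show "AE x in L. G' (y x) *\<^sub>R g x = (2 * y x) *\<^sub>R g x" using b by eventually_elim (auto simp: G'_def k_def)
  qed (use H10gD[OF y] in auto)
qed

text \<open>Polarisation: four times the product is the difference of the squares of sum and
  difference, both of which are bounded by \<open>K + K'\<close>.\<close>

lemma H10g_mult:
  assumes y: "H10g \<Omega> y g" "AE x in L. \<bar>y x\<bar> \<le> K" and z: "H10g \<Omega> z k" "AE x in L. \<bar>z x\<bar> \<le> K'"
  shows "H10g \<Omega> (\<lambda>x. y x * z x) (\<lambda>x. y x *\<^sub>R k x + z x *\<^sub>R g x)"
proof -
  have "AE x in L. \<bar>y x + z x\<bar> \<le> K + K'" "AE x in L. \<bar>y x - z x\<bar> \<le> K + K'"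
    using y(2) z(2) by (eventually_elim, linarith)+
  from H10g_cmult[OF H10g_diff[OF H10g_square[OF H10g_add[OF y(1) z(1)] this(1)] H10g_square[OF H10g_diff[OF y(1) z(1)] this(2)]], of "1/4"]
  have "H10g \<Omega> (\<lambda>x. 1/4 * ((y x + z x)\<^sup>2 - (y x - z x)\<^sup>2))
    (\<lambda>x. (1/4) *\<^sub>R ((2 * (y x + z x)) *\<^sub>R (g x + k x) - (2 * (y x - z x)) *\<^sub>R (g x - k x)))" .
  moreover have "1/4 * ((y x + z x)\<^sup>2 - (y x - z x)\<^sup>2) = y x * z x" for x
    by (simp add: power2_eq_square algebra_simps)
  moreover have "(1/4) *\<^sub>R ((2 * (y x + z x)) *\<^sub>R (g x + k x) - (2 * (y x - z x)) *\<^sub>R (g x - k x)) = y x *\<^sub>R k x + z x *\<^sub>R g x" for x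
    by (rule euclidean_eqI) (simp add: algebra_simps inner_diff_left inner_add_left)
  ultimately show ?thesis by simp
qed

end


section \<open>Existence for monotone Lipschitz nonlinearities\<close>

lemma L2vn_parallelogram:
  assumes f: "f \<in> L2v M" and g: "g \<in> L2v M"
  shows "(L2vn M (\<lambda>x. f x - g x))\<^sup>2 + (L2vn M (\<lambda>x. f x + g x))\<^sup>2 = 2 * (L2vn M f)\<^sup>2 + 2 * (L2vn M g)\<^sup>2"
proof -
  have "(L2vn M (\<lambda>x. f x - g x))\<^sup>2 + (L2vn M (\<lambda>x. f x + g x))\<^sup>2
    = (\<integral>x. (norm (f x - g x))\<^sup>2 + (norm (f x + g x))\<^sup>2 \<partial>M)"
    unfolding L2vn_sq by (intro Bochner_Integration.integral_add[symmetric] L2v_integrable L2v_diff L2v_add f g)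
  also have "\<dots> = (\<integral>x. 2 * (norm (f x))\<^sup>2 + 2 * (norm (g x))\<^sup>2 \<partial>M)"
    by (intro Bochner_Integration.integral_cong refl)
       (simp add: power2_norm_eq_inner inner_add_left inner_add_right inner_diff_left inner_diff_right inner_commute)
  also have "\<dots> = 2 * (L2vn M f)\<^sup>2 + 2 * (L2vn M g)\<^sup>2"
    unfolding L2vn_sq using L2v_integrable[OF f] L2v_integrable[OF g] by simp
  finally show ?thesis .
qed

lemma L2vn_add_scaleR_sq:
  assumes f: "f \<in> L2v M" and g: "g \<in> L2v M"
  shows "(L2vn M (\<lambda>x. a *\<^sub>R f x + b *\<^sub>R g x))\<^sup>2 = a\<^sup>2 * (L2vn M f)\<^sup>2 + 2 * a * b * (\<integral>x. f x \<bullet> g x \<partial>M) + b\<^sup>2 * (L2vn M g)\<^sup>2"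
proof -
  have "(L2vn M (\<lambda>x. a *\<^sub>R f x + b *\<^sub>R g x))\<^sup>2
     = (\<integral>x. a\<^sup>2 * (norm (f x))\<^sup>2 + 2 * a * b * (f x \<bullet> g x) + b\<^sup>2 * (norm (g x))\<^sup>2 \<partial>M)"
    unfolding L2vn_sq
    unfolding power2_norm_eq_inner
    by (intro Bochner_Integration.integral_cong refl)
       (simp add: inner_add_left inner_add_right inner_commute power2_eq_square algebra_simps)
  also have "\<dots> = a\<^sup>2 * (L2vn M f)\<^sup>2 + 2 * a * b * (\<integral>x. f x \<bullet> g x \<partial>M) + b\<^sup>2 * (L2vn M g)\<^sup>2"
    unfolding L2vn_sq using L2v_integrable[OF f] L2v_integrable[OF g] L2v_integrable_inner[OF f g] by simp
  finally show ?thesis .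
qed

text \<open>First-order condition of a quadratic minimisation: for small \<open>t\<close> the linear
  term dominates, so it cannot have a sign.\<close>

lemma linear_term_zero:
  fixes A B :: real
  assumes "\<And>t. 0 \<le> t * A + t\<^sup>2 * B"
  shows "A = 0"
proof (rule ccontr)
  assume A: "A \<noteq> 0"
  \<comment> \<open>Small enough for \<open>r * B < 1\<close>, whatever the sign of
    \<open>B\<close>; the step \<open>- A * r\<close> then goes downhill.\<close>
  define r where "r = 1 / (2 * (\<bar>B\<bar> + 1))"
  define t where "t = - A * r"
  have t: "t * A + t\<^sup>2 * B = (A\<^sup>2 * r) * (r * B - 1)"
    by (simp add: t_def power2_eq_square algebra_simps)
  have "B < 2 * (\<bar>B\<bar> + 1)" by argo
  hence "r * B < 1" by (simp add: r_def pos_divide_less_eq)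
  moreover have "A\<^sup>2 * r > 0" using A by (simp add: r_def)
  ultimately have "t * A + t\<^sup>2 * B < 0" unfolding t by (simp add: mult_pos_neg)
  with assms[of t] show False by simp
qed

context bounded_domain
begin

text \<open>Dirichlet's principle: the energy \<open>E\<close> is minimised over the Sobolev space,
  and the stationarity of the minimiser is the weak equation.\<close>

lemma Riesz_representation:
  fixes f :: "'a \<Rightarrow> real"
  assumes f: "f \<in> L2v L"
  obtains z k where "H10g \<Omega> z k" "\<And>v h. H10g \<Omega> v h \<Longrightarrow> (\<integral>x. k x \<bullet> h x \<partial>L) = (\<integral>x. f x * v x \<partial>L)"
proof -
  obtain C where C: "C > 0" "\<And>y g. H10g \<Omega> y g \<Longrightarrow> L2vn L y \<le> C * L2vn L g" using Poincare by blast
  define E where "E v h = (L2vn L h)\<^sup>2 / 2 - (\<integral>x. f x * v x \<partial>L)" for v :: "'a \<Rightarrow> real" and h :: "'a \<Rightarrow> 'a"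
  define S where "S = {E v h | v h. H10g \<Omega> v h}"
  have H0: "H10g \<Omega> (\<lambda>x. 0) (grad (\<lambda>x. 0))" by (rule test_H10g) simp
  \<comment> \<open>Cauchy-Schwarz, Poincare and Young's inequality let the quadratic part absorb
    the linear part of the energy.\<close>
  have lower: "- ((C * L2vn L f)\<^sup>2 / 2) \<le> E v h" if vh: "H10g \<Omega> v h" for v h
  proof -
    have "(\<integral>x. f x * v x \<partial>L) \<le> L2vn L f * L2vn L v" using L2v_CS_real[OF f H10gD(1)[OF vh]] by simp
    also have "\<dots> \<le> L2vn L f * (C * L2vn L h)" by (intro mult_left_mono C vh) simp
    also have "\<dots> \<le> (C * L2vn L f)\<^sup>2 / 2 + (L2vn L h)\<^sup>2 / 2"
      using zero_le_power2[of "C * L2vn L f - L2vn L h"] by (simp add: power2_diff field_simps)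
    finally show ?thesis by (simp add: E_def)
  qed
  have bdd: "bdd_below S" unfolding S_def bdd_below_def using lower by blast
  have ne: "S \<noteq> {}" unfolding S_def using H0 by blast
  define m where "m = Inf S"
  have m: "m \<le> E v h" if "H10g \<Omega> v h" for v h
    unfolding m_def by (rule cInf_lower[OF _ bdd]) (use that in \<open>auto simp: S_def\<close>)
  have "\<exists>v h. H10g \<Omega> v h \<and> E v h < m + 1 / real (Suc n)" for n
  proof -
    have "Inf S < m + 1 / real (Suc n)" by (simp add: m_def)
    from cInf_lessD[OF ne this] show ?thesis unfolding S_def by blast
  qed
  then obtain V H where VH: "\<And>n. H10g \<Omega> (V n) (H n)" "\<And>n. E (V n) (H n) < m + 1 / real (Suc n)" by metis
  \<comment> \<open>The midpoint of two near-minimisers has energy at least \<open>m\<close>. With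
    the parallelogram identity this leaves no room for the gradients to differ, so the sequence is
    Cauchy.\<close>
  have dist: "(L2vn L (\<lambda>x. H i x - H j x))\<^sup>2 \<le> 4 * (1 / real (Suc i) + 1 / real (Suc j))" for i j
  proof -
    have mid: "H10g \<Omega> (\<lambda>x. (1/2) * (V i x + V j x)) (\<lambda>x. (1/2) *\<^sub>R (H i x + H j x))"
      by (intro H10g_cmult H10g_add VH)
    have "(\<integral>x. f x * ((1/2) * (V i x + V j x)) \<partial>L) = (1/2) * ((\<integral>x. f x * V i x \<partial>L) + (\<integral>x. f x * V j x \<partial>L))"
      using L2v_integrable_mult[OF f H10gD(1)[OF VH(1)[of i]]] L2v_integrable_mult[OF f H10gD(1)[OF VH(1)[of j]]]
      by (simp add: algebra_simps flip: add_divide_distrib)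
    moreover have "(L2vn L (\<lambda>x. (1/2) *\<^sub>R (H i x + H j x)))\<^sup>2 = (L2vn L (\<lambda>x. H i x + H j x))\<^sup>2 / 4"
      unfolding L2vn_scaleR by (simp add: power2_eq_square)
    ultimately have "m \<le> (L2vn L (\<lambda>x. H i x + H j x))\<^sup>2 / 8 - (1/2) * ((\<integral>x. f x * V i x \<partial>L) + (\<integral>x. f x * V j x \<partial>L))"
      using m[OF mid] by (simp add: E_def)
    moreover have "D \<le> 4 * (e1 + e2)" if "m \<le> S / 8 - 1 / 2 * (f1 + f2)" "D + S = 2 * p + 2 * q"
      "p / 2 - f1 < m + e1" "q / 2 - f2 < m + e2" for S D p q f1 f2 e1 e2 :: real
      using that by argo
    ultimately show ?thesis
      using L2vn_parallelogram[OF H10gD(2)[OF VH(1)[of i]] H10gD(2)[OF VH(1)[of j]]] VH(2)[of i] VH(2)[of j]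
      unfolding E_def by blast
  qed
  have cauchyH: "\<exists>N. \<forall>i\<ge>N. \<forall>j\<ge>N. L2vn L (\<lambda>x. H i x - H j x) < e" if e: "e > 0" for e
  proof -
    obtain N where N: "1 / real (Suc N) < e\<^sup>2 / 8" using nat_approx_posE[of "e\<^sup>2 / 8"] e by auto
    have "L2vn L (\<lambda>x. H i x - H j x) < e" if ij: "i \<ge> N" "j \<ge> N" for i j
    proof (rule power2_less_imp_less)
      have "1 / real (Suc i) \<le> 1 / real (Suc N)" "1 / real (Suc j) \<le> 1 / real (Suc N)"
        using ij by (auto intro!: divide_left_mono)
      thus "(L2vn L (\<lambda>x. H i x - H j x))\<^sup>2 < e\<^sup>2" using dist[of i j] N by argo
    qed (use e in simp)
    thus ?thesis by blast
  qed
  obtain z k where zk: "H10g \<Omega> z k" "(\<lambda>n. L2vn L (\<lambda>x. V n x - z x)) \<longlonglongrightarrow> 0" "(\<lambda>n. L2vn L (\<lambda>x. H n x - k x)) \<longlonglongrightarrow> 0"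
    by (rule H10g_complete_grad[OF VH(1) cauchyH])
  have "(\<integral>x. k x \<bullet> h x \<partial>L) = (\<integral>x. f x * v x \<partial>L)" if vh: "H10g \<Omega> v h" for v h
  proof -
    \<comment> \<open>Near-minimality of \<open>V n\<close> gives this inequality up to
      \<open>1 / (n + 1)\<close> for every step \<open>t\<close>; only the linear term depends on
      \<open>n\<close>, and it converges.\<close>
    have "0 \<le> t * ((\<integral>x. k x \<bullet> h x \<partial>L) - (\<integral>x. f x * v x \<partial>L)) + t\<^sup>2 * ((L2vn L h)\<^sup>2 / 2)" for t
    proof -
      have ge: "- (1 / real (Suc n)) \<le> t * ((\<integral>x. H n x \<bullet> h x \<partial>L) - (\<integral>x. f x * v x \<partial>L)) + t\<^sup>2 * ((L2vn L h)\<^sup>2 / 2)" for n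
      proof -
        have "m \<le> E (\<lambda>x. V n x + t * v x) (\<lambda>x. H n x + t *\<^sub>R h x)"
          by (intro m H10g_add H10g_cmult VH vh)
        moreover have "(\<integral>x. f x * (V n x + t * v x) \<partial>L) = (\<integral>x. f x * V n x \<partial>L) + t * (\<integral>x. f x * v x \<partial>L)"
          using L2v_integrable_mult[OF f H10gD(1)[OF VH(1)[of n]]] L2v_integrable_mult[OF f H10gD(1)[OF vh]]
          by (simp add: algebra_simps)
        moreover have "(L2vn L (\<lambda>x. H n x + t *\<^sub>R h x))\<^sup>2 = (L2vn L (H n))\<^sup>2 + 2 * t * (\<integral>x. H n x \<bullet> h x \<partial>L) + t\<^sup>2 * (L2vn L h)\<^sup>2"
          using L2vn_add_scaleR_sq[OF H10gD(2)[OF VH(1)[of n]] H10gD(2)[OF vh], of 1 t] by simp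
        moreover have "- e \<le> t * (I - F) + t\<^sup>2 * (h / 2)" if "m \<le> N / 2 - G" "G = f1 + t * F" "N = p + 2 * t * I + t\<^sup>2 * h"
          "p / 2 - f1 < m + e" for N G F I p h f1 e :: real
        proof -
          have "m \<le> (p + 2 * (t * I) + t\<^sup>2 * h) / 2 - (f1 + t * F)" using that by (simp add: mult.assoc)
          moreover have "t * (I - F) + t\<^sup>2 * (h / 2) = t * I - t * F + (t\<^sup>2 * h) / 2" by (simp add: algebra_simps)
          ultimately show ?thesis using that(4) by argo
        qed
        ultimately show ?thesis using VH(2)[of n] unfolding E_def by blast
      qed
      have "(\<lambda>n. \<integral>x. H n x \<bullet> h x \<partial>L) \<longlonglongrightarrow> (\<integral>x. k x \<bullet> h x \<partial>L)"
        by (intro L2v_integral_tendsto zk(3) H10gD(2)[OF VH(1)] H10gD(2)[OF vh] H10gD(2)[OF zk(1)])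
      hence r: "(\<lambda>n. t * ((\<integral>x. H n x \<bullet> h x \<partial>L) - (\<integral>x. f x * v x \<partial>L)) + t\<^sup>2 * ((L2vn L h)\<^sup>2 / 2))
        \<longlonglongrightarrow> t * ((\<integral>x. k x \<bullet> h x \<partial>L) - (\<integral>x. f x * v x \<partial>L)) + t\<^sup>2 * ((L2vn L h)\<^sup>2 / 2)"
        by (intro tendsto_intros)
      have l: "(\<lambda>n. - (1 / real (Suc n))) \<longlonglongrightarrow> - 0"
        by (intro tendsto_minus LIMSEQ_Suc[OF lim_1_over_n])
      show ?thesis using LIMSEQ_le[OF l r] ge by auto
    qed
    from linear_term_zero[OF this] show ?thesis by simp
  qed
  with zk(1) that show ?thesis by blast
qed

text \<open>Zarantonello's fixed point iteration for a Lipschitz monotone nonlinearity.\<close>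

lemma monotone_Lipschitz_solution:
  fixes f :: "'a \<Rightarrow> real" and b :: "'a \<Rightarrow> real \<Rightarrow> real"
  assumes f: "f \<in> L2v L" and bL: "\<And>y. y \<in> L2v L \<Longrightarrow> (\<lambda>x. b x (y x)) \<in> L2v L"
    and lip: "AE x in L. \<forall>s t. \<bar>b x s - b x t\<bar> \<le> \<Lambda> * \<bar>s - t\<bar>" and \<Lambda>: "\<Lambda> \<ge> 0"
    and mono: "AE x in L. \<forall>s t. 0 \<le> (b x s - b x t) * (s - t)"
  obtains z k where "H10g \<Omega> z k"
    "\<And>v h. H10g \<Omega> v h \<Longrightarrow> (\<integral>x. k x \<bullet> h x \<partial>L) + (\<integral>x. b x (z x) * v x \<partial>L) = (\<integral>x. f x * v x \<partial>L)"
proof -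
  obtain C where C: "C > 0" "\<And>y g. H10g \<Omega> y g \<Longrightarrow> L2vn L y \<le> C * L2vn L g" using Poincare by blast
  have "\<exists>z k. H10g \<Omega> z k \<and> (\<forall>v h. H10g \<Omega> v h \<longrightarrow> (\<integral>x. k x \<bullet> h x \<partial>L) = (\<integral>x. F x * v x \<partial>L))" if "F \<in> L2v L" for F
    by (rule Riesz_representation[OF that]) blast
  then obtain Z K where ZK: "\<And>F. F \<in> L2v L \<Longrightarrow> H10g \<Omega> (Z F) (K F)"
    "\<And>F v h. F \<in> L2v L \<Longrightarrow> H10g \<Omega> v h \<Longrightarrow> (\<integral>x. K F x \<bullet> h x \<partial>L) = (\<integral>x. F x * v x \<partial>L)" by metis
  \<comment> \<open>\<open>S\<close> is the squared Lipschitz constant, in the gradient norm, of the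
    map that sends \<open>y\<close> to the solution with right-hand side \<open>f - b y\<close>. The
    relaxation \<open>t\<close> satisfies \<open>t * (1 + S) = 1\<close>, which turns
    \<open>(1 - t)^2 + t^2 * S\<close> into \<open>1 - t\<close>.\<close>
  define S where "S = (C * (\<Lambda> * C))\<^sup>2"
  define t where "t = 1 / (1 + S)"
  have S0: "S \<ge> 0" by (simp add: S_def)
  have t: "0 < t" "t \<le> 1" "t * (1 + S) = 1" using S0 by (auto simp: t_def)
  define F where "F y x = f x - b x (y x)" for y :: "'a \<Rightarrow> real" and x
  have FL: "F y \<in> L2v L" if "y \<in> L2v L" for y unfolding F_def by (intro L2v_diff f bL that)
  \<comment> \<open>Relaxed iteration on pairs of function and gradient: the linear equation is
    solved with the nonlinearity frozen, and the result is averaged with the old iterate.\<close>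
  define step where "step p = ((\<lambda>x. (1 - t) * fst p x + t * Z (F (fst p)) x), (\<lambda>x. (1 - t) *\<^sub>R snd p x + t *\<^sub>R K (F (fst p)) x))"
    for p :: "('a \<Rightarrow> real) \<times> ('a \<Rightarrow> 'a)"
  define P where "P n = (step ^^ n) ((\<lambda>x. 0), grad (\<lambda>x. 0))" for n
  define y where "y n = fst (P n)" for n
  define g where "g n = snd (P n)" for n
  have y_Suc: "y (Suc n) = (\<lambda>x. (1 - t) * y n x + t * Z (F (y n)) x)"
    and g_Suc: "g (Suc n) = (\<lambda>x. (1 - t) *\<^sub>R g n x + t *\<^sub>R K (F (y n)) x)" for n
    by (simp_all add: y_def g_def P_def step_def)
  have yg: "H10g \<Omega> (y n) (g n)" for n
  proof (induction n)
    case 0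
    have "H10g \<Omega> (\<lambda>x. 0) (grad (\<lambda>x. 0))" by (rule test_H10g) simp
    thus ?case by (simp add: y_def g_def P_def)
  next
    case (Suc n)
    show ?case unfolding y_Suc g_Suc
      by (intro H10g_add H10g_cmult Suc ZK FL H10gD(1)[OF Suc])
  qed
  note yL = H10gD(1)[OF yg] and gL = H10gD(2)[OF yg]
  have contr: "(L2vn L (\<lambda>x. g (Suc (Suc n)) x - g (Suc n) x))\<^sup>2 \<le> (1 - t) * (L2vn L (\<lambda>x. g (Suc n) x - g n x))\<^sup>2" for n
  proof -
    define u where "u x = y (Suc n) x - y n x" for x
    define d where "d x = g (Suc n) x - g n x" for x
    define U where "U x = Z (F (y (Suc n))) x - Z (F (y n)) x" for x
    define D where "D x = K (F (y (Suc n))) x - K (F (y n)) x" for x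
    have ud: "H10g \<Omega> u d" unfolding u_def d_def by (intro H10g_diff yg)
    have UD: "H10g \<Omega> U D" unfolding U_def D_def by (intro H10g_diff ZK FL yL)
    define \<beta> where "\<beta> x = b x (y (Suc n) x) - b x (y n x)" for x
    have \<beta>L: "\<beta> \<in> L2v L" unfolding \<beta>_def by (intro L2v_diff bL yL)
    have \<beta>le: "L2vn L \<beta> \<le> \<Lambda> * L2vn L u"
    proof -
      have "L2vn L \<beta> \<le> L2vn L (\<lambda>x. \<Lambda> * u x)"
        by (rule L2v_norm_bound(2)[OF L2v_meas[OF \<beta>L] L2v_cmult[OF H10gD(1)[OF ud]]])
           (use lip \<Lambda> in \<open>auto simp: \<beta>_def u_def abs_mult\<close>)
      thus ?thesis using \<Lambda> by (simp add: L2vn_cmult)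
    qed
    have D: "(\<integral>x. D x \<bullet> h x \<partial>L) = - (\<integral>x. \<beta> x * v x \<partial>L)" if vh: "H10g \<Omega> v h" for v h
    proof -
      have "(\<integral>x. D x \<bullet> h x \<partial>L) = (\<integral>x. K (F (y (Suc n))) x \<bullet> h x \<partial>L) - (\<integral>x. K (F (y n)) x \<bullet> h x \<partial>L)"
        unfolding D_def inner_diff_left
        by (intro Bochner_Integration.integral_diff L2v_integrable_inner H10gD(2)[OF ZK(1)] FL yL H10gD(2)[OF vh])
      also have "\<dots> = (\<integral>x. F (y (Suc n)) x * v x \<partial>L) - (\<integral>x. F (y n) x * v x \<partial>L)"
        by (simp add: ZK(2)[OF FL[OF yL] vh])
      also have "\<dots> = (\<integral>x. F (y (Suc n)) x * v x - F (y n) x * v x \<partial>L)"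
        by (intro Bochner_Integration.integral_diff[symmetric] L2v_integrable_mult FL yL H10gD(1)[OF vh])
      also have "\<dots> = (\<integral>x. - (\<beta> x * v x) \<partial>L)"
        by (intro Bochner_Integration.integral_cong refl) (simp add: F_def \<beta>_def algebra_simps)
      finally show ?thesis by simp
    qed
    have "(L2vn L D)\<^sup>2 = (\<integral>x. D x \<bullet> D x \<partial>L)" by (simp add: L2vn_sq power2_norm_eq_inner)
    also have "\<dots> \<le> \<bar>\<integral>x. \<beta> x * U x \<partial>L\<bar>" unfolding D[OF UD] by simp
    also have "\<dots> \<le> L2vn L \<beta> * L2vn L U" by (rule L2v_CS_real[OF \<beta>L H10gD(1)[OF UD]])
    also have "\<dots> \<le> (\<Lambda> * (C * L2vn L d)) * (C * L2vn L D)"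
      by (intro mult_mono order_trans[OF \<beta>le] mult_left_mono C ud UD \<Lambda>) (use C \<Lambda> in auto)
    finally have "L2vn L D * L2vn L D \<le> (C * (\<Lambda> * C) * L2vn L d) * L2vn L D" by (simp add: power2_eq_square algebra_simps)
    hence "L2vn L D \<le> C * (\<Lambda> * C) * L2vn L d"
      using L2vn_nonneg[of L D] C \<Lambda> by (cases "L2vn L D = 0") (auto simp: mult_le_cancel_right)
    hence Dle: "(L2vn L D)\<^sup>2 \<le> S * (L2vn L d)\<^sup>2"
      unfolding S_def power_mult_distrib[symmetric] by (intro power_mono) auto
    \<comment> \<open>Monotonicity enters here: it makes the cross term in the expanded square
      nonpositive, so a large Lipschitz constant does not destroy the contraction.\<close>
    have "0 \<le> (\<integral>x. \<beta> x * u x \<partial>L)"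
      by (rule integral_nonneg_AE) (use mono in \<open>auto simp: \<beta>_def u_def\<close>)
    hence dD: "(\<integral>x. d x \<bullet> D x \<partial>L) \<le> 0" using D[OF ud] by (simp add: inner_commute)
    have "(\<lambda>x. g (Suc (Suc n)) x - g (Suc n) x) = (\<lambda>x. (1 - t) *\<^sub>R d x + t *\<^sub>R D x)"
      unfolding g_Suc[of "Suc n"] by (rule ext, subst (2) g_Suc) (simp add: d_def D_def algebra_simps)
    hence "(L2vn L (\<lambda>x. g (Suc (Suc n)) x - g (Suc n) x))\<^sup>2
      = (1 - t)\<^sup>2 * (L2vn L d)\<^sup>2 + 2 * (1 - t) * t * (\<integral>x. d x \<bullet> D x \<partial>L) + t\<^sup>2 * (L2vn L D)\<^sup>2"
      by (simp add: L2vn_add_scaleR_sq[OF H10gD(2)[OF ud] H10gD(2)[OF UD]])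
    also have "\<dots> \<le> (1 - t)\<^sup>2 * (L2vn L d)\<^sup>2 + 0 + t\<^sup>2 * (S * (L2vn L d)\<^sup>2)"
      using dD t Dle by (intro add_mono mult_left_mono mult_nonneg_nonpos) auto
    also have "\<dots> = (1 - 2 * t + t * (t * (1 + S))) * (L2vn L d)\<^sup>2" by (simp add: power2_eq_square algebra_simps)
    also have "\<dots> = (1 - t) * (L2vn L d)\<^sup>2" unfolding t(3) by simp
    finally show ?thesis by (simp add: d_def[abs_def])
  qed
  define \<kappa> where "\<kappa> = sqrt (1 - t)"
  have \<kappa>: "0 \<le> \<kappa>" "\<kappa> < 1" using t by (auto simp: \<kappa>_def)
  define c where "c = L2vn L (\<lambda>x. g 1 x - g 0 x)"
  have geo: "L2vn L (\<lambda>x. g (Suc n) x - g n x) \<le> \<kappa> ^ n * c" for n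
  proof (induction n)
    case (Suc n)
    have "L2vn L (\<lambda>x. g (Suc (Suc n)) x - g (Suc n) x) \<le> sqrt ((1 - t) * (L2vn L (\<lambda>x. g (Suc n) x - g n x))\<^sup>2)"
      by (rule real_le_rsqrt[OF contr])
    also have "\<dots> = \<kappa> * L2vn L (\<lambda>x. g (Suc n) x - g n x)" by (simp add: \<kappa>_def real_sqrt_mult)
    also have "\<dots> \<le> \<kappa> * (\<kappa> ^ n * c)" by (intro mult_left_mono Suc \<kappa>)
    finally show ?case by simp
  qed (simp add: c_def)
  have geo2: "L2vn L (\<lambda>x. g (n + i) x - g n x) \<le> \<kappa> ^ n * c * (1 - \<kappa> ^ i) / (1 - \<kappa>)" for n i
  proof (induction i)
    case (Suc i)
    have "L2vn L (\<lambda>x. g (n + Suc i) x - g n x) \<le> L2vn L (\<lambda>x. g (Suc (n + i)) x - g (n + i) x) + L2vn L (\<lambda>x. g (n + i) x - g n x)"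
      using L2vn_triangle_diff[OF gL gL gL] by simp
    also have "\<dots> \<le> \<kappa> ^ (n + i) * c + \<kappa> ^ n * c * (1 - \<kappa> ^ i) / (1 - \<kappa>)"
      by (intro add_mono geo Suc)
    also have "\<dots> = \<kappa> ^ n * c * (1 - \<kappa> ^ Suc i) / (1 - \<kappa>)" using \<kappa> by (simp add: field_simps power_add)
    finally show ?case .
  qed (simp add: L2vn_def)
  have c0: "c \<ge> 0" by (simp add: c_def)
  have geo3: "L2vn L (\<lambda>x. g m x - g n x) \<le> \<kappa> ^ n * c / (1 - \<kappa>)" if mn: "n \<le> m" for m n
  proof -
    have "L2vn L (\<lambda>x. g m x - g n x) \<le> \<kappa> ^ n * c * (1 - \<kappa> ^ (m - n)) / (1 - \<kappa>)" using geo2[of n "m - n"] mn by simp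
    also have "\<dots> \<le> \<kappa> ^ n * c * 1 / (1 - \<kappa>)"
      using \<kappa> c0 by (intro divide_right_mono mult_left_mono) auto
    finally show ?thesis by simp
  qed
  have cauchyg: "\<exists>N. \<forall>m\<ge>N. \<forall>n\<ge>N. L2vn L (\<lambda>x. g m x - g n x) < e" if e: "e > 0" for e
  proof -
    have "(\<lambda>n. \<kappa> ^ n * (c / (1 - \<kappa>))) \<longlonglongrightarrow> 0 * (c / (1 - \<kappa>))" using \<kappa> by (intro tendsto_mult_right LIMSEQ_realpow_zero) auto
    hence "\<forall>\<^sub>F n in sequentially. \<kappa> ^ n * (c / (1 - \<kappa>)) < e" using e by (intro order_tendstoD) auto
    then obtain N where N: "\<And>n. n \<ge> N \<Longrightarrow> \<kappa> ^ n * (c / (1 - \<kappa>)) < e" unfolding eventually_sequentially by blast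
    have "L2vn L (\<lambda>x. g m x - g n x) < e" if "m \<ge> N" "n \<ge> N" for m n
      using geo3[of n m] geo3[of m n] N[OF that(1)] N[OF that(2)] L2vn_commute[of L "g m" "g n"] linorder_linear[of n m] by auto
    thus ?thesis by blast
  qed
  obtain z k where zk: "H10g \<Omega> z k" "(\<lambda>n. L2vn L (\<lambda>x. y n x - z x)) \<longlonglongrightarrow> 0" "(\<lambda>n. L2vn L (\<lambda>x. g n x - k x)) \<longlonglongrightarrow> 0"
    by (rule H10g_complete_grad[OF yg cauchyg])
  note zL = H10gD(1)[OF zk(1)]
  have blim: "(\<lambda>n. L2vn L (\<lambda>x. F (y n) x - F z x)) \<longlonglongrightarrow> 0"
  proof (rule tendsto_sandwich[OF _ _ tendsto_const])
    show "(\<lambda>n. \<Lambda> * L2vn L (\<lambda>x. y n x - z x)) \<longlonglongrightarrow> 0" using tendsto_mult_left[OF zk(2), of \<Lambda>] by simp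
    have "L2vn L (\<lambda>x. F (y n) x - F z x) \<le> L2vn L (\<lambda>x. \<Lambda> * (y n x - z x))" for n
    proof (rule L2v_norm_bound(2)[OF _ L2v_cmult[OF L2v_diff[OF yL zL]]])
      show "(\<lambda>x. F (y n) x - F z x) \<in> borel_measurable L" by (intro L2v_meas L2v_diff FL yL zL)
      show "AE x in L. norm (F (y n) x - F z x) \<le> norm (\<Lambda> * (y n x - z x))"
        using lip
      proof eventually_elim
        case (elim x)
        have "\<bar>b x (z x) - b x (y n x)\<bar> \<le> \<Lambda> * \<bar>z x - y n x\<bar>" using elim by blast
        thus ?case using \<Lambda> by (simp add: F_def abs_mult abs_minus_commute)
      qed
    qed
    thus "\<forall>\<^sub>F n in sequentially. L2vn L (\<lambda>x. F (y n) x - F z x) \<le> \<Lambda> * L2vn L (\<lambda>x. y n x - z x)"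
      using \<Lambda> by (simp add: L2vn_cmult)
  qed auto
  have "(\<integral>x. k x \<bullet> h x \<partial>L) + (\<integral>x. b x (z x) * v x \<partial>L) = (\<integral>x. f x * v x \<partial>L)" if vh: "H10g \<Omega> v h" for v h
  proof -
    note hL = H10gD(2)[OF vh] and vL = H10gD(1)[OF vh]
    have 1: "(\<lambda>n. \<integral>x. g n x \<bullet> h x \<partial>L) \<longlonglongrightarrow> (\<integral>x. k x \<bullet> h x \<partial>L)"
      by (intro L2v_integral_tendsto zk(3) gL hL H10gD(2)[OF zk(1)])
    have "(\<lambda>n. \<integral>x. F (y n) x \<bullet> v x \<partial>L) \<longlonglongrightarrow> (\<integral>x. F z x \<bullet> v x \<partial>L)"
      by (intro L2v_integral_tendsto blim FL yL zL vL)
    hence 2: "(\<lambda>n. (1 - t) * (\<integral>x. g n x \<bullet> h x \<partial>L) + t * (\<integral>x. F (y n) x * v x \<partial>L)) \<longlonglongrightarrow>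
      (1 - t) * (\<integral>x. k x \<bullet> h x \<partial>L) + t * (\<integral>x. F z x * v x \<partial>L)"
      by (intro tendsto_intros 1) simp
    have "(\<integral>x. g (Suc n) x \<bullet> h x \<partial>L) = (1 - t) * (\<integral>x. g n x \<bullet> h x \<partial>L) + t * (\<integral>x. F (y n) x * v x \<partial>L)" for n
    proof -
      have "(\<integral>x. g (Suc n) x \<bullet> h x \<partial>L) = (\<integral>x. (1 - t) * (g n x \<bullet> h x) + t * (K (F (y n)) x \<bullet> h x) \<partial>L)"
        by (simp add: g_Suc inner_add_left)
      also have "\<dots> = (1 - t) * (\<integral>x. g n x \<bullet> h x \<partial>L) + t * (\<integral>x. K (F (y n)) x \<bullet> h x \<partial>L)"
        using L2v_integrable_inner[OF gL[of n] hL] L2v_integrable_inner[OF H10gD(2)[OF ZK(1)[OF FL[OF yL[of n]]]] hL] by simp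
      finally show ?thesis by (simp add: ZK(2)[OF FL[OF yL] vh])
    qed
    with LIMSEQ_Suc[OF 1] have "(\<lambda>n. (1 - t) * (\<integral>x. g n x \<bullet> h x \<partial>L) + t * (\<integral>x. F (y n) x * v x \<partial>L)) \<longlonglongrightarrow> (\<integral>x. k x \<bullet> h x \<partial>L)"
      by simp
    \<comment> \<open>The limit of the recursion is the fixed point identity; cancelling
      \<open>1 - t\<close> leaves the weak equation.\<close>
    from LIMSEQ_unique[OF this 2] have "t * (\<integral>x. k x \<bullet> h x \<partial>L) = t * (\<integral>x. F z x * v x \<partial>L)" by (simp add: algebra_simps)
    hence "(\<integral>x. k x \<bullet> h x \<partial>L) = (\<integral>x. F z x * v x \<partial>L)" using t by simp
    also have "\<dots> = (\<integral>x. f x * v x \<partial>L) - (\<integral>x. b x (z x) * v x \<partial>L)"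
      unfolding F_def left_diff_distrib
      by (intro Bochner_Integration.integral_diff L2v_integrable_mult f bL zL vL)
    finally show ?thesis by simp
  qed
  with zk(1) that show ?thesis by blast
qed

end


section \<open>Essential bounds for solutions\<close>

lemma smooth_powr:
  assumes "smooth f" "\<And>x. f x > 0" shows "smooth (\<lambda>x. f x powr a)"
proof -
  \<comment> \<open>The derivatives of a real power: falling factorials times lowered
    powers.\<close>
  define F where "F n t = (\<Prod>j<n. a - real j) * t powr (a - real n)" for n and t :: real
  have "(F n has_real_derivative F (Suc n) t) (at t)" if "t \<in> {0<..}" for n t
    unfolding F_def using that
    by (auto intro!: derivative_eq_intros simp: algebra_simps)
  from smooth_comp[of "{0<..}" F, OF this assms(1), of 0] assms(2) show ?thesis by (simp add: F_def)
qed

lemma smooth_ln: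
  assumes "smooth f" "\<And>x. f x > 0" shows "smooth (\<lambda>x. ln (f x))"
proof -
  \<comment> \<open>From the first derivative on these are the derivatives of the power with
    exponent \<open>- 1\<close>.\<close>
  define F where "F n t = (case n of 0 \<Rightarrow> ln t | Suc m \<Rightarrow> (\<Prod>j<m. - 1 - real j) * t powr (- 1 - real m))" for n and t :: real
  have "(F n has_real_derivative F (Suc n) t) (at t)" if "t \<in> {0<..}" for n t
    unfolding F_def using that
    by (cases n) (auto intro!: derivative_eq_intros simp: algebra_simps powr_minus_divide powr_minus)
  from smooth_comp[of "{0<..}" F, OF this assms(1), of 0] assms(2) show ?thesis by (simp add: F_def)
qed

text \<open>The squared distance to \<open>x0\<close>, regularised by \<open>\<epsilon>^2\<close>.
  It is smooth and positive, so its powers and its logarithm replace the singular fundamental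
  solutions.\<close>

definition qf :: "'a::euclidean_space \<Rightarrow> real \<Rightarrow> 'a \<Rightarrow> real" where
  "qf x0 \<epsilon> x = (x - x0) \<bullet> (x - x0) + \<epsilon>\<^sup>2"

lemma smooth_affine: "smooth (\<lambda>x. (x - x0) \<bullet> i)"
  using smooth_add[OF smooth_inner[of i] smooth_const[of "- (x0 \<bullet> i)"]] by (simp add: inner_diff_left)

lemma pd_affine: "pd (\<lambda>x. (x - x0) \<bullet> i) j x = j \<bullet> i"
  by (rule pd_eqI[of _ "\<lambda>h. h \<bullet> i"]) (auto intro!: derivative_eq_intros)

lemma smooth_qf: "smooth (qf x0 \<epsilon>)"
proof -
  have "qf x0 \<epsilon> = (\<lambda>x. (\<Sum>i\<in>Basis. ((x - x0) \<bullet> i) ^ 2) + \<epsilon>\<^sup>2)"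
    unfolding qf_def by (rule ext, subst euclidean_inner) (simp add: power2_eq_square)
  thus ?thesis by (auto intro!: smooth_add smooth_sum smooth_power smooth_affine)
qed

lemma qf_pos: "\<epsilon> > 0 \<Longrightarrow> qf x0 \<epsilon> x > 0"
  unfolding qf_def by (intro add_nonneg_pos) auto

lemma pd_qf: "pd (qf x0 \<epsilon>) i x = 2 * ((x - x0) \<bullet> i)"
  unfolding qf_def
  by (rule pd_eqI[of _ "\<lambda>h. 2 * ((x - x0) \<bullet> h)", simplified])
     (auto intro!: derivative_eq_intros simp: inner_commute)

lemma laplacian_radial:
  fixes x0 :: "'a::euclidean_space"
  assumes \<epsilon>: "\<epsilon> > 0" and F: "\<And>t. t > 0 \<Longrightarrow> (F has_real_derivative F1 t) (at t)"
      "\<And>t. t > 0 \<Longrightarrow> (F1 has_real_derivative F2 t) (at t)"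
    and s: "smooth (\<lambda>x. F1 (qf x0 \<epsilon> x))"
  shows "laplacian (\<lambda>x. F (qf x0 \<epsilon> x)) x
     = 4 * F2 (qf x0 \<epsilon> x) * ((x - x0) \<bullet> (x - x0)) + 2 * real DIM('a) * F1 (qf x0 \<epsilon> x)"
proof -
  have 1: "pd (\<lambda>x. F (qf x0 \<epsilon> x)) i = (\<lambda>x. F1 (qf x0 \<epsilon> x) * (2 * ((x - x0) \<bullet> i)))" for i
    by (rule ext) (simp add: pd_comp[OF smooth_qf F(1)[OF qf_pos[OF \<epsilon>]]] pd_qf)
  have 2: "pd (pd (\<lambda>x. F (qf x0 \<epsilon> x)) i) i x
      = F1 (qf x0 \<epsilon> x) * 2 + 4 * F2 (qf x0 \<epsilon> x) * (((x - x0) \<bullet> i) * ((x - x0) \<bullet> i))" if "i \<in> Basis" for i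
    unfolding 1 using that
    by (simp add: pd_mult[OF s smooth_mult[OF smooth_const smooth_affine]] pd_cmult[OF smooth_affine] pd_affine
        pd_comp[OF smooth_qf F(2)[OF qf_pos[OF \<epsilon>]]] pd_qf)
  have "laplacian (\<lambda>x. F (qf x0 \<epsilon> x)) x
    = (\<Sum>i\<in>Basis. F1 (qf x0 \<epsilon> x) * 2 + 4 * F2 (qf x0 \<epsilon> x) * (((x - x0) \<bullet> i) * ((x - x0) \<bullet> i)))"
    unfolding laplacian_def by (intro sum.cong refl 2)
  also have "\<dots> = 2 * real DIM('a) * F1 (qf x0 \<epsilon> x)
      + 4 * F2 (qf x0 \<epsilon> x) * (\<Sum>i\<in>Basis. ((x - x0) \<bullet> i) * ((x - x0) \<bullet> i))"
    by (simp add: sum.distrib sum_distrib_left)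
  also have "(\<Sum>i\<in>Basis. ((x - x0) \<bullet> i) * ((x - x0) \<bullet> i)) = (x - x0) \<bullet> (x - x0)"
    by (subst (3) euclidean_inner) simp
  finally show ?thesis by simp
qed

text \<open>With \<open>s = 1 / t\<close> the claim is \<open>s^2 * exp (- s) \<le> 2\<close>, which
  follows from the quadratic term of the exponential series.\<close>

lemma bump_1_bound: "\<bar>bump 1 t\<bar> \<le> 2"
proof (cases "t > 0")
  case True
  define s where "s = 1 / t"
  have s: "s > 0" using True by (simp add: s_def)
  have "s\<^sup>2 / 2 \<le> exp s" using exp_lower_Taylor_quadratic[of s] s by simp
  hence "s\<^sup>2 * exp (- s) \<le> 2" by (simp add: exp_minus field_simps)
  moreover have "bump 1 t = s\<^sup>2 * exp (- s)" using True by (simp add: bump_def s_def power2_eq_square)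
  ultimately show ?thesis by simp
qed (simp add: bump_def)

text \<open>\<open>soft_sign\<close> is the derivative of this regularised absolute value and
  \<open>soft_sign'\<close> the next one. They stand in for absolute value and sign, which the chain
  rule for continuously differentiable functions does not cover. For \<open>\<delta> = 1\<close> the
  square of \<open>soft_sign\<close> is the cut-off \<open>t^2 / (1 + t^2)\<close>.\<close>

definition smooth_abs :: "real \<Rightarrow> real \<Rightarrow> real" where
  "smooth_abs \<delta> t = sqrt (\<delta> + t\<^sup>2)"

definition soft_sign :: "real \<Rightarrow> real \<Rightarrow> real" where
  "soft_sign \<delta> t = t / smooth_abs \<delta> t"

definition soft_sign' :: "real \<Rightarrow> real \<Rightarrow> real" where
  "soft_sign' \<delta> t = \<delta> / (smooth_abs \<delta> t) ^ 3"

context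
  fixes \<delta> :: real
  assumes \<delta>: "\<delta> > 0"
begin

lemma smooth_abs_pos: "smooth_abs \<delta> t > 0"
  and smooth_abs_sq: "(smooth_abs \<delta> t)\<^sup>2 = \<delta> + t\<^sup>2"
  using \<delta> by (auto simp: smooth_abs_def add_pos_nonneg)

lemma smooth_abs_ge: "\<bar>t\<bar> \<le> smooth_abs \<delta> t"
  unfolding smooth_abs_def using \<delta> by (intro real_le_rsqrt) simp

lemma smooth_abs_deriv: "(smooth_abs \<delta> has_real_derivative soft_sign \<delta> t) (at t)"
proof -
  have "\<delta> + t\<^sup>2 > 0" using \<delta> by (simp add: add_pos_nonneg)
  thus ?thesis unfolding smooth_abs_def[abs_def] soft_sign_def by (auto intro!: derivative_eq_intros simp: field_simps)
qed

lemma smooth_abs_cont: "continuous_on UNIV (smooth_abs \<delta>)"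
  using smooth_abs_deriv by (meson DERIV_isCont continuous_at_imp_continuous_on)

lemma soft_sign_deriv: "(soft_sign \<delta> has_real_derivative soft_sign' \<delta> t) (at t)"
proof -
  note N = smooth_abs_pos[of t]
  have "(soft_sign \<delta> has_real_derivative (1 * smooth_abs \<delta> t - t * soft_sign \<delta> t) / (smooth_abs \<delta> t * smooth_abs \<delta> t)) (at t)"
    unfolding soft_sign_def[of \<delta>, abs_def] by (intro DERIV_divide DERIV_ident smooth_abs_deriv[unfolded soft_sign_def]) (use N in auto)
  also have "(1 * smooth_abs \<delta> t - t * soft_sign \<delta> t) / (smooth_abs \<delta> t * smooth_abs \<delta> t)
      = ((smooth_abs \<delta> t)\<^sup>2 - t\<^sup>2) / (smooth_abs \<delta> t) ^ 3"
    using N by (simp add: soft_sign_def field_simps power2_eq_square power3_eq_cube)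
  finally show ?thesis by (simp add: smooth_abs_sq soft_sign'_def)
qed

lemma soft_sign_cont: "continuous_on UNIV (soft_sign \<delta>)"
  using soft_sign_deriv by (meson DERIV_isCont continuous_at_imp_continuous_on)

lemma soft_sign'_cont: "continuous_on UNIV (soft_sign' \<delta>)"
  unfolding soft_sign'_def[abs_def] using smooth_abs_pos
  by (intro continuous_intros smooth_abs_cont) (auto simp: less_imp_neq[symmetric])

lemma soft_sign'_bound: "\<bar>soft_sign' \<delta> t\<bar> \<le> \<delta> / (sqrt \<delta>) ^ 3"
proof -
  have "sqrt \<delta> \<le> smooth_abs \<delta> t" by (simp add: smooth_abs_def)
  thus ?thesis unfolding soft_sign'_def using \<delta> smooth_abs_pos[of t]
    by (auto intro!: divide_left_mono power_mono mult_pos_pos)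
qed

lemma soft_sign_bound: "\<bar>soft_sign \<delta> t\<bar> \<le> 1"
  unfolding soft_sign_def using smooth_abs_ge[of t] smooth_abs_pos[of t] by simp

lemma soft_sign'_nonneg: "soft_sign' \<delta> t \<ge> 0"
  unfolding soft_sign'_def using smooth_abs_pos[of t] \<delta> by simp

text \<open>With \<open>N\<close> the regularised absolute value, the right-hand side is
  \<open>N - \<delta> / N\<close>, and \<open>N \<ge> sqrt \<delta>\<close>. The loss is uniform in
  \<open>t\<close> and vanishes with \<open>\<delta>\<close>.\<close>

lemma abs_diff_soft_sign: "\<bar>t\<bar> - sqrt \<delta> \<le> t * soft_sign \<delta> t"
proof -
  note N = smooth_abs_pos[of t]
  have "t * soft_sign \<delta> t = ((smooth_abs \<delta> t)\<^sup>2 - \<delta>) / smooth_abs \<delta> t"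
    unfolding smooth_abs_sq by (simp add: soft_sign_def power2_eq_square)
  also have "\<dots> = smooth_abs \<delta> t - \<delta> / smooth_abs \<delta> t" using N by (simp add: diff_divide_distrib power2_eq_square)
  also have "\<dots> \<ge> smooth_abs \<delta> t - \<delta> / sqrt \<delta>"
    using \<delta> N by (intro diff_left_mono divide_left_mono) (auto simp: smooth_abs_def)
  finally have "smooth_abs \<delta> t - sqrt \<delta> \<le> t * soft_sign \<delta> t" using \<delta> by (simp add: real_div_sqrt)
  thus ?thesis using smooth_abs_ge[of t] by linarith
qed

end

section \<open>Superharmonic kernels and the sup bound\<close>

context bounded_domain
begin

text \<open>The weight is dominated by the divergence of the field \<open>(x - x0) * q powr a\<close>, cut off outside
  a large ball.\<close>

lemma weight_integral_bound:
  assumes a: "a < 0" "- 1 \<le> a" "real DIM('a) + 2 * a \<ge> 1"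
  obtains K where "K > 0" "\<And>x0 \<epsilon>. x0 \<in> \<Omega> \<Longrightarrow> 0 < \<epsilon> \<Longrightarrow> \<epsilon> \<le> 2 \<Longrightarrow> (\<integral>x. qf x0 \<epsilon> x powr a \<partial>L) \<le> K"
proof -
  obtain R where R: "R > 0" "\<And>x. x \<in> \<Omega> \<Longrightarrow> norm x \<le> R" using bounded_dom bounded_pos by blast
  \<comment> \<open>Points of the domain are at distance at most \<open>2 * R\<close> from each
    other, so on the domain \<open>\<rho>^2\<close> exceeds the squared distance to
    \<open>x0\<close> by at least 1 and the cut-off is at least \<open>exp (- 1)\<close>.\<close>
  define \<rho> where "\<rho> = 2 * R + 1"
  have \<rho>: "\<rho> > 0" using R by (simp add: \<rho>_def)
  define V where "V = measure lborel (cball (0::'a) (R + \<rho>))"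
  \<comment> \<open>\<open>exp 1\<close> undoes the lower bound of the cut-off, 4 is twice the bound
    of \<open>bump 1\<close>, \<open>\<rho>^2 + 4\<close> bounds the regularised squared distance
    where the cut-off lives, and \<open>V\<close> is the volume of a ball containing all
    supports.\<close>
  define K where "K = exp 1 * (4 * (\<rho>\<^sup>2 + 4) powr (a + 1) * V) + 1"
  have V0: "V \<ge> 0" by (simp add: V_def)
  have "K > 0" unfolding K_def using V0 by (intro add_nonneg_pos mult_nonneg_nonneg) auto
  moreover have "(\<integral>x. qf x0 \<epsilon> x powr a \<partial>L) \<le> K" if x0: "x0 \<in> \<Omega>" and \<epsilon>: "0 < \<epsilon>" "\<epsilon> \<le> 2" for x0 \<epsilon>
  proof -
    define r2 where "r2 x = (x - x0) \<bullet> (x - x0)" for x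
    have r20: "r2 x \<ge> 0" for x by (simp add: r2_def)
    have qr: "qf x0 \<epsilon> x = r2 x + \<epsilon>\<^sup>2" for x by (simp add: qf_def r2_def)
    note qpos = qf_pos[OF \<epsilon>(1), of x0]
    define arg where "arg x = (\<rho>\<^sup>2 + \<epsilon>\<^sup>2) + (- 1) * qf x0 \<epsilon> x" for x
    have arg: "arg x = \<rho>\<^sup>2 - r2 x" for x by (simp add: arg_def qr)
    have s_arg: "smooth arg" unfolding arg_def by (intro smooth_add smooth_mult smooth_const smooth_qf)
    have pd_arg: "pd arg i x = - 2 * ((x - x0) \<bullet> i)" for i x
      unfolding arg_def pd_add[OF smooth_const smooth_mult[OF smooth_const smooth_qf]] pd_cmult[OF smooth_qf] pd_qf
      by simp
    define \<zeta> where "\<zeta> x = bump 0 (arg x)" for x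
    define w where "w x = qf x0 \<epsilon> x powr a" for x
    have s\<zeta>: "smooth \<zeta>" unfolding \<zeta>_def by (rule smooth_bump[OF s_arg])
    have sw: "smooth w" unfolding w_def by (rule smooth_powr[OF smooth_qf qpos])
    have pd\<zeta>: "pd \<zeta> i x = bump 1 (arg x) * (- 2 * ((x - x0) \<bullet> i))" for i x
      unfolding \<zeta>_def using pd_comp[OF s_arg bump_deriv[of 0]] pd_arg by simp
    have pdw: "pd w i x = a * qf x0 \<epsilon> x powr (a - 1) * (2 * ((x - x0) \<bullet> i))" for i x
      unfolding w_def
      by (subst pd_comp[OF smooth_qf, of "\<lambda>t. t powr a" "a * qf x0 \<epsilon> x powr (a - 1)"])
         (use qpos in \<open>auto intro!: derivative_eq_intros simp: pd_qf\<close>)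
    have zero: "arg x \<le> 0" if "x \<notin> cball x0 \<rho>" for x
    proof -
      have "\<rho> \<le> norm (x - x0)" using that by (simp add: dist_norm norm_minus_commute)
      hence "\<rho>\<^sup>2 \<le> r2 x" unfolding r2_def power2_norm_eq_inner[symmetric] using \<rho> by (intro power_mono) auto
      thus ?thesis by (simp add: arg)
    qed
    define \<phi> where "\<phi> i x = (w x * ((x - x0) \<bullet> i)) * \<zeta> x" for i x
    have t\<zeta>: "\<zeta> \<in> test_functions UNIV"
    proof -
      have "\<zeta> x = 0" if "x \<notin> cball x0 \<rho>" for x using zero[OF that] by (simp add: \<zeta>_def bump_0)
      thus ?thesis unfolding test_functions_iff using s\<zeta> by (intro conjI exI[of _ "cball x0 \<rho>"]) auto
    qed
    have t\<phi>: "\<phi> i \<in> test_functions UNIV" for i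
      unfolding \<phi>_def by (intro test_mult t\<zeta> smooth_mult sw smooth_affine)
    have tw\<zeta>: "(\<lambda>x. w x * \<zeta> x) \<in> test_functions UNIV" by (intro test_mult t\<zeta> sw)
    have pd\<phi>: "pd (\<phi> i) i x = w x * \<zeta> x + (2 * a * qf x0 \<epsilon> x powr (a - 1) * \<zeta> x - 2 * bump 1 (arg x) * w x) * (((x - x0) \<bullet> i) * ((x - x0) \<bullet> i))"
      if "i \<in> Basis" for i x
      unfolding \<phi>_def pd_mult[OF smooth_mult[OF sw smooth_affine] s\<zeta>] pd_mult[OF sw smooth_affine] pd\<zeta> pdw pd_affine
      using that by (simp add: algebra_simps)
    have sum: "(\<Sum>i\<in>Basis. pd (\<phi> i) i x) = real DIM('a) * (w x * \<zeta> x) + (2 * a * qf x0 \<epsilon> x powr (a - 1) * \<zeta> x - 2 * bump 1 (arg x) * w x) * r2 x" for x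
    proof -
      have "(\<Sum>i\<in>Basis. pd (\<phi> i) i x) = (\<Sum>i\<in>Basis. w x * \<zeta> x + (2 * a * qf x0 \<epsilon> x powr (a - 1) * \<zeta> x - 2 * bump 1 (arg x) * w x) * (((x - x0) \<bullet> i) * ((x - x0) \<bullet> i)))"
        by (intro sum.cong refl pd\<phi>)
      also have "\<dots> = real DIM('a) * (w x * \<zeta> x) + (2 * a * qf x0 \<epsilon> x powr (a - 1) * \<zeta> x - 2 * bump 1 (arg x) * w x) * (\<Sum>i\<in>Basis. ((x - x0) \<bullet> i) * ((x - x0) \<bullet> i))"
        by (simp add: sum.distrib sum_distrib_left)
      also have "(\<Sum>i\<in>Basis. ((x - x0) \<bullet> i) * ((x - x0) \<bullet> i)) = r2 x"
        unfolding r2_def by (subst (3) euclidean_inner) simp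
      finally show ?thesis .
    qed
    have \<zeta>0: "\<zeta> x \<ge> 0" for x unfolding \<zeta>_def by (rule bump_bounds)
    have w0: "w x \<ge> 0" for x by (simp add: w_def)
    define B where "B = 4 * (\<rho>\<^sup>2 + 4) powr (a + 1)"
    \<comment> \<open>The divergence contains the dimension times the weight and a radial term with
      the negative factor \<open>2 * a\<close>. The latter costs at most \<open>- 2 * a\<close>
      copies of the weight, so at least one copy remains; the derivative of the cut-off contributes
      the bounded rest.\<close>
    have ptw: "w x * \<zeta> x \<le> (\<Sum>i\<in>Basis. pd (\<phi> i) i x) + B * indicator (cball x0 \<rho>) x" for x
    proof -
      have qw: "qf x0 \<epsilon> x powr (a - 1) * r2 x \<le> w x"
      proof -
        have "qf x0 \<epsilon> x powr (a - 1) * r2 x \<le> qf x0 \<epsilon> x powr (a - 1) * qf x0 \<epsilon> x"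
          by (intro mult_left_mono) (auto simp: qr)
        also have "\<dots> = w x" unfolding w_def using qpos[of x] powr_add[of "qf x0 \<epsilon> x" "a - 1" 1] by simp
        finally show ?thesis .
      qed
      have "(- 2 * a) * (\<zeta> x * (qf x0 \<epsilon> x powr (a - 1) * r2 x)) \<le> (- 2 * a) * (\<zeta> x * w x)"
        using a \<zeta>0 by (intro mult_left_mono qw) auto
      moreover have "(1 - 2 * a) * (w x * \<zeta> x) \<le> real DIM('a) * (w x * \<zeta> x)"
        using a w0 \<zeta>0 by (intro mult_right_mono) auto
      moreover have "2 * bump 1 (arg x) * w x * r2 x \<le> B * indicator (cball x0 \<rho>) x"
      proof (cases "x \<in> cball x0 \<rho>")
        case True
        have "norm (x - x0) \<le> \<rho>" using True by (simp add: dist_norm norm_minus_commute)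
        hence "r2 x \<le> \<rho>\<^sup>2" unfolding r2_def power2_norm_eq_inner[symmetric] by (intro power_mono) auto
        moreover have "\<epsilon>\<^sup>2 \<le> 2\<^sup>2" using \<epsilon> by (intro power_mono) auto
        ultimately have q: "qf x0 \<epsilon> x \<le> \<rho>\<^sup>2 + 4" by (simp add: qr)
        have "w x * r2 x \<le> w x * qf x0 \<epsilon> x" using w0 by (intro mult_left_mono) (auto simp: qr)
        also have "\<dots> = qf x0 \<epsilon> x powr (a + 1)" unfolding w_def using qpos[of x] powr_add[of "qf x0 \<epsilon> x" a 1] by simp
        also have "\<dots> \<le> (\<rho>\<^sup>2 + 4) powr (a + 1)" using a q qpos[of x] by (intro powr_mono2) auto
        finally have wr: "w x * r2 x \<le> (\<rho>\<^sup>2 + 4) powr (a + 1)" .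
        have "2 * bump 1 (arg x) * w x * r2 x = (2 * bump 1 (arg x)) * (w x * r2 x)" by simp
        also have "\<dots> \<le> 4 * (w x * r2 x)"
          using bump_1_bound[of "arg x"] w0[of x] r20[of x] by (intro mult_right_mono) auto
        also have "\<dots> \<le> B" unfolding B_def using wr by simp
        finally show ?thesis using True by simp
      next
        case False
        thus ?thesis using zero[OF False] by (simp add: bump_def)
      qed
      ultimately show ?thesis unfolding sum by (simp add: algebra_simps)
    qed
    have ballfin: "emeasure lborel (cball x \<rho>') < \<infinity>" for x :: 'a and \<rho>' by (rule emeasure_bounded_finite) simp
    have int_pd: "integrable lborel (\<lambda>x. \<Sum>i\<in>Basis. pd (\<phi> i) i x)"
      by (intro Bochner_Integration.integrable_sum test_integrable[OF test_pd[OF t\<phi>]]) auto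
    have int_ind: "integrable lborel (\<lambda>x. B * indicator (cball x0 \<rho>) x)"
      using ballfin[of x0 \<rho>] by (intro integrable_mult_right integrable_real_indicator) auto
    have "(\<integral>x. w x * \<zeta> x \<partial>lborel) \<le> (\<integral>x. (\<Sum>i\<in>Basis. pd (\<phi> i) i x) + B * indicator (cball x0 \<rho>) x \<partial>lborel)"
      by (intro integral_mono Bochner_Integration.integrable_add int_pd int_ind test_integrable[OF tw\<zeta>] ptw)
    also have "\<dots> = (\<integral>x. (\<Sum>i\<in>Basis. pd (\<phi> i) i x) \<partial>lborel) + (\<integral>x. B * indicator (cball x0 \<rho>) x \<partial>lborel)"
      by (rule Bochner_Integration.integral_add[OF int_pd int_ind])
    also have "(\<integral>x. (\<Sum>i\<in>Basis. pd (\<phi> i) i x) \<partial>lborel) = (\<Sum>i\<in>Basis. \<integral>x. pd (\<phi> i) i x \<partial>lborel)"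
      by (intro Bochner_Integration.integral_sum test_integrable[OF test_pd[OF t\<phi>]]) auto
    also have "\<dots> = 0" by (intro sum.neutral ballI integral_pd_test[OF t\<phi>]) auto
    also have "(\<integral>x. B * indicator (cball x0 \<rho>) x \<partial>lborel) = B * measure lborel (cball x0 \<rho>)" by simp
    also have "\<dots> \<le> B * V"
    proof (intro mult_left_mono)
      have "cball x0 \<rho> \<subseteq> cball 0 (R + \<rho>)" 
      proof
        fix x assume "x \<in> cball x0 \<rho>"
        hence "norm (x - x0) \<le> \<rho>" by (simp add: dist_norm norm_minus_commute)
        thus "x \<in> cball 0 (R + \<rho>)" using R(2)[OF x0] norm_triangle_ineq[of "x - x0" x0] by simp
      qed
      thus "measure lborel (cball x0 \<rho>) \<le> V" unfolding V_def
        using ballfin[of "0::'a" "R + \<rho>"] by (intro measure_mono_fmeasurable) (auto simp: fmeasurable_def)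
    qed (simp add: B_def)
    finally have main: "(\<integral>x. w x * \<zeta> x \<partial>lborel) \<le> B * V" by simp
    have "(\<integral>x. w x \<partial>L) = (\<integral>x. indicator \<Omega> x * w x \<partial>L)"
      by (intro Bochner_Integration.integral_cong refl) simp
    also have "\<dots> = (\<integral>x. indicator \<Omega> x * w x \<partial>lborel)"
      using open_dom smooth_borel[OF sw] by (intro integral_test_on) auto
    also have "\<dots> \<le> (\<integral>x. exp 1 * (w x * \<zeta> x) \<partial>lborel)"
    proof (rule integral_mono')
      show "integrable lborel (\<lambda>x. exp 1 * (w x * \<zeta> x))" by (intro integrable_mult_right test_integrable[OF tw\<zeta>])
      show "indicator \<Omega> x * w x \<le> exp 1 * (w x * \<zeta> x)" for x
      proof (cases "x \<in> \<Omega>")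
        case True
        have "norm (x - x0) \<le> 2 * R" using R(2)[OF True] R(2)[OF x0] norm_triangle_ineq4[of x x0] by simp
        hence "r2 x \<le> (2 * R)\<^sup>2" unfolding r2_def power2_norm_eq_inner[symmetric] by (intro power_mono) auto
        hence "arg x \<ge> 1" unfolding arg \<rho>_def using R by (simp add: power2_eq_square algebra_simps)
        hence "\<zeta> x \<ge> exp (- 1)" by (simp add: \<zeta>_def bump_0)
        hence "1 \<le> exp 1 * \<zeta> x" by (simp add: exp_minus field_simps)
        hence "w x * 1 \<le> w x * (exp 1 * \<zeta> x)" using w0 by (intro mult_left_mono) auto
        thus ?thesis using True by (simp add: algebra_simps)
      qed (use w0 \<zeta>0 in auto)
    qed (use w0 \<zeta>0 in auto)
    also have "\<dots> = exp 1 * (\<integral>x. w x * \<zeta> x \<partial>lborel)" by simp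
    also have "\<dots> \<le> exp 1 * (B * V)" by (intro mult_left_mono main) auto
    also have "\<dots> \<le> K" by (simp add: K_def B_def)
    finally show ?thesis by (simp add: w_def)
  qed
  ultimately show ?thesis using that by blast
qed

text \<open>The kernels are \<open>q powr (- 1/2)\<close> in three dimensions and
  \<open>1/2 * ln (D / q)\<close> in two, with \<open>q\<close> the regularised squared distance. Up
  to sign their Laplacians are \<open>3 * \<epsilon>^2 * q powr (- 5/2)\<close> and
  \<open>2 * \<epsilon>^2 / q^2\<close>: approximate point masses of height
  \<open>\<epsilon>^(-d)\<close> on the ball of radius \<open>\<epsilon>\<close>, where
  \<open>q \<le> 2 * \<epsilon>^2\<close>. The L2 norms stay bounded because the fundamental
  solution is square integrable in these dimensions.\<close>

lemma superharmonic_kernels: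
  assumes dim: "DIM('a) \<in> {2, 3}"
  obtains K c where "K > 0" "c > 0" "\<And>x0 \<epsilon>. x0 \<in> \<Omega> \<Longrightarrow> 0 < \<epsilon> \<Longrightarrow> \<epsilon> \<le> 2 \<Longrightarrow>
    \<exists>\<psi>. smooth \<psi> \<and> (\<forall>x\<in>\<Omega>. 0 \<le> \<psi> x \<and> laplacian \<psi> x \<le> 0 \<and>
      (norm (x - x0) \<le> \<epsilon> \<longrightarrow> c / \<epsilon> ^ DIM('a) \<le> - laplacian \<psi> x)) \<and> L2vn L \<psi> \<le> K"
proof (cases "DIM('a) = 3")
  case True
  obtain K where K: "K > 0" "\<And>x0 \<epsilon>. x0 \<in> \<Omega> \<Longrightarrow> 0 < \<epsilon> \<Longrightarrow> \<epsilon> \<le> 2 \<Longrightarrow> (\<integral>x. qf x0 \<epsilon> x powr (- 1) \<partial>L) \<le> K"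
    by (rule weight_integral_bound[of "-1"]) (use True in auto)
  have "\<exists>\<psi>. smooth \<psi> \<and> (\<forall>x\<in>\<Omega>. 0 \<le> \<psi> x \<and> laplacian \<psi> x \<le> 0 \<and>
      (norm (x - x0) \<le> \<epsilon> \<longrightarrow> 3 * 2 powr (- 5/2) / \<epsilon> ^ DIM('a) \<le> - laplacian \<psi> x)) \<and> L2vn L \<psi> \<le> sqrt K"
    if x0: "x0 \<in> \<Omega>" and \<epsilon>: "0 < \<epsilon>" "\<epsilon> \<le> 2" for x0 \<epsilon>
  proof -
    note qpos = qf_pos[OF \<epsilon>(1), of x0]
    define \<psi> where "\<psi> x = qf x0 \<epsilon> x powr (- 1/2)" for x
    have lap: "laplacian \<psi> x = - (3 * \<epsilon>\<^sup>2 * qf x0 \<epsilon> x powr (- 5/2))" for x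
    proof -
      have "laplacian \<psi> x = 4 * (3/4 * qf x0 \<epsilon> x powr (- 5/2)) * ((x - x0) \<bullet> (x - x0))
          + 2 * real DIM('a) * (- 1/2 * qf x0 \<epsilon> x powr (- 3/2))"
        unfolding \<psi>_def
      proof (rule laplacian_radial[OF \<epsilon>(1)])
        show "((\<lambda>t. t powr (- 1/2)) has_real_derivative - 1/2 * t powr (- 3/2)) (at t)" if "t > 0" for t :: real
          using has_real_derivative_powr[OF that, of "- 1/2"] by simp
        show "((\<lambda>t. - 1/2 * t powr (- 3/2)) has_real_derivative 3/4 * t powr (- 5/2)) (at t)" if "t > 0" for t :: real
          using DERIV_cmult[OF has_real_derivative_powr[OF that, of "- 3/2"], of "- 1/2"] by simp
        show "smooth (\<lambda>x. - 1 / 2 * qf x0 \<epsilon> x powr (- 3 / 2))"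
          by (intro smooth_mult smooth_const smooth_powr smooth_qf qpos)
      qed
      also have "qf x0 \<epsilon> x powr (- 3/2) = qf x0 \<epsilon> x powr (- 5/2) * ((x - x0) \<bullet> (x - x0) + \<epsilon>\<^sup>2)"
        using powr_add[of "qf x0 \<epsilon> x" "- 5/2" 1] qpos[of x] by (simp add: qf_def)
      finally show ?thesis unfolding True by (simp add: algebra_simps)
    qed
    have "smooth \<psi>" unfolding \<psi>_def by (intro smooth_powr smooth_qf qpos)
    moreover have "3 * 2 powr (- 5/2) / \<epsilon> ^ DIM('a) \<le> - laplacian \<psi> x" if x: "norm (x - x0) \<le> \<epsilon>" for x
    proof -
      have "(norm (x - x0))\<^sup>2 \<le> \<epsilon>\<^sup>2" using x by (intro power_mono) auto
      hence q: "qf x0 \<epsilon> x \<le> 2 * \<epsilon>\<^sup>2" by (simp add: qf_def power2_norm_eq_inner)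
      have "(2 * \<epsilon>\<^sup>2) powr (- 5/2) = 2 powr (- 5/2) * \<epsilon> powr (- 5)"
        using \<epsilon> by (simp add: powr_mult powr_powr flip: powr_numeral)
      also have "\<epsilon> powr (- 5) = 1 / \<epsilon> ^ 5" using \<epsilon> by (simp add: powr_minus_divide)
      finally have e: "(2 * \<epsilon>\<^sup>2) powr (- 5/2) = 2 powr (- 5/2) / \<epsilon> ^ 5" by simp
      have "3 * 2 powr (- 5/2) / \<epsilon> ^ 3 = 3 * \<epsilon>\<^sup>2 * (2 * \<epsilon>\<^sup>2) powr (- 5/2)"
        unfolding e using \<epsilon> by (simp add: field_simps power_numeral_reduce)
      also have "\<dots> \<le> 3 * \<epsilon>\<^sup>2 * qf x0 \<epsilon> x powr (- 5/2)"
        using q qpos[of x] by (intro mult_left_mono powr_mono2') auto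
      finally show ?thesis unfolding True lap by simp
    qed
    moreover have "L2vn L \<psi> \<le> sqrt K"
    proof -
      have "(norm (\<psi> x))\<^sup>2 = qf x0 \<epsilon> x powr (- 1)" for x
        unfolding \<psi>_def using qpos[of x] by (simp add: power2_eq_square flip: powr_add)
      thus ?thesis unfolding L2vn_def using K(2)[OF x0 \<epsilon>] by simp
    qed
    ultimately show ?thesis using lap by (intro exI[of _ \<psi>]) (auto simp: \<psi>_def)
  qed
  with K that[of "sqrt K" "3 * 2 powr (- 5/2)"] show ?thesis by simp
next
  case False
  hence d2: "DIM('a) = 2" using dim by auto
  obtain K where K: "K > 0" "\<And>x0 \<epsilon>. x0 \<in> \<Omega> \<Longrightarrow> 0 < \<epsilon> \<Longrightarrow> \<epsilon> \<le> 2 \<Longrightarrow> (\<integral>x. qf x0 \<epsilon> x powr (- 1/2) \<partial>L) \<le> K"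
    by (rule weight_integral_bound[of "- 1/2"]) (use d2 in auto)
  obtain R where R: "R > 0" "\<And>x. x \<in> \<Omega> \<Longrightarrow> norm x \<le> R" using bounded_dom bounded_pos by blast
  \<comment> \<open>An upper bound for \<open>qf\<close> on the domain when
    \<open>\<epsilon> \<le> 2\<close>; it keeps the logarithmic kernel nonnegative.\<close>
  define D where "D = (2 * R)\<^sup>2 + 4"
  have D: "D > 0" by (simp add: D_def add_nonneg_pos)
  have "\<exists>\<psi>. smooth \<psi> \<and> (\<forall>x\<in>\<Omega>. 0 \<le> \<psi> x \<and> laplacian \<psi> x \<le> 0 \<and>
      (norm (x - x0) \<le> \<epsilon> \<longrightarrow> (1/2) / \<epsilon> ^ DIM('a) \<le> - laplacian \<psi> x)) \<and> L2vn L \<psi> \<le> sqrt (4 * D powr (1/2) * K)"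
    if x0: "x0 \<in> \<Omega>" and \<epsilon>: "0 < \<epsilon>" "\<epsilon> \<le> 2" for x0 \<epsilon>
  proof -
    note qpos = qf_pos[OF \<epsilon>(1), of x0]
    have qD: "qf x0 \<epsilon> x \<le> D" if "x \<in> \<Omega>" for x
    proof -
      have "norm (x - x0) \<le> 2 * R" using R(2)[OF that] R(2)[OF x0] norm_triangle_ineq4[of x x0] by simp
      hence "(norm (x - x0))\<^sup>2 \<le> (2 * R)\<^sup>2" by (intro power_mono) auto
      moreover have "\<epsilon>\<^sup>2 \<le> 2\<^sup>2" using \<epsilon> by (intro power_mono) auto
      ultimately show ?thesis by (simp add: qf_def D_def power2_norm_eq_inner)
    qed
    define \<psi> where "\<psi> x = 1/2 * (ln D + (- 1) * ln (qf x0 \<epsilon> x))" for x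
    have lap: "laplacian \<psi> x = - (2 * \<epsilon>\<^sup>2 / (qf x0 \<epsilon> x)\<^sup>2)" for x
    proof -
      have "laplacian \<psi> x = 4 * (1 / (2 * (qf x0 \<epsilon> x)\<^sup>2)) * ((x - x0) \<bullet> (x - x0))
          + 2 * real DIM('a) * (- 1/2 * qf x0 \<epsilon> x powr (- 1))"
        unfolding \<psi>_def
      proof (rule laplacian_radial[OF \<epsilon>(1)])
        show "((\<lambda>t. 1/2 * (ln D + (- 1) * ln t)) has_real_derivative - 1/2 * t powr (- 1)) (at t)" if "t > 0" for t :: real
          using that by (auto intro!: derivative_eq_intros simp: powr_minus_divide)
        show "((\<lambda>t. - 1/2 * t powr (- 1)) has_real_derivative 1 / (2 * t\<^sup>2)) (at t)" if "t > 0" for t :: real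
          using DERIV_cmult[OF has_real_derivative_powr[OF that, of "- 1"], of "- 1/2"] that
          by (simp add: powr_minus_divide powr_numeral)
        show "smooth (\<lambda>x. - 1 / 2 * qf x0 \<epsilon> x powr (- 1))"
          by (intro smooth_mult smooth_const smooth_powr smooth_qf qpos)
      qed
      also have "\<dots> = 2 * ((x - x0) \<bullet> (x - x0)) / (qf x0 \<epsilon> x)\<^sup>2 - 2 * qf x0 \<epsilon> x / (qf x0 \<epsilon> x)\<^sup>2"
        unfolding d2 using qpos[of x] by (simp add: powr_minus_divide power2_eq_square)
      also have "\<dots> = - (2 * \<epsilon>\<^sup>2 / (qf x0 \<epsilon> x)\<^sup>2)"
        unfolding diff_divide_distrib[symmetric] by (simp add: qf_def algebra_simps)
      finally show ?thesis .
    qed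
    have s: "smooth \<psi>" unfolding \<psi>_def by (intro smooth_mult smooth_add smooth_const smooth_ln smooth_qf qpos)
    moreover have \<psi>0: "0 \<le> \<psi> x" if "x \<in> \<Omega>" for x
      unfolding \<psi>_def using qD[OF that] qpos[of x] D by simp
    moreover have "(1/2) / \<epsilon> ^ DIM('a) \<le> - laplacian \<psi> x" if x: "norm (x - x0) \<le> \<epsilon>" for x
    proof -
      have "(norm (x - x0))\<^sup>2 \<le> \<epsilon>\<^sup>2" using x by (intro power_mono) auto
      hence q: "qf x0 \<epsilon> x \<le> 2 * \<epsilon>\<^sup>2" by (simp add: qf_def power2_norm_eq_inner)
      have "(1/2) / \<epsilon> ^ 2 = 2 * \<epsilon>\<^sup>2 / (2 * \<epsilon>\<^sup>2)\<^sup>2" using \<epsilon> by (simp add: power2_eq_square)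
      also have "\<dots> \<le> 2 * \<epsilon>\<^sup>2 / (qf x0 \<epsilon> x)\<^sup>2"
        using q qpos[of x] by (intro divide_left_mono power_mono mult_pos_pos) auto
      finally show ?thesis unfolding d2 lap by simp
    qed
    moreover have "L2vn L \<psi> \<le> sqrt (4 * D powr (1/2) * K)"
      unfolding L2vn_def
    proof (rule real_sqrt_le_mono)
      have "(\<integral>x. (norm (\<psi> x))\<^sup>2 \<partial>L) \<le> (\<integral>x. 4 * D powr (1/2) * qf x0 \<epsilon> x powr (- 1/2) \<partial>L)"
      proof (rule integral_mono)
        show "integrable L (\<lambda>x. (norm (\<psi> x))\<^sup>2)" by (intro L2v_integrable smooth_L2v s)
        show "integrable L (\<lambda>x. 4 * D powr (1/2) * qf x0 \<epsilon> x powr (- 1/2))"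
          by (intro L2v_integrable_norm(3)[OF finite_L] smooth_L2v smooth_mult smooth_const smooth_powr smooth_qf qpos)
        fix x assume "x \<in> space L"
        hence x: "x \<in> \<Omega>" by simp
        \<comment> \<open>The logarithm is bounded by a fourth root, so the squared kernel is
          dominated by \<open>qf powr (- 1/2)\<close>, the strongest weight that the integral bound
          admits in two dimensions.\<close>
        define y where "y = D / qf x0 \<epsilon> x"
        have y: "y > 0" using D qpos[of x] by (simp add: y_def)
        have "\<psi> x = 1/2 * ln y" unfolding \<psi>_def y_def using D qpos[of x] by (simp add: ln_div)
        also have "ln y = 4 * ln (y powr (1/4))" using y by (simp add: ln_powr)
        finally have "\<psi> x = 2 * ln (y powr (1/4))" by simp
        also have "\<dots> \<le> 2 * y powr (1/4)" using ln_bound[of "y powr (1/4)"] y by simp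
        finally have "(norm (\<psi> x))\<^sup>2 \<le> (2 * y powr (1/4))\<^sup>2" using \<psi>0[OF x] by (intro power_mono) auto
        also have "\<dots> = 4 * y powr (1/2)" using y by (simp add: power_mult_distrib power2_eq_square flip: powr_add)
        also have "y powr (1/2) = D powr (1/2) * qf x0 \<epsilon> x powr (- 1/2)"
          unfolding y_def using D qpos[of x] by (simp add: powr_divide powr_minus_divide)
        finally show "(norm (\<psi> x))\<^sup>2 \<le> 4 * D powr (1/2) * qf x0 \<epsilon> x powr (- 1/2)" by simp
      qed
      also have "\<dots> = 4 * D powr (1/2) * (\<integral>x. qf x0 \<epsilon> x powr (- 1/2) \<partial>L)" by simp
      also have "\<dots> \<le> 4 * D powr (1/2) * K" using K(2)[OF x0 \<epsilon>] by (intro mult_left_mono) auto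
      finally show "(\<integral>x. (norm (\<psi> x))\<^sup>2 \<partial>L) \<le> 4 * D powr (1/2) * K" .
    qed
    ultimately show ?thesis using lap by (intro exI[of _ \<psi>]) auto
  qed
  with K D that[of "sqrt (4 * D powr (1/2) * K)" "1/2"] show ?thesis by simp
qed

text \<open>Here \<open>c\<close> is the whole zero-order term at the solution, not a coefficient;
  all that is asked of it is to have the sign of \<open>z\<close>. One constant therefore serves the
  nonlinear state equation and every adjoint equation, however large its coefficient.\<close>

definition Linf_const :: "real \<Rightarrow> bool" where
  "Linf_const C \<longleftrightarrow> C > 0 \<and> (\<forall>z k c g. H10g \<Omega> z k \<longrightarrow> g \<in> L2v L \<longrightarrow> (AE x in L. 0 \<le> c x * z x) \<longrightarrow>
     (\<forall>w h. H10g \<Omega> w h \<longrightarrow> (\<exists>B. AE x in L. \<bar>w x\<bar> \<le> B) \<longrightarrow>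
        (\<integral>x. k x \<bullet> h x \<partial>L) + (\<integral>x. c x * w x \<partial>L) = (\<integral>x. g x * w x \<partial>L)) \<longrightarrow>
     (AE x in L. \<bar>z x\<bar> \<le> C * L2vn L g))"

text \<open>Testing with \<open>\<psi> z / sqrt (\<delta> + z\<^sup>2)\<close> shows that \<open>\<bar>z\<bar>\<close> is a subsolution, which is then tested
  with regularised fundamental solutions \<open>\<psi>\<close>.\<close>

lemma subsolution_estimate:
  assumes z: "H10g \<Omega> z k" and g: "g \<in> L2v L" and cz: "AE x in L. 0 \<le> c x * z x"
    and eq: "\<And>w h. H10g \<Omega> w h \<Longrightarrow> \<exists>B. AE x in L. \<bar>w x\<bar> \<le> B \<Longrightarrow>
        (\<integral>x. k x \<bullet> h x \<partial>L) + (\<integral>x. c x * w x \<partial>L) = (\<integral>x. g x * w x \<partial>L)"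
    and \<psi>: "smooth \<psi>" "\<And>x. x \<in> \<Omega> \<Longrightarrow> 0 \<le> \<psi> x" "\<And>x. x \<in> \<Omega> \<Longrightarrow> laplacian \<psi> x \<le> 0"
  shows "(\<integral>x. \<bar>z x\<bar> * - laplacian \<psi> x \<partial>L) \<le> L2vn L g * L2vn L \<psi>"
proof -
  note zD = H10gD[OF z]
  define \<Lambda> where "\<Lambda> = (\<integral>x. - laplacian \<psi> x \<partial>L)"
  have lapL: "(\<lambda>x. - laplacian \<psi> x) \<in> L2v L" by (intro L2v_minus smooth_L2v smooth_laplacian \<psi>)
  have \<Lambda>0: "\<Lambda> \<ge> 0" unfolding \<Lambda>_def by (intro integral_nonneg_AE AE_I2) (use \<psi>(3) in auto)
  have zabs: "(\<lambda>x. \<bar>z x\<bar>) \<in> L2v L" using zD by (auto simp: L2v_def)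
  have key: "(\<integral>x. \<bar>z x\<bar> * - laplacian \<psi> x \<partial>L) \<le> L2vn L g * L2vn L \<psi> + sqrt \<delta> * \<Lambda>" if \<delta>: "\<delta> > 0" for \<delta>
  proof -
    define N where "N = smooth_abs \<delta>"
    define G where "G = soft_sign \<delta>"
    define G' where "G' = soft_sign' \<delta>"
    note N = smooth_abs_pos[OF \<delta>, folded N_def] and Nabs = smooth_abs_ge[OF \<delta>, folded N_def]
      and Nd = smooth_abs_deriv[OF \<delta>, folded N_def G_def]
      and Gd = soft_sign_deriv[OF \<delta>, folded G_def G'_def] and contG' = soft_sign'_cont[OF \<delta>, folded G'_def]
      and contG = soft_sign_cont[OF \<delta>, folded G_def] and G'b = soft_sign'_bound[OF \<delta>, folded G'_def]
      and G1 = soft_sign_bound[OF \<delta>, folded G_def] and G'0 = soft_sign'_nonneg[OF \<delta>, folded G'_def]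
    have G_eq: "G t = t / N t" for t by (simp add: G_def N_def soft_sign_def)
    have hG: "H10g \<Omega> (\<lambda>x. G (z x)) (\<lambda>x. G' (z x) *\<^sub>R k x)"
      by (rule H10g_comp[OF z Gd contG' _ G'b]) (simp add: G_eq)
    \<comment> \<open>Subtracting \<open>sqrt \<delta>\<close>, the value at 0, keeps the zero
      boundary values; the constant is restored at the end through \<open>\<Lambda>\<close>.\<close>
    have hN: "H10g \<Omega> (\<lambda>x. N (z x) - sqrt \<delta>) (\<lambda>x. G (z x) *\<^sub>R k x)"
    proof (rule H10g_comp[OF z _ contG])
      show "((\<lambda>t. N t - sqrt \<delta>) has_real_derivative G t) (at t)" for t
        using DERIV_diff[OF Nd[of t] DERIV_const[of "sqrt \<delta>"]] by simp
    qed (use G1 in \<open>auto simp: N_def smooth_abs_def\<close>)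
    have Gzm: "(\<lambda>x. G (z x)) \<in> borel_measurable L" "(\<lambda>x. G' (z x)) \<in> borel_measurable L"
      using borel_measurable_continuous_on[OF contG zD(3)] borel_measurable_continuous_on[OF contG' zD(3)] by auto
    \<comment> \<open>The test function is the kernel times a regularised sign of \<open>z\<close>;
      it is bounded by the kernel, so the right-hand side sees only the L2 norm of
      \<open>\<psi>\<close>.\<close>
    define w where "w x = \<psi> x * G (z x)" for x
    define h where "h x = \<psi> x *\<^sub>R (G' (z x) *\<^sub>R k x) + G (z x) *\<^sub>R grad \<psi> x" for x
    have wh: "H10g \<Omega> w h" unfolding w_def h_def by (rule H10g_mult_smooth[OF hG \<psi>(1)])
    obtain B where B: "\<And>x. x \<in> \<Omega> \<Longrightarrow> \<bar>\<psi> x\<bar> \<le> B" using smooth_bounded[OF \<psi>(1)] by blast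
    have wle: "\<bar>w x\<bar> \<le> \<bar>\<psi> x\<bar>" for x unfolding w_def abs_mult using G1[of "z x"] by (simp add: mult_left_le)
    have "AE x in L. \<bar>w x\<bar> \<le> B" using B wle by (intro AE_I2) (force intro: order_trans)
    hence e: "(\<integral>x. k x \<bullet> h x \<partial>L) + (\<integral>x. c x * w x \<partial>L) = (\<integral>x. g x * w x \<partial>L)" using eq[OF wh] by blast
    have "0 \<le> (\<integral>x. c x * w x \<partial>L)"
    proof (rule integral_nonneg_AE)
      have "AE x in L. x \<in> \<Omega>" by (rule AE_I2) simp
      thus "AE x in L. 0 \<le> c x * w x"
        using cz
      proof eventually_elim
        case (elim x)
        have "c x * w x = (c x * z x) * (\<psi> x / N (z x))" by (simp add: w_def G_eq)
        moreover have "0 \<le> \<psi> x / N (z x)" using \<psi>(2)[OF elim(1)] N[of "z x"] by simp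
        ultimately show ?case using elim(2) by (metis mult_nonneg_nonneg)
      qed
    qed
    moreover have "(\<integral>x. g x * w x \<partial>L) \<le> L2vn L g * L2vn L \<psi>"
    proof -
      have "(\<integral>x. g x * w x \<partial>L) \<le> L2vn L g * L2vn L w" using L2v_CS_real[OF g H10gD(1)[OF wh]] by simp
      also have "\<dots> \<le> L2vn L g * L2vn L \<psi>"
        by (intro mult_left_mono L2v_norm_bound(2) smooth_L2v \<psi> H10gD(3)[OF wh]) (use wle in auto)
      finally show ?thesis .
    qed
    moreover have "(\<integral>x. (N (z x) - sqrt \<delta>) * - laplacian \<psi> x \<partial>L) \<le> (\<integral>x. k x \<bullet> h x \<partial>L)"
    proof -
      have "(\<integral>x. (N (z x) - sqrt \<delta>) * - laplacian \<psi> x \<partial>L) = (\<integral>x. (G (z x) *\<^sub>R k x) \<bullet> grad \<psi> x \<partial>L)"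
        using H10g_green[OF hN \<psi>(1)] by simp
      also have "\<dots> \<le> (\<integral>x. k x \<bullet> h x \<partial>L)"
      proof (rule integral_mono)
        show "integrable L (\<lambda>x. (G (z x) *\<^sub>R k x) \<bullet> grad \<psi> x)" by (intro L2v_integrable_inner H10gD(2)[OF hN] grad_L2v \<psi>)
        show "integrable L (\<lambda>x. k x \<bullet> h x)" by (intro L2v_integrable_inner H10gD(2)[OF wh] zD)
        fix x assume "x \<in> space L"
        \<comment> \<open>Differentiating the regularised sign yields a nonnegative term (Kato's
          inequality), which is dropped.\<close>
        hence "0 \<le> \<psi> x * G' (z x) * (k x \<bullet> k x)" using \<psi>(2) G'0 by simp
        thus "(G (z x) *\<^sub>R k x) \<bullet> grad \<psi> x \<le> k x \<bullet> h x" by (simp add: h_def inner_add_right mult.assoc)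
      qed
      finally show ?thesis .
    qed
    ultimately have 1: "(\<integral>x. (N (z x) - sqrt \<delta>) * - laplacian \<psi> x \<partial>L) \<le> L2vn L g * L2vn L \<psi>" using e by linarith
    have i1: "integrable L (\<lambda>x. (N (z x) - sqrt \<delta>) * - laplacian \<psi> x)"
      by (intro L2v_integrable_mult H10gD(1)[OF hN] lapL)
    have i2: "integrable L (\<lambda>x. - laplacian \<psi> x)" by (rule L2v_integrable_norm(3)[OF finite_L lapL])
    have "(\<integral>x. \<bar>z x\<bar> * - laplacian \<psi> x \<partial>L) \<le> (\<integral>x. (N (z x) - sqrt \<delta>) * - laplacian \<psi> x + sqrt \<delta> * - laplacian \<psi> x \<partial>L)"
    proof (rule integral_mono)
      show "integrable L (\<lambda>x. \<bar>z x\<bar> * - laplacian \<psi> x)" by (intro L2v_integrable_mult zabs lapL)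
      show "integrable L (\<lambda>x. (N (z x) - sqrt \<delta>) * - laplacian \<psi> x + sqrt \<delta> * - laplacian \<psi> x)"
        by (intro Bochner_Integration.integrable_add i1 integrable_mult_right i2)
      fix x assume "x \<in> space L"
      hence "\<bar>z x\<bar> * - laplacian \<psi> x \<le> N (z x) * - laplacian \<psi> x" using \<psi>(3) Nabs by (intro mult_right_mono) auto
      thus "\<bar>z x\<bar> * - laplacian \<psi> x \<le> (N (z x) - sqrt \<delta>) * - laplacian \<psi> x + sqrt \<delta> * - laplacian \<psi> x"
        by (simp add: algebra_simps)
    qed
    also have "\<dots> = (\<integral>x. (N (z x) - sqrt \<delta>) * - laplacian \<psi> x \<partial>L) + sqrt \<delta> * \<Lambda>"
      unfolding \<Lambda>_def by (subst Bochner_Integration.integral_add[OF i1 integrable_mult_right[OF i2]]) simp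
    finally show ?thesis using 1 by simp
  qed
  show ?thesis
  proof (rule field_le_epsilon)
    fix e :: real assume e: "e > 0"
    \<comment> \<open>This choice of \<open>\<delta>\<close> makes the regularisation error at most
      \<open>e\<close>.\<close>
    have "sqrt ((e / (\<Lambda> + 1))\<^sup>2) * \<Lambda> = e / (\<Lambda> + 1) * \<Lambda>" using e \<Lambda>0 by simp
    also have "\<dots> \<le> e" using e \<Lambda>0 by (simp add: field_simps)
    finally show "(\<integral>x. \<bar>z x\<bar> * - laplacian \<psi> x \<partial>L) \<le> L2vn L g * L2vn L \<psi> + e"
      using key[of "(e / (\<Lambda> + 1))\<^sup>2"] e \<Lambda>0 by auto
  qed
qed

text \<open>The average of \<open>\<bar>z\<bar>\<close> over a small cube is tested by the kernel
  centred at the corner of the cube, whose Laplacian is at least of the order of the reciprocal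
  volume there. The bound is uniform in the cube, so it passes to almost every point.\<close>

theorem Linf_const_exists:
  assumes dim: "DIM('a) \<in> {2, 3}"
  shows "\<exists>C. Linf_const C"
proof -
  obtain K c where K: "K > 0" "c > 0" and ker: "\<And>x0 \<epsilon>. x0 \<in> \<Omega> \<Longrightarrow> 0 < \<epsilon> \<Longrightarrow> \<epsilon> \<le> 2 \<Longrightarrow>
    \<exists>\<psi>. smooth \<psi> \<and> (\<forall>x\<in>\<Omega>. 0 \<le> \<psi> x \<and> laplacian \<psi> x \<le> 0 \<and>
      (norm (x - x0) \<le> \<epsilon> \<longrightarrow> c / \<epsilon> ^ DIM('a) \<le> - laplacian \<psi> x)) \<and> L2vn L \<psi> \<le> K"
    using superharmonic_kernels[OF dim] by metis
  \<comment> \<open>The factor \<open>2 ^ DIM('a)\<close> appears because kernels of radius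
    \<open>2 * h\<close> are used for cubes of side \<open>h\<close>.\<close>
  define C where "C = 2 ^ DIM('a) / c * K"
  have C: "C > 0" using K by (simp add: C_def)
  have "AE x in L. \<bar>z x\<bar> \<le> C * L2vn L g"
    if z: "H10g \<Omega> z k" and g: "g \<in> L2v L" and cz: "AE x in L. 0 \<le> b x * z x"
    and eq: "\<forall>w h. H10g \<Omega> w h \<longrightarrow> (\<exists>B. AE x in L. \<bar>w x\<bar> \<le> B) \<longrightarrow>
        (\<integral>x. k x \<bullet> h x \<partial>L) + (\<integral>x. b x * w x \<partial>L) = (\<integral>x. g x * w x \<partial>L)" for z k b g
  proof (rule AE_le_of_cube_averages[OF open_dom])
    note zD = H10gD[OF z]
    have zabs: "(\<lambda>x. \<bar>z x\<bar>) \<in> L2v L" using zD by (auto simp: L2v_def)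
    show "integrable L (\<lambda>x. \<bar>z x\<bar>)" by (rule L2v_integrable_norm(3)[OF finite_L zabs])
    fix x0 :: 'a and h :: real
    assume h: "0 < h" "h \<le> 1" and sub: "cbox x0 (x0 + h *\<^sub>R One) \<subseteq> \<Omega>"
    have "x0 \<in> cbox x0 (x0 + h *\<^sub>R One)" using h by (auto simp: mem_box inner_add_left)
    hence x0: "x0 \<in> \<Omega>" using sub by auto
    have e2: "0 < 2 * h" "2 * h \<le> 2" using h by auto
    from ker[OF x0 e2] obtain \<psi> where "smooth \<psi> \<and> (\<forall>x\<in>\<Omega>. 0 \<le> \<psi> x \<and> laplacian \<psi> x \<le> 0 \<and>
      (norm (x - x0) \<le> 2 * h \<longrightarrow> c / (2 * h) ^ DIM('a) \<le> - laplacian \<psi> x)) \<and> L2vn L \<psi> \<le> K" ..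
    hence \<psi>: "smooth \<psi>" "\<And>x. x \<in> \<Omega> \<Longrightarrow> 0 \<le> \<psi> x" "\<And>x. x \<in> \<Omega> \<Longrightarrow> laplacian \<psi> x \<le> 0"
      "\<And>x. x \<in> \<Omega> \<Longrightarrow> norm (x - x0) \<le> 2 * h \<Longrightarrow> c / (2 * h) ^ DIM('a) \<le> - laplacian \<psi> x" "L2vn L \<psi> \<le> K"
      by blast+
    define s where "s = (2 * h) ^ DIM('a) / c"
    have s: "s > 0" using h K by (simp add: s_def)
    have near: "norm (x - x0) \<le> 2 * h" if "x \<in> cbox x0 (x0 + h *\<^sub>R One)" for x
    proof -
      have "(norm (x - x0))\<^sup>2 = (\<Sum>i\<in>Basis. ((x - x0) \<bullet> i)\<^sup>2)"
        unfolding power2_norm_eq_inner by (subst euclidean_inner) (simp add: power2_eq_square)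
      also have "\<dots> \<le> (\<Sum>i\<in>(Basis::'a set). h\<^sup>2)"
        using that by (intro sum_mono power_mono) (auto simp: mem_box inner_add_left inner_diff_left)
      also have "\<dots> = real DIM('a) * h\<^sup>2" by simp
      \<comment> \<open>In dimension at most 4 the diagonal of the cube is at most twice its side,
        so the ball of radius \<open>2 * h\<close> around the corner covers the cube.\<close>
      also have "\<dots> \<le> 4 * h\<^sup>2" using dim by (intro mult_right_mono) auto
      also have "\<dots> = (2 * h)\<^sup>2" by (simp add: power_mult_distrib)
      finally show ?thesis by (rule power2_le_imp_le) (use h in simp)
    qed
    have lapL: "(\<lambda>x. - laplacian \<psi> x) \<in> L2v L" by (intro L2v_minus smooth_L2v smooth_laplacian \<psi>)
    have "(\<integral>y. indicator (cbox x0 (x0 + h *\<^sub>R One)) y * \<bar>z y\<bar> \<partial>L) \<le> (\<integral>y. s * (\<bar>z y\<bar> * - laplacian \<psi> y) \<partial>L)"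
    proof (rule integral_mono')
      show "integrable L (\<lambda>y. s * (\<bar>z y\<bar> * - laplacian \<psi> y))"
        by (intro integrable_mult_right L2v_integrable_mult zabs lapL)
      fix y assume "y \<in> space L"
      hence y: "y \<in> \<Omega>" by simp
      show "indicator (cbox x0 (x0 + h *\<^sub>R One)) y * \<bar>z y\<bar> \<le> s * (\<bar>z y\<bar> * - laplacian \<psi> y)"
      proof (cases "y \<in> cbox x0 (x0 + h *\<^sub>R One)")
        case True
        have "1 = s * (c / (2 * h) ^ DIM('a))" using h K by (simp add: s_def)
        also have "\<dots> \<le> s * - laplacian \<psi> y" using s by (intro mult_left_mono \<psi>(4)[OF y near[OF True]]) auto
        finally have "\<bar>z y\<bar> * 1 \<le> \<bar>z y\<bar> * (s * - laplacian \<psi> y)" by (intro mult_left_mono) auto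
        thus ?thesis using True by (simp add: algebra_simps)
      next
        case False
        have "0 \<le> s * (\<bar>z y\<bar> * - laplacian \<psi> y)" using s \<psi>(3)[OF y] by (intro mult_nonneg_nonneg) auto
        thus ?thesis using False by simp
      qed
      show "0 \<le> s * (\<bar>z y\<bar> * - laplacian \<psi> y)" using s \<psi>(3)[OF y] by (intro mult_nonneg_nonneg) auto
    qed
    also have "\<dots> = s * (\<integral>y. \<bar>z y\<bar> * - laplacian \<psi> y \<partial>L)" by simp
    also have "\<dots> \<le> s * (L2vn L g * L2vn L \<psi>)"
      using s eq by (intro mult_left_mono subsolution_estimate[OF z g cz _ \<psi>(1-3)]) auto
    also have "\<dots> \<le> s * (L2vn L g * K)" using s \<psi>(5) by (intro mult_left_mono) auto
    also have "\<dots> = C * L2vn L g * h ^ DIM('a)" by (simp add: s_def C_def power_mult_distrib)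
    finally show "(\<integral>y. indicator (cbox x0 (x0 + h *\<^sub>R One)) y * \<bar>z y\<bar> \<partial>L) \<le> C * L2vn L g * h ^ DIM('a)" .
  qed
  with C show ?thesis unfolding Linf_const_def by blast
qed

end


section \<open>State and adjoint equations, derivative of the reduced cost\<close>

definition clip :: "real \<Rightarrow> real \<Rightarrow> real" where
  "clip K t = max (- K) (min K t)"

lemma clip_simps:
  assumes "K \<ge> 0"
  shows "\<bar>clip K t\<bar> \<le> K" "\<bar>t\<bar> \<le> K \<Longrightarrow> clip K t = t" "\<bar>clip K s - clip K t\<bar> \<le> \<bar>s - t\<bar>"
    "s \<le> t \<Longrightarrow> clip K s \<le> clip K t"
  using assms by (auto simp: clip_def)

section \<open>Measurability of compositions and uniqueness of derivatives on L2\<close>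

context bounded_domain
begin

text \<open>Completeness of Lebesgue measure. It matters because the regularity of \<open>a\<close>
  in its second argument holds only for almost every \<open>x\<close>.\<close>

lemma borel_measurable_cong_AE_L:
  fixes f g :: "'a \<Rightarrow> real"
  assumes f: "f \<in> borel_measurable L" and eq: "AE x in L. f x = g x"
  shows "g \<in> borel_measurable L"
proof -
  have "(\<lambda>x. if x \<in> \<Omega> then f x else 0) \<in> borel_measurable lebesgue"
    using f by (subst borel_measurable_if) auto
  moreover have "AE x in lebesgue. (if x \<in> \<Omega> then f x else 0) = (if x \<in> \<Omega> then g x else 0)"
    using eq unfolding AE_lebesgue_on_iff[OF dom_sets] by eventually_elim auto
  ultimately have "(\<lambda>x. if x \<in> \<Omega> then g x else 0) \<in> borel_measurable lebesgue"
    by (rule borel_measurable_AE)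
  thus ?thesis by (subst (asm) borel_measurable_if) auto
qed

lemma borel_measurable_AE_limit:
  fixes f :: "nat \<Rightarrow> 'a \<Rightarrow> real"
  assumes f: "\<And>n. f n \<in> borel_measurable L" and lim: "AE x in L. (\<lambda>n. f n x) \<longlonglongrightarrow> g x"
  shows "g \<in> borel_measurable L"
proof (rule borel_measurable_cong_AE_L)
  show "(\<lambda>x. lim (\<lambda>n. f n x)) \<in> borel_measurable L" using f by (rule borel_measurable_lim_metric)
  show "AE x in L. lim (\<lambda>n. f n x) = g x" using lim by eventually_elim (rule limI)
qed

text \<open>For a simple function in place of \<open>y\<close> the composition is a finite sum of
  products of measurable functions; continuity in the second argument carries this to the
  limit.\<close>

lemma Caratheodory_measurable:
  fixes a :: "'a \<Rightarrow> real \<Rightarrow> real"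
  assumes a: "\<And>t. (\<lambda>x. a x t) \<in> borel_measurable L" and cont: "AE x in L. continuous_on UNIV (a x)"
    and y: "y \<in> borel_measurable L"
  shows "(\<lambda>x. a x (y x)) \<in> borel_measurable L"
proof -
  obtain F where F: "\<And>i. simple_function L (F i)" "\<And>x. x \<in> space L \<Longrightarrow> (\<lambda>i. F i x) \<longlonglongrightarrow> y x"
    using borel_measurable_implies_sequence_metric[OF y, of 0] by blast
  show ?thesis
  proof (rule borel_measurable_AE_limit)
    show "(\<lambda>x. a x (F n x)) \<in> borel_measurable L" for n
    proof -
      have fin: "finite (F n ` space L)" using F(1)[of n] by (rule simple_functionD)
      have "(\<lambda>x. \<Sum>v\<in>F n ` space L. a x v * indicator (F n -` {v} \<inter> space L) x) \<in> borel_measurable L"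
        using simple_functionD(2)[OF F(1)[of n]] a
        by (intro borel_measurable_sum borel_measurable_times borel_measurable_indicator) auto
      moreover have "(\<Sum>v\<in>F n ` space L. a x v * indicator (F n -` {v} \<inter> space L) x) = a x (F n x)" if "x \<in> space L" for x
      proof -
        have "(\<Sum>v\<in>F n ` space L. a x v * indicator (F n -` {v} \<inter> space L) x) = (\<Sum>v\<in>F n ` space L. if v = F n x then a x v else 0)"
          by (intro sum.cong refl) (use that in \<open>auto simp: indicator_def\<close>)
        also have "\<dots> = a x (F n x)" using fin that by (simp add: sum.delta)
        finally show ?thesis .
      qed
      ultimately show ?thesis by (subst measurable_cong[symmetric]) auto
    qed
    have "AE x in L. x \<in> space L" by (rule AE_I2)
    thus "AE x in L. (\<lambda>n. a x (F n x)) \<longlonglongrightarrow> a x (y x)"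
      using cont
    proof eventually_elim
      case (elim x)
      have "isCont (a x) (y x)" using elim(2) by (simp add: continuous_on_eq_continuous_at)
      thus ?case using F(2)[OF elim(1)] by (rule isCont_tendsto_compose)
    qed
  qed
qed

text \<open>The difference of two derivatives is linear and of smaller order than the norm of the
  increment, so scaling a fixed \<open>v\<close> towards 0 forces it to vanish.\<close>

lemma has_L2_deriv_unique:
  assumes 1: "has_L2_deriv \<Omega> F D u" and 2: "has_L2_deriv \<Omega> F D' u" and v: "v \<in> L2v L"
  shows "D v = D' v"
proof -
  have lin: "D (\<lambda>x. c * v x) = c * D v" "D' (\<lambda>x. c * v x) = c * D' v" for c
    using 1 2 v unfolding has_L2_deriv_def L2_linear_def L2_eq_L2v by blast+
  have "\<bar>D v - D' v\<bar> \<le> 0"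
  proof (rule field_le_epsilon)
    fix e :: real assume e: "e > 0"
    define \<epsilon> where "\<epsilon> = e / (2 * (L2vn L v + 1))"
    have n: "L2vn L v + 1 > 0" by (simp add: add_nonneg_pos)
    have \<epsilon>: "\<epsilon> > 0" unfolding \<epsilon>_def using e n by simp
    obtain \<delta>1 where \<delta>1: "\<delta>1 > 0" "\<And>h. h \<in> L2v L \<Longrightarrow> L2vn L h < \<delta>1 \<Longrightarrow> \<bar>F (\<lambda>x. u x + h x) - F u - D h\<bar> \<le> \<epsilon> * L2vn L h"
      using 1 \<epsilon> unfolding has_L2_deriv_def L2_eq_L2v L2_norm_eq by blast
    obtain \<delta>2 where \<delta>2: "\<delta>2 > 0" "\<And>h. h \<in> L2v L \<Longrightarrow> L2vn L h < \<delta>2 \<Longrightarrow> \<bar>F (\<lambda>x. u x + h x) - F u - D' h\<bar> \<le> \<epsilon> * L2vn L h"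
      using 2 \<epsilon> unfolding has_L2_deriv_def L2_eq_L2v L2_norm_eq by blast
    \<comment> \<open>Scales \<open>v\<close> into both neighbourhoods; the summand 1 keeps the
      quotient meaningful when \<open>v\<close> vanishes.\<close>
    define t where "t = min \<delta>1 \<delta>2 / (2 * (L2vn L v + 1))"
    have t: "t > 0" unfolding t_def using \<delta>1 \<delta>2 n by simp
    define h where "h x = t * v x" for x
    have hL: "h \<in> L2v L" unfolding h_def by (rule L2v_cmult[OF v])
    have hn: "L2vn L h = t * L2vn L v" unfolding h_def using t by (simp add: L2vn_cmult)
    have "t * L2vn L v < t * (2 * (L2vn L v + 1))" using t by (intro mult_strict_left_mono) (auto simp: add_nonneg_pos)
    also have "\<dots> = min \<delta>1 \<delta>2" unfolding t_def using n by simp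
    finally have "L2vn L h < \<delta>1" "L2vn L h < \<delta>2" using hn by auto
    with \<delta>1(2)[OF hL] \<delta>2(2)[OF hL] have "\<bar>D h - D' h\<bar> \<le> 2 * (\<epsilon> * L2vn L h)" by argo
    hence "t * \<bar>D v - D' v\<bar> \<le> t * (2 * \<epsilon> * L2vn L v)"
      using t by (simp add: h_def[abs_def] lin hn[unfolded h_def[abs_def]] abs_mult flip: right_diff_distrib)
    hence "\<bar>D v - D' v\<bar> \<le> 2 * \<epsilon> * L2vn L v" using t by simp
    also have "\<dots> \<le> 2 * \<epsilon> * (L2vn L v + 1)" using \<epsilon> by (intro mult_left_mono) auto
    also have "\<dots> = e" unfolding \<epsilon>_def using n by (simp add: field_simps)
    finally show "\<bar>D v - D' v\<bar> \<le> 0 + e" by simp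
  qed
  thus ?thesis by simp
qed

lemma L2_deriv_eq:
  assumes "has_L2_deriv \<Omega> F D u" "v \<in> L2v L"
  shows "L2_deriv \<Omega> F u v = D v"
  unfolding L2_deriv_def
  by (rule has_L2_deriv_unique[OF someI[where P = "\<lambda>D. has_L2_deriv \<Omega> F D u", OF assms(1)] assms(1,2)])

end

section \<open>The semilinear setting and bounds for the nonlinearity\<close>

locale semilinear = bounded_domain \<Omega> for \<Omega> :: "'a::euclidean_space set" +
  fixes a :: "'a \<Rightarrow> real \<Rightarrow> real" and yd :: "'a \<Rightarrow> real"
  assumes dim: "DIM('a) \<in> {2, 3}"
    and A1: "assumption_A1 \<Omega> a" and A2: "assumption_A2 \<Omega> a" and A3: "assumption_A3 \<Omega> a"
    and yd: "yd \<in> L2v L"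
begin

text \<open>The Poincare constant and, below, the sup-norm constant are fixed once for the domain,
  so that constants built from them cannot depend on states, controls or meshes.\<close>

definition Cp :: real where
  "Cp = (SOME C. C > 0 \<and> (\<forall>y g. H10g \<Omega> y g \<longrightarrow> L2vn L y \<le> C * L2vn L g))"

definition Ci :: real where
  "Ci = (SOME C. Linf_const C)"

lemma Cp: "Cp > 0" "H10g \<Omega> y g \<Longrightarrow> L2vn L y \<le> Cp * L2vn L g"
proof -
  have "\<exists>C. C > 0 \<and> (\<forall>y g. H10g \<Omega> y g \<longrightarrow> L2vn L y \<le> C * L2vn L g)" by (rule Poincare) blast
  from someI_ex[OF this] show "Cp > 0" "H10g \<Omega> y g \<Longrightarrow> L2vn L y \<le> Cp * L2vn L g"
    unfolding Cp_def[symmetric] by auto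
qed

lemma Ci: "Linf_const Ci"
  unfolding Ci_def by (rule someI_ex[OF Linf_const_exists[OF dim]])

lemma Ci_pos: "Ci > 0"
  using Ci by (simp add: Linf_const_def)

lemma Ci_bound:
  assumes "H10g \<Omega> z k" "g \<in> L2v L" "AE x in L. 0 \<le> c x * z x"
    and "\<And>w h. H10g \<Omega> w h \<Longrightarrow> \<exists>B. AE x in L. \<bar>w x\<bar> \<le> B \<Longrightarrow>
        (\<integral>x. k x \<bullet> h x \<partial>L) + (\<integral>x. c x * w x \<partial>L) = (\<integral>x. g x * w x \<partial>L)"
  shows "AE x in L. \<bar>z x\<bar> \<le> Ci * L2vn L g"
  using Ci assms unfolding Linf_const_def by blast

lemma a_meas: "(\<lambda>x. a x t) \<in> borel_measurable L"
  using A1 by (simp add: assumption_A1_def)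

lemma a_cont: "AE x in L. continuous_on UNIV (a x)"
  using A1 by (simp add: assumption_A1_def)

lemma a0: "(\<lambda>x. a x 0) \<in> L2v L"
  using A1 by (simp add: assumption_A1_def L2_eq_L2v)

lemma a_deriv: "AE x in L. (\<forall>t. (a x has_real_derivative deriv (a x) t) (at t)) \<and>
    (\<forall>t. (deriv (a x) has_real_derivative deriv (deriv (a x)) t) (at t)) \<and> (\<forall>t. 0 \<le> deriv (a x) t)"
proof -
  have "AE x in L. (\<forall>y. a x differentiable at y) \<and> (\<forall>y. deriv (a x) differentiable at y) \<and>
        continuous_on UNIV (deriv (deriv (a x)))" using A1 by (simp add: assumption_A1_def)
  moreover have "AE x in L. \<forall>y. deriv (a x) y \<ge> 0" using A2 by (simp add: assumption_A2_def)
  ultimately show ?thesis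
    by eventually_elim (auto simp: DERIV_deriv_iff_real_differentiable real_differentiable_def intro: DERIV_deriv_iff_real_differentiable[THEN iffD2])
qed

lemma a_mono: "AE x in L. \<forall>s t. 0 \<le> (a x s - a x t) * (s - t)"
  using a_deriv
proof eventually_elim
  case (elim x)
  have mono: "a x s \<le> a x t" if "s \<le> t" for s t
    by (rule DERIV_nonneg_imp_nondecreasing[OF that]) (use elim in blast)
  show ?case
  proof (intro allI)
    fix s t :: real
    show "0 \<le> (a x s - a x t) * (s - t)"
      using mono[of s t] mono[of t s] by (cases "s \<le> t") (auto simp: mult_nonpos_nonpos)
  qed
qed

lemma a_comp_meas: "y \<in> borel_measurable L \<Longrightarrow> (\<lambda>x. a x (y x)) \<in> borel_measurable L"
  by (rule Caratheodory_measurable[OF a_meas a_cont])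

text \<open>The derivative is a pointwise limit of difference quotients of \<open>a\<close>, whose
  compositions are already known to be measurable.\<close>

lemma da_comp_meas:
  assumes y: "y \<in> borel_measurable L" shows "(\<lambda>x. deriv (a x) (y x)) \<in> borel_measurable L"
proof (rule borel_measurable_AE_limit)
  define t where "t n = 1 / real (Suc n)" for n
  have t: "t n > 0" for n by (simp add: t_def)
  have t0: "t \<longlonglongrightarrow> 0" unfolding t_def by (rule LIMSEQ_Suc[OF lim_1_over_n])
  show "(\<lambda>x. (a x (y x + t n) - a x (y x)) / t n) \<in> borel_measurable L" for n
    using y by (intro borel_measurable_divide borel_measurable_diff a_comp_meas) auto
  show "AE x in L. (\<lambda>n. (a x (y x + t n) - a x (y x)) / t n) \<longlonglongrightarrow> deriv (a x) (y x)"
    using a_deriv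
  proof eventually_elim
    case (elim x)
    have "((\<lambda>h. (a x (y x + h) - a x (y x)) / h) \<longlongrightarrow> deriv (a x) (y x)) (at 0)"
      using elim by (auto simp: DERIV_def)
    moreover have "filterlim t (at 0) sequentially"
      using t0 t by (simp add: filterlim_at less_imp_neq[symmetric] eventually_sequentiallyI)
    ultimately show ?case by (rule filterlim_compose)
  qed
qed

text \<open>One constant for all that (A.3) gives on a bounded range: size of the derivative,
  Lipschitz continuity of \<open>a\<close> and of its derivative, and a quadratic Taylor
  remainder.\<close>

definition a_bounds :: "real \<Rightarrow> real \<Rightarrow> bool" where
  "a_bounds K \<Lambda> \<longleftrightarrow> \<Lambda> > 0 \<and> (AE x in L. \<forall>s t. \<bar>s\<bar> \<le> K \<longrightarrow> \<bar>t\<bar> \<le> K \<longrightarrow>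
     \<bar>deriv (a x) s\<bar> \<le> \<Lambda> \<and> \<bar>a x s - a x t\<bar> \<le> \<Lambda> * \<bar>s - t\<bar> \<and>
     \<bar>deriv (a x) s - deriv (a x) t\<bar> \<le> \<Lambda> * \<bar>s - t\<bar> \<and>
     \<bar>a x t - a x s - deriv (a x) s * (t - s)\<bar> \<le> \<Lambda> * \<bar>t - s\<bar>\<^sup>2)"

lemma a_bounds_exists:
  assumes "K > 0" obtains \<Lambda> where "a_bounds K \<Lambda>"
proof -
  obtain C where C: "C > 0" "AE x in L. \<forall>y. \<bar>y\<bar> \<le> K \<longrightarrow> (\<Sum>i=1..2. \<bar>(deriv ^^ i) (a x) y\<bar>) \<le> C"
    using A3 assms unfolding assumption_A3_def by blast
  have "AE x in L. \<forall>s t. \<bar>s\<bar> \<le> K \<longrightarrow> \<bar>t\<bar> \<le> K \<longrightarrow>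
     \<bar>deriv (a x) s\<bar> \<le> C \<and> \<bar>a x s - a x t\<bar> \<le> C * \<bar>s - t\<bar> \<and>
     \<bar>deriv (a x) s - deriv (a x) t\<bar> \<le> C * \<bar>s - t\<bar> \<and>
     \<bar>a x t - a x s - deriv (a x) s * (t - s)\<bar> \<le> C * \<bar>t - s\<bar>\<^sup>2"
    using C(2) a_deriv
  proof eventually_elim
    case (elim x)
    have b: "\<bar>deriv (a x) s\<bar> \<le> C" "\<bar>deriv (deriv (a x)) s\<bar> \<le> C" if "\<bar>s\<bar> \<le> K" for s
    proof -
      have "(\<Sum>i=1..2. \<bar>(deriv ^^ i) (a x) s\<bar>) = \<bar>deriv (a x) s\<bar> + \<bar>deriv (deriv (a x)) s\<bar>"
        by (simp add: numeral_2_eq_2)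
      with elim(1) that show "\<bar>deriv (a x) s\<bar> \<le> C" "\<bar>deriv (deriv (a x)) s\<bar> \<le> C" by force+
    qed
    have d1: "(a x has_field_derivative deriv (a x) s) (at s within S)"
      and d2: "(deriv (a x) has_field_derivative deriv (deriv (a x)) s) (at s within S)" for s S
      using elim(2) by (auto intro: has_field_derivative_at_within)
    have inK: "\<bar>s\<bar> \<le> K \<longleftrightarrow> s \<in> {-K..K}" for s by auto
    show ?case
    proof (intro allI impI conjI)
      fix s t assume st: "\<bar>s\<bar> \<le> K" "\<bar>t\<bar> \<le> K"
      show "\<bar>deriv (a x) s\<bar> \<le> C" by (rule b[OF st(1)])
      show "\<bar>a x s - a x t\<bar> \<le> C * \<bar>s - t\<bar>"
        using field_differentiable_bound[of "{-K..K}" "a x" "deriv (a x)" C s t] d1 b st by (auto simp: inK)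
      show d: "\<bar>deriv (a x) s - deriv (a x) t\<bar> \<le> C * \<bar>s - t\<bar>"
        using field_differentiable_bound[of "{-K..K}" "deriv (a x)" "deriv (deriv (a x))" C s t] d2 b st by (auto simp: inK)
      \<comment> \<open>Taylor remainder: the mean value bound is applied to \<open>a\<close> minus
        its linear part at \<open>s\<close>, whose derivative is at most
        \<open>C * \<bar>t - s\<bar>\<close> on the segment.\<close>
      have "norm ((\<lambda>r. a x r - deriv (a x) s * r) t - (\<lambda>r. a x r - deriv (a x) s * r) s) \<le> (C * \<bar>t - s\<bar>) * norm (t - s)"
      proof (rule field_differentiable_bound[of "closed_segment s t" _ "\<lambda>r. deriv (a x) r - deriv (a x) s"])
        show "((\<lambda>r. a x r - deriv (a x) s * r) has_field_derivative deriv (a x) r - deriv (a x) s) (at r within closed_segment s t)" for r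
          by (auto intro!: derivative_eq_intros d1)
        fix r assume r: "r \<in> closed_segment s t"
        have "\<bar>r\<bar> \<le> K" using r st by (auto simp: closed_segment_eq_real_ivl split: if_splits)
        moreover have "\<bar>r - s\<bar> \<le> \<bar>t - s\<bar>" using r by (auto simp: closed_segment_eq_real_ivl split: if_splits)
        ultimately show "norm (deriv (a x) r - deriv (a x) s) \<le> C * \<bar>t - s\<bar>"
          using field_differentiable_bound[of "{-K..K}" "deriv (a x)" "deriv (deriv (a x))" C r s] d2 b st C(1)
          by (auto simp: inK intro: order_trans mult_left_mono)
      qed auto
      thus "\<bar>a x t - a x s - deriv (a x) s * (t - s)\<bar> \<le> C * \<bar>t - s\<bar>\<^sup>2"
        by (simp add: algebra_simps power2_eq_square)
    qed
  qed
  with C(1) that show ?thesis unfolding a_bounds_def by blast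
qed

lemma a_comp_L2v:
  assumes y: "y \<in> borel_measurable L" and b: "AE x in L. \<bar>y x\<bar> \<le> K"
  shows "(\<lambda>x. a x (y x)) \<in> L2v L"
proof -
  \<comment> \<open>No sign is known for \<open>K\<close>; the radius
    \<open>1 + \<bar>K\<bar>\<close> is positive and at least \<open>K\<close>.\<close>
  obtain \<Lambda> where \<Lambda>: "a_bounds (1 + \<bar>K\<bar>) \<Lambda>"
    using a_bounds_exists[OF abs_add_one_gt_zero[of K]] by blast
  have m: "(\<lambda>x. a x (y x) - a x 0) \<in> borel_measurable L" using a_comp_meas[OF y] a_meas by simp
  have "AE x in L. \<bar>a x (y x) - a x 0\<bar> \<le> \<Lambda> * \<bar>K\<bar>"
    using b \<Lambda>[unfolded a_bounds_def, THEN conjunct2]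
  proof eventually_elim
    case (elim x)
    have "\<bar>a x (y x) - a x 0\<bar> \<le> \<Lambda> * \<bar>y x - 0\<bar>" using elim(1) elim(2)[rule_format, of "y x" 0] by simp
    also have "\<dots> \<le> \<Lambda> * \<bar>K\<bar>" using elim(1) \<Lambda> by (auto simp: a_bounds_def)
    finally show ?case .
  qed
  hence "(\<lambda>x. a x (y x) - a x 0) \<in> L2v L" by (intro L2v_Bounded(1)[OF finite_L m]) auto
  from L2v_add[OF this a0] show ?thesis by simp
qed

section \<open>Solvability, stability and sup bounds for state and adjoint equations\<close>

lemma H10_H10g: "y \<in> H10 \<Omega> \<Longrightarrow> H10g \<Omega> y (wgrad \<Omega> y)"
  by (simp add: H10_iff)

lemma state_eqD:
  assumes "state_eq \<Omega> a (H10 \<Omega>) u y"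
  shows "H10g \<Omega> y (wgrad \<Omega> y)"
    "H10g \<Omega> v h \<Longrightarrow> integrable L (\<lambda>x. a x (y x) * v x)"
    "H10g \<Omega> v h \<Longrightarrow> (\<integral>x. wgrad \<Omega> y x \<bullet> h x \<partial>L) + (\<integral>x. a x (y x) * v x \<partial>L) = (\<integral>x. u x * v x \<partial>L)"
proof -
  show y: "H10g \<Omega> y (wgrad \<Omega> y)" using assms by (simp add: state_eq_def H10_iff)
  assume vh: "H10g \<Omega> v h"
  show "integrable L (\<lambda>x. a x (y x) * v x)" using assms H10gD_H10(1)[OF vh] by (simp add: state_eq_def)
  show "(\<integral>x. wgrad \<Omega> y x \<bullet> h x \<partial>L) + (\<integral>x. a x (y x) * v x \<partial>L) = (\<integral>x. u x * v x \<partial>L)"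
  proof -
    have "grad_inner \<Omega> y v + (\<integral>x. a x (y x) * v x \<partial>L) = (\<integral>x. u x * v x \<partial>L)"
      using assms H10gD_H10(1)[OF vh] unfolding state_eq_def L2_inner_def by blast
    thus ?thesis unfolding grad_inner_H10g[OF y vh] .
  qed
qed

lemma adjoint_eqD:
  assumes "adjoint_eq \<Omega> a yd (H10 \<Omega>) y p"
  shows "H10g \<Omega> p (wgrad \<Omega> p)"
    "H10g \<Omega> w h \<Longrightarrow> integrable L (\<lambda>x. deriv (a x) (y x) * p x * w x)"
    "H10g \<Omega> w h \<Longrightarrow> (\<integral>x. wgrad \<Omega> p x \<bullet> h x \<partial>L) + (\<integral>x. deriv (a x) (y x) * p x * w x \<partial>L) = (\<integral>x. (y x - yd x) * w x \<partial>L)"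
proof -
  show p: "H10g \<Omega> p (wgrad \<Omega> p)" using assms by (simp add: adjoint_eq_def H10_iff)
  assume wh: "H10g \<Omega> w h"
  show "integrable L (\<lambda>x. deriv (a x) (y x) * p x * w x)" using assms H10gD_H10(1)[OF wh] by (simp add: adjoint_eq_def)
  show "(\<integral>x. wgrad \<Omega> p x \<bullet> h x \<partial>L) + (\<integral>x. deriv (a x) (y x) * p x * w x \<partial>L) = (\<integral>x. (y x - yd x) * w x \<partial>L)"
  proof -
    have "grad_inner \<Omega> w p + (\<integral>x. deriv (a x) (y x) * p x * w x \<partial>L) = (\<integral>x. (y x - yd x) * w x \<partial>L)"
      using assms H10gD_H10(1)[OF wh] unfolding adjoint_eq_def L2_inner_def by blast
    thus ?thesis unfolding grad_inner_H10g[OF wh p] by (simp only: inner_commute)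
  qed
qed

text \<open>The nonlinearity is frozen outside \<open>[-K, K]\<close>, which makes it Lipschitz and
  keeps it monotone. The sup bound of the solution depends on the data and not on the truncation,
  and \<open>K\<close> was chosen above it, so the truncation is inactive.\<close>

lemma state_exists:
  assumes u: "u \<in> L2v L"
  shows "\<exists>y. state_eq \<Omega> a (H10 \<Omega>) u y"
proof -
  define g where "g x = u x - a x 0" for x
  have g: "g \<in> L2v L" unfolding g_def by (intro L2v_diff u a0)
  define K where "K = Ci * L2vn L g + 1"
  have K: "K > 0" unfolding K_def using Ci_pos by (intro add_nonneg_pos) auto
  obtain \<Lambda> where \<Lambda>: "a_bounds K \<Lambda>" using a_bounds_exists[OF K] by blast
  have \<Lambda>0: "\<Lambda> > 0" using \<Lambda> by (simp add: a_bounds_def)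
  define b where "b x t = a x (clip K t)" for x t
  have clm: "(\<lambda>x. clip K (y x)) \<in> borel_measurable L" if "y \<in> borel_measurable L" for y
    unfolding clip_def using that by simp
  have bL: "(\<lambda>x. b x (y x)) \<in> L2v L" if "y \<in> L2v L" for y
    unfolding b_def using clip_simps(1)[of K] K by (intro a_comp_L2v[of _ K] clm L2v_meas that) auto
  have lip: "AE x in L. \<forall>s t. \<bar>b x s - b x t\<bar> \<le> \<Lambda> * \<bar>s - t\<bar>"
    using \<Lambda>[unfolded a_bounds_def, THEN conjunct2]
  proof eventually_elim
    case (elim x)
    show ?case
    proof (intro allI)
      fix s t
      have "\<bar>b x s - b x t\<bar> \<le> \<Lambda> * \<bar>clip K s - clip K t\<bar>"
        unfolding b_def using elim clip_simps(1)[of K] K by auto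
      also have "\<dots> \<le> \<Lambda> * \<bar>s - t\<bar>" using clip_simps(3)[of K s t] K \<Lambda>0 by (intro mult_left_mono) auto
      finally show "\<bar>b x s - b x t\<bar> \<le> \<Lambda> * \<bar>s - t\<bar>" .
    qed
  qed
  have mono: "AE x in L. \<forall>s t. 0 \<le> (b x s - b x t) * (s - t)"
    using a_mono
  proof eventually_elim
    case (elim x)
    have inc: "a x s \<le> a x t" if "s \<le> t" for s t
      using elim[rule_format, of s t] that by (cases "s = t") (auto simp: zero_le_mult_iff)
    show ?case
    proof (intro allI)
      fix s t
      show "0 \<le> (b x s - b x t) * (s - t)"
        using inc[OF clip_simps(4)[of K s t]] inc[OF clip_simps(4)[of K t s]] K unfolding b_def
        by (cases "s \<le> t") (auto simp: mult_nonpos_nonpos)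
    qed
  qed
  obtain z k where zk: "H10g \<Omega> z k"
    "\<And>v h. H10g \<Omega> v h \<Longrightarrow> (\<integral>x. k x \<bullet> h x \<partial>L) + (\<integral>x. b x (z x) * v x \<partial>L) = (\<integral>x. u x * v x \<partial>L)"
    by (rule monotone_Lipschitz_solution[OF u bL lip less_imp_le[OF \<Lambda>0] mono]) (assumption, rule that, assumption, blast)
  note zL = H10gD(1)[OF zk(1)]
  have "AE x in L. \<bar>z x\<bar> \<le> Ci * L2vn L g"
  proof (rule Ci_bound[OF zk(1) g, where c = "\<lambda>x. b x (z x) - b x 0"])
    show "AE x in L. 0 \<le> (b x (z x) - b x 0) * z x" using mono
    proof eventually_elim
      case (elim x)
      from elim[rule_format, of "z x" 0] show ?case by simp
    qed
    fix w h assume wh: "H10g \<Omega> w h"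
    have b0: "b x 0 = a x 0" for x unfolding b_def using K by (simp add: clip_def)
    have "(\<integral>x. (b x (z x) - b x 0) * w x \<partial>L) = (\<integral>x. b x (z x) * w x \<partial>L) - (\<integral>x. a x 0 * w x \<partial>L)"
      unfolding b0 left_diff_distrib
      by (intro Bochner_Integration.integral_diff L2v_integrable_mult bL zL a0 H10gD(1)[OF wh])
    moreover have "(\<integral>x. g x * w x \<partial>L) = (\<integral>x. u x * w x \<partial>L) - (\<integral>x. a x 0 * w x \<partial>L)"
      unfolding g_def left_diff_distrib
      by (intro Bochner_Integration.integral_diff L2v_integrable_mult u a0 H10gD(1)[OF wh])
    ultimately show "(\<integral>x. k x \<bullet> h x \<partial>L) + (\<integral>x. (b x (z x) - b x 0) * w x \<partial>L) = (\<integral>x. g x * w x \<partial>L)"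
      using zk(2)[OF wh] by simp
  qed
  hence zK: "AE x in L. \<bar>z x\<bar> \<le> K" unfolding K_def by eventually_elim simp
  have ba: "AE x in L. b x (z x) = a x (z x)" using zK unfolding b_def
    by eventually_elim (use clip_simps(2)[of K] K in simp)
  have aL: "(\<lambda>x. a x (z x)) \<in> L2v L" by (rule a_comp_L2v[OF L2v_meas[OF zL] zK])
  have "state_eq \<Omega> a (H10 \<Omega>) u z"
    unfolding state_eq_def L2_inner_def
  proof (intro conjI ballI)
    show "z \<in> H10 \<Omega>" by (rule H10gD_H10[OF zk(1)])
    fix v assume "v \<in> H10 \<Omega>"
    hence v: "H10g \<Omega> v (wgrad \<Omega> v)" by (rule H10_H10g)
    show "integrable L (\<lambda>x. a x (z x) * v x)" by (intro L2v_integrable_mult aL H10gD(1)[OF v])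
    have "(\<integral>x. a x (z x) * v x \<partial>L) = (\<integral>x. b x (z x) * v x \<partial>L)"
      by (intro integral_cong_AE borel_measurable_times L2v_meas aL bL zL H10gD(1)[OF v]) (use ba in auto)
    thus "grad_inner \<Omega> z v + (\<integral>x. a x (z x) * v x \<partial>L) = (\<integral>x. u x * v x \<partial>L)"
      using zk(2)[OF v] grad_inner_H10g[OF zk(1) v] by simp
  qed
  thus ?thesis by blast
qed

text \<open>The difference of the equations is tested with the difference of the states and
  monotonicity discards the nonlinear term. The Poincare inequality is used twice, hence the square
  of \<open>Cp\<close>.\<close>

lemma state_diff:
  assumes 1: "state_eq \<Omega> a (H10 \<Omega>) u1 y1" and 2: "state_eq \<Omega> a (H10 \<Omega>) u2 y2"
    and u: "u1 \<in> L2v L" "u2 \<in> L2v L"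
  shows "L2vn L (\<lambda>x. y1 x - y2 x) \<le> Cp\<^sup>2 * L2vn L (\<lambda>x. u1 x - u2 x)"
proof -
  define e where "e x = y1 x - y2 x" for x
  define d where "d x = wgrad \<Omega> y1 x - wgrad \<Omega> y2 x" for x
  have ed: "H10g \<Omega> e d" unfolding e_def d_def by (intro H10g_diff state_eqD(1)[OF 1] state_eqD(1)[OF 2])
  note eL = H10gD(1)[OF ed] and dL = H10gD(2)[OF ed]
  have "(L2vn L d)\<^sup>2 = (\<integral>x. d x \<bullet> d x \<partial>L)" by (simp add: L2vn_sq power2_norm_eq_inner)
  also have "\<dots> = (\<integral>x. wgrad \<Omega> y1 x \<bullet> d x \<partial>L) - (\<integral>x. wgrad \<Omega> y2 x \<bullet> d x \<partial>L)"
  proof -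
    have "(\<integral>x. d x \<bullet> d x \<partial>L) = (\<integral>x. wgrad \<Omega> y1 x \<bullet> d x - wgrad \<Omega> y2 x \<bullet> d x \<partial>L)"
      by (intro Bochner_Integration.integral_cong refl) (simp add: d_def inner_diff_left)
    thus ?thesis
      using L2v_integrable_inner[OF H10gD(2)[OF state_eqD(1)[OF 1]] dL] L2v_integrable_inner[OF H10gD(2)[OF state_eqD(1)[OF 2]] dL]
      by simp
  qed
  also have "\<dots> = (\<integral>x. (u1 x - u2 x) * e x \<partial>L) - (\<integral>x. (a x (y1 x) - a x (y2 x)) * e x \<partial>L)"
  proof -
    have "(\<integral>x. (u1 x - u2 x) * e x \<partial>L) = (\<integral>x. u1 x * e x \<partial>L) - (\<integral>x. u2 x * e x \<partial>L)"
      unfolding left_diff_distrib by (intro Bochner_Integration.integral_diff L2v_integrable_mult u eL)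
    moreover have "(\<integral>x. (a x (y1 x) - a x (y2 x)) * e x \<partial>L) = (\<integral>x. a x (y1 x) * e x \<partial>L) - (\<integral>x. a x (y2 x) * e x \<partial>L)"
      unfolding left_diff_distrib
      by (intro Bochner_Integration.integral_diff state_eqD(2)[OF 1 ed] state_eqD(2)[OF 2 ed])
    ultimately show ?thesis using state_eqD(3)[OF 1 ed] state_eqD(3)[OF 2 ed] by argo
  qed
  also have "\<dots> \<le> (\<integral>x. (u1 x - u2 x) * e x \<partial>L)"
  proof -
    have "0 \<le> (\<integral>x. (a x (y1 x) - a x (y2 x)) * e x \<partial>L)"
      by (rule integral_nonneg_AE) (use a_mono in \<open>auto simp: e_def\<close>)
    thus ?thesis by simp
  qed
  also have "\<dots> \<le> L2vn L (\<lambda>x. u1 x - u2 x) * L2vn L e"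
    using L2v_CS_real[OF L2v_diff[OF u] eL] by simp
  also have "\<dots> \<le> L2vn L (\<lambda>x. u1 x - u2 x) * (Cp * L2vn L d)" by (intro mult_left_mono Cp(2) ed) simp
  finally have "L2vn L d * L2vn L d \<le> (Cp * L2vn L (\<lambda>x. u1 x - u2 x)) * L2vn L d"
    by (simp add: power2_eq_square algebra_simps)
  hence "L2vn L d \<le> Cp * L2vn L (\<lambda>x. u1 x - u2 x)"
    using L2vn_nonneg[of L d] Cp(1) by (cases "L2vn L d = 0") (auto simp: mult_le_cancel_right)
  hence "Cp * L2vn L d \<le> Cp * (Cp * L2vn L (\<lambda>x. u1 x - u2 x))" using Cp(1) by simp
  with Cp(2)[OF ed] show ?thesis by (simp add: e_def[abs_def] power2_eq_square)
qed

lemma state_unique: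
  assumes "state_eq \<Omega> a (H10 \<Omega>) u y1" "state_eq \<Omega> a (H10 \<Omega>) u y2" "u \<in> L2v L"
  shows "AE x in L. y1 x = y2 x"
proof -
  have z: "(\<lambda>x. y1 x - y2 x) \<in> L2v L"
    by (intro L2v_diff H10gD(1)[OF state_eqD(1)[OF assms(1)]] H10gD(1)[OF state_eqD(1)[OF assms(2)]])
  have "L2vn L (\<lambda>x. y1 x - y2 x) \<le> 0" using state_diff[OF assms(1,2,3,3)] by (simp add: L2vn_def)
  hence "L2vn L (\<lambda>x. y1 x - y2 x) = 0" by (simp add: order_antisym)
  thus ?thesis unfolding L2vn_eq_0_iff[OF z] by eventually_elim simp
qed

text \<open>Moving \<open>a x 0\<close> to the right-hand side leaves a nonlinear term that has the
  sign of \<open>y\<close> by monotonicity.\<close>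

lemma state_bound:
  assumes y: "state_eq \<Omega> a (H10 \<Omega>) u y" and u: "u \<in> L2v L"
  shows "AE x in L. \<bar>y x\<bar> \<le> Ci * L2vn L (\<lambda>x. u x - a x 0)"
proof (rule Ci_bound[OF state_eqD(1)[OF y] L2v_diff[OF u a0], where c = "\<lambda>x. a x (y x) - a x 0"])
  show "AE x in L. 0 \<le> (a x (y x) - a x 0) * y x" using a_mono
  proof eventually_elim
    case (elim x)
    from elim[rule_format, of "y x" 0] show ?case by simp
  qed
  fix w h assume wh: "H10g \<Omega> w h"
  have "(\<integral>x. (a x (y x) - a x 0) * w x \<partial>L) = (\<integral>x. a x (y x) * w x \<partial>L) - (\<integral>x. a x 0 * w x \<partial>L)"
    unfolding left_diff_distrib
    by (intro Bochner_Integration.integral_diff L2v_integrable_mult state_eqD(2)[OF y wh] a0 H10gD(1)[OF wh])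
  moreover have "(\<integral>x. (u x - a x 0) * w x \<partial>L) = (\<integral>x. u x * w x \<partial>L) - (\<integral>x. a x 0 * w x \<partial>L)"
    unfolding left_diff_distrib
    by (intro Bochner_Integration.integral_diff L2v_integrable_mult u a0 H10gD(1)[OF wh])
  ultimately show "(\<integral>x. wgrad \<Omega> y x \<bullet> h x \<partial>L) + (\<integral>x. (a x (y x) - a x 0) * w x \<partial>L) = (\<integral>x. (u x - a x 0) * w x \<partial>L)"
    using state_eqD(3)[OF y wh] by simp
qed

text \<open>A bounded nonnegative coefficient is a special Lipschitz monotone nonlinearity. The
  bound \<open>Q\<close> gives existence, while the sup bound of the solution is independent of
  it.\<close>

lemma linear_solution_exists:
  assumes q: "q \<in> borel_measurable L" "AE x in L. 0 \<le> q x \<and> q x \<le> Q" and f: "f \<in> L2v L"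
  obtains p k where "H10g \<Omega> p k" "\<And>v h. H10g \<Omega> v h \<Longrightarrow> (\<integral>x. k x \<bullet> h x \<partial>L) + (\<integral>x. q x * p x * v x \<partial>L) = (\<integral>x. f x * v x \<partial>L)"
    "AE x in L. \<bar>p x\<bar> \<le> Ci * L2vn L f"
proof -
  have qb: "AE x in L. \<bar>q x\<bar> \<le> \<bar>Q\<bar>" using q(2) by eventually_elim auto
  have bL: "(\<lambda>x. q x * y x) \<in> L2v L" if "y \<in> L2v L" for y
    using L2v_mult_bounded(1)[OF that q(1) qb] by simp
  have lip: "AE x in L. \<forall>s t. \<bar>q x * s - q x * t\<bar> \<le> \<bar>Q\<bar> * \<bar>s - t\<bar>"
    using qb by eventually_elim (simp add: abs_mult mult_right_mono flip: right_diff_distrib)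
  have mono: "AE x in L. \<forall>s t. 0 \<le> (q x * s - q x * t) * (s - t)"
    using q(2) by eventually_elim (simp add: mult.assoc flip: right_diff_distrib)
  obtain p k where pk: "H10g \<Omega> p k" "\<And>v h. H10g \<Omega> v h \<Longrightarrow> (\<integral>x. k x \<bullet> h x \<partial>L) + (\<integral>x. q x * p x * v x \<partial>L) = (\<integral>x. f x * v x \<partial>L)"
    by (rule monotone_Lipschitz_solution[OF f bL lip _ mono]) auto
  have "AE x in L. \<bar>p x\<bar> \<le> Ci * L2vn L f"
  proof (rule Ci_bound[OF pk(1) f, where c = "\<lambda>x. q x * p x"])
    show "AE x in L. 0 \<le> q x * p x * p x" using q(2) by eventually_elim (simp add: mult.assoc)
  qed (use pk(2) in auto)
  with pk that show ?thesis by blast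
qed

lemma da_bounded:
  assumes y: "y \<in> borel_measurable L" "AE x in L. \<bar>y x\<bar> \<le> K"
  obtains Q where "AE x in L. 0 \<le> deriv (a x) (y x) \<and> deriv (a x) (y x) \<le> Q"
proof -
  obtain \<Lambda> where \<Lambda>: "a_bounds (1 + \<bar>K\<bar>) \<Lambda>"
    using a_bounds_exists[OF abs_add_one_gt_zero[of K]] by blast
  have "AE x in L. 0 \<le> deriv (a x) (y x) \<and> deriv (a x) (y x) \<le> \<Lambda>"
    using y(2) a_deriv \<Lambda>[unfolded a_bounds_def, THEN conjunct2]
  proof eventually_elim
    case (elim x)
    have "\<bar>deriv (a x) (y x)\<bar> \<le> \<Lambda>" using elim(1) elim(3)[rule_format, of "y x" "y x"] by simp
    thus ?case using elim(2) by simp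
  qed
  with that show ?thesis by blast
qed

lemma adjoint_exists:
  assumes y: "y \<in> L2v L" "AE x in L. \<bar>y x\<bar> \<le> K"
  shows "\<exists>p. adjoint_eq \<Omega> a yd (H10 \<Omega>) y p"
proof -
  obtain Q where Q: "AE x in L. 0 \<le> deriv (a x) (y x) \<and> deriv (a x) (y x) \<le> Q"
    using da_bounded[OF L2v_meas[OF y(1)] y(2)] by blast
  note dm = da_comp_meas[OF L2v_meas[OF y(1)]]
  obtain p k where pk: "H10g \<Omega> p k" "\<And>v h. H10g \<Omega> v h \<Longrightarrow> (\<integral>x. k x \<bullet> h x \<partial>L) + (\<integral>x. deriv (a x) (y x) * p x * v x \<partial>L) = (\<integral>x. (y x - yd x) * v x \<partial>L)"
    by (rule linear_solution_exists[OF dm Q L2v_diff[OF y(1) yd]]) blast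
  have qb: "AE x in L. \<bar>deriv (a x) (y x)\<bar> \<le> \<bar>Q\<bar>" using Q by eventually_elim auto
  have "adjoint_eq \<Omega> a yd (H10 \<Omega>) y p"
    unfolding adjoint_eq_def L2_inner_def
  proof (intro conjI ballI)
    show "p \<in> H10 \<Omega>" by (rule H10gD_H10[OF pk(1)])
    fix w assume "w \<in> H10 \<Omega>"
    hence w: "H10g \<Omega> w (wgrad \<Omega> w)" by (rule H10_H10g)
    have "(\<lambda>x. deriv (a x) (y x) *\<^sub>R p x) \<in> L2v L" by (rule L2v_mult_bounded(1)[OF H10gD(1)[OF pk(1)] dm qb])
    thus "integrable L (\<lambda>x. deriv (a x) (y x) * p x * w x)"
      using L2v_integrable_mult[OF _ H10gD(1)[OF w]] by simp
    show "grad_inner \<Omega> w p + (\<integral>x. deriv (a x) (y x) * p x * w x \<partial>L) = (\<integral>x. (y x - yd x) * w x \<partial>L)"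
      using pk(2)[OF w] grad_inner_H10g[OF w pk(1)] by (simp add: inner_commute)
  qed
  thus ?thesis by blast
qed

text \<open>The coefficient is nonnegative, so its product with \<open>p\<close> has the sign of
  \<open>p\<close>. The bound therefore does not see the size of the coefficient, and holds for a
  discrete state without mesh-dependent constants.\<close>

lemma adjoint_bound:
  assumes p: "adjoint_eq \<Omega> a yd (H10 \<Omega>) y p" and y: "y \<in> L2v L"
  shows "AE x in L. \<bar>p x\<bar> \<le> Ci * L2vn L (\<lambda>x. y x - yd x)"
proof (rule Ci_bound[OF adjoint_eqD(1)[OF p] L2v_diff[OF y yd], where c = "\<lambda>x. deriv (a x) (y x) * p x"])
  show "AE x in L. 0 \<le> deriv (a x) (y x) * p x * p x" using a_deriv by eventually_elim (simp add: mult.assoc)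
qed (rule adjoint_eqD(3)[OF p])

lemma control_to_state: "u \<in> L2v L \<Longrightarrow> state_eq \<Omega> a (H10 \<Omega>) u (control_to_state \<Omega> a u)"
  unfolding control_to_state_def by (rule someI_ex[OF state_exists])

lemma cost_cong_AE:
  assumes "AE x in L. y x = z x" "y \<in> borel_measurable L" "z \<in> borel_measurable L"
  shows "cost \<Omega> \<nu> yd y u = cost \<Omega> \<nu> yd z u"
proof -
  have "L2vn L (\<lambda>x. y x - yd x) = L2vn L (\<lambda>x. z x - yd x)"
    by (rule L2vn_cong_AE) (use assms L2v_meas[OF yd] in auto)
  thus ?thesis by (simp add: cost_def L2_norm_eq)
qed

text \<open>\<open>control_to_state\<close> picks some solution; uniqueness up to null sets makes
  the cost independent of the choice.\<close>

lemma reduced_cost_state: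
  assumes "state_eq \<Omega> a (H10 \<Omega>) u y" "u \<in> L2v L"
  shows "reduced_cost \<Omega> a \<nu> yd u = cost \<Omega> \<nu> yd y u"
  unfolding reduced_cost_def
  by (rule cost_cong_AE[OF state_unique[OF control_to_state[OF assms(2)] assms]])
     (use H10gD(3)[OF state_eqD(1)] assms control_to_state in blast)+

lemma L2vn_sq_add:
  fixes f g :: "'a \<Rightarrow> real"
  assumes "f \<in> L2v L" "g \<in> L2v L"
  shows "(L2vn L (\<lambda>x. f x + g x))\<^sup>2 = (L2vn L f)\<^sup>2 + 2 * (\<integral>x. f x * g x \<partial>L) + (L2vn L g)\<^sup>2"
  using L2vn_add_scaleR_sq[OF assms, of 1 1] by simp

text \<open>Only the adjoint state enters: the linearised state equation is not needed, because the
  remainder is quadratic in the difference of the states.\<close>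

lemma reduced_cost_deriv:
  assumes y: "state_eq \<Omega> a (H10 \<Omega>) u y" and p: "adjoint_eq \<Omega> a yd (H10 \<Omega>) y p" and u: "u \<in> L2v L"
  shows "has_L2_deriv \<Omega> (reduced_cost \<Omega> a \<nu> yd) (\<lambda>v. \<integral>x. (p x + \<nu> * u x) * v x \<partial>L) u"
proof -
  note yL = H10gD(1)[OF state_eqD(1)[OF y]] and pL = H10gD(1)[OF adjoint_eqD(1)[OF p]]
  define \<pi> where "\<pi> x = p x + \<nu> * u x" for x
  have \<pi>L: "\<pi> \<in> L2v L" unfolding \<pi>_def by (intro L2v_add L2v_cmult pL u)
  define P where "P = Ci * L2vn L (\<lambda>x. y x - yd x)"
  have pP: "AE x in L. \<bar>p x\<bar> \<le> P" unfolding P_def by (rule adjoint_bound[OF p yL])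
  \<comment> \<open>Large enough to bound the states of all controls within L2 distance 1 of
    \<open>u\<close>.\<close>
  define K where "K = Ci * (1 + L2vn L (\<lambda>x. u x - a x 0)) + 1"
  have K: "K > 0" unfolding K_def using Ci_pos by (intro add_nonneg_pos mult_nonneg_nonneg) auto
  obtain \<Lambda> where \<Lambda>: "a_bounds K \<Lambda>" using a_bounds_exists[OF K] by blast
  have \<Lambda>0: "\<Lambda> > 0" using \<Lambda> by (simp add: a_bounds_def)
  \<comment> \<open>The state error contributes half its square from the cost and
    \<open>\<Lambda> * \<bar>P\<bar>\<close> times its square from the Taylor remainder; it is
    itself at most \<open>Cp^2\<close> times the norm of \<open>h\<close>. The last term is the
    quadratic control cost.\<close>
  define R where "R = (1/2 + \<Lambda> * \<bar>P\<bar>) * (Cp\<^sup>2)\<^sup>2 + \<bar>\<nu>\<bar> / 2"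
  have R0: "R \<ge> 0" unfolding R_def using \<Lambda>0 by (intro add_nonneg_nonneg mult_nonneg_nonneg) auto
  have main: "\<bar>reduced_cost \<Omega> a \<nu> yd (\<lambda>x. u x + h x) - reduced_cost \<Omega> a \<nu> yd u - (\<integral>x. \<pi> x * h x \<partial>L)\<bar> \<le> R * (L2vn L h)\<^sup>2"
    if h: "h \<in> L2v L" "L2vn L h \<le> 1" for h
  proof -
    define uh where "uh x = u x + h x" for x
    have uhL: "uh \<in> L2v L" unfolding uh_def by (intro L2v_add u h)
    obtain yh where yh: "state_eq \<Omega> a (H10 \<Omega>) uh yh" using state_exists[OF uhL] by blast
    note yhL = H10gD(1)[OF state_eqD(1)[OF yh]]
    define e where "e x = yh x - y x" for x
    define k where "k x = wgrad \<Omega> yh x - wgrad \<Omega> y x" for x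
    have ek: "H10g \<Omega> e k" unfolding e_def k_def by (intro H10g_diff state_eqD(1)[OF yh] state_eqD(1)[OF y])
    note eL = H10gD(1)[OF ek]
    have en: "L2vn L e \<le> Cp\<^sup>2 * L2vn L h"
      using state_diff[OF yh y uhL u] by (simp add: e_def[abs_def] uh_def)
    have yK: "AE x in L. \<bar>y x\<bar> \<le> K"
    proof -
      have "Ci * L2vn L (\<lambda>x. u x - a x 0) \<le> K" using Ci_pos by (simp add: K_def algebra_simps)
      thus ?thesis using state_bound[OF y u] by (auto elim: eventually_mono)
    qed
    have yhK: "AE x in L. \<bar>yh x\<bar> \<le> K"
    proof -
      have "L2vn L (\<lambda>x. uh x - a x 0) = L2vn L (\<lambda>x. h x + (u x - a x 0))" by (simp add: uh_def algebra_simps)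
      also have "\<dots> \<le> 1 + L2vn L (\<lambda>x. u x - a x 0)" using L2vn_triangle[OF h(1) L2v_diff[OF u a0]] h(2) by simp
      finally have "Ci * L2vn L (\<lambda>x. uh x - a x 0) \<le> Ci * (1 + L2vn L (\<lambda>x. u x - a x 0))" using Ci_pos by simp
      hence "Ci * L2vn L (\<lambda>x. uh x - a x 0) \<le> K" by (simp add: K_def)
      thus ?thesis using state_bound[OF yh uhL] by (auto elim: eventually_mono)
    qed
    have ayL: "(\<lambda>x. a x (y x)) \<in> L2v L" and ayhL: "(\<lambda>x. a x (yh x)) \<in> L2v L"
      using a_comp_L2v L2v_meas yL yhL yK yhK by blast+
    define \<rho> where "\<rho> x = a x (yh x) - a x (y x) - deriv (a x) (y x) * e x" for x
    obtain Q where Q: "AE x in L. 0 \<le> deriv (a x) (y x) \<and> deriv (a x) (y x) \<le> Q"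
      using da_bounded[OF L2v_meas[OF yL] yK] by blast
    have qb: "AE x in L. \<bar>deriv (a x) (y x)\<bar> \<le> \<bar>Q\<bar>" using Q by eventually_elim auto
    have deL: "(\<lambda>x. deriv (a x) (y x) * e x) \<in> L2v L"
      using L2v_mult_bounded(1)[OF eL da_comp_meas[OF L2v_meas[OF yL]] qb] by simp
    have \<rho>L: "\<rho> \<in> L2v L" unfolding \<rho>_def by (intro L2v_diff ayhL ayL deL)
    have k1: "(\<integral>x. k x \<bullet> wgrad \<Omega> p x \<partial>L) = (\<integral>x. h x * p x \<partial>L) - (\<integral>x. (a x (yh x) - a x (y x)) * p x \<partial>L)"
    proof -
      note pp = adjoint_eqD(1)[OF p]
      have "(\<integral>x. k x \<bullet> wgrad \<Omega> p x \<partial>L) = (\<integral>x. wgrad \<Omega> yh x \<bullet> wgrad \<Omega> p x \<partial>L) - (\<integral>x. wgrad \<Omega> y x \<bullet> wgrad \<Omega> p x \<partial>L)"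
        unfolding k_def inner_diff_left
        by (intro Bochner_Integration.integral_diff L2v_integrable_inner H10gD(2)[OF state_eqD(1)[OF yh]] H10gD(2)[OF state_eqD(1)[OF y]] H10gD(2)[OF pp])
      also have "\<dots> = ((\<integral>x. uh x * p x \<partial>L) - (\<integral>x. u x * p x \<partial>L)) - ((\<integral>x. a x (yh x) * p x \<partial>L) - (\<integral>x. a x (y x) * p x \<partial>L))"
        using state_eqD(3)[OF yh pp] state_eqD(3)[OF y pp] by argo
      also have "(\<integral>x. uh x * p x \<partial>L) - (\<integral>x. u x * p x \<partial>L) = (\<integral>x. h x * p x \<partial>L)"
        unfolding uh_def distrib_right
        by (subst Bochner_Integration.integral_add) (auto intro!: L2v_integrable_mult u h pL)
      also have "(\<integral>x. a x (yh x) * p x \<partial>L) - (\<integral>x. a x (y x) * p x \<partial>L) = (\<integral>x. (a x (yh x) - a x (y x)) * p x \<partial>L)"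
        unfolding left_diff_distrib
        by (intro Bochner_Integration.integral_diff[symmetric] L2v_integrable_mult ayL ayhL pL)
      finally show ?thesis .
    qed
    \<comment> \<open>The adjoint equation is tested with \<open>e\<close> and the difference of the
      state equations with \<open>p\<close>; the gradient terms coincide, and beyond the linear term
      only the Taylor remainder \<open>\<rho>\<close> is left.\<close>
    have "(\<integral>x. (y x - yd x) * e x \<partial>L) = (\<integral>x. wgrad \<Omega> p x \<bullet> k x \<partial>L) + (\<integral>x. deriv (a x) (y x) * p x * e x \<partial>L)"
      using adjoint_eqD(3)[OF p ek] by simp
    also have "(\<integral>x. wgrad \<Omega> p x \<bullet> k x \<partial>L) = (\<integral>x. h x * p x \<partial>L) - (\<integral>x. (a x (yh x) - a x (y x)) * p x \<partial>L)"
      using k1 by (simp add: inner_commute)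
    also have "(\<integral>x. deriv (a x) (y x) * p x * e x \<partial>L) = (\<integral>x. (a x (yh x) - a x (y x)) * p x \<partial>L) - (\<integral>x. \<rho> x * p x \<partial>L)"
    proof -
      have "(\<integral>x. \<rho> x * p x \<partial>L) = (\<integral>x. (a x (yh x) - a x (y x)) * p x - deriv (a x) (y x) * e x * p x \<partial>L)"
        by (simp add: \<rho>_def left_diff_distrib)
      also have "\<dots> = (\<integral>x. (a x (yh x) - a x (y x)) * p x \<partial>L) - (\<integral>x. deriv (a x) (y x) * e x * p x \<partial>L)"
        by (intro Bochner_Integration.integral_diff L2v_integrable_mult L2v_diff ayhL ayL deL pL)
      finally show ?thesis by (simp add: mult_ac)
    qed
    finally have dual: "(\<integral>x. (y x - yd x) * e x \<partial>L) = (\<integral>x. h x * p x \<partial>L) - (\<integral>x. \<rho> x * p x \<partial>L)" by simp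
    have "reduced_cost \<Omega> a \<nu> yd uh = 1/2 * (L2vn L (\<lambda>x. (y x - yd x) + e x))\<^sup>2 + \<nu>/2 * (L2vn L (\<lambda>x. u x + h x))\<^sup>2"
      unfolding reduced_cost_state[OF yh uhL] cost_def L2_norm_eq by (simp add: e_def uh_def[abs_def])
    also have "\<dots> = 1/2 * ((L2vn L (\<lambda>x. y x - yd x))\<^sup>2 + 2 * (\<integral>x. (y x - yd x) * e x \<partial>L) + (L2vn L e)\<^sup>2)
       + \<nu>/2 * ((L2vn L u)\<^sup>2 + 2 * (\<integral>x. u x * h x \<partial>L) + (L2vn L h)\<^sup>2)"
      by (simp only: L2vn_sq_add[OF L2v_diff[OF yL yd] eL] L2vn_sq_add[OF u h(1)])
    finally have r1: "reduced_cost \<Omega> a \<nu> yd uh = 1/2 * (L2vn L (\<lambda>x. y x - yd x))\<^sup>2 + (\<integral>x. (y x - yd x) * e x \<partial>L)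
      + 1/2 * (L2vn L e)\<^sup>2 + \<nu>/2 * (L2vn L u)\<^sup>2 + \<nu> * (\<integral>x. u x * h x \<partial>L) + \<nu>/2 * (L2vn L h)\<^sup>2"
      by (simp add: algebra_simps)
    have r0: "reduced_cost \<Omega> a \<nu> yd u = 1/2 * (L2vn L (\<lambda>x. y x - yd x))\<^sup>2 + \<nu>/2 * (L2vn L u)\<^sup>2"
      unfolding reduced_cost_state[OF y u] cost_def L2_norm_eq by simp
    have r2: "(\<integral>x. \<pi> x * h x \<partial>L) = (\<integral>x. h x * p x \<partial>L) + \<nu> * (\<integral>x. u x * h x \<partial>L)"
    proof -
      have "(\<integral>x. \<pi> x * h x \<partial>L) = (\<integral>x. h x * p x + \<nu> * (u x * h x) \<partial>L)" by (simp add: \<pi>_def algebra_simps)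
      thus ?thesis using L2v_integrable_mult[OF h(1) pL] L2v_integrable_mult[OF u h(1)] by simp
    qed
    \<comment> \<open>All first-order terms cancel; what remains is quadratic in
      \<open>h\<close>.\<close>
    have eq: "reduced_cost \<Omega> a \<nu> yd uh - reduced_cost \<Omega> a \<nu> yd u - (\<integral>x. \<pi> x * h x \<partial>L)
       = 1/2 * (L2vn L e)\<^sup>2 - (\<integral>x. \<rho> x * p x \<partial>L) + \<nu>/2 * (L2vn L h)\<^sup>2"
      unfolding r0 r1 r2 dual by simp
    have "\<bar>\<integral>x. \<rho> x * p x \<partial>L\<bar> \<le> (\<integral>x. \<Lambda> * \<bar>P\<bar> * (norm (e x))\<^sup>2 \<partial>L)"
    proof (rule order_trans[OF integral_abs_bound], rule integral_mono_AE)
      show "integrable L (\<lambda>x. \<bar>\<rho> x * p x\<bar>)" by (intro integrable_abs L2v_integrable_mult \<rho>L pL)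
      show "integrable L (\<lambda>x. \<Lambda> * \<bar>P\<bar> * (norm (e x))\<^sup>2)" by (intro integrable_mult_right L2v_integrable eL)
      show "AE x in L. \<bar>\<rho> x * p x\<bar> \<le> \<Lambda> * \<bar>P\<bar> * (norm (e x))\<^sup>2"
        using yK yhK pP \<Lambda>[unfolded a_bounds_def, THEN conjunct2]
      proof eventually_elim
        case (elim x)
        have "\<bar>\<rho> x\<bar> \<le> \<Lambda> * \<bar>yh x - y x\<bar>\<^sup>2" unfolding \<rho>_def e_def using elim by blast
        hence "\<bar>\<rho> x\<bar> * \<bar>p x\<bar> \<le> (\<Lambda> * \<bar>yh x - y x\<bar>\<^sup>2) * \<bar>P\<bar>" using elim(3) by (intro mult_mono) auto
        thus ?case by (simp add: abs_mult e_def algebra_simps)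
      qed
    qed
    also have "\<dots> = \<Lambda> * \<bar>P\<bar> * (L2vn L e)\<^sup>2" by (simp add: L2vn_sq)
    finally have \<rho>b: "\<bar>\<integral>x. \<rho> x * p x \<partial>L\<bar> \<le> \<Lambda> * \<bar>P\<bar> * (L2vn L e)\<^sup>2" .
    have e2: "(L2vn L e)\<^sup>2 \<le> (Cp\<^sup>2)\<^sup>2 * (L2vn L h)\<^sup>2"
      unfolding power_mult_distrib[symmetric] by (intro power_mono en) simp
    have "\<bar>1/2 * (L2vn L e)\<^sup>2 - (\<integral>x. \<rho> x * p x \<partial>L) + \<nu>/2 * (L2vn L h)\<^sup>2\<bar>
      \<le> 1/2 * (L2vn L e)\<^sup>2 + \<Lambda> * \<bar>P\<bar> * (L2vn L e)\<^sup>2 + \<bar>\<nu>\<bar>/2 * (L2vn L h)\<^sup>2"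
    proof -
      have "\<bar>\<nu>/2 * (L2vn L h)\<^sup>2\<bar> = \<bar>\<nu>\<bar>/2 * (L2vn L h)\<^sup>2" by (simp add: abs_mult)
      moreover have "0 \<le> 1/2 * (L2vn L e)\<^sup>2" by simp
      ultimately show ?thesis using \<rho>b by linarith
    qed
    also have "\<dots> = (1/2 + \<Lambda> * \<bar>P\<bar>) * (L2vn L e)\<^sup>2 + \<bar>\<nu>\<bar>/2 * (L2vn L h)\<^sup>2" by (simp add: algebra_simps)
    also have "\<dots> \<le> (1/2 + \<Lambda> * \<bar>P\<bar>) * ((Cp\<^sup>2)\<^sup>2 * (L2vn L h)\<^sup>2) + \<bar>\<nu>\<bar>/2 * (L2vn L h)\<^sup>2"
      using e2 \<Lambda>0 by (intro add_mono mult_left_mono) auto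
    also have "\<dots> = R * (L2vn L h)\<^sup>2" by (simp add: R_def algebra_simps)
    finally show ?thesis using eq by (simp add: uh_def[abs_def])
  qed
  show ?thesis
    unfolding has_L2_deriv_def L2_linear_def L2_eq_L2v L2_norm_eq \<pi>_def[symmetric]
  proof (intro conjI ballI allI impI)
    fix v w :: "'a \<Rightarrow> real" assume "v \<in> L2v L" "w \<in> L2v L"
    thus "(\<integral>x. \<pi> x * (v x + w x) \<partial>L) = (\<integral>x. \<pi> x * v x \<partial>L) + (\<integral>x. \<pi> x * w x \<partial>L)"
      using L2v_integrable_mult[OF \<pi>L] by (simp add: distrib_left)
  next
    fix c :: real and v :: "'a \<Rightarrow> real" assume "v \<in> L2v L"
    show "(\<integral>x. \<pi> x * (c * v x) \<partial>L) = c * (\<integral>x. \<pi> x * v x \<partial>L)" by (simp add: mult.left_commute)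
  next
    show "\<exists>K. \<forall>v\<in>L2v L. \<bar>\<integral>x. \<pi> x * v x \<partial>L\<bar> \<le> K * L2vn L v" using L2v_CS_real[OF \<pi>L] by blast
  next
    fix \<epsilon> :: real assume \<epsilon>: "\<epsilon> > 0"
    define \<delta> where "\<delta> = min 1 (\<epsilon> / (R + 1))"
    have \<delta>: "\<delta> > 0" unfolding \<delta>_def using \<epsilon> R0 by simp
    have "\<bar>reduced_cost \<Omega> a \<nu> yd (\<lambda>x. u x + h x) - reduced_cost \<Omega> a \<nu> yd u - (\<integral>x. \<pi> x * h x \<partial>L)\<bar> \<le> \<epsilon> * L2vn L h"
      if h: "h \<in> L2v L" "L2vn L h < \<delta>" for h
    proof -
      have "R * L2vn L h \<le> (R + 1) * (\<epsilon> / (R + 1))" using h R0 by (intro mult_mono) (auto simp: \<delta>_def)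
      also have "\<dots> = \<epsilon>" using R0 by simp
      finally have "R * L2vn L h * L2vn L h \<le> \<epsilon> * L2vn L h" by (intro mult_right_mono) auto
      thus ?thesis using main[OF h(1)] h(2) by (simp add: power2_eq_square mult.assoc \<delta>_def)
    qed
    with \<delta> show "\<exists>\<delta>>0. \<forall>h\<in>L2v L. L2vn L h < \<delta> \<longrightarrow>
        \<bar>reduced_cost \<Omega> a \<nu> yd (\<lambda>x. u x + h x) - reduced_cost \<Omega> a \<nu> yd u - (\<integral>x. \<pi> x * h x \<partial>L)\<bar> \<le> \<epsilon> * L2vn L h"
      by blast
  qed
qed

lemma U_ad_bounded: "u \<in> U_ad \<Omega> lb ub \<Longrightarrow> u \<in> L2v L" "u \<in> U_ad \<Omega> lb ub \<Longrightarrow> AE x in L. lb \<le> u x \<and> u x \<le> ub"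
  by (auto simp: U_ad_def L2_eq_L2v)

text \<open>The admissible set is convex, so the segment from \<open>u\<close> to \<open>u'\<close>
  may be followed for a short time, where local minimality forbids a decrease of the cost.\<close>

lemma first_order_condition:
  assumes sol: "local_solution \<Omega> a \<nu> yd (H10 \<Omega>) (U_ad \<Omega> lb ub) y u" and p: "adjoint_eq \<Omega> a yd (H10 \<Omega>) y p"
    and u': "u' \<in> U_ad \<Omega> lb ub"
  shows "0 \<le> (\<integral>x. (p x + \<nu> * u x) * (u' x - u x) \<partial>L)"
proof -
  have uU: "u \<in> U_ad \<Omega> lb ub" and y: "state_eq \<Omega> a (H10 \<Omega>) u y" using sol by (auto simp: local_solution_def)
  obtain \<epsilon> where \<epsilon>: "\<epsilon> > 0" "\<And>w z. w \<in> U_ad \<Omega> lb ub \<Longrightarrow> state_eq \<Omega> a (H10 \<Omega>) w z \<Longrightarrow> L2vn L (\<lambda>x. w x - u x) < \<epsilon> \<Longrightarrow>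
        cost \<Omega> \<nu> yd y u \<le> cost \<Omega> \<nu> yd z w"
    using sol unfolding local_solution_def L2_norm_eq by blast
  note uL = U_ad_bounded(1)[OF uU] and u'L = U_ad_bounded(1)[OF u']
  define v where "v x = u' x - u x" for x
  have vL: "v \<in> L2v L" unfolding v_def by (intro L2v_diff uL u'L)
  define D where "D w = (\<integral>x. (p x + \<nu> * u x) * w x \<partial>L)" for w
  have der: "has_L2_deriv \<Omega> (reduced_cost \<Omega> a \<nu> yd) D u"
    unfolding D_def by (rule reduced_cost_deriv[OF y p uL])
  have "0 \<le> D v"
  proof (rule field_le_epsilon)
    fix e :: real assume e: "e > 0"
    define \<eta> where "\<eta> = e / (L2vn L v + 1)"
    have n: "L2vn L v + 1 > 0" by (simp add: add_nonneg_pos)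
    have \<eta>: "\<eta> > 0" unfolding \<eta>_def using e n by simp
    obtain \<delta> where \<delta>: "\<delta> > 0" "\<And>h. h \<in> L2v L \<Longrightarrow> L2vn L h < \<delta> \<Longrightarrow>
        \<bar>reduced_cost \<Omega> a \<nu> yd (\<lambda>x. u x + h x) - reduced_cost \<Omega> a \<nu> yd u - D h\<bar> \<le> \<eta> * L2vn L h"
      using der \<eta> unfolding has_L2_deriv_def L2_eq_L2v L2_norm_eq by blast
    \<comment> \<open>Keeps the step on the segment, inside the radius \<open>\<epsilon>\<close> of
      local minimality and inside the radius \<open>\<delta>\<close> of the differentiability
      estimate.\<close>
    define t where "t = min 1 (min \<delta> \<epsilon> / (2 * (L2vn L v + 1)))"
    have t: "0 < t" "t \<le> 1" unfolding t_def using \<delta> \<epsilon> n by auto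
    have "t * L2vn L v \<le> min \<delta> \<epsilon> / (2 * (L2vn L v + 1)) * (L2vn L v + 1)"
      using t \<delta> \<epsilon> by (intro mult_mono) (auto simp: t_def)
    also have "\<dots> = min \<delta> \<epsilon> / 2" using n by (simp add: field_simps)
    also have "\<dots> < min \<delta> \<epsilon>" using \<delta> \<epsilon> by auto
    finally have tn: "t * L2vn L v < \<delta>" "t * L2vn L v < \<epsilon>" by auto
    define h where "h x = t * v x" for x
    have hL: "h \<in> L2v L" unfolding h_def by (rule L2v_cmult[OF vL])
    have hn: "L2vn L h = t * L2vn L v" unfolding h_def using t by (simp add: L2vn_cmult)
    define w where "w x = u x + h x" for x
    have wL: "w \<in> L2v L" unfolding w_def by (intro L2v_add uL hL)
    have "AE x in L. lb \<le> w x \<and> w x \<le> ub"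
      using U_ad_bounded(2)[OF uU] U_ad_bounded(2)[OF u']
    proof eventually_elim
      case (elim x)
      have "w x = (1 - t) * u x + t * u' x" by (simp add: w_def h_def v_def algebra_simps)
      moreover have "(1 - t) * lb + t * lb \<le> (1 - t) * u x + t * u' x" "(1 - t) * u x + t * u' x \<le> (1 - t) * ub + t * ub"
        using elim t by (intro add_mono mult_left_mono; simp)+
      ultimately show ?case by (simp add: algebra_simps)
    qed
    hence wU: "w \<in> U_ad \<Omega> lb ub" using wL by (simp add: U_ad_def L2_eq_L2v)
    obtain z where z: "state_eq \<Omega> a (H10 \<Omega>) w z" using state_exists[OF wL] by blast
    have "L2vn L (\<lambda>x. w x - u x) < \<epsilon>" using tn hn by (simp add: w_def)
    from \<epsilon>(2)[OF wU z this] have "reduced_cost \<Omega> a \<nu> yd u \<le> reduced_cost \<Omega> a \<nu> yd w"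
      by (simp add: reduced_cost_state[OF z wL] reduced_cost_state[OF y uL])
    moreover have "\<bar>reduced_cost \<Omega> a \<nu> yd w - reduced_cost \<Omega> a \<nu> yd u - D h\<bar> \<le> \<eta> * (t * L2vn L v)"
      using \<delta>(2)[OF hL] tn hn by (simp add: w_def[abs_def])
    moreover have "D h = t * D v" unfolding D_def h_def by (simp add: mult.left_commute)
    ultimately have "0 \<le> t * D v + \<eta> * (t * L2vn L v)" by argo
    hence "0 \<le> t * (D v + \<eta> * L2vn L v)" by (simp add: algebra_simps)
    hence "0 \<le> D v + \<eta> * L2vn L v" using t by (simp add: zero_le_mult_iff)
    also have "\<eta> * L2vn L v \<le> \<eta> * (L2vn L v + 1)" using \<eta> by (intro mult_left_mono) auto
    also have "\<dots> = e" unfolding \<eta>_def using n by simp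
    finally show "0 \<le> D v + e" by simp
  qed
  thus ?thesis by (simp add: D_def v_def)
qed

end


section \<open>Stability of the adjoint state without a uniform bound on the discrete state\<close>

context semilinear
begin

abbreviation (input) "m\<Omega> \<equiv> sqrt (measure L \<Omega>)"

lemma L2v_bounded:
  fixes f :: "'a \<Rightarrow> real"
  assumes "f \<in> borel_measurable L" "AE x in L. \<bar>f x\<bar> \<le> B"
  shows "f \<in> L2v L" "B \<ge> 0 \<Longrightarrow> L2vn L f \<le> B * m\<Omega>"
  using L2v_Bounded[OF finite_L assms(1), of B] assms(2) by auto

lemma AE_abs_leD:
  assumes "AE x in L. \<bar>f x\<bar> \<le> B" "B \<le> C" shows "AE x in L. \<bar>f x\<bar> \<le> (C::real)"
  using assms(1) by eventually_elim (use assms(2) in linarith)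

text \<open>Galerkin orthogonality with the discrete state itself as test function.  Where the discrete
  state exceeds \<open>2 K + 1\<close>, monotonicity absorbs the nonlinear term, so that no bound on the
  discrete state is needed.\<close>

lemma discrete_state_energy:
  assumes V: "V \<subseteq> H10 \<Omega>" and uL: "u \<in> L2v L"
    and yT: "state_eq \<Omega> a V u yT" and yTb: "AE x in L. \<bar>yT x\<bar> \<le> KT"
    and y: "state_eq \<Omega> a (H10 \<Omega>) u y" and yK: "AE x in L. \<bar>y x\<bar> \<le> K" and K: "K \<ge> 0"
    and \<Lambda>: "a_bounds (2 * K + 1) \<Lambda>"
  shows "(L2vn L (\<lambda>x. wgrad \<Omega> y x - wgrad \<Omega> yT x))\<^sup>2
    \<le> (L2vn L (\<lambda>x. u x - a x (y x)) + \<Lambda> * K * m\<Omega>) * L2vn L (\<lambda>x. y x - yT x)"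
proof -
  have \<Lambda>0: "\<Lambda> > 0" using \<Lambda> by (simp add: a_bounds_def)
  have yTV: "yT \<in> V" using yT by (simp add: state_eq_def)
  have hT: "H10g \<Omega> yT (wgrad \<Omega> yT)" using V yTV H10_H10g by blast
  note h = state_eqD(1)[OF y]
  define e where "e x = y x - yT x" for x
  define d where "d x = wgrad \<Omega> y x - wgrad \<Omega> yT x" for x
  have ed: "H10g \<Omega> e d" unfolding e_def d_def by (intro H10g_diff h hT)
  note eL = H10gD(1)[OF ed] and dL = H10gD(2)[OF ed]
  have ayL: "(\<lambda>x. a x (y x)) \<in> L2v L" by (rule a_comp_L2v[OF H10gD(3)[OF h] yK])
  have ayTL: "(\<lambda>x. a x (yT x)) \<in> L2v L" by (rule a_comp_L2v[OF H10gD(3)[OF hT] yTb])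
  define \<Delta> where "\<Delta> x = a x (y x) - a x (yT x)" for x
  have \<Delta>L: "\<Delta> \<in> L2v L" unfolding \<Delta>_def by (intro L2v_diff ayL ayTL)
  \<comment> \<open>Galerkin orthogonality: \<open>yT\<close> is admissible as a test function in
    the discrete and in the continuous equation.\<close>
  have dTest: "(\<integral>x. d x \<bullet> wgrad \<Omega> yT x \<partial>L) = - (\<integral>x. \<Delta> x * yT x \<partial>L)"
  proof -
    have 1: "(\<integral>x. wgrad \<Omega> yT x \<bullet> wgrad \<Omega> yT x \<partial>L) + (\<integral>x. a x (yT x) * yT x \<partial>L) = (\<integral>x. u x * yT x \<partial>L)"
      using yT yTV unfolding state_eq_def L2_inner_def grad_inner_H10g[OF hT hT, symmetric] by blast
    have 2: "(\<integral>x. wgrad \<Omega> y x \<bullet> wgrad \<Omega> yT x \<partial>L) + (\<integral>x. a x (y x) * yT x \<partial>L) = (\<integral>x. u x * yT x \<partial>L)"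
      by (rule state_eqD(3)[OF y hT])
    have 3: "(\<integral>x. d x \<bullet> wgrad \<Omega> yT x \<partial>L) = (\<integral>x. wgrad \<Omega> y x \<bullet> wgrad \<Omega> yT x \<partial>L) - (\<integral>x. wgrad \<Omega> yT x \<bullet> wgrad \<Omega> yT x \<partial>L)"
      unfolding d_def inner_diff_left
      by (intro Bochner_Integration.integral_diff L2v_integrable_inner H10gD(2)[OF h] H10gD(2)[OF hT])
    have 4: "(\<integral>x. \<Delta> x * yT x \<partial>L) = (\<integral>x. a x (y x) * yT x \<partial>L) - (\<integral>x. a x (yT x) * yT x \<partial>L)"
      unfolding \<Delta>_def left_diff_distrib
      by (intro Bochner_Integration.integral_diff L2v_integrable_mult ayL ayTL H10gD(1)[OF hT])
    show ?thesis using 1 2 3 4 by argo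
  qed
  have "(L2vn L d)\<^sup>2 = (\<integral>x. d x \<bullet> d x \<partial>L)" by (simp add: L2vn_sq power2_norm_eq_inner)
  \<comment> \<open>The first product is handled by the continuous equation tested with
    \<open>e\<close>, the second by orthogonality. The discrete equation is not tested with
    \<open>e\<close>, which need not lie in \<open>V\<close>.\<close>
  also have "\<dots> = (\<integral>x. wgrad \<Omega> y x \<bullet> d x - d x \<bullet> wgrad \<Omega> yT x \<partial>L)"
    by (intro Bochner_Integration.integral_cong refl) (simp add: d_def inner_diff_left inner_diff_right inner_commute)
  also have "\<dots> = (\<integral>x. wgrad \<Omega> y x \<bullet> d x \<partial>L) - (\<integral>x. d x \<bullet> wgrad \<Omega> yT x \<partial>L)"
    by (intro Bochner_Integration.integral_diff L2v_integrable_inner dL H10gD(2)[OF h] H10gD(2)[OF hT])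
  also have "(\<integral>x. wgrad \<Omega> y x \<bullet> d x \<partial>L) = (\<integral>x. u x * e x \<partial>L) - (\<integral>x. a x (y x) * e x \<partial>L)"
    using state_eqD(3)[OF y ed] by simp
  also have "\<dots> = (\<integral>x. (u x - a x (y x)) * e x \<partial>L)"
    unfolding left_diff_distrib by (intro Bochner_Integration.integral_diff[symmetric] L2v_integrable_mult uL ayL eL)
  also have "\<dots> - (\<integral>x. d x \<bullet> wgrad \<Omega> yT x \<partial>L) = (\<integral>x. (u x - a x (y x)) * e x \<partial>L) + (\<integral>x. \<Delta> x * yT x \<partial>L)"
    unfolding dTest by simp
  also have "\<dots> \<le> L2vn L (\<lambda>x. u x - a x (y x)) * L2vn L e + \<Lambda> * K * (L2vn L e * m\<Omega>)"
  proof (rule add_mono)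
    show "(\<integral>x. (u x - a x (y x)) * e x \<partial>L) \<le> L2vn L (\<lambda>x. u x - a x (y x)) * L2vn L e"
      using L2v_CS_real[OF L2v_diff[OF uL ayL] eL] by simp
    have "(\<integral>x. \<Delta> x * yT x \<partial>L) \<le> (\<integral>x. \<Lambda> * K * norm (e x) \<partial>L)"
    proof (rule integral_mono_AE)
      show "integrable L (\<lambda>x. \<Delta> x * yT x)" by (intro L2v_integrable_mult \<Delta>L H10gD(1)[OF hT])
      show "integrable L (\<lambda>x. \<Lambda> * K * norm (e x))" by (intro integrable_mult_right L2v_integrable_norm(1)[OF finite_L eL])
      show "AE x in L. \<Delta> x * yT x \<le> \<Lambda> * K * norm (e x)"
        using yK a_mono \<Lambda>[unfolded a_bounds_def, THEN conjunct2]
      proof eventually_elim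
        case (elim x)
        have mono: "0 \<le> \<Delta> x * e x" unfolding \<Delta>_def e_def using elim(2) by blast
        have split: "\<Delta> x * yT x = \<Delta> x * y x - \<Delta> x * e x" by (simp add: e_def algebra_simps)
        have "\<bar>\<Delta> x * y x\<bar> \<le> \<bar>\<Delta> x\<bar> * K" using elim(1) by (simp add: abs_mult mult_left_mono)
        hence yle: "\<Delta> x * y x \<le> \<bar>\<Delta> x\<bar> * K" by linarith
        show ?case
        proof (cases "\<bar>yT x\<bar> \<le> 2 * K + 1")
          case True
          have yK': "\<bar>y x\<bar> \<le> 2 * K + 1" using elim(1) K by linarith
          have "\<bar>\<Delta> x\<bar> \<le> \<Lambda> * \<bar>e x\<bar>" unfolding \<Delta>_def e_def using elim(3)[rule_format, OF yK' True] by blast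
          hence "\<bar>\<Delta> x\<bar> * K \<le> \<Lambda> * \<bar>e x\<bar> * K" using K by (intro mult_right_mono)
          also have "\<dots> = \<Lambda> * K * norm (e x)" by simp
          finally have "\<bar>\<Delta> x\<bar> * K \<le> \<Lambda> * K * norm (e x)" .
          thus ?thesis using split yle mono by linarith
        next
          case False
          \<comment> \<open>With \<open>yT\<close> beyond \<open>2 * K + 1\<close> and
            \<open>y\<close> below \<open>K\<close> the error exceeds
            \<open>\<bar>y x\<bar>\<close>, so the monotone term \<open>\<Delta> x * e x\<close>
            outweighs \<open>\<Delta> x * y x\<close>.\<close>
          have "\<bar>e x\<bar> \<ge> K" unfolding e_def using False elim(1) K by linarith
          hence "\<bar>\<Delta> x\<bar> * K \<le> \<bar>\<Delta> x\<bar> * \<bar>e x\<bar>" by (intro mult_left_mono) auto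
          also have "\<dots> = \<Delta> x * e x" using mono by (simp flip: abs_mult)
          finally have "\<Delta> x * yT x \<le> 0" using split yle by linarith
          also have "0 \<le> \<Lambda> * K * norm (e x)" using \<Lambda>0 K by simp
          finally show ?thesis .
        qed
      qed
    qed
    also have "\<dots> = \<Lambda> * K * (\<integral>x. norm (e x) \<partial>L)" by simp
    also have "\<dots> \<le> \<Lambda> * K * (L2vn L e * m\<Omega>)"
      using L2v_integrable_norm(2)[OF finite_L eL] \<Lambda>0 K by (intro mult_left_mono) auto
    finally show "(\<integral>x. \<Delta> x * yT x \<partial>L) \<le> \<Lambda> * K * (L2vn L e * m\<Omega>)" .
  qed
  finally show ?thesis by (simp add: e_def[abs_def] d_def[abs_def] algebra_simps)
qed

text \<open>\<open>\<theta> = e\<^sup>2 / (1 + e\<^sup>2)\<close> is a cut-off around the set where \<open>e\<close> is large.  The capacity of that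
  set is controlled by the energy of \<open>e\<close>, hence linearly by its \<open>L2\<close> norm, and so is the mass that
  an unbounded coefficient \<open>q\<close> can create there.\<close>

lemma large_coefficient_mass:
  assumes e: "H10g \<Omega> e d" and energy: "(L2vn L d)\<^sup>2 \<le> E * L2vn L e"
    and p: "H10g \<Omega> p k" and pB: "AE x in L. \<bar>p x\<bar> \<le> B" and B: "B \<ge> 0"
    and q: "q \<in> borel_measurable L" "AE x in L. 0 \<le> q x \<and> q x \<le> Q" and f: "f \<in> L2v L" "L2vn L f \<le> F"
    and eq: "\<And>w h. H10g \<Omega> w h \<Longrightarrow> (\<integral>x. k x \<bullet> h x \<partial>L) + (\<integral>x. q x * p x * w x \<partial>L) = (\<integral>x. f x * w x \<partial>L)"
  shows "(\<integral>x. q x * (soft_sign 1 (e x))\<^sup>2 * \<bar>p x\<bar> \<partial>L) \<le> (F + 2 * B * F + 4 * B\<^sup>2 * E + E) * L2vn L e"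
proof -
  have F0: "F \<ge> 0" using f(2) L2vn_nonneg[of L f] by linarith
  note one = zero_less_one[where 'a = real]
  \<comment> \<open>The square root of the cut-off: since the gradient of \<open>\<theta>\<close> is
    \<open>2 * \<eta>\<close> times that of \<open>\<eta>\<close>, one factor \<open>\<eta>\<close>
    can be paired with the gradient of \<open>p\<close>.\<close>
  define \<eta> where "\<eta> x = soft_sign 1 (e x)" for x
  define d\<eta> where "d\<eta> x = soft_sign' 1 (e x) *\<^sub>R d x" for x
  have h\<eta>: "H10g \<Omega> \<eta> d\<eta>" unfolding \<eta>_def d\<eta>_def
    by (rule H10g_comp[OF e soft_sign_deriv[OF one] soft_sign'_cont[OF one] _ soft_sign'_bound[OF one]]) (simp add: soft_sign_def)
  have \<eta>1: "\<bar>\<eta> x\<bar> \<le> 1" for x unfolding \<eta>_def by (rule soft_sign_bound[OF one])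
  have \<eta>e: "\<bar>\<eta> x\<bar> \<le> \<bar>e x\<bar>" for x
  proof -
    have "smooth_abs 1 (e x) \<ge> 1" by (simp add: smooth_abs_def)
    hence "\<bar>e x\<bar> * 1 \<le> \<bar>e x\<bar> * smooth_abs 1 (e x)" by (intro mult_left_mono) auto
    thus ?thesis unfolding \<eta>_def soft_sign_def using \<open>smooth_abs 1 (e x) \<ge> 1\<close> by (simp add: divide_le_eq)
  qed
  have d\<eta>n: "L2vn L d\<eta> \<le> L2vn L d"
  proof (rule L2v_norm_bound(2)[OF H10gD(4)[OF h\<eta>] H10gD(2)[OF e]], rule AE_I2)
    fix x
    have "\<bar>soft_sign' 1 (e x)\<bar> * norm (d x) \<le> 1 * norm (d x)"
      using soft_sign'_bound[OF one, of "e x"] by (intro mult_right_mono) auto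
    thus "norm (d\<eta> x) \<le> norm (d x)" by (simp add: d\<eta>_def)
  qed
  define \<theta> where "\<theta> x = (\<eta> x)\<^sup>2" for x
  define d\<theta> where "d\<theta> x = (2 * \<eta> x) *\<^sub>R d\<eta> x" for x
  have h\<theta>: "H10g \<Omega> \<theta> d\<theta>" unfolding \<theta>_def d\<theta>_def by (rule H10g_square[OF h\<eta>, of 1]) (use \<eta>1 in auto)
  have \<theta>0: "0 \<le> \<theta> x" for x by (simp add: \<theta>_def)
  have \<theta>\<eta>: "\<theta> x \<le> \<bar>\<eta> x\<bar>" for x
    unfolding \<theta>_def power2_eq_square using \<eta>1[of x] by (metis abs_ge_zero abs_mult_self_eq mult_left_le)
  have \<theta>1: "\<bar>\<theta> x\<bar> \<le> 1" for x using \<theta>\<eta>[of x] \<eta>1[of x] \<theta>0[of x] by linarith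
  have \<theta>e: "\<bar>\<theta> x\<bar> \<le> \<bar>e x\<bar>" for x using \<theta>\<eta>[of x] \<eta>e[of x] \<theta>0[of x] by linarith
  have \<theta>1': "AE x in L. \<bar>\<theta> x\<bar> \<le> 1" using \<theta>1 by simp
  have fw: "(\<integral>x. f x * (\<theta> x * r x) \<partial>L) \<le> F * (R * L2vn L e)"
    if r: "r \<in> borel_measurable L" "AE x in L. \<bar>r x\<bar> \<le> R" "R \<ge> 0" for r R
  proof -
    have m: "(\<lambda>x. \<theta> x * r x) \<in> borel_measurable L" using r(1) H10gD(3)[OF h\<theta>] by simp
    have "AE x in L. norm (\<theta> x * r x) \<le> norm (R * e x)"
      using r(2)
    proof eventually_elim
      case (elim x)
      have "\<bar>\<theta> x\<bar> * \<bar>r x\<bar> \<le> \<bar>e x\<bar> * R" using \<theta>e elim by (intro mult_mono) auto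
      thus ?case using r(3) by (simp add: abs_mult mult.commute)
    qed
    note b = L2v_norm_bound[OF m L2v_cmult[OF H10gD(1)[OF e]] this]
    have "(\<integral>x. f x * (\<theta> x * r x) \<partial>L) \<le> L2vn L f * L2vn L (\<lambda>x. \<theta> x * r x)"
      using L2v_CS_real[OF f(1) b(1)] by simp
    also have "\<dots> \<le> F * (R * L2vn L e)" using b(2) f(2) r(3) F0 by (intro mult_mono) (auto simp: L2vn_cmult)
    finally show ?thesis .
  qed
  \<comment> \<open>The gradient of \<open>p\<close> localised by \<open>\<eta>\<close>. Its norm
    \<open>X\<close> is estimated first and then used to bound the mass.\<close>
  define g where "g x = \<eta> x *\<^sub>R k x" for x
  have gL: "g \<in> L2v L" unfolding g_def
    by (rule L2v_mult_bounded(1)[OF H10gD(2)[OF p] H10gD(3)[OF h\<eta>], of 1]) (use \<eta>1 in auto)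
  have cross: "\<bar>\<integral>x. g x \<bullet> (r x *\<^sub>R d\<eta> x) \<partial>L\<bar> \<le> L2vn L g * (R * L2vn L d)"
    if r: "r \<in> borel_measurable L" "AE x in L. \<bar>r x\<bar> \<le> R" "R \<ge> 0" for r R
  proof -
    note b = L2v_mult_bounded[OF H10gD(2)[OF h\<eta>] r(1,2)]
    have "\<bar>\<integral>x. g x \<bullet> (r x *\<^sub>R d\<eta> x) \<partial>L\<bar> \<le> L2vn L g * L2vn L (\<lambda>x. r x *\<^sub>R d\<eta> x)" by (rule L2v_CS[OF gL b(1)])
    also have "\<dots> \<le> L2vn L g * (R * L2vn L d)"
      using b(2) d\<eta>n r(3) by (intro mult_left_mono order_trans[OF b(2)]) (auto intro: mult_left_mono)
    finally show ?thesis .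
  qed
  have qle: "AE x in L. \<bar>q x\<bar> \<le> \<bar>Q\<bar>" using q(2) by eventually_elim auto

  define X where "X = L2vn L g"
  define D where "D = L2vn L d"
  define \<epsilon> where "\<epsilon> = L2vn L e"
  have X0: "X \<ge> 0" and D0: "D \<ge> 0" and \<epsilon>0: "\<epsilon> \<ge> 0" by (auto simp: X_def D_def \<epsilon>_def)
  have DE: "D\<^sup>2 \<le> E * \<epsilon>" using energy by (simp add: D_def \<epsilon>_def)

  \<comment> \<open>Caccioppoli's inequality: the test function \<open>\<theta> * p\<close> makes
    the coefficient term nonnegative, so it is dropped however large the coefficient.\<close>
  have step1: "X\<^sup>2 \<le> F * (B * \<epsilon>) + 2 * B * (X * D)"
  proof -
    define h where "h x = \<theta> x *\<^sub>R k x + p x *\<^sub>R d\<theta> x" for x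
    have wh: "H10g \<Omega> (\<lambda>x. \<theta> x * p x) h" unfolding h_def by (rule H10g_mult[OF h\<theta> \<theta>1' p pB])
    have pm: "(\<lambda>x. 2 * p x) \<in> borel_measurable L" "AE x in L. \<bar>2 * p x\<bar> \<le> 2 * B"
      using H10gD(3)[OF p] pB by (auto elim: eventually_mono)
    have "(\<integral>x. k x \<bullet> h x \<partial>L) = (\<integral>x. (norm (g x))\<^sup>2 + g x \<bullet> ((2 * p x) *\<^sub>R d\<eta> x) \<partial>L)"
      unfolding power2_norm_eq_inner
      by (intro Bochner_Integration.integral_cong refl)
         (simp add: h_def g_def d\<theta>_def \<theta>_def inner_add_right power2_eq_square mult_ac)
    also have "\<dots> = X\<^sup>2 + (\<integral>x. g x \<bullet> ((2 * p x) *\<^sub>R d\<eta> x) \<partial>L)"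
      unfolding X_def L2vn_sq
      by (intro Bochner_Integration.integral_add L2v_integrable gL L2v_integrable_inner
          L2v_mult_bounded(1)[OF H10gD(2)[OF h\<eta>] pm])
    finally have "X\<^sup>2 + (\<integral>x. g x \<bullet> ((2 * p x) *\<^sub>R d\<eta> x) \<partial>L) + (\<integral>x. q x * p x * (\<theta> x * p x) \<partial>L) = (\<integral>x. f x * (\<theta> x * p x) \<partial>L)"
      using eq[OF wh] by simp
    moreover have "0 \<le> (\<integral>x. q x * p x * (\<theta> x * p x) \<partial>L)"
    proof (rule integral_nonneg_AE, use q(2) in eventually_elim)
      case (elim x)
      have "q x * p x * (\<theta> x * p x) = q x * \<theta> x * (p x * p x)" by simp
      also have "\<dots> \<ge> 0"
        by (rule mult_nonneg_nonneg[OF mult_nonneg_nonneg]) (use elim \<theta>0[of x] in auto)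
      finally show ?case .
    qed
    moreover have "(\<integral>x. f x * (\<theta> x * p x) \<partial>L) \<le> F * (B * \<epsilon>)"
      unfolding \<epsilon>_def by (rule fw[OF H10gD(3)[OF p] pB B])
    moreover have "\<bar>\<integral>x. g x \<bullet> ((2 * p x) *\<^sub>R d\<eta> x) \<partial>L\<bar> \<le> X * (2 * B * D)"
      unfolding X_def D_def using B by (intro cross pm) auto
    ultimately have "X\<^sup>2 \<le> F * (B * \<epsilon>) + X * (2 * B * D)" by argo
    thus ?thesis by (simp add: algebra_simps)
  qed
  have X2: "X\<^sup>2 \<le> (2 * B * F + 4 * B\<^sup>2 * E) * \<epsilon>"
  proof -
    \<comment> \<open>Young's inequality lets half of \<open>X^2\<close> be absorbed on the left;
      the energy bound makes \<open>D^2\<close>, and with it \<open>X^2\<close>, linear in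
      \<open>\<epsilon>\<close>.\<close>
    have "2 * (2 * B * (X * D)) \<le> X\<^sup>2 + 4 * B\<^sup>2 * D\<^sup>2"
      using zero_le_power2[of "X - 2 * B * D"] by (simp add: power2_eq_square algebra_simps)
    moreover have "4 * B\<^sup>2 * D\<^sup>2 \<le> 4 * B\<^sup>2 * (E * \<epsilon>)" using DE by (intro mult_left_mono) auto
    ultimately have "X\<^sup>2 \<le> 2 * (F * (B * \<epsilon>)) + 4 * B\<^sup>2 * (E * \<epsilon>)" using step1 by argo
    thus ?thesis by (simp add: algebra_simps)
  qed
  define J where "J = (\<integral>x. q x * \<theta> x * \<bar>p x\<bar> \<partial>L)"
  define I where "I = (\<integral>x. q x * \<theta> x \<partial>L)"
  have \<theta>L: "\<theta> \<in> L2v L" by (rule H10gD(1)[OF h\<theta>])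
  have pL: "p \<in> L2v L" by (rule H10gD(1)[OF p])
  have q\<theta>L: "(\<lambda>x. q x * \<theta> x) \<in> L2v L" using L2v_mult_bounded(1)[OF \<theta>L q(1) qle] by simp
  have I0: "I \<ge> 0" unfolding I_def
    by (rule integral_nonneg_AE, use q(2) in eventually_elim) (use \<theta>0 in simp)
  \<comment> \<open>Now the test function is \<open>\<theta>\<close> times a regularised sign of
    \<open>p\<close>, which turns the coefficient term into the mass itself, up to
    \<open>sqrt \<delta> * I\<close>.\<close>
  have step2: "J \<le> F * \<epsilon> + 2 * (X * D) + sqrt \<delta> * I" if \<delta>: "\<delta> > 0" for \<delta>
  proof -
    define s where "s x = soft_sign \<delta> (p x)" for x
    define ds where "ds x = soft_sign' \<delta> (p x) *\<^sub>R k x" for x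
    have hs: "H10g \<Omega> s ds" unfolding s_def ds_def
      by (rule H10g_comp[OF p soft_sign_deriv[OF \<delta>] soft_sign'_cont[OF \<delta>] _ soft_sign'_bound[OF \<delta>]]) (simp add: soft_sign_def)
    have s1: "AE x in L. \<bar>s x\<bar> \<le> 1" unfolding s_def using soft_sign_bound[OF \<delta>] by simp
    define h where "h x = \<theta> x *\<^sub>R ds x + s x *\<^sub>R d\<theta> x" for x
    have wh: "H10g \<Omega> (\<lambda>x. \<theta> x * s x) h" unfolding h_def by (rule H10g_mult[OF h\<theta> \<theta>1' hs s1])
    have sm: "(\<lambda>x. 2 * s x) \<in> borel_measurable L" "AE x in L. \<bar>2 * s x\<bar> \<le> 2"
      using H10gD(3)[OF hs] s1 by (auto elim: eventually_mono)
    have "(\<integral>x. g x \<bullet> ((2 * s x) *\<^sub>R d\<eta> x) \<partial>L) \<le> (\<integral>x. k x \<bullet> h x \<partial>L)"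
    proof (rule integral_mono)
      show "integrable L (\<lambda>x. g x \<bullet> ((2 * s x) *\<^sub>R d\<eta> x))"
        by (intro L2v_integrable_inner gL L2v_mult_bounded(1)[OF H10gD(2)[OF h\<eta>] sm])
      show "integrable L (\<lambda>x. k x \<bullet> h x)" by (intro L2v_integrable_inner H10gD(2)[OF p] H10gD(2)[OF wh])
      fix x
      have "k x \<bullet> h x = \<theta> x * soft_sign' \<delta> (p x) * (k x \<bullet> k x) + g x \<bullet> ((2 * s x) *\<^sub>R d\<eta> x)"
        by (simp add: h_def g_def d\<theta>_def ds_def inner_add_right mult_ac)
      moreover have "0 \<le> \<theta> x * soft_sign' \<delta> (p x) * (k x \<bullet> k x)" using \<theta>0[of x] soft_sign'_nonneg[OF \<delta>, of "p x"] by simp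
      ultimately show "g x \<bullet> ((2 * s x) *\<^sub>R d\<eta> x) \<le> k x \<bullet> h x" by linarith
    qed
    moreover have "\<bar>\<integral>x. g x \<bullet> ((2 * s x) *\<^sub>R d\<eta> x) \<partial>L\<bar> \<le> X * (2 * D)"
      unfolding X_def D_def by (intro cross sm) auto
    moreover have "(\<integral>x. f x * (\<theta> x * s x) \<partial>L) \<le> F * (1 * \<epsilon>)"
      unfolding \<epsilon>_def by (rule fw[OF H10gD(3)[OF hs] s1]) simp
    ultimately have 1: "(\<integral>x. q x * p x * (\<theta> x * s x) \<partial>L) \<le> F * \<epsilon> + 2 * (X * D)" using eq[OF wh] by argo
    have i1: "integrable L (\<lambda>x. q x * p x * (\<theta> x * s x))"
    proof -
      have "(\<lambda>x. q x * p x) \<in> L2v L" using L2v_mult_bounded(1)[OF pL q(1) qle] by simp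
      thus ?thesis by (intro L2v_integrable_mult H10gD(1)[OF wh])
    qed
    have i2: "integrable L (\<lambda>x. sqrt \<delta> * (q x * \<theta> x))"
      by (intro integrable_mult_right L2v_integrable_norm(3)[OF finite_L q\<theta>L])
    have "J \<le> (\<integral>x. q x * p x * (\<theta> x * s x) + sqrt \<delta> * (q x * \<theta> x) \<partial>L)"
      unfolding J_def
    proof (rule integral_mono_AE[OF _ Bochner_Integration.integrable_add[OF i1 i2]])
      have "(\<lambda>x. \<bar>p x\<bar>) \<in> L2v L" using pL by (auto simp: L2v_def)
      thus "integrable L (\<lambda>x. q x * \<theta> x * \<bar>p x\<bar>)" by (intro L2v_integrable_mult q\<theta>L)
      show "AE x in L. q x * \<theta> x * \<bar>p x\<bar> \<le> q x * p x * (\<theta> x * s x) + sqrt \<delta> * (q x * \<theta> x)"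
        using q(2)
      proof eventually_elim
        case (elim x)
        have "(q x * \<theta> x) * (\<bar>p x\<bar> - sqrt \<delta>) \<le> (q x * \<theta> x) * (p x * s x)"
          unfolding s_def using abs_diff_soft_sign[OF \<delta>] elim \<theta>0[of x] by (intro mult_left_mono) auto
        thus ?case by (simp add: algebra_simps)
      qed
    qed
    also have "\<dots> = (\<integral>x. q x * p x * (\<theta> x * s x) \<partial>L) + sqrt \<delta> * I"
      unfolding I_def by (subst Bochner_Integration.integral_add[OF i1 i2]) simp
    finally show ?thesis using 1 by linarith
  qed
  \<comment> \<open>\<open>I\<close> is finite but depends on the bound of the coefficient, hence on
    the mesh; it disappears as \<open>\<delta>\<close> tends to 0.\<close>
  have "J \<le> F * \<epsilon> + 2 * (X * D)"
  proof (rule field_le_epsilon)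
    fix r :: real assume r: "r > 0"
    have "sqrt ((r / (I + 1))\<^sup>2) * I = r / (I + 1) * I" using r I0 by simp
    also have "\<dots> \<le> r" using r I0 by (simp add: field_simps)
    finally show "J \<le> F * \<epsilon> + 2 * (X * D) + r" using step2[of "(r / (I + 1))\<^sup>2"] r I0 by auto
  qed
  also have "2 * (X * D) \<le> X\<^sup>2 + D\<^sup>2" using zero_le_power2[of "X - D"] by (simp add: power2_eq_square algebra_simps)
  also have "F * \<epsilon> + (X\<^sup>2 + D\<^sup>2) \<le> F * \<epsilon> + ((2 * B * F + 4 * B\<^sup>2 * E) * \<epsilon> + E * \<epsilon>)" using X2 DE by linarith
  also have "\<dots> = (F + 2 * B * F + 4 * B\<^sup>2 * E + E) * \<epsilon>" by (simp add: algebra_simps)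
  finally show ?thesis by (simp add: J_def \<theta>_def \<eta>_def \<epsilon>_def)
qed

text \<open>Duality against the error \<open>P - p\<close>. Where \<open>yT\<close> stays below
  \<open>2 * K + 1\<close> the coefficients differ by a Lipschitz bound; elsewhere the coefficient
  at \<open>yT\<close> is only known through its mass against \<open>\<bar>P\<bar>\<close>, an L1
  bound that suffices because the dual solution is bounded in the sup norm by the L2 norm of the
  error.\<close>

lemma adjoint_stability_aux:
  assumes y: "y \<in> L2v L" "AE x in L. \<bar>y x\<bar> \<le> K" and K: "K \<ge> 0" and \<Lambda>: "a_bounds (2 * K + 1) \<Lambda>"
    and yT: "yT \<in> L2v L" "AE x in L. \<bar>yT x\<bar> \<le> KT"
    and yh: "AE x in L. \<bar>yh x\<bar> \<le> K" and e: "H10g \<Omega> (\<lambda>x. yh x - yT x) d"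
      "(L2vn L d)\<^sup>2 \<le> E * L2vn L (\<lambda>x. yh x - yT x)"
    and p: "adjoint_eq \<Omega> a yd (H10 \<Omega>) y p" and P: "adjoint_eq \<Omega> a yd (H10 \<Omega>) yT P"
    and F: "L2vn L (\<lambda>x. yT x - yd x) \<le> F"
    and B: "B = Ci * F"
  shows "L2vn L (\<lambda>x. P x - p x) \<le> Ci * ((1 + \<Lambda> * B) * m\<Omega> * L2vn L (\<lambda>x. y x - yT x)
    + (\<Lambda> * B * m\<Omega> + 2 * (F + 2 * B * F + 4 * B\<^sup>2 * E + E)) * L2vn L (\<lambda>x. yh x - yT x))"
proof -
  have \<Lambda>0: "\<Lambda> > 0" using \<Lambda> by (simp add: a_bounds_def)
  have F0: "F \<ge> 0" using F L2vn_nonneg[of L "\<lambda>x. yT x - yd x"] by linarith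
  have B0: "B \<ge> 0" unfolding B using Ci_pos F0 by simp
  define q where "q x = deriv (a x) (yT x)" for x
  define q0 where "q0 x = deriv (a x) (y x)" for x
  have qm: "q \<in> borel_measurable L" "q0 \<in> borel_measurable L"
    unfolding q_def q0_def by (intro da_comp_meas L2v_meas yT y)+
  obtain Q where Q: "AE x in L. 0 \<le> q x \<and> q x \<le> Q" using da_bounded[OF L2v_meas[OF yT(1)] yT(2)] unfolding q_def by blast
  obtain Q0 where Q0: "AE x in L. 0 \<le> q0 x \<and> q0 x \<le> Q0" using da_bounded[OF L2v_meas[OF y(1)] y(2)] unfolding q0_def by blast
  have qb: "AE x in L. \<bar>q x\<bar> \<le> \<bar>Q\<bar>" "AE x in L. \<bar>q0 x\<bar> \<le> \<bar>Q0\<bar>" using Q Q0 by (auto elim: eventually_mono)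
  note hP = adjoint_eqD(1)[OF P] and hp = adjoint_eqD(1)[OF p]
  note PL = H10gD(1)[OF hP] and pL = H10gD(1)[OF hp]
  have PB: "AE x in L. \<bar>P x\<bar> \<le> B"
    unfolding B using Ci_pos F by (intro AE_abs_leD[OF adjoint_bound[OF P yT(1)]]) simp
  define \<epsilon> where "\<epsilon> = L2vn L (\<lambda>x. yh x - yT x)"
  define C where "C = F + 2 * B * F + 4 * B\<^sup>2 * E + E"
  define \<theta> where "\<theta> x = (soft_sign 1 (yh x - yT x))\<^sup>2" for x
  have mass: "(\<integral>x. q x * \<theta> x * \<bar>P x\<bar> \<partial>L) \<le> C * \<epsilon>"
    unfolding C_def \<epsilon>_def \<theta>_def
    by (rule large_coefficient_mass[OF e hP PB B0 qm(1) Q L2v_diff[OF yT(1) yd] F])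
       (simp add: adjoint_eqD(3)[OF P] q_def)
  define \<delta> where "\<delta> x = P x - p x" for x
  define d\<delta> where "d\<delta> x = wgrad \<Omega> P x - wgrad \<Omega> p x" for x
  have h\<delta>: "H10g \<Omega> \<delta> d\<delta>" unfolding \<delta>_def d\<delta>_def by (intro H10g_diff hP hp)
  note \<delta>L = H10gD(1)[OF h\<delta>]
  define n where "n = L2vn L \<delta>"
  have n0: "n \<ge> 0" by (simp add: n_def)
  \<comment> \<open>The dual problem carries the coefficient \<open>q0\<close> at the bounded state
    \<open>y\<close>. Testing the two adjoint equations with its solution leaves the difference of
    the coefficients multiplied by \<open>P\<close> and \<open>z\<close>.\<close>
  obtain z k where z: "H10g \<Omega> z k"
    and zeq: "\<And>v h. H10g \<Omega> v h \<Longrightarrow> (\<integral>x. k x \<bullet> h x \<partial>L) + (\<integral>x. q0 x * z x * v x \<partial>L) = (\<integral>x. \<delta> x * v x \<partial>L)"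
    and zb: "AE x in L. \<bar>z x\<bar> \<le> Ci * L2vn L \<delta>"
    by (rule linear_solution_exists[OF qm(2) Q0 \<delta>L]) blast
  note zL = H10gD(1)[OF z]
  define Z where "Z = Ci * n"
  have Z0: "Z \<ge> 0" unfolding Z_def using Ci_pos n0 by simp
  have zZ: "AE x in L. \<bar>z x\<bar> \<le> Z" using zb by (simp add: Z_def n_def)
  have zn: "L2vn L z \<le> Z * m\<Omega>" by (rule L2v_bounded(2)[OF H10gD(3)[OF z] zZ Z0])
  have q0zL: "(\<lambda>x. q0 x * z x) \<in> L2v L" using L2v_mult_bounded(1)[OF zL qm(2) qb(2)] by simp
  have qPL: "(\<lambda>x. q x * P x) \<in> L2v L" using L2v_mult_bounded(1)[OF PL qm(1) qb(1)] by simp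
  have q0PL: "(\<lambda>x. q0 x * P x) \<in> L2v L" using L2v_mult_bounded(1)[OF PL qm(2) qb(2)] by simp
  have q0pL: "(\<lambda>x. q0 x * p x) \<in> L2v L" using L2v_mult_bounded(1)[OF pL qm(2) qb(2)] by simp
  have rep: "n\<^sup>2 = (\<integral>x. (yT x - y x) * z x \<partial>L) + (\<integral>x. (q0 x * P x - q x * P x) * z x \<partial>L)"
  proof -
    have "n\<^sup>2 = (\<integral>x. \<delta> x * \<delta> x \<partial>L)" unfolding n_def L2vn_sq by (simp add: power2_eq_square)
    also have "\<dots> = (\<integral>x. k x \<bullet> d\<delta> x \<partial>L) + (\<integral>x. q0 x * z x * \<delta> x \<partial>L)" using zeq[OF h\<delta>] by simp
    also have "(\<integral>x. k x \<bullet> d\<delta> x \<partial>L) = (\<integral>x. wgrad \<Omega> P x \<bullet> k x \<partial>L) - (\<integral>x. wgrad \<Omega> p x \<bullet> k x \<partial>L)"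
    proof -
      have "(\<integral>x. k x \<bullet> d\<delta> x \<partial>L) = (\<integral>x. wgrad \<Omega> P x \<bullet> k x - wgrad \<Omega> p x \<bullet> k x \<partial>L)"
        by (intro Bochner_Integration.integral_cong refl) (simp add: d\<delta>_def inner_diff_right inner_commute)
      thus ?thesis using L2v_integrable_inner[OF H10gD(2)[OF hP] H10gD(2)[OF z]] L2v_integrable_inner[OF H10gD(2)[OF hp] H10gD(2)[OF z]] by simp
    qed
    also have "(\<integral>x. q0 x * z x * \<delta> x \<partial>L) = (\<integral>x. q0 x * P x * z x \<partial>L) - (\<integral>x. q0 x * p x * z x \<partial>L)"
    proof -
      have "(\<integral>x. q0 x * z x * \<delta> x \<partial>L) = (\<integral>x. q0 x * P x * z x - q0 x * p x * z x \<partial>L)"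
        by (intro Bochner_Integration.integral_cong refl) (simp add: \<delta>_def algebra_simps)
      thus ?thesis using L2v_integrable_mult[OF q0PL zL] L2v_integrable_mult[OF q0pL zL] by simp
    qed
    also have "(\<integral>x. wgrad \<Omega> P x \<bullet> k x \<partial>L) = (\<integral>x. (yT x - yd x) * z x \<partial>L) - (\<integral>x. q x * P x * z x \<partial>L)"
      using adjoint_eqD(3)[OF P z] by (simp add: q_def)
    also have "(\<integral>x. wgrad \<Omega> p x \<bullet> k x \<partial>L) = (\<integral>x. (y x - yd x) * z x \<partial>L) - (\<integral>x. q0 x * p x * z x \<partial>L)"
      using adjoint_eqD(3)[OF p z] by (simp add: q0_def)
    finally have "n\<^sup>2 = ((\<integral>x. (yT x - yd x) * z x \<partial>L) - (\<integral>x. (y x - yd x) * z x \<partial>L))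
      + ((\<integral>x. q0 x * P x * z x \<partial>L) - (\<integral>x. q x * P x * z x \<partial>L))" by argo
    moreover have "(\<integral>x. (yT x - y x) * z x \<partial>L) = (\<integral>x. (yT x - yd x) * z x - (y x - yd x) * z x \<partial>L)"
      by (intro Bochner_Integration.integral_cong refl) (simp add: algebra_simps)
    moreover have "(\<integral>x. (yT x - yd x) * z x - (y x - yd x) * z x \<partial>L) = (\<integral>x. (yT x - yd x) * z x \<partial>L) - (\<integral>x. (y x - yd x) * z x \<partial>L)"
      by (intro Bochner_Integration.integral_diff L2v_integrable_mult L2v_diff yT y yd zL)
    moreover have "(\<integral>x. (q0 x * P x - q x * P x) * z x \<partial>L) = (\<integral>x. q0 x * P x * z x \<partial>L) - (\<integral>x. q x * P x * z x \<partial>L)"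
      unfolding left_diff_distrib[of _ _ "z _"] by (intro Bochner_Integration.integral_diff L2v_integrable_mult q0PL qPL zL)
    ultimately show ?thesis by argo
  qed
  have yyT: "(\<lambda>x. y x - yT x) \<in> L2v L" by (intro L2v_diff y yT)
  note eL = H10gD(1)[OF e(1)]
  \<comment> \<open>Three error densities: \<open>i1\<close> covers the region where the
    coefficients are Lipschitz close, \<open>i2\<close> the coefficient \<open>q0\<close> on the
    region where \<open>yT\<close> is large, and \<open>i3\<close> the large coefficient
    \<open>q\<close> there.\<close>
  define i1 where "i1 x = \<bar>y x - yT x\<bar> * \<bar>z x\<bar>" for x
  define i2 where "i2 x = \<bar>yh x - yT x\<bar> * \<bar>z x\<bar>" for x
  define i3 where "i3 x = q x * \<theta> x * \<bar>P x\<bar>" for x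
  have I: "integrable L i1" "integrable L i2" unfolding i1_def i2_def
    using L2v_integrable_norm_mult[OF yyT zL] L2v_integrable_norm_mult[OF eL zL] by simp_all
  have I3: "integrable L i3"
  proof -
    have "\<bar>\<theta> x\<bar> \<le> 1" for x
      unfolding \<theta>_def using power_mono[OF soft_sign_bound[of 1 "yh x - yT x"], of 2] by simp
    moreover have "\<theta> \<in> borel_measurable L" unfolding \<theta>_def
      using borel_measurable_continuous_on[OF soft_sign_cont[of 1] H10gD(3)[OF e(1)]] by simp
    ultimately have "\<theta> \<in> L2v L" by (intro L2v_bounded(1)[of _ 1]) auto
    moreover have "(\<lambda>x. \<bar>q x * P x\<bar>) \<in> L2v L" using qPL by (auto simp: L2v_def)
    ultimately have "integrable L (\<lambda>x. \<theta> x * \<bar>q x * P x\<bar>)" by (rule L2v_integrable_mult)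
    moreover have "AE x in L. \<theta> x * \<bar>q x * P x\<bar> = i3 x" using Q by eventually_elim (simp add: i3_def abs_mult)
    moreover have "i3 \<in> borel_measurable L" unfolding i3_def using qm \<open>\<theta> \<in> borel_measurable L\<close> H10gD(3)[OF hP] by simp
    ultimately show ?thesis by (subst integrable_cong_AE[symmetric]) auto
  qed
  have "(\<integral>x. (q0 x * P x - q x * P x) * z x \<partial>L) \<le> (\<integral>x. \<Lambda> * B * i1 x + (\<Lambda> * B * i2 x + 2 * Z * i3 x) \<partial>L)"
  proof (rule integral_mono_AE)
    show "integrable L (\<lambda>x. (q0 x * P x - q x * P x) * z x)" by (intro L2v_integrable_mult L2v_diff q0PL qPL zL)
    show "integrable L (\<lambda>x. \<Lambda> * B * i1 x + (\<Lambda> * B * i2 x + 2 * Z * i3 x))"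
      by (intro Bochner_Integration.integrable_add integrable_mult_right I I3)
    show "AE x in L. (q0 x * P x - q x * P x) * z x \<le> \<Lambda> * B * i1 x + (\<Lambda> * B * i2 x + 2 * Z * i3 x)"
      using y(2) yh PB zZ Q \<Lambda>[unfolded a_bounds_def, THEN conjunct2]
    proof eventually_elim
      case (elim x)
      have yK': "\<bar>y x\<bar> \<le> 2 * K + 1" using elim(1) K by linarith
      have i0: "i1 x \<ge> 0" "i2 x \<ge> 0" by (auto simp: i1_def i2_def)
      have i30: "i3 x \<ge> 0" unfolding i3_def using elim(5) by (simp add: \<theta>_def)
      have Pz: "\<bar>P x * z x\<bar> \<le> B * \<bar>z x\<bar>" using elim(3) by (simp add: abs_mult mult_right_mono)
      show ?case
      proof (cases "\<bar>yT x\<bar> \<le> 2 * K + 1")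
        case True
        have "\<bar>q0 x - q x\<bar> \<le> \<Lambda> * \<bar>y x - yT x\<bar>" unfolding q0_def q_def using elim(6)[rule_format, OF yK' True] by blast
        hence "\<bar>q0 x - q x\<bar> * \<bar>P x * z x\<bar> \<le> (\<Lambda> * \<bar>y x - yT x\<bar>) * (B * \<bar>z x\<bar>)" using Pz \<Lambda>0 by (intro mult_mono) auto
        also have "\<dots> = \<Lambda> * B * i1 x" by (simp add: i1_def)
        finally have "(q0 x - q x) * (P x * z x) \<le> \<Lambda> * B * i1 x" unfolding abs_mult[symmetric] by linarith
        moreover have "0 \<le> \<Lambda> * B * i2 x + 2 * Z * i3 x" using i0 i30 \<Lambda>0 B0 Z0 by simp
        ultimately show ?thesis by (simp add: algebra_simps)
      next
        case False
        \<comment> \<open>Since \<open>yh\<close> stays below \<open>K\<close>, the error is at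
          least 1 where \<open>yT\<close> exceeds \<open>2 * K + 1\<close>, and there the cut-off is
          at least 1/2. This is the origin of the factor 2 in front of \<open>i3\<close>.\<close>
        have e1: "\<bar>yh x - yT x\<bar> \<ge> 1" using False elim(2) K by linarith
        have "\<theta> x = (yh x - yT x)\<^sup>2 / (1 + (yh x - yT x)\<^sup>2)"
          unfolding \<theta>_def soft_sign_def power_divide smooth_abs_sq[OF zero_less_one] ..
        moreover have "(yh x - yT x)\<^sup>2 \<ge> 1" using e1 by (metis abs_le_square_iff abs_one one_power2)
        moreover have "1 / 2 \<le> s / (1 + s)" if "s \<ge> 1" for s :: real using that by (simp add: field_simps)
        ultimately have "1 / 2 \<le> \<theta> x" by simp
        hence \<theta>h: "1 \<le> 2 * \<theta> x" by simp
        have "\<bar>q0 x\<bar> \<le> \<Lambda>" unfolding q0_def using elim(6)[rule_format, OF yK' yK'] by blast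
        hence "\<bar>q0 x\<bar> * \<bar>P x * z x\<bar> \<le> \<Lambda> * (B * \<bar>z x\<bar>)" using Pz \<Lambda>0 by (intro mult_mono) auto
        also have "\<dots> = \<Lambda> * B * (1 * \<bar>z x\<bar>)" by simp
        also have "\<dots> \<le> \<Lambda> * B * i2 x" unfolding i2_def using e1 \<Lambda>0 B0 by (intro mult_left_mono mult_right_mono) auto
        finally have 1: "q0 x * (P x * z x) \<le> \<Lambda> * B * i2 x" unfolding abs_mult[symmetric] by linarith
        have "\<bar>q x * P x * z x\<bar> = q x * \<bar>P x\<bar> * \<bar>z x\<bar>" using elim(5) by (simp add: abs_mult)
        also have "\<dots> \<le> q x * \<bar>P x\<bar> * Z" using elim(4,5) by (intro mult_left_mono) auto
        also have "\<dots> = 1 * (q x * \<bar>P x\<bar> * Z)" by simp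
        also have "\<dots> \<le> (2 * \<theta> x) * (q x * \<bar>P x\<bar> * Z)" using \<theta>h elim(5) Z0 by (intro mult_right_mono) auto
        also have "\<dots> = 2 * Z * i3 x" by (simp add: i3_def)
        finally have 2: "- (q x * P x * z x) \<le> 2 * Z * i3 x" by linarith
        have "0 \<le> \<Lambda> * B * i1 x" using i0 \<Lambda>0 B0 by simp
        thus ?thesis using 1 2 by (simp add: algebra_simps)
      qed
    qed
  qed
  also have "\<dots> = \<Lambda> * B * (\<integral>x. i1 x \<partial>L) + (\<Lambda> * B * (\<integral>x. i2 x \<partial>L) + 2 * Z * (\<integral>x. i3 x \<partial>L))"
    using I I3 by simp
  also have "\<dots> \<le> \<Lambda> * B * (L2vn L (\<lambda>x. y x - yT x) * (Z * m\<Omega>)) + (\<Lambda> * B * (\<epsilon> * (Z * m\<Omega>)) + 2 * Z * (C * \<epsilon>))"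
  proof (intro add_mono mult_left_mono)
    have "(\<integral>x. i1 x \<partial>L) \<le> L2vn L (\<lambda>x. y x - yT x) * L2vn L z" unfolding i1_def using L2v_CS_norm[OF yyT zL] by simp
    thus "(\<integral>x. i1 x \<partial>L) \<le> L2vn L (\<lambda>x. y x - yT x) * (Z * m\<Omega>)" using zn by (meson L2vn_nonneg mult_left_mono order_trans)
    have "(\<integral>x. i2 x \<partial>L) \<le> \<epsilon> * L2vn L z" unfolding i2_def \<epsilon>_def using L2v_CS_norm[OF eL zL] by simp
    thus "(\<integral>x. i2 x \<partial>L) \<le> \<epsilon> * (Z * m\<Omega>)" unfolding \<epsilon>_def using zn by (meson L2vn_nonneg mult_left_mono order_trans)
    show "(\<integral>x. i3 x \<partial>L) \<le> C * \<epsilon>" unfolding i3_def by (rule mass)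
  qed (use \<Lambda>0 B0 Z0 in auto)
  finally have r1: "(\<integral>x. (q0 x * P x - q x * P x) * z x \<partial>L)
    \<le> \<Lambda> * B * (L2vn L (\<lambda>x. y x - yT x) * (Z * m\<Omega>)) + (\<Lambda> * B * (\<epsilon> * (Z * m\<Omega>)) + 2 * Z * (C * \<epsilon>))" .
  have "(\<integral>x. (yT x - y x) * z x \<partial>L) \<le> L2vn L (\<lambda>x. yT x - y x) * L2vn L z"
    using L2v_CS_real[OF L2v_diff[OF yT(1) y(1)] zL] by simp
  also have "\<dots> \<le> L2vn L (\<lambda>x. y x - yT x) * (Z * m\<Omega>)" unfolding L2vn_commute[of L yT y] by (intro mult_left_mono zn) simp
  finally have r2: "(\<integral>x. (yT x - y x) * z x \<partial>L) \<le> L2vn L (\<lambda>x. y x - yT x) * (Z * m\<Omega>)" .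
  define R where "R = Ci * ((1 + \<Lambda> * B) * m\<Omega> * L2vn L (\<lambda>x. y x - yT x) + (\<Lambda> * B * m\<Omega> + 2 * C) * \<epsilon>)"
  have "n * n \<le> L2vn L (\<lambda>x. y x - yT x) * (Z * m\<Omega>) + (\<Lambda> * B * (L2vn L (\<lambda>x. y x - yT x) * (Z * m\<Omega>)) + (\<Lambda> * B * (\<epsilon> * (Z * m\<Omega>)) + 2 * Z * (C * \<epsilon>)))"
    using rep r1 r2 by (simp add: power2_eq_square)
  also have "\<dots> = R * n" by (simp add: R_def Z_def algebra_simps)
  finally have nR: "n * n \<le> R * n" .
  have R0: "n \<le> R"
  proof (cases "n = 0")
    case True
    \<comment> \<open>When the error vanishes it cannot be cancelled, so \<open>R\<close> has to be
      shown nonnegative directly. No sign of \<open>E\<close> is given; the energy inequality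
      supplies that of the product.\<close>
    have "E * \<epsilon> \<ge> 0" using e(2) unfolding \<epsilon>_def by (meson order_trans zero_le_power2)
    hence "C * \<epsilon> \<ge> 0" unfolding C_def using F0 B0
      by (simp add: distrib_right \<epsilon>_def mult.assoc)
    hence "R \<ge> 0" unfolding R_def using Ci_pos \<Lambda>0 B0
      by (simp add: distrib_right \<epsilon>_def)
    thus ?thesis using True by simp
  next
    case False
    thus ?thesis using nR n0 by (simp add: mult_le_cancel_right)
  qed
  show ?thesis using R0 unfolding n_def R_def \<delta>_def C_def \<epsilon>_def .
qed

text \<open>The order of the quantifiers is the point: the constant is fixed before the discrete
  space, the discrete state and its bound \<open>KT\<close>.\<close>

theorem adjoint_stability:
  fixes lb ub :: real
  shows "\<exists>C>0. \<forall>V u yT KT yh P w y p. V \<subseteq> H10 \<Omega> \<longrightarrow> u \<in> U_ad \<Omega> lb ub \<longrightarrow> state_eq \<Omega> a V u yT \<longrightarrow>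
    (AE x in L. \<bar>yT x\<bar> \<le> KT) \<longrightarrow> state_eq \<Omega> a (H10 \<Omega>) u yh \<longrightarrow> adjoint_eq \<Omega> a yd (H10 \<Omega>) yT P \<longrightarrow>
    w \<in> U_ad \<Omega> lb ub \<longrightarrow> state_eq \<Omega> a (H10 \<Omega>) w y \<longrightarrow> adjoint_eq \<Omega> a yd (H10 \<Omega>) y p \<longrightarrow>
    L2vn L (\<lambda>x. P x - p x) \<le> C * (L2vn L (\<lambda>x. y x - yT x) + L2vn L (\<lambda>x. yh x - yT x))"
proof -
  define U where "U = max \<bar>lb\<bar> \<bar>ub\<bar>"
  have U0: "U \<ge> 0" by (simp add: U_def)
  define a0n where "a0n = L2vn L (\<lambda>x. a x 0)"
  \<comment> \<open>A sup bound for the continuous states of all admissible controls, whose L2 norms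
    are at most \<open>U\<close> times the root of the volume.\<close>
  define K where "K = Ci * (U * m\<Omega> + a0n)"
  have K0: "K \<ge> 0" unfolding K_def a0n_def using Ci_pos U0 by simp
  obtain \<Lambda> where \<Lambda>: "a_bounds (2 * K + 1) \<Lambda>" using a_bounds_exists[of "2 * K + 1"] K0 by auto
  have \<Lambda>0: "\<Lambda> > 0" using \<Lambda> by (simp add: a_bounds_def)
  \<comment> \<open>The coefficient of the energy estimate: the bracket bounds the norm of
    \<open>u - a yh\<close>, the last term comes from the region where \<open>yT\<close> is
    moderate.\<close>
  define E where "E = (U * m\<Omega> + (\<Lambda> * K * m\<Omega> + a0n)) + \<Lambda> * K * m\<Omega>"
  have E0: "E \<ge> 0" unfolding E_def a0n_def using U0 \<Lambda>0 K0 by simp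
  \<comment> \<open>Bounds the right-hand side \<open>yT - yd\<close> of the auxiliary adjoint
    equation: \<open>E * Cp^2\<close> bounds the state error and \<open>K\<close> times the root of
    the volume the continuous state.\<close>
  define F where "F = E * Cp\<^sup>2 + K * m\<Omega> + L2vn L yd"
  have F0: "F \<ge> 0" unfolding F_def using E0 K0 by simp
  define B where "B = Ci * F"
  have B0: "B \<ge> 0" unfolding B_def using Ci_pos F0 by simp
  define c1 where "c1 = Ci * ((1 + \<Lambda> * B) * m\<Omega>)"
  define c2 where "c2 = Ci * (\<Lambda> * B * m\<Omega> + 2 * (F + 2 * B * F + 4 * B\<^sup>2 * E + E))"
  have c: "c1 \<ge> 0" "c2 \<ge> 0" unfolding c1_def c2_def using Ci_pos \<Lambda>0 B0 F0 E0 by simp_all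
  define C where "C = c1 + c2 + 1"
  have un: "L2vn L u \<le> U * m\<Omega>" if "u \<in> U_ad \<Omega> lb ub" for u
  proof (rule L2v_bounded(2)[OF L2v_meas[OF U_ad_bounded(1)[OF that]] _ U0])
    show "AE x in L. \<bar>u x\<bar> \<le> U" using U_ad_bounded(2)[OF that] by eventually_elim (auto simp: U_def)
  qed
  have yK: "AE x in L. \<bar>y x\<bar> \<le> K" if u: "u \<in> U_ad \<Omega> lb ub" and y: "state_eq \<Omega> a (H10 \<Omega>) u y" for u y
  proof (rule AE_abs_leD[OF state_bound[OF y U_ad_bounded(1)[OF u]]])
    have "L2vn L (\<lambda>x. u x - a x 0) \<le> U * m\<Omega> + a0n"
      using L2vn_triangle[OF U_ad_bounded(1)[OF u] L2v_minus[OF a0]] un[OF u]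
      by (simp add: a0n_def L2vn_def)
    thus "Ci * L2vn L (\<lambda>x. u x - a x 0) \<le> K" unfolding K_def using Ci_pos by simp
  qed
  have "L2vn L (\<lambda>x. P x - p x) \<le> C * (L2vn L (\<lambda>x. y x - yT x) + L2vn L (\<lambda>x. yh x - yT x))"
    if V: "V \<subseteq> H10 \<Omega>" and u: "u \<in> U_ad \<Omega> lb ub" and yT: "state_eq \<Omega> a V u yT" and yTb: "AE x in L. \<bar>yT x\<bar> \<le> KT"
      and yh: "state_eq \<Omega> a (H10 \<Omega>) u yh" and P: "adjoint_eq \<Omega> a yd (H10 \<Omega>) yT P"
      and w: "w \<in> U_ad \<Omega> lb ub" and y: "state_eq \<Omega> a (H10 \<Omega>) w y" and p: "adjoint_eq \<Omega> a yd (H10 \<Omega>) y p"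
    for V u yT KT yh P w y p
  proof -
    note uL = U_ad_bounded(1)[OF u]
    note yhK = yK[OF u yh]
    have hT: "H10g \<Omega> yT (wgrad \<Omega> yT)" using V yT H10_H10g unfolding state_eq_def by blast
    note hh = state_eqD(1)[OF yh]
    define e where "e x = yh x - yT x" for x
    define d where "d x = wgrad \<Omega> yh x - wgrad \<Omega> yT x" for x
    have ed: "H10g \<Omega> e d" unfolding e_def d_def by (intro H10g_diff hh hT)
    have ahn: "L2vn L (\<lambda>x. a x (yh x)) \<le> \<Lambda> * K * m\<Omega> + a0n"
    proof -
      have ayL: "(\<lambda>x. a x (yh x)) \<in> L2v L" by (rule a_comp_L2v[OF H10gD(3)[OF hh] yhK])
      have b: "AE x in L. \<bar>a x (yh x) - a x 0\<bar> \<le> \<Lambda> * K"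
        using yhK \<Lambda>[unfolded a_bounds_def, THEN conjunct2]
      proof eventually_elim
        case (elim x)
        have "\<bar>a x (yh x) - a x 0\<bar> \<le> \<Lambda> * \<bar>yh x - 0\<bar>" using elim(1) K0 elim(2)[rule_format, of "yh x" 0] by simp
        also have "\<dots> \<le> \<Lambda> * K" using elim(1) \<Lambda>0 by simp
        finally show ?case .
      qed
      have "L2vn L (\<lambda>x. a x (yh x) - a x 0) \<le> \<Lambda> * K * m\<Omega>"
        using L2v_meas[OF L2v_diff[OF ayL a0]] b \<Lambda>0 K0 by (intro L2v_bounded(2)) auto
      moreover have "L2vn L (\<lambda>x. (a x (yh x) - a x 0) + a x 0) \<le> L2vn L (\<lambda>x. a x (yh x) - a x 0) + a0n"
        unfolding a0n_def by (rule L2vn_triangle[OF L2v_diff[OF ayL a0] a0])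
      ultimately show ?thesis by simp
    qed
    have energy: "(L2vn L d)\<^sup>2 \<le> E * L2vn L e"
    proof -
      have ayL: "(\<lambda>x. a x (yh x)) \<in> L2v L" by (rule a_comp_L2v[OF H10gD(3)[OF hh] yhK])
      have "L2vn L (\<lambda>x. u x - a x (yh x)) \<le> U * m\<Omega> + (\<Lambda> * K * m\<Omega> + a0n)"
        using L2vn_triangle[OF uL L2v_minus[OF ayL]] un[OF u] ahn by (simp add: L2vn_def)
      hence "(L2vn L (\<lambda>x. u x - a x (yh x)) + \<Lambda> * K * m\<Omega>) * L2vn L e \<le> E * L2vn L e"
        unfolding E_def by (intro mult_right_mono add_right_mono) auto
      thus ?thesis using discrete_state_energy[OF V uL yT yTb yh yhK K0 \<Lambda>]
        unfolding e_def[symmetric] d_def[symmetric] by linarith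
    qed
    \<comment> \<open>The energy is linear in the L2 norm of \<open>e\<close>, while Poincare bounds
      the square of that norm by the energy; one factor cancels and an a priori bound for the
      discrete state results.\<close>
    have en: "L2vn L e \<le> E * Cp\<^sup>2"
    proof -
      have "(L2vn L e)\<^sup>2 \<le> (Cp * L2vn L d)\<^sup>2" by (intro power_mono Cp(2) ed) simp
      also have "\<dots> \<le> Cp\<^sup>2 * (E * L2vn L e)" unfolding power_mult_distrib by (intro mult_left_mono energy) simp
      finally have "L2vn L e * L2vn L e \<le> (E * Cp\<^sup>2) * L2vn L e" by (simp add: power2_eq_square mult_ac)
      thus ?thesis using E0 L2vn_nonneg[of L e] by (cases "L2vn L e = 0") (auto simp: mult_le_cancel_right)
    qed
    have Fb: "L2vn L (\<lambda>x. yT x - yd x) \<le> F"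
    proof -
      have yhn: "L2vn L yh \<le> K * m\<Omega>" by (rule L2v_bounded(2)[OF H10gD(3)[OF hh] yhK K0])
      have 1: "L2vn L yT \<le> L2vn L yh + L2vn L e"
        using L2vn_diff_ineq[OF H10gD(1)[OF hh] H10gD(1)[OF hT]] by (simp add: e_def[abs_def])
      have 2: "L2vn L (\<lambda>x. yT x - yd x) \<le> L2vn L yT + L2vn L yd"
        using L2vn_triangle[OF H10gD(1)[OF hT] L2v_minus[OF yd]] by (simp add: L2vn_def)
      show ?thesis using 1 2 yhn en by (simp add: F_def)
    qed
    have "L2vn L (\<lambda>x. P x - p x) \<le> Ci * ((1 + \<Lambda> * B) * m\<Omega> * L2vn L (\<lambda>x. y x - yT x)
      + (\<Lambda> * B * m\<Omega> + 2 * (F + 2 * B * F + 4 * B\<^sup>2 * E + E)) * L2vn L (\<lambda>x. yh x - yT x))"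
      by (rule adjoint_stability_aux[OF H10gD(1)[OF state_eqD(1)[OF y]] yK[OF w y] K0 \<Lambda> H10gD(1)[OF hT] yTb yhK
            ed[unfolded e_def] energy[unfolded e_def] p P Fb B_def])
    also have "\<dots> = c1 * L2vn L (\<lambda>x. y x - yT x) + c2 * L2vn L (\<lambda>x. yh x - yT x)"
      unfolding c1_def c2_def by (simp add: distrib_left[of Ci])
    also have "\<dots> \<le> C * L2vn L (\<lambda>x. y x - yT x) + C * L2vn L (\<lambda>x. yh x - yT x)"
      using c by (intro add_mono mult_right_mono) (auto simp: C_def)
    finally show ?thesis by (simp add: distrib_left)
  qed
  moreover have "C > 0" using c by (simp add: C_def)
  ultimately show ?thesis by blast
qed

end


section \<open>The error estimate\<close>

context bounded_domain
begin

lemma Linf_norm_AE: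
  assumes "f \<in> Linf \<Omega>" shows "AE x in L. \<bar>f x\<bar> \<le> Linf_norm \<Omega> f"
proof -
  define s where "s = esssup L (\<lambda>x. ereal \<bar>f x\<bar>)"
  have s: "s < \<infinity>" using assms by (simp add: Linf_def s_def)
  have "AE x in L. ereal \<bar>f x\<bar> \<le> s" unfolding s_def by (rule esssup_AE)
  thus ?thesis
  proof eventually_elim
    case (elim x)
    thus ?case using s unfolding Linf_norm_def s_def[symmetric] by (cases s) auto
  qed
qed

lemma Linf_norm_le:
  assumes f: "f \<in> borel_measurable L" and B: "AE x in L. \<bar>f x\<bar> \<le> B" "B \<ge> 0"
  shows "f \<in> Linf \<Omega>" "Linf_norm \<Omega> f \<le> B"
proof -
  define s where "s = esssup L (\<lambda>x. ereal \<bar>f x\<bar>)"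
  have s: "s \<le> ereal B" unfolding s_def
    by (rule esssup_I) (use f B in auto)
  hence "s < \<infinity>" by (auto intro: le_less_trans)
  thus "f \<in> Linf \<Omega>" using f by (simp add: Linf_def s_def)
  show "Linf_norm \<Omega> f \<le> B" using s B(2) unfolding Linf_norm_def s_def[symmetric] by (cases s) auto
qed

text \<open>The essential supremum is minus infinity on a null space and infinite for a
  non-measurable function; \<open>real_of_ereal\<close> sends both infinite values to 0.\<close>

lemma Linf_norm_nonneg: "0 \<le> Linf_norm \<Omega> f"
proof (cases "emeasure L (space L) = 0")
  case True
  have "esssup L (\<lambda>x. ereal \<bar>f x\<bar>) = - \<infinity> \<or> esssup L (\<lambda>x. ereal \<bar>f x\<bar>) = top"
    using esssup_zero_space[OF True] esssup_non_measurable by blast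
  thus ?thesis unfolding Linf_norm_def by (auto simp: top_ereal_def)
next
  case False
  have "0 \<le> esssup L (\<lambda>x. ereal \<bar>f x\<bar>)"
  proof (rule ccontr)
    assume n: "\<not> 0 \<le> esssup L (\<lambda>x. ereal \<bar>f x\<bar>)"
    have "AE x in L. ereal \<bar>f x\<bar> \<le> esssup L (\<lambda>x. ereal \<bar>f x\<bar>)" by (rule esssup_AE)
    hence "AE x in L. False"
    proof eventually_elim
      case (elim x)
      have "(0::ereal) \<le> ereal \<bar>f x\<bar>" by simp
      with elim n show ?case by (meson order_trans)
    qed
    hence "emeasure L (space L) = 0" by (simp add: eventually_False ae_filter_eq_bot_iff)
    with False show False by simp
  qed
  thus ?thesis unfolding Linf_norm_def by (rule real_of_ereal_pos)
qed

lemma continuous_on_closure_bounded: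
  assumes "continuous_on (closure \<Omega>) f"
  obtains B where "B \<ge> 0" "AE x in L. \<bar>f x :: real\<bar> \<le> B"
proof -
  have "compact (f ` closure \<Omega>)"
    using bounded_dom unfolding compact_closure[symmetric] by (rule compact_continuous_image[OF assms])
  hence "bounded (f ` closure \<Omega>)" by (rule compact_imp_bounded)
  then obtain B where B: "\<forall>x\<in>f ` closure \<Omega>. norm x \<le> B" unfolding bounded_iff by blast
  have "AE x in L. \<bar>f x\<bar> \<le> \<bar>B\<bar>"
  proof (rule AE_I2)
    fix x assume "x \<in> space L"
    hence "x \<in> closure \<Omega>" using closure_subset by auto
    thus "\<bar>f x\<bar> \<le> \<bar>B\<bar>" using B by force
  qed
  with that[of "\<bar>B\<bar>"] show ?thesis by simp
qed

end

section \<open>Distance between the projected and the optimal control\<close>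

context semilinear
begin

text \<open>The first-order condition is tested with the control \<open>w\<close> that jumps to the
  favourable bound wherever \<open>\<pi>\<close> is nonzero. The integrand
  \<open>\<pi> * (u - w)\<close> is nonnegative with nonpositive integral, so it vanishes almost
  everywhere.\<close>

lemma optimal_control_bang:
  assumes sol: "local_solution \<Omega> a \<nu> yd (H10 \<Omega>) (U_ad \<Omega> lb ub) y u" and p: "adjoint_eq \<Omega> a yd (H10 \<Omega>) y p"
    and lu: "lb < ub"
  shows "AE x in L. (p x + \<nu> * u x > 0 \<longrightarrow> u x = lb) \<and> (p x + \<nu> * u x < 0 \<longrightarrow> u x = ub)"
proof -
  have uU: "u \<in> U_ad \<Omega> lb ub" using sol by (simp add: local_solution_def)
  note uL = U_ad_bounded(1)[OF uU] and ub' = U_ad_bounded(2)[OF uU]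
  note pL = H10gD(1)[OF adjoint_eqD(1)[OF p]]
  define \<pi> where "\<pi> x = p x + \<nu> * u x" for x
  have \<pi>L: "\<pi> \<in> L2v L" unfolding \<pi>_def by (intro L2v_add L2v_cmult pL uL)
  have \<pi>m: "\<pi> \<in> borel_measurable L" and um: "u \<in> borel_measurable L" by (rule L2v_meas[OF \<pi>L], rule L2v_meas[OF uL])
  define w where "w x = (if \<pi> x > 0 then lb else if \<pi> x < 0 then ub else u x)" for x
  have wm: "w \<in> borel_measurable L"
    unfolding w_def using \<pi>m um by measurable
  have wb: "AE x in L. lb \<le> w x \<and> w x \<le> ub" using ub' by eventually_elim (use lu in \<open>auto simp: w_def\<close>)
  have wL: "w \<in> L2v L"
    by (rule L2v_bounded(1)[OF wm, of "max \<bar>lb\<bar> \<bar>ub\<bar>"], use wb in eventually_elim) auto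
  have wU: "w \<in> U_ad \<Omega> lb ub" using wL wb by (simp add: U_ad_def L2_eq_L2v)
  have int: "integrable L (\<lambda>x. \<pi> x * (u x - w x))" by (intro L2v_integrable_mult \<pi>L L2v_diff uL wL)
  have nn: "AE x in L. 0 \<le> \<pi> x * (u x - w x)"
    using ub' by eventually_elim (auto simp: w_def mult_nonpos_nonpos)
  have "(\<integral>x. \<pi> x * (u x - w x) \<partial>L) = - (\<integral>x. \<pi> x * (w x - u x) \<partial>L)"
    unfolding Bochner_Integration.integral_minus[symmetric]
    by (intro Bochner_Integration.integral_cong refl) (simp add: algebra_simps)
  also have "\<dots> \<le> 0" using first_order_condition[OF sol p wU] by (simp add: \<pi>_def)
  finally have "(\<integral>x. \<pi> x * (u x - w x) \<partial>L) = 0" using integral_nonneg_AE[OF nn] by linarith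
  hence "AE x in L. \<pi> x * (u x - w x) = 0" using integral_nonneg_eq_0_iff_AE[OF int nn] by simp
  thus ?thesis unfolding \<pi>_def[symmetric] by eventually_elim (auto simp: w_def split: if_splits)
qed

text \<open>Pointwise, \<open>t\<close> and \<open>u\<close> are the projections of
  \<open>r = - q / \<nu>\<close> and \<open>s = - p / \<nu>\<close>. The projection is nonexpansive
  and satisfies a variational inequality. If \<open>\<bar>p + \<nu> * u\<bar>\<close> exceeds
  \<open>\<tau>\<close>, then \<open>s\<close> lies more than \<open>\<tau> / \<nu>\<close> beyond
  the active bound while \<open>r\<close> is within half that distance of \<open>s\<close>, so both
  project to the same bound.\<close>

lemma proj_box_facts:
  fixes lb ub u p q \<nu> \<tau> :: real
  assumes \<nu>: "\<nu> > 0" and u: "lb \<le> u" "u \<le> ub" and bang: "p + \<nu> * u > 0 \<longrightarrow> u = lb" "p + \<nu> * u < 0 \<longrightarrow> u = ub"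
    and lu: "lb < ub"
  defines "t \<equiv> min ub (max (- (1/\<nu>) * q) lb)"
  shows "lb \<le> t" "t \<le> ub" "\<bar>t - u\<bar> \<le> \<bar>p - q\<bar> / \<nu>" "(q + \<nu> * t) * (t - u) \<le> 0"
    "\<bar>p - q\<bar> \<le> \<tau> / 2 \<Longrightarrow> \<tau> > 0 \<Longrightarrow> \<bar>p + \<nu> * u\<bar> > \<tau> \<Longrightarrow> t = u"
proof -
  define r where "r = - (1/\<nu>) * q"
  define s where "s = - (1/\<nu>) * p"
  have rs: "q = - \<nu> * r" "p = - \<nu> * s" using \<nu> by (auto simp: r_def s_def)
  have t: "t = min ub (max r lb)" by (simp add: t_def r_def)
  show tb: "lb \<le> t" "t \<le> ub" using lu by (auto simp: t)
  have sgn: "p + \<nu> * u = \<nu> * (u - s)" using rs by (simp add: algebra_simps)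
  have bs: "u > s \<longrightarrow> u = lb" "u < s \<longrightarrow> u = ub"
    using bang \<nu> unfolding sgn by (auto simp: zero_less_mult_iff mult_less_0_iff)
  have us: "u = min ub (max s lb)" using bs u lu by (auto simp: min_def max_def)
  have pq: "\<bar>p - q\<bar> / \<nu> = \<bar>s - r\<bar>"
  proof -
    have "p - q = \<nu> * (r - s)" by (simp add: rs algebra_simps)
    thus ?thesis using \<nu> by (simp add: abs_mult abs_minus_commute)
  qed
  show "\<bar>t - u\<bar> \<le> \<bar>p - q\<bar> / \<nu>" unfolding pq t us by (auto simp: min_def max_def abs_if)
  have "(t - r) * (t - u) \<le> 0"
    using u lu by (auto simp: t min_def max_def mult_le_0_iff)
  moreover have "(q + \<nu> * t) * (t - u) = \<nu> * ((t - r) * (t - u))" by (simp add: rs algebra_simps)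
  ultimately show "(q + \<nu> * t) * (t - u) \<le> 0" using \<nu> by (metis less_imp_le mult_nonneg_nonpos)
  assume close: "\<bar>p - q\<bar> \<le> \<tau> / 2" and \<tau>: "\<tau> > 0" and big: "\<bar>p + \<nu> * u\<bar> > \<tau>"
  have c: "\<bar>s - r\<bar> \<le> (\<tau> / \<nu>) / 2" unfolding pq[symmetric] using divide_right_mono[OF close, of \<nu>] \<nu> by (simp add: mult.commute)
  have b: "\<bar>u - s\<bar> > \<tau> / \<nu>" using big \<nu> unfolding sgn by (simp add: abs_mult pos_divide_less_eq mult.commute)
  have p0: "\<tau> / \<nu> > 0" using \<tau> \<nu> by simp
  show "t = u"
  proof (cases "u > s")
    case True
    hence "u = lb" using bs by blast
    moreover have "r < lb" using True c b p0 \<open>u = lb\<close> by (simp add: abs_if split: if_splits)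
    ultimately show ?thesis using lu by (simp add: t)
  next
    case False
    hence "u < s" using b p0 by auto
    hence "u = ub" using bs by blast
    moreover have "r > ub" using \<open>u < s\<close> c b p0 \<open>u = ub\<close> by (simp add: abs_if split: if_splits)
    ultimately show ?thesis by (simp add: t)
  qed
qed

text \<open>The difference \<open>ut - ubar\<close> lies in the extended cone, where the second
  derivative at \<open>ubar\<close> is coercive. Passing to the intermediate point costs at most
  half of \<open>\<mu>\<close>. The mean value identity turns the second derivative into a
  difference of first derivatives, and the two variational inequalities reduce this to the pairing
  of \<open>pt - pT\<close> with \<open>ut - ubar\<close>.\<close>

lemma control_distance:
  fixes \<nu> lb ub \<mu> :: real
  defines "j \<equiv> reduced_cost \<Omega> a \<nu> yd"
  assumes \<nu>: "\<nu> > 0" and lu: "lb < ub" and \<mu>: "\<mu> > 0"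
    and sol: "local_solution \<Omega> a \<nu> yd (H10 \<Omega>) (U_ad \<Omega> lb ub) ybar ubar"
    and padj: "adjoint_eq \<Omega> a yd (H10 \<Omega>) ybar pbar" and pinf: "pbar \<in> Linf \<Omega>" and \<tau>: "\<tau> > 0"
    and ssc: "\<forall>v\<in>extended_cone \<Omega> lb ub \<nu> ubar pbar \<tau>. L2_deriv2 \<Omega> j ubar v v \<ge> \<mu> * (L2_norm \<Omega> v)\<^sup>2"
    and pT: "pT \<in> borel_measurable L" "AE x in L. \<bar>pT x\<bar> \<le> PT"
    and ut: "ut = proj_box lb ub (\<lambda>x. - (1/\<nu>) * pT x)" and \<theta>: "0 < \<theta>" "\<theta> < 1"
    and mv: "L2_deriv \<Omega> j ut (\<lambda>x. ut x - ubar x) - L2_deriv \<Omega> j ubar (\<lambda>x. ut x - ubar x)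
      = L2_deriv2 \<Omega> j (\<lambda>x. ubar x + \<theta> * (ut x - ubar x)) (\<lambda>x. ut x - ubar x) (\<lambda>x. ut x - ubar x)"
    and M: "max (Linf_norm \<Omega> (\<lambda>x. ubar x + \<theta> * (ut x - ubar x))) (Linf_norm \<Omega> (\<lambda>x. ut x - ubar x)) \<le> M"
    and hess: "hessian_lipschitz_constant \<Omega> j M CM"
    and close: "Linf_norm \<Omega> (\<lambda>x. pbar x - pT x) \<le> min (\<nu> * \<mu> / (2 * CM)) (\<tau> / 2)"
    and yt: "state_eq \<Omega> a (H10 \<Omega>) ut yt" and pt: "adjoint_eq \<Omega> a yd (H10 \<Omega>) yt pt"
  shows "ut \<in> U_ad \<Omega> lb ub" "L2vn L (\<lambda>x. ut x - ubar x) \<le> 2 / \<mu> * L2vn L (\<lambda>x. pt x - pT x)"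
proof -
  have uU: "ubar \<in> U_ad \<Omega> lb ub" and ybar: "state_eq \<Omega> a (H10 \<Omega>) ubar ybar" using sol by (auto simp: local_solution_def)
  note uL = U_ad_bounded(1)[OF uU] and ub' = U_ad_bounded(2)[OF uU]
  note pL = H10gD(1)[OF adjoint_eqD(1)[OF padj]] and ptL = H10gD(1)[OF adjoint_eqD(1)[OF pt]]
  have CM: "CM > 0" using hess by (simp add: hessian_lipschitz_constant_def)
  define \<beta> where "\<beta> = Linf_norm \<Omega> (\<lambda>x. pbar x - pT x)"
  have \<beta>0: "\<beta> \<ge> 0" unfolding \<beta>_def by (rule Linf_norm_nonneg)
  have pTL: "pT \<in> L2v L" by (rule L2v_bounded(1)[OF pT])
  have AE\<beta>: "AE x in L. \<bar>pbar x - pT x\<bar> \<le> \<beta>"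
  proof -
    \<comment> \<open>The norm bound for \<open>pbar - pT\<close> carries information only once this
      function is known to be essentially bounded, since an infinite supremum would be read as
      0.\<close>
    have "AE x in L. \<bar>pbar x - pT x\<bar> \<le> \<bar>Linf_norm \<Omega> pbar\<bar> + \<bar>PT\<bar>"
      using Linf_norm_AE[OF pinf] pT(2) by eventually_elim linarith
    from Linf_norm_le(1)[OF L2v_meas[OF L2v_diff[OF pL pTL]] this]
    show ?thesis unfolding \<beta>_def by (intro Linf_norm_AE) simp
  qed
  have \<beta>2: "\<beta> \<le> \<tau> / 2" "\<beta> \<le> \<nu> * \<mu> / (2 * CM)" using close by (auto simp: \<beta>_def)
  define d where "d x = ut x - ubar x" for x
  have facts: "AE x in L. (lb \<le> ut x \<and> ut x \<le> ub) \<and> \<bar>d x\<bar> \<le> \<beta> / \<nu> \<and> (pT x + \<nu> * ut x) * d x \<le> 0 \<and>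
      (\<bar>pbar x + \<nu> * ubar x\<bar> > \<tau> \<longrightarrow> d x = 0)"
    using ub' optimal_control_bang[OF sol padj lu] AE\<beta>
  proof eventually_elim
    case (elim x)
    have utx: "ut x = min ub (max (- (1/\<nu>) * pT x) lb)" by (simp add: ut proj_box_def)
    note f = proj_box_facts[OF \<nu> conjunct1[OF elim(1)] conjunct2[OF elim(1)] conjunct1[OF elim(2)] conjunct2[OF elim(2)] lu,
        of "pT x", folded utx]
    have "\<bar>d x\<bar> \<le> \<beta> / \<nu>" unfolding d_def using f(3) elim(3) \<nu> by (meson divide_right_mono less_imp_le order_trans)
    moreover have "\<bar>pbar x - pT x\<bar> \<le> \<tau> / 2" using elim(3) \<beta>2(1) by linarith
    ultimately show ?case using f(1,2,4) f(5)[of \<tau>] \<tau> by (simp add: d_def)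
  qed
  have utm: "ut \<in> borel_measurable L" unfolding ut proj_box_def using pT(1) by simp
  have utL: "ut \<in> L2v L"
    by (rule L2v_bounded(1)[OF utm, of "max \<bar>lb\<bar> \<bar>ub\<bar>"], use facts in eventually_elim) auto
  show utU: "ut \<in> U_ad \<Omega> lb ub"
    unfolding U_ad_def L2_eq_L2v using utL facts by (auto elim: eventually_mono)
  have dL: "d \<in> L2v L" unfolding d_def by (intro L2v_diff utL uL)
  have dm: "d \<in> borel_measurable L" by (rule L2v_meas[OF dL])
  define n where "n = L2vn L d"
  have dcone: "d \<in> extended_cone \<Omega> lb ub \<nu> ubar pbar \<tau>"
    unfolding extended_cone_def sign_condition_def L2_eq_L2v
  proof (intro CollectI conjI dL)
    show "AE x in L. (ubar x = lb \<longrightarrow> 0 \<le> d x) \<and> (ubar x = ub \<longrightarrow> d x \<le> 0)"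
      using facts by eventually_elim (auto simp: d_def)
    show "AE x in L. \<tau> < \<bar>pbar x + \<nu> * ubar x\<bar> \<longrightarrow> d x = 0" using facts by eventually_elim auto
  qed
  have 1: "\<mu> * n\<^sup>2 \<le> L2_deriv2 \<Omega> j ubar d d" using ssc dcone by (simp add: L2_norm_eq n_def)
  define \<zeta> where "\<zeta> x = ubar x + \<theta> * d x" for x
  \<comment> \<open>The increment leads from the intermediate point back to \<open>ubar\<close>,
    because \<open>M\<close> bounds the norm at the intermediate point.\<close>
  define h where "h x = - \<theta> * d x" for x
  have hb: "AE x in L. \<bar>h x\<bar> \<le> \<bar>d x\<bar>"
    by (rule AE_I2) (use \<theta> in \<open>simp add: h_def abs_mult mult_left_le_one_le\<close>)
  have dB: "AE x in L. \<bar>d x\<bar> \<le> \<beta> / \<nu>" using facts by eventually_elim simp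
  have d0: "0 \<le> \<beta> / \<nu>" using \<beta>0 \<nu> by simp
  have dLinf: "d \<in> Linf \<Omega>" by (rule Linf_norm_le(1)[OF dm dB d0])
  have hm: "h \<in> borel_measurable L" unfolding h_def using dm by simp
  have "AE x in L. \<bar>h x\<bar> \<le> \<beta> / \<nu>" using hb dB by eventually_elim linarith
  note h1 = Linf_norm_le[OF hm this d0]
  have "AE x in L. \<bar>h x\<bar> \<le> Linf_norm \<Omega> d" using hb Linf_norm_AE[OF dLinf] by eventually_elim linarith
  note h2 = Linf_norm_le(2)[OF hm this Linf_norm_nonneg]
  have \<zeta>m: "\<zeta> \<in> borel_measurable L" unfolding \<zeta>_def using dm L2v_meas[OF uL] by simp
  have "AE x in L. \<bar>\<zeta> x\<bar> \<le> max \<bar>lb\<bar> \<bar>ub\<bar> + \<beta> / \<nu>"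
    using ub' dB
  proof eventually_elim
    case (elim x)
    have "\<bar>\<theta> * d x\<bar> \<le> \<bar>d x\<bar>" using \<theta> by (simp add: abs_mult mult_left_le_one_le)
    moreover have "\<bar>ubar x\<bar> \<le> max \<bar>lb\<bar> \<bar>ub\<bar>" using elim(1) by auto
    ultimately show ?case unfolding \<zeta>_def using elim(2) by linarith
  qed
  from Linf_norm_le(1)[OF \<zeta>m this] d0 have \<zeta>inf: "\<zeta> \<in> Linf \<Omega>" by simp
  have "(\<lambda>x. \<zeta> x + h x) = ubar" by (rule ext) (simp add: \<zeta>_def h_def)
  moreover have "max (Linf_norm \<Omega> \<zeta>) (Linf_norm \<Omega> h) \<le> M"
    using M h2 unfolding \<zeta>_def d_def by simp
  moreover have "max (Linf_norm \<Omega> u) (Linf_norm \<Omega> h) \<le> M \<Longrightarrow>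
      \<bar>L2_deriv2 \<Omega> j (\<lambda>x. u x + h x) d d - L2_deriv2 \<Omega> j u d d\<bar> \<le> CM * Linf_norm \<Omega> h * n\<^sup>2"
    if "u \<in> Linf \<Omega>" for u
    using hess that h1(1) dLinf unfolding hessian_lipschitz_constant_def L2_norm_eq n_def by blast
  ultimately have "\<bar>L2_deriv2 \<Omega> j ubar d d - L2_deriv2 \<Omega> j \<zeta> d d\<bar> \<le> CM * Linf_norm \<Omega> h * n\<^sup>2"
    using \<zeta>inf by fastforce
  moreover have "CM * Linf_norm \<Omega> h * n\<^sup>2 \<le> \<mu> / 2 * n\<^sup>2"
  proof (rule mult_right_mono)
    have "CM * Linf_norm \<Omega> h \<le> CM * (\<beta> / \<nu>)" using CM by (intro mult_left_mono h1(2)) simp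
    \<comment> \<open>The first entry of the closeness condition on the mesh is made for this step:
      the projection divides the adjoint error by \<open>\<nu>\<close>, and the Hessian changes by
      at most half of \<open>\<mu>\<close>.\<close>
    also have "\<dots> \<le> CM * ((\<nu> * \<mu> / (2 * CM)) / \<nu>)" using \<beta>2(2) CM \<nu> by (intro mult_left_mono divide_right_mono) auto
    also have "\<dots> = \<mu> / 2" using CM \<nu> by simp
    finally show "CM * Linf_norm \<Omega> h \<le> \<mu> / 2" .
  qed simp
  ultimately have 2: "\<mu> / 2 * n\<^sup>2 \<le> L2_deriv2 \<Omega> j \<zeta> d d" using 1 by linarith
  have 3: "L2_deriv2 \<Omega> j \<zeta> d d = (\<integral>x. (pt x + \<nu> * ut x) * d x \<partial>L) - (\<integral>x. (pbar x + \<nu> * ubar x) * d x \<partial>L)"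
    using mv unfolding d_def[symmetric] \<zeta>_def[symmetric] j_def
    by (simp add: L2_deriv_eq[OF reduced_cost_deriv[OF yt pt utL] dL] L2_deriv_eq[OF reduced_cost_deriv[OF ybar padj uL] dL])
  have 4: "0 \<le> (\<integral>x. (pbar x + \<nu> * ubar x) * d x \<partial>L)"
    unfolding d_def by (rule first_order_condition[OF sol padj utU])
  have 5: "(\<integral>x. (pT x + \<nu> * ut x) * d x \<partial>L) \<le> 0"
  \<comment> \<open>\<open>pT + \<nu> * ut\<close> satisfies the projection inequality pointwise
    against every admissible value, in particular that of \<open>ubar\<close>.\<close>
  proof -
    have "0 \<le> (\<integral>x. - ((pT x + \<nu> * ut x) * d x) \<partial>L)"
      by (rule integral_nonneg_AE, use facts in eventually_elim) simp
    thus ?thesis by simp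
  qed
  have 6: "(\<integral>x. (pt x + \<nu> * ut x) * d x \<partial>L) - (\<integral>x. (pT x + \<nu> * ut x) * d x \<partial>L) = (\<integral>x. (pt x - pT x) * d x \<partial>L)"
  proof -
    have "(\<integral>x. (pt x - pT x) * d x \<partial>L) = (\<integral>x. (pt x + \<nu> * ut x) * d x - (pT x + \<nu> * ut x) * d x \<partial>L)"
      by (intro Bochner_Integration.integral_cong refl) (simp add: algebra_simps)
    also have "\<dots> = (\<integral>x. (pt x + \<nu> * ut x) * d x \<partial>L) - (\<integral>x. (pT x + \<nu> * ut x) * d x \<partial>L)"
      by (intro Bochner_Integration.integral_diff L2v_integrable_mult L2v_add L2v_cmult ptL pTL utL dL)
    finally show ?thesis by simp
  qed
  have "\<mu> / 2 * n\<^sup>2 \<le> L2vn L (\<lambda>x. pt x - pT x) * n"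
    using L2v_CS_real[OF L2v_diff[OF ptL pTL] dL] 2 3 4 5 6 unfolding n_def by linarith
  hence "n * (\<mu> / 2) * n \<le> L2vn L (\<lambda>x. pt x - pT x) * n" by (simp add: power2_eq_square mult_ac)
  hence "n * (\<mu> / 2) \<le> L2vn L (\<lambda>x. pt x - pT x)"
  proof (cases "n = 0")
    case False
    with L2vn_nonneg[of L d, folded n_def] have "n > 0" by simp
    with \<open>n * (\<mu> / 2) * n \<le> L2vn L (\<lambda>x. pt x - pT x) * n\<close> show ?thesis by (rule mult_right_le_imp_le)
  qed simp
  thus "L2vn L (\<lambda>x. ut x - ubar x) \<le> 2 / \<mu> * L2vn L (\<lambda>x. pt x - pT x)"
    using \<mu> unfolding d_def[symmetric] n_def[symmetric] by (simp add: field_simps mult.commute[of n])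
qed

end

theorem theorem7p1:
  fixes \<Omega> :: "(real ^ 'n) set"
    and a :: "real ^ 'n \<Rightarrow> real \<Rightarrow> real"
    and yd :: "real ^ 'n \<Rightarrow> real"
    and \<nu> lb ub \<mu> C0 \<sigma> :: real
  assumes dim: "CARD('n) \<in> {2, 3}"
    and domain: "polytopal_domain \<Omega>" "lipschitz_boundary \<Omega>" "convex \<Omega>"
    and data: "\<nu> > 0" "yd \<in> L2 \<Omega>" "lb < ub"
    and A1: "assumption_A1 \<Omega> a"
    and A2: "assumption_A2 \<Omega> a"
    and A3: "assumption_A3 \<Omega> a"
    and params: "\<mu> > 0" "C0 > 0"
  shows "let j = reduced_cost \<Omega> a \<nu> yd in \<exists>C>0. \<forall>T0 TT \<T> ubar ybar pbar \<tau> uT yT pT ut yhat phat M CM \<theta> Est Ead.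
    mesh_family \<Omega> \<sigma> T0 TT \<longrightarrow> \<T> \<in> TT \<longrightarrow>
    local_solution \<Omega> a \<nu> yd (H10 \<Omega>) (U_ad \<Omega> lb ub) ybar ubar \<longrightarrow>
    adjoint_eq \<Omega> a yd (H10 \<Omega>) ybar pbar \<longrightarrow> pbar \<in> Linf \<Omega> \<longrightarrow>
    (\<forall>v\<in>critical_cone \<Omega> lb ub \<nu> ubar pbar.
       \<not> (AE x in lebesgue_on \<Omega>. v x = 0) \<longrightarrow> L2_deriv2 \<Omega> j ubar v v > 0) \<longrightarrow>
    \<tau> > 0 \<longrightarrow>
    (\<forall>v\<in>extended_cone \<Omega> lb ub \<nu> ubar pbar \<tau>.
       L2_deriv2 \<Omega> j ubar v v \<ge> \<mu> * (L2_norm \<Omega> v)\<^sup>2) \<longrightarrow>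
    local_solution \<Omega> a \<nu> yd (fe_space \<Omega> \<T>) (U_ad1 \<Omega> \<T> lb ub) yT uT \<longrightarrow>
    adjoint_eq \<Omega> a yd (fe_space \<Omega> \<T>) yT pT \<longrightarrow>
    ut = proj_box lb ub (\<lambda>x. - (1/\<nu>) * pT x) \<longrightarrow>
    0 < \<theta> \<longrightarrow> \<theta> < 1 \<longrightarrow>
    L2_deriv \<Omega> j ut (\<lambda>x. ut x - ubar x) - L2_deriv \<Omega> j ubar (\<lambda>x. ut x - ubar x)
      = L2_deriv2 \<Omega> j (\<lambda>x. ubar x + \<theta> * (ut x - ubar x))
          (\<lambda>x. ut x - ubar x) (\<lambda>x. ut x - ubar x) \<longrightarrow>
    M > 0 \<longrightarrow>
    max (Linf_norm \<Omega> (\<lambda>x. ubar x + \<theta> * (ut x - ubar x))) (Linf_norm \<Omega> (\<lambda>x. ut x - ubar x)) \<le> M \<longrightarrow>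
    hessian_lipschitz_constant \<Omega> j M CM \<longrightarrow>
    Linf_norm \<Omega> (\<lambda>x. pbar x - pT x) \<le> min (\<nu> * \<mu> / (2 * CM)) (\<tau> / 2) \<longrightarrow>
    state_eq \<Omega> a (H10 \<Omega>) uT yhat \<longrightarrow>
    adjoint_eq \<Omega> a yd (H10 \<Omega>) yT phat \<longrightarrow>
    Est \<ge> 0 \<longrightarrow> Ead \<ge> 0 \<longrightarrow>
    L2_norm \<Omega> (\<lambda>x. yhat x - yT x) \<le> C0 * Est \<longrightarrow>
    L2_norm \<Omega> (\<lambda>x. phat x - pT x) \<le> C0 * Ead \<longrightarrow>
    L2_norm \<Omega> (\<lambda>x. ybar x - yT x) + L2_norm \<Omega> (\<lambda>x. pbar x - pT x) + L2_norm \<Omega> (\<lambda>x. ubar x - uT x)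
      \<le> C * (Est + Ead + L2_norm \<Omega> (\<lambda>x. ut x - uT x))"
proof -
  interpret semilinear \<Omega> a yd
  proof
    show "open \<Omega>" "bounded \<Omega>" using domain(1) by (auto simp: polytopal_domain_def)
    show "DIM(real ^ 'n) \<in> {2, 3}" using dim by simp
    show "yd \<in> L2v (lebesgue_on \<Omega>)" using data(2) by (simp add: L2_eq_L2v)
  qed (fact A1 A2 A3)+
  obtain C1 where C1: "C1 > 0" and stab: "\<forall>V u yT KT yh P w y p. V \<subseteq> H10 \<Omega> \<longrightarrow> u \<in> U_ad \<Omega> lb ub \<longrightarrow> state_eq \<Omega> a V u yT \<longrightarrow>
    (AE x in L. \<bar>yT x\<bar> \<le> KT) \<longrightarrow> state_eq \<Omega> a (H10 \<Omega>) u yh \<longrightarrow> adjoint_eq \<Omega> a yd (H10 \<Omega>) yT P \<longrightarrow>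
    w \<in> U_ad \<Omega> lb ub \<longrightarrow> state_eq \<Omega> a (H10 \<Omega>) w y \<longrightarrow> adjoint_eq \<Omega> a yd (H10 \<Omega>) y p \<longrightarrow>
    L2vn L (\<lambda>x. P x - p x) \<le> C1 * (L2vn L (\<lambda>x. y x - yT x) + L2vn L (\<lambda>x. yh x - yT x))"
    using adjoint_stability[of lb ub] by blast
  \<comment> \<open>\<open>C2\<close> belongs to the adjoint error of \<open>ut\<close>,
    \<open>C3\<close> to the control, \<open>C4\<close> to the state and \<open>C5\<close> to the
    adjoint state; each is built from earlier ones in the order in which the errors are
    estimated.\<close>
  define C2 where "C2 = C1 * (Cp\<^sup>2 + 2 * C0) + C0"
  define C3 where "C3 = 2 / \<mu> * C2 + 1"
  define C4 where "C4 = Cp\<^sup>2 * C3 + C0"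
  define C5 where "C5 = C1 * (C4 + C0) + C0"
  have pos: "C2 > 0" "C3 > 0" "C4 > 0" "C5 > 0"
  proof -
    show C2: "C2 > 0" unfolding C2_def using C1 params by (intro add_nonneg_pos mult_nonneg_nonneg) auto
    show C3: "C3 > 0" unfolding C3_def using C2 params by (intro add_nonneg_pos mult_nonneg_nonneg) auto
    show C4: "C4 > 0" unfolding C4_def using C3 params by (intro add_nonneg_pos mult_nonneg_nonneg) auto
    show "C5 > 0" unfolding C5_def using C4 C1 params by (intro add_nonneg_pos mult_nonneg_nonneg) auto
  qed
  have main: "L2vn L (\<lambda>x. ybar x - yT x) + L2vn L (\<lambda>x. pbar x - pT x) + L2vn L (\<lambda>x. ubar x - uT x)
      \<le> (C3 + C4 + C5) * (Est + Ead + L2vn L (\<lambda>x. ut x - uT x))"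
    if sol: "local_solution \<Omega> a \<nu> yd (H10 \<Omega>) (U_ad \<Omega> lb ub) ybar ubar"
    and padj: "adjoint_eq \<Omega> a yd (H10 \<Omega>) ybar pbar" and pinf: "pbar \<in> Linf \<Omega>" and \<tau>: "\<tau> > 0"
    and ssc: "\<forall>v\<in>extended_cone \<Omega> lb ub \<nu> ubar pbar \<tau>.
       L2_deriv2 \<Omega> (reduced_cost \<Omega> a \<nu> yd) ubar v v \<ge> \<mu> * (L2_norm \<Omega> v)\<^sup>2"
    and solT: "local_solution \<Omega> a \<nu> yd (fe_space \<Omega> \<T>) (U_ad1 \<Omega> \<T> lb ub) yT uT"
    and adjT: "adjoint_eq \<Omega> a yd (fe_space \<Omega> \<T>) yT pT"
    and ut: "ut = proj_box lb ub (\<lambda>x. - (1/\<nu>) * pT x)" and \<theta>: "0 < \<theta>" "\<theta> < 1"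
    and mv: "L2_deriv \<Omega> (reduced_cost \<Omega> a \<nu> yd) ut (\<lambda>x. ut x - ubar x) - L2_deriv \<Omega> (reduced_cost \<Omega> a \<nu> yd) ubar (\<lambda>x. ut x - ubar x)
      = L2_deriv2 \<Omega> (reduced_cost \<Omega> a \<nu> yd) (\<lambda>x. ubar x + \<theta> * (ut x - ubar x)) (\<lambda>x. ut x - ubar x) (\<lambda>x. ut x - ubar x)"
    and M: "max (Linf_norm \<Omega> (\<lambda>x. ubar x + \<theta> * (ut x - ubar x))) (Linf_norm \<Omega> (\<lambda>x. ut x - ubar x)) \<le> M"
    and hess: "hessian_lipschitz_constant \<Omega> (reduced_cost \<Omega> a \<nu> yd) M CM"
    and close: "Linf_norm \<Omega> (\<lambda>x. pbar x - pT x) \<le> min (\<nu> * \<mu> / (2 * CM)) (\<tau> / 2)"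
    and yhat: "state_eq \<Omega> a (H10 \<Omega>) uT yhat" and phat: "adjoint_eq \<Omega> a yd (H10 \<Omega>) yT phat"
    and E: "Est \<ge> 0" "Ead \<ge> 0"
    and est: "L2vn L (\<lambda>x. yhat x - yT x) \<le> C0 * Est" "L2vn L (\<lambda>x. phat x - pT x) \<le> C0 * Ead"
    for \<T> ubar ybar pbar \<tau> uT yT pT ut yhat phat M CM \<theta> Est Ead
  proof -
    have V: "fe_space \<Omega> \<T> \<subseteq> H10 \<Omega>" by (auto simp: fe_space_def)
    have uTU: "uT \<in> U_ad \<Omega> lb ub" and yT: "state_eq \<Omega> a (fe_space \<Omega> \<T>) uT yT"
      using solT by (auto simp: local_solution_def U_ad1_def)
    have yTV: "yT \<in> fe_space \<Omega> \<T>" and pTV: "pT \<in> fe_space \<Omega> \<T>" using yT adjT by (auto simp: state_eq_def adjoint_eq_def)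
    have uU: "ubar \<in> U_ad \<Omega> lb ub" and ybar: "state_eq \<Omega> a (H10 \<Omega>) ubar ybar" using sol by (auto simp: local_solution_def)
    \<comment> \<open>The bounds \<open>KT\<close> and \<open>PT\<close> depend on the mesh; the
      constants of the lemmas that receive them do not.\<close>
    obtain KT where KT: "AE x in L. \<bar>yT x\<bar> \<le> KT"
      by (rule continuous_on_closure_bounded[of yT]) (use yTV in \<open>auto simp: fe_space_def P1_continuous_def\<close>)
    obtain PT where PT: "AE x in L. \<bar>pT x\<bar> \<le> PT"
      by (rule continuous_on_closure_bounded[of pT]) (use pTV in \<open>auto simp: fe_space_def P1_continuous_def\<close>)
    have yTL: "yT \<in> L2v L" and pTL: "pT \<in> L2v L" using yTV pTV V H10_L2v by auto
    have utm: "ut \<in> borel_measurable L" unfolding ut proj_box_def using L2v_meas[OF pTL] by simp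
    have "AE x in L. \<bar>ut x\<bar> \<le> max \<bar>lb\<bar> \<bar>ub\<bar>" by (rule AE_I2) (auto simp: ut proj_box_def)
    hence utL: "ut \<in> L2v L" by (rule L2v_bounded(1)[OF utm])
    obtain yt where yt: "state_eq \<Omega> a (H10 \<Omega>) ut yt" using state_exists[OF utL] by blast
    obtain pt where pt: "adjoint_eq \<Omega> a yd (H10 \<Omega>) yt pt"
      using adjoint_exists[OF H10gD(1)[OF state_eqD(1)[OF yt]] state_bound[OF yt utL]] by blast
    note cd = control_distance[OF data(1) data(3) params(1) sol padj pinf \<tau> ssc L2v_meas[OF pTL] PT ut \<theta> mv M hess close yt pt]
    note uL = U_ad_bounded(1)[OF uU] and uTL = U_ad_bounded(1)[OF uTU]
    note ytL = H10gD(1)[OF state_eqD(1)[OF yt]] and yhL = H10gD(1)[OF state_eqD(1)[OF yhat]]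
      and ybL = H10gD(1)[OF state_eqD(1)[OF ybar]] and phL = H10gD(1)[OF adjoint_eqD(1)[OF phat]]
      and ptL = H10gD(1)[OF adjoint_eqD(1)[OF pt]] and pbL = H10gD(1)[OF adjoint_eqD(1)[OF padj]]
    define Ect where "Ect = L2vn L (\<lambda>x. ut x - uT x)"
    define S where "S = Est + Ead + Ect"
    have Ect0: "Ect \<ge> 0" by (simp add: Ect_def)
    have le: "Est \<le> S" "Ead \<le> S" "Ect \<le> S" using E Ect0 by (auto simp: S_def)
    have e: "L2vn L (\<lambda>x. yhat x - yT x) \<le> C0 * S" "L2vn L (\<lambda>x. phat x - pT x) \<le> C0 * S"
      using est le params(2) by (meson less_imp_le mult_left_mono order_trans)+
    have s1: "L2vn L (\<lambda>x. pt x - pT x) \<le> C2 * S"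
    proof -
      \<comment> \<open>\<open>yt\<close> and \<open>yhat\<close> are the continuous states of
        \<open>ut\<close> and \<open>uT\<close>, so their distance is governed by
        \<open>Ect\<close>; here the control estimator enters the adjoint error.\<close>
      have "L2vn L (\<lambda>x. yt x - yT x) \<le> L2vn L (\<lambda>x. yt x - yhat x) + L2vn L (\<lambda>x. yhat x - yT x)"
        by (rule L2vn_triangle_diff[OF ytL yhL yTL])
      also have "\<dots> \<le> Cp\<^sup>2 * S + C0 * S"
        using state_diff[OF yt yhat utL uTL] le(3) unfolding Ect_def[symmetric]
        by (intro add_mono e(1)) (meson mult_left_mono order_trans zero_le_power2)
      finally have "C1 * (L2vn L (\<lambda>x. yt x - yT x) + L2vn L (\<lambda>x. yhat x - yT x)) \<le> C1 * ((Cp\<^sup>2 * S + C0 * S) + C0 * S)"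
        using e(1) C1 by (intro mult_left_mono add_mono) auto
      hence "L2vn L (\<lambda>x. phat x - pt x) \<le> C1 * ((Cp\<^sup>2 * S + C0 * S) + C0 * S)"
        using stab[rule_format, OF V uTU yT KT yhat phat cd(1) yt pt] by linarith
      moreover have "L2vn L (\<lambda>x. pt x - pT x) \<le> L2vn L (\<lambda>x. pt x - phat x) + L2vn L (\<lambda>x. phat x - pT x)"
        by (rule L2vn_triangle_diff[OF ptL phL pTL])
      ultimately have "L2vn L (\<lambda>x. pt x - pT x) \<le> C1 * ((Cp\<^sup>2 * S + C0 * S) + C0 * S) + C0 * S"
        using e(2) L2vn_commute[of L pt phat] by linarith
      also have "\<dots> = C2 * S" by (simp add: C2_def algebra_simps)
      finally show ?thesis .
    qed
    have s2: "L2vn L (\<lambda>x. ubar x - uT x) \<le> C3 * S"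
    proof -
      have "L2vn L (\<lambda>x. ubar x - uT x) \<le> L2vn L (\<lambda>x. ubar x - ut x) + Ect"
        unfolding Ect_def by (rule L2vn_triangle_diff[OF uL utL uTL])
      also have "L2vn L (\<lambda>x. ubar x - ut x) \<le> 2 / \<mu> * (C2 * S)"
        unfolding L2vn_commute[of L ubar ut] using s1 params(1)
        by (intro order_trans[OF cd(2)] mult_left_mono) auto
      also have "2 / \<mu> * (C2 * S) + Ect \<le> 2 / \<mu> * (C2 * S) + S" using le(3) by simp
      also have "\<dots> = C3 * S" by (simp add: C3_def algebra_simps)
      finally show ?thesis by simp
    qed
    have s3: "L2vn L (\<lambda>x. ybar x - yT x) \<le> C4 * S"
    proof -
      have "L2vn L (\<lambda>x. ybar x - yT x) \<le> L2vn L (\<lambda>x. ybar x - yhat x) + L2vn L (\<lambda>x. yhat x - yT x)"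
        by (rule L2vn_triangle_diff[OF ybL yhL yTL])
      also have "\<dots> \<le> Cp\<^sup>2 * (C3 * S) + C0 * S"
        using state_diff[OF ybar yhat uL uTL] s2
        by (intro add_mono e(1)) (meson mult_left_mono order_trans zero_le_power2)
      also have "\<dots> = C4 * S" by (simp add: C4_def algebra_simps)
      finally show ?thesis .
    qed
    have s4: "L2vn L (\<lambda>x. pbar x - pT x) \<le> C5 * S"
    proof -
      have "C1 * (L2vn L (\<lambda>x. ybar x - yT x) + L2vn L (\<lambda>x. yhat x - yT x)) \<le> C1 * (C4 * S + C0 * S)"
        using s3 e(1) C1 by (intro mult_left_mono add_mono) auto
      hence "L2vn L (\<lambda>x. phat x - pbar x) \<le> C1 * (C4 * S + C0 * S)"
        \<comment> \<open>Second use of the stability bound, now with the optimal state, whose error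
          is already estimated.\<close>
        using stab[rule_format, OF V uTU yT KT yhat phat uU ybar padj] by linarith
      moreover have "L2vn L (\<lambda>x. pbar x - pT x) \<le> L2vn L (\<lambda>x. pbar x - phat x) + L2vn L (\<lambda>x. phat x - pT x)"
        by (rule L2vn_triangle_diff[OF pbL phL pTL])
      ultimately have "L2vn L (\<lambda>x. pbar x - pT x) \<le> C1 * (C4 * S + C0 * S) + C0 * S"
        using e(2) L2vn_commute[of L pbar phat] by linarith
      also have "\<dots> = C5 * S" by (simp add: C5_def algebra_simps)
      finally show ?thesis .
    qed
    have "L2vn L (\<lambda>x. ybar x - yT x) + L2vn L (\<lambda>x. pbar x - pT x) + L2vn L (\<lambda>x. ubar x - uT x) \<le> C4 * S + C5 * S + C3 * S"
      using s2 s3 s4 by linarith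
    also have "\<dots> = (C3 + C4 + C5) * S" by (simp add: algebra_simps)
    finally show ?thesis by (simp add: S_def Ect_def)
  qed
  show ?thesis
    unfolding Let_def
  proof (intro exI[of _ "C3 + C4 + C5"] conjI allI impI)
    show "0 < C3 + C4 + C5" using pos by simp
  qed (unfold L2_norm_eq[of \<Omega>], rule main[unfolded L2_norm_eq[of \<Omega>]]; assumption)
qed


end
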